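(* Let $A$ be an artin algebra. Let $P$ be an indecomposable projective module in $\mathrm{mod}\,A$ with a proper submodule $M$ such that $\mathrm{top}^sM$ is uniserial and $\mathrm{rad}^{s-1}M\not\subseteq \mathrm{rad}^{s+1}P$, for some $s\ge 1$. If $\mathrm{soc}^{s+1}(I_{\mathrm{soc}(\mathrm{top}^sM)})$ is uniserial, then there is an almost split sequence $$0\longrightarrow \mathrm{top}^sM \xrightarrow{(q_1,\,p_1)^T} (P/\mathrm{rad}^sM)\oplus \mathrm{top}^{s-1}M \xrightarrow{(-p_2,\,q_2)} P/\mathrm{rad}^{s-1}M\longrightarrow 0$$ in $\mathrm{mod}\,A$, where $q_1,q_2$ are inclusion maps and $p_1,p_2$ are canonical projections.
   Context: $A$ is an artin algebra with Jacobson radical $J$; $\mathrm{mod}\,A$ is the category of finitely generated left $A$-modules. For a module $M$ and $i\ge 0$: $\mathrm{rad}^iM=J^iM$ (with $\mathrm{rad}^0M=M$); $\mathrm{top}^iM=M/\mathrm{rad}^iM$ (so $\mathrm{top}^0M=0$); $\mathrm{soc}^iM$ is the $i$-th term of the socle series, i.e. $\mathrm{soc}^0M=0$ and $\mathrm{soc}^iM/\mathrm{soc}^{i-1}M=\mathrm{soc}(M/\mathrm{soc}^{i-1}M)$, equivalently $\mathrm{soc}^iM=\{m\in M: J^im=0\}$. $I_M$ denotes an injective envelope of $M$. A module is uniserial if any two of its submodules are comparable under inclusion. *)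

theory Defs
  imports "HOL-Algebra.Module" "HOL-Algebra.Ideal_Product"
begin

section \<open>Left modules over a not necessarily commutative ring\<close>

text \<open>
  The locale \<open>module\<close> of \<open>HOL-Algebra\<close> requires a commutative ring.  The record type, the
  locale \<open>submodule\<close> and the coset operations do not, and are reused.  The multiplicative fields
  of a module record are irrelevant unless the record is used as an algebra.  A submodule \<open>N\<close> of
  \<open>M\<close> is a set; regarded as a module it is \<open>M\<lparr>carrier := N\<rparr>\<close>.
\<close>

locale left_module = R?: ring R + M?: abelian_group M
  for R :: "('a, 'x) ring_scheme" (structure) and M :: "('a, 'm, 'y) module_scheme" (structure) +
  assumes smult_closed [simp, intro]:
      "\<lbrakk>a \<in> carrier R; x \<in> carrier M\<rbrakk> \<Longrightarrow> a \<odot>\<^bsub>M\<^esub> x \<in> carrier M"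
    and smult_l_distr:
      "\<lbrakk>a \<in> carrier R; b \<in> carrier R; x \<in> carrier M\<rbrakk> \<Longrightarrow>
        (a \<oplus>\<^bsub>R\<^esub> b) \<odot>\<^bsub>M\<^esub> x = a \<odot>\<^bsub>M\<^esub> x \<oplus>\<^bsub>M\<^esub> b \<odot>\<^bsub>M\<^esub> x"
    and smult_r_distr:
      "\<lbrakk>a \<in> carrier R; x \<in> carrier M; y \<in> carrier M\<rbrakk> \<Longrightarrow>
        a \<odot>\<^bsub>M\<^esub> (x \<oplus>\<^bsub>M\<^esub> y) = a \<odot>\<^bsub>M\<^esub> x \<oplus>\<^bsub>M\<^esub> a \<odot>\<^bsub>M\<^esub> y"
    and smult_assoc1:
      "\<lbrakk>a \<in> carrier R; b \<in> carrier R; x \<in> carrier M\<rbrakk> \<Longrightarrow>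
        (a \<otimes>\<^bsub>R\<^esub> b) \<odot>\<^bsub>M\<^esub> x = a \<odot>\<^bsub>M\<^esub> (b \<odot>\<^bsub>M\<^esub> x)"
    and smult_one [simp]:
      "x \<in> carrier M \<Longrightarrow> \<one>\<^bsub>R\<^esub> \<odot>\<^bsub>M\<^esub> x = x"

definition generated_submodule ::
    "('a, 'x) ring_scheme \<Rightarrow> ('a, 'm, 'y) module_scheme \<Rightarrow> 'm set \<Rightarrow> 'm set"
  where "generated_submodule A M X = \<Inter> {N. submodule N A M \<and> X \<subseteq> N}"

definition finitely_generated :: "('a, 'x) ring_scheme \<Rightarrow> ('a, 'm, 'y) module_scheme \<Rightarrow> bool"
  where "finitely_generated A M \<longleftrightarrow>
    (\<exists>X. finite X \<and> X \<subseteq> carrier M \<and> generated_submodule A M X = carrier M)"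

text \<open>The objects of mod \<open>A\<close>:\<close>

definition fg_left_module :: "('a, 'x) ring_scheme \<Rightarrow> ('a, 'm, 'y) module_scheme \<Rightarrow> bool"
  where "fg_left_module A M \<longleftrightarrow> left_module A M \<and> finitely_generated A M"

definition mod_hom ::
    "('a, 'x) ring_scheme \<Rightarrow> ('a, 'm, 'y) module_scheme \<Rightarrow> ('a, 'n, 'z) module_scheme \<Rightarrow> ('m \<Rightarrow> 'n) set"
  where "mod_hom A M N = {f \<in> carrier M \<rightarrow> carrier N.
    (\<forall>x\<in>carrier M. \<forall>y\<in>carrier M. f (x \<oplus>\<^bsub>M\<^esub> y) = f x \<oplus>\<^bsub>N\<^esub> f y) \<and>
    (\<forall>a\<in>carrier A. \<forall>x\<in>carrier M. f (a \<odot>\<^bsub>M\<^esub> x) = a \<odot>\<^bsub>N\<^esub> f x)}"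

text \<open>The scalar action on a coset \<open>X = N +> x\<close> is \<open>a \<odot> X = N +> (a \<odot> x)\<close>.\<close>

definition quotient_module :: "('a, 'm, 'y) module_scheme \<Rightarrow> 'm set \<Rightarrow> ('a, 'm set) module"
  where "quotient_module M N =
    \<lparr>carrier = a_rcosets\<^bsub>M\<^esub> N, mult = undefined, one = undefined, zero = N, add = set_add M,
     smult = (\<lambda>a X. \<Union>x\<in>X. N +>\<^bsub>M\<^esub> (a \<odot>\<^bsub>M\<^esub> x))\<rparr>"

text \<open>
  For \<open>N \<subseteq> N'\<close> this is the canonical projection from the quotient by \<open>N\<close> to the quotient by \<open>N'\<close>:
  \<open>N' <+> (N +> x) = N' +> x\<close>.
\<close>

definition canonical_projection :: "('a, 'm, 'y) module_scheme \<Rightarrow> 'm set \<Rightarrow> 'm set \<Rightarrow> 'm set"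
  where "canonical_projection M N' X = N' <+>\<^bsub>M\<^esub> X"

definition direct_sum_module ::
    "('a, 'm, 'y) module_scheme \<Rightarrow> ('a, 'n, 'z) module_scheme \<Rightarrow> ('a, 'm \<times> 'n) module"
  where "direct_sum_module M N =
    \<lparr>carrier = carrier M \<times> carrier N, mult = undefined, one = undefined,
     zero = (\<zero>\<^bsub>M\<^esub>, \<zero>\<^bsub>N\<^esub>),
     add = (\<lambda>(x, y) (x', y'). (x \<oplus>\<^bsub>M\<^esub> x', y \<oplus>\<^bsub>N\<^esub> y')),
     smult = (\<lambda>a (x, y). (a \<odot>\<^bsub>M\<^esub> x, a \<odot>\<^bsub>N\<^esub> y))\<rparr>"

definition uniserial :: "('a, 'x) ring_scheme \<Rightarrow> ('a, 'm, 'y) module_scheme \<Rightarrow> bool"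
  where "uniserial A M \<longleftrightarrow>
    (\<forall>N N'. submodule N A M \<and> submodule N' A M \<longrightarrow> N \<subseteq> N' \<or> N' \<subseteq> N)"

definition simple_module :: "('a, 'x) ring_scheme \<Rightarrow> ('a, 'm, 'y) module_scheme \<Rightarrow> bool"
  where "simple_module A M \<longleftrightarrow> carrier M \<noteq> {\<zero>\<^bsub>M\<^esub>} \<and>
    (\<forall>N. submodule N A M \<longrightarrow> N = {\<zero>\<^bsub>M\<^esub>} \<or> N = carrier M)"

definition indecomposable :: "('a, 'x) ring_scheme \<Rightarrow> ('a, 'm, 'y) module_scheme \<Rightarrow> bool"
  where "indecomposable A M \<longleftrightarrow> carrier M \<noteq> {\<zero>\<^bsub>M\<^esub>} \<and>
    (\<forall>N N'. submodule N A M \<and> submodule N' A M \<and>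
        N <+>\<^bsub>M\<^esub> N' = carrier M \<and> N \<inter> N' = {\<zero>\<^bsub>M\<^esub>} \<longrightarrow>
      N = {\<zero>\<^bsub>M\<^esub>} \<or> N' = {\<zero>\<^bsub>M\<^esub>})"


section \<open>Artin algebras\<close>

definition artinian_cring :: "('r, 'x) ring_scheme \<Rightarrow> bool"
  where "artinian_cring R \<longleftrightarrow> cring R \<and>
    (\<forall>I :: nat \<Rightarrow> 'r set. (\<forall>n. ideal (I n) R) \<and> (\<forall>n. I (Suc n) \<subseteq> I n) \<longrightarrow>
      (\<exists>k. \<forall>n\<ge>k. I n = I k))"

text \<open>
  \<open>A\<close> carries both its ring structure and its scalar multiplication by \<open>R\<close>, as in the locale
  \<open>algebra\<close> of \<open>HOL-Algebra\<close>, which cannot be used because it makes \<open>A\<close> commutative.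
\<close>

definition artin_algebra :: "('r, 'x) ring_scheme \<Rightarrow> ('r, 'a, 'y) module_scheme \<Rightarrow> bool"
  where "artin_algebra R A \<longleftrightarrow> artinian_cring R \<and> ring A \<and> module R A \<and>
    (\<forall>r\<in>carrier R. \<forall>x\<in>carrier A. \<forall>y\<in>carrier A.
      (r \<odot>\<^bsub>A\<^esub> x) \<otimes>\<^bsub>A\<^esub> y = r \<odot>\<^bsub>A\<^esub> (x \<otimes>\<^bsub>A\<^esub> y) \<and>
      x \<otimes>\<^bsub>A\<^esub> (r \<odot>\<^bsub>A\<^esub> y) = r \<odot>\<^bsub>A\<^esub> (x \<otimes>\<^bsub>A\<^esub> y)) \<and>
    finitely_generated R A"


section \<open>Radical series and socle series\<close>

definition regular_module :: "('a, 'x) ring_scheme \<Rightarrow> ('a, 'a) module"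
  where "regular_module A =
    \<lparr>carrier = carrier A, mult = mult A, one = one A, zero = zero A, add = add A, smult = mult A\<rparr>"

definition maximal_left_ideal :: "'a set \<Rightarrow> ('a, 'x) ring_scheme \<Rightarrow> bool"
  where "maximal_left_ideal I A \<longleftrightarrow>
    submodule I A (regular_module A) \<and> I \<noteq> carrier A \<and>
    (\<forall>K. submodule K A (regular_module A) \<and> I \<subseteq> K \<longrightarrow> K = I \<or> K = carrier A)"

definition jacobson_radical :: "('a, 'x) ring_scheme \<Rightarrow> 'a set"
  where "jacobson_radical A = carrier A \<inter> \<Inter> {I. maximal_left_ideal I A}"

primrec jacobson_power :: "('a, 'x) ring_scheme \<Rightarrow> nat \<Rightarrow> 'a set"
  where
    "jacobson_power A 0 = carrier A"
  | "jacobson_power A (Suc i) = ideal_prod A (jacobson_power A i) (jacobson_radical A)"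

definition rad :: "('a, 'x) ring_scheme \<Rightarrow> nat \<Rightarrow> ('a, 'm, 'y) module_scheme \<Rightarrow> 'm set"
  where "rad A i M =
    generated_submodule A M {a \<odot>\<^bsub>M\<^esub> x | a x. a \<in> jacobson_power A i \<and> x \<in> carrier M}"

definition top_module ::
    "('a, 'x) ring_scheme \<Rightarrow> nat \<Rightarrow> ('a, 'm, 'y) module_scheme \<Rightarrow> ('a, 'm set) module"
  where "top_module A i M = quotient_module M (rad A i M)"

definition socle :: "('a, 'x) ring_scheme \<Rightarrow> ('a, 'm, 'y) module_scheme \<Rightarrow> 'm set"
  where "socle A M =
    generated_submodule A M (\<Union> {S. submodule S A M \<and> simple_module A (M\<lparr>carrier := S\<rparr>)})"

primrec soc :: "('a, 'x) ring_scheme \<Rightarrow> nat \<Rightarrow> ('a, 'm, 'y) module_scheme \<Rightarrow> 'm set"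
  where
    "soc A 0 M = {\<zero>\<^bsub>M\<^esub>}"
  | "soc A (Suc i) M =
      {x \<in> carrier M. soc A i M +>\<^bsub>M\<^esub> x \<in> socle A (quotient_module M (soc A i M))}"


section \<open>Projectivity, injective envelopes and almost split sequences in mod \<open>A\<close>\<close>

text \<open>
  The definitions below quantify over all objects of mod \<open>A\<close>.  In HOL such a quantifier ranges
  over modules whose elements have a fixed type, here \<open>(nat \<Rightarrow> 'a) set\<close>, where \<open>'a\<close> is the type of
  ring elements.  Nothing is lost: a module generated by \<open>n\<close> elements is a quotient of \<open>A\<close>\<open>\<^sup>n\<close>, so
  its elements can be coded as sets of coefficient sequences.  The lemma
  \<open>fg_left_module_isomorphic_mod_obj\<close> says that every finitely generated left module,
  with elements of any type, is isomorphic to one of this kind.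
\<close>

type_synonym 'a mod_obj = "('a, (nat \<Rightarrow> 'a) set) module"

definition projective_in_mod :: "('a, 'x) ring_scheme \<Rightarrow> ('a, 'm, 'y) module_scheme \<Rightarrow> bool"
  where "projective_in_mod A P \<longleftrightarrow> fg_left_module A P \<and>
    (\<forall>(X :: 'a mod_obj) (Y :: 'a mod_obj) g f.
      fg_left_module A X \<and> fg_left_module A Y \<and>
      g \<in> mod_hom A X Y \<and> g ` carrier X = carrier Y \<and> f \<in> mod_hom A P Y \<longrightarrow>
      (\<exists>h \<in> mod_hom A P X. \<forall>x\<in>carrier P. g (h x) = f x))"

definition injective_in_mod :: "('a, 'x) ring_scheme \<Rightarrow> ('a, 'm, 'y) module_scheme \<Rightarrow> bool"
  where "injective_in_mod A I \<longleftrightarrow> fg_left_module A I \<and>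
    (\<forall>(X :: 'a mod_obj) (Y :: 'a mod_obj) g f.
      fg_left_module A X \<and> fg_left_module A Y \<and>
      g \<in> mod_hom A X Y \<and> inj_on g (carrier X) \<and> f \<in> mod_hom A X I \<longrightarrow>
      (\<exists>h \<in> mod_hom A Y I. \<forall>x\<in>carrier X. h (g x) = f x))"

definition injective_envelope ::
    "('a, 'x) ring_scheme \<Rightarrow> ('a, 'm, 'y) module_scheme \<Rightarrow> ('a, 'n, 'z) module_scheme \<Rightarrow> ('m \<Rightarrow> 'n) \<Rightarrow> bool"
  where "injective_envelope A M I \<iota> \<longleftrightarrow> injective_in_mod A I \<and>
    \<iota> \<in> mod_hom A M I \<and> inj_on \<iota> (carrier M) \<and>
    (\<forall>N. submodule N A I \<and> N \<inter> \<iota> ` carrier M = {\<zero>\<^bsub>I\<^esub>} \<longrightarrow> N = {\<zero>\<^bsub>I\<^esub>})"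

definition split_mono ::
    "('a, 'x) ring_scheme \<Rightarrow> ('a, 'm, 'y) module_scheme \<Rightarrow> ('a, 'n, 'z) module_scheme \<Rightarrow> ('m \<Rightarrow> 'n) \<Rightarrow> bool"
  where "split_mono A M N f \<longleftrightarrow> f \<in> mod_hom A M N \<and>
    (\<exists>r \<in> mod_hom A N M. \<forall>x\<in>carrier M. r (f x) = x)"

definition split_epi ::
    "('a, 'x) ring_scheme \<Rightarrow> ('a, 'm, 'y) module_scheme \<Rightarrow> ('a, 'n, 'z) module_scheme \<Rightarrow> ('m \<Rightarrow> 'n) \<Rightarrow> bool"
  where "split_epi A M N g \<longleftrightarrow> g \<in> mod_hom A M N \<and>
    (\<exists>r \<in> mod_hom A N M. \<forall>y\<in>carrier N. g (r y) = y)"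

definition left_almost_split ::
    "('a, 'x) ring_scheme \<Rightarrow> ('a, 'm, 'y) module_scheme \<Rightarrow> ('a, 'n, 'z) module_scheme \<Rightarrow> ('m \<Rightarrow> 'n) \<Rightarrow> bool"
  where "left_almost_split A L E f \<longleftrightarrow> f \<in> mod_hom A L E \<and> \<not> split_mono A L E f \<and>
    (\<forall>(U :: 'a mod_obj) u.
      fg_left_module A U \<and> u \<in> mod_hom A L U \<and> \<not> split_mono A L U u \<longrightarrow>
      (\<exists>v \<in> mod_hom A E U. \<forall>x\<in>carrier L. v (f x) = u x))"

definition right_almost_split ::
    "('a, 'x) ring_scheme \<Rightarrow> ('a, 'm, 'y) module_scheme \<Rightarrow> ('a, 'n, 'z) module_scheme \<Rightarrow> ('m \<Rightarrow> 'n) \<Rightarrow> bool"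
  where "right_almost_split A E N g \<longleftrightarrow> g \<in> mod_hom A E N \<and> \<not> split_epi A E N g \<and>
    (\<forall>(V :: 'a mod_obj) v.
      fg_left_module A V \<and> v \<in> mod_hom A V N \<and> \<not> split_epi A V N v \<longrightarrow>
      (\<exists>w \<in> mod_hom A V E. \<forall>x\<in>carrier V. g (w x) = v x))"

definition short_exact ::
    "('a, 'x) ring_scheme \<Rightarrow> ('a, 'l, 'u) module_scheme \<Rightarrow> ('a, 'e, 'v) module_scheme \<Rightarrow>
      ('a, 'n, 'w) module_scheme \<Rightarrow> ('l \<Rightarrow> 'e) \<Rightarrow> ('e \<Rightarrow> 'n) \<Rightarrow> bool"
  where "short_exact A L E N f g \<longleftrightarrow> f \<in> mod_hom A L E \<and> g \<in> mod_hom A E N \<and>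
    inj_on f (carrier L) \<and> f ` carrier L = a_kernel E N g \<and> g ` carrier E = carrier N"

definition almost_split_sequence ::
    "('a, 'x) ring_scheme \<Rightarrow> ('a, 'l, 'u) module_scheme \<Rightarrow> ('a, 'e, 'v) module_scheme \<Rightarrow>
      ('a, 'n, 'w) module_scheme \<Rightarrow> ('l \<Rightarrow> 'e) \<Rightarrow> ('e \<Rightarrow> 'n) \<Rightarrow> bool"
  where "almost_split_sequence A L E N f g \<longleftrightarrow>
    fg_left_module A L \<and> fg_left_module A E \<and> fg_left_module A N \<and>
    short_exact A L E N f g \<and> left_almost_split A L E f \<and> right_almost_split A E N g"


section \<open>The type of test objects represents every finitely generated module\<close>

lemma transported_left_module:
  fixes A :: "('a, 'x) ring_scheme" and M :: "('a, 'm, 'y) module_scheme"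
    and \<phi> :: "'m \<Rightarrow> 'n"
  assumes M: "left_module A M" and inj: "inj_on \<phi> (carrier M)"
  defines "\<psi> \<equiv> inv_into (carrier M) \<phi>"
  defines "U \<equiv> \<lparr>carrier = \<phi> ` carrier M, mult = undefined, one = undefined, zero = \<phi> \<zero>\<^bsub>M\<^esub>,
      add = (\<lambda>x y. \<phi> (\<psi> x \<oplus>\<^bsub>M\<^esub> \<psi> y)), smult = (\<lambda>a x. \<phi> (a \<odot>\<^bsub>M\<^esub> \<psi> x))\<rparr> :: ('a, 'n) module"
  shows "left_module A U" and "\<phi> \<in> mod_hom A M U" and "bij_betw \<phi> (carrier M) (carrier U)"
proof -
  interpret left_module A M by (rule M)
  have \<psi>[simp]: "\<psi> (\<phi> x) = x" if "x \<in> carrier M" for x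
    using that inj by (simp add: \<psi>_def)
  have "abelian_group U"
  proof (rule abelian_groupI)
    fix x assume "x \<in> carrier U"
    then obtain m where m: "m \<in> carrier M" "x = \<phi> m" by (auto simp: U_def)
    have "\<phi> (\<ominus>\<^bsub>M\<^esub> m) \<in> carrier U" "\<phi> (\<ominus>\<^bsub>M\<^esub> m) \<oplus>\<^bsub>U\<^esub> x = \<zero>\<^bsub>U\<^esub>"
      using m by (auto simp: U_def M.l_neg)
    then show "\<exists>y\<in>carrier U. y \<oplus>\<^bsub>U\<^esub> x = \<zero>\<^bsub>U\<^esub>" by blast
  qed (auto simp: U_def M.a_ac)
  then show "left_module A U"
    using R.ring_axioms
    by (intro left_module.intro left_module_axioms.intro)
       (auto simp: U_def smult_l_distr smult_r_distr smult_assoc1)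
  show "\<phi> \<in> mod_hom A M U" by (auto simp: mod_hom_def U_def)
  show "bij_betw \<phi> (carrier M) (carrier U)"
    using inj by (simp add: bij_betw_def U_def)
qed


lemma (in left_module) submoduleI:
  assumes "N \<subseteq> carrier M" "\<zero>\<^bsub>M\<^esub> \<in> N"
    and "\<And>x y. \<lbrakk>x \<in> N; y \<in> N\<rbrakk> \<Longrightarrow> x \<oplus>\<^bsub>M\<^esub> y \<in> N"
    and smult: "\<And>a x. \<lbrakk>a \<in> carrier R; x \<in> N\<rbrakk> \<Longrightarrow> a \<odot>\<^bsub>M\<^esub> x \<in> N"
  shows "submodule N R M"
proof -
  have "\<ominus>\<^bsub>M\<^esub> x \<in> N" if x: "x \<in> N" for x
  proof -
    have xM: "x \<in> carrier M" using x assms(1) by blast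
    have "(\<one> \<oplus> \<ominus> \<one>) \<odot>\<^bsub>M\<^esub> x = x \<oplus>\<^bsub>M\<^esub> (\<ominus> \<one>) \<odot>\<^bsub>M\<^esub> x"
      using xM smult_l_distr[of \<one> "\<ominus> \<one>" x] by simp
    moreover have "\<zero> \<odot>\<^bsub>M\<^esub> x = \<zero>\<^bsub>M\<^esub>"
      using xM smult_l_distr[of \<zero> \<zero> x] by (metis M.add.r_cancel_one' R.l_zero R.zero_closed smult_closed)
    ultimately have "x \<oplus>\<^bsub>M\<^esub> (\<ominus> \<one>) \<odot>\<^bsub>M\<^esub> x = \<zero>\<^bsub>M\<^esub>" by (simp add: R.r_neg)
    then have "(\<ominus> \<one>) \<odot>\<^bsub>M\<^esub> x = \<ominus>\<^bsub>M\<^esub> x"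
      using xM by (metis M.add.inv_equality M.a_comm R.a_inv_closed R.one_closed smult_closed)
    then show ?thesis using smult[OF _ x, of "\<ominus> \<one>"] by simp
  qed
  then show ?thesis
    using assms by (intro submodule.intro subgroup.intro submodule_axioms.intro)
      (simp_all flip: a_inv_def)
qed

lemma (in left_module) linear_combinations_submodule:
  fixes x :: "nat \<Rightarrow> 'm" and n :: nat
  assumes x: "x \<in> {..<n} \<rightarrow> carrier M"
  defines "W \<equiv> {(\<Oplus>\<^bsub>M\<^esub>i\<in>{..<n}. c i \<odot>\<^bsub>M\<^esub> x i) | c. c \<in> {..<n} \<rightarrow> carrier R}"
  shows "submodule W R M" and "x ` {..<n} \<subseteq> W"
proof -
  have null: "\<zero> \<odot>\<^bsub>M\<^esub> y = \<zero>\<^bsub>M\<^esub>" if "y \<in> carrier M" for y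
    using that smult_l_distr[of \<zero> \<zero> y]
    by (metis M.add.r_cancel_one' R.l_zero R.zero_closed smult_closed)
  have finsum_smult: "a \<odot>\<^bsub>M\<^esub> (\<Oplus>\<^bsub>M\<^esub>i\<in>F. f i) = (\<Oplus>\<^bsub>M\<^esub>i\<in>F. a \<odot>\<^bsub>M\<^esub> f i)"
    if "finite F" "a \<in> carrier R" "f \<in> F \<rightarrow> carrier M" for F :: "nat set" and a f
    using that
  proof (induction F)
    case empty
    have "a \<odot>\<^bsub>M\<^esub> \<zero>\<^bsub>M\<^esub> = \<zero>\<^bsub>M\<^esub>"
      using empty smult_r_distr[of a "\<zero>\<^bsub>M\<^esub>" "\<zero>\<^bsub>M\<^esub>"]
      by (metis M.add.r_cancel_one' M.l_zero M.zero_closed smult_closed)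
    then show ?case by simp
  next
    case (insert i F)
    then show ?case by (simp add: Pi_def smult_r_distr)
  qed
  show "x ` {..<n} \<subseteq> W"
  proof
    fix y assume "y \<in> x ` {..<n}"
    then obtain j where j: "j < n" "y = x j" by blast
    have "(\<Oplus>\<^bsub>M\<^esub>i\<in>{..<n}. (if j = i then \<one> else \<zero>) \<odot>\<^bsub>M\<^esub> x i) =
        (\<Oplus>\<^bsub>M\<^esub>i\<in>{..<n}. if j = i then x i else \<zero>\<^bsub>M\<^esub>)"
      using x by (intro M.finsum_cong') (auto simp: null Pi_def)
    also have "\<dots> = x j" using j x by (intro M.add.finprod_singleton) (auto simp: Pi_def)
    finally show "y \<in> W"
      unfolding W_def using j
      by (intro CollectI exI[of _ "\<lambda>i. if j = i then \<one> else \<zero>"]) auto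
  qed
  have cx: "c i \<odot>\<^bsub>M\<^esub> x i \<in> carrier M" if "c \<in> {..<n} \<rightarrow> carrier R" "i < n" for c i
    using x that by (auto simp: Pi_def)
  show "submodule W R M"
  proof (rule submoduleI)
    show "W \<subseteq> carrier M" using cx by (auto simp: W_def intro!: M.finsum_closed)
    have "(\<Oplus>\<^bsub>M\<^esub>i\<in>{..<n}. \<zero> \<odot>\<^bsub>M\<^esub> x i) = \<zero>\<^bsub>M\<^esub>"
      using x by (intro M.add.finprod_one_eqI) (auto simp: null Pi_def)
    then show "\<zero>\<^bsub>M\<^esub> \<in> W"
      unfolding W_def by (intro CollectI exI[of _ "\<lambda>_. \<zero>"]) auto
  next
    fix u v assume "u \<in> W" "v \<in> W"
    then obtain c d where c: "c \<in> {..<n} \<rightarrow> carrier R" "u = (\<Oplus>\<^bsub>M\<^esub>i\<in>{..<n}. c i \<odot>\<^bsub>M\<^esub> x i)"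
      and d: "d \<in> {..<n} \<rightarrow> carrier R" "v = (\<Oplus>\<^bsub>M\<^esub>i\<in>{..<n}. d i \<odot>\<^bsub>M\<^esub> x i)"
      by (auto simp: W_def)
    have "u \<oplus>\<^bsub>M\<^esub> v = (\<Oplus>\<^bsub>M\<^esub>i\<in>{..<n}. c i \<odot>\<^bsub>M\<^esub> x i \<oplus>\<^bsub>M\<^esub> d i \<odot>\<^bsub>M\<^esub> x i)"
      using c d cx by (simp add: M.finsum_addf Pi_def)
    also have "\<dots> = (\<Oplus>\<^bsub>M\<^esub>i\<in>{..<n}. (c i \<oplus> d i) \<odot>\<^bsub>M\<^esub> x i)"
      using c d x by (intro M.finsum_cong') (auto simp: Pi_def smult_l_distr)
    finally show "u \<oplus>\<^bsub>M\<^esub> v \<in> W"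
      unfolding W_def using c d by (intro CollectI exI[of _ "\<lambda>i. c i \<oplus> d i"]) (auto simp: Pi_def)
  next
    fix a u assume a: "a \<in> carrier R" and "u \<in> W"
    then obtain c where c: "c \<in> {..<n} \<rightarrow> carrier R" "u = (\<Oplus>\<^bsub>M\<^esub>i\<in>{..<n}. c i \<odot>\<^bsub>M\<^esub> x i)"
      by (auto simp: W_def)
    have "a \<odot>\<^bsub>M\<^esub> u = (\<Oplus>\<^bsub>M\<^esub>i\<in>{..<n}. a \<odot>\<^bsub>M\<^esub> (c i \<odot>\<^bsub>M\<^esub> x i))"
      using a c cx by (simp add: finsum_smult Pi_def)
    also have "\<dots> = (\<Oplus>\<^bsub>M\<^esub>i\<in>{..<n}. (a \<otimes> c i) \<odot>\<^bsub>M\<^esub> x i)"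
      using a c x by (intro M.finsum_cong') (auto simp: Pi_def smult_assoc1)
    finally show "a \<odot>\<^bsub>M\<^esub> u \<in> W"
      unfolding W_def using a c by (intro CollectI exI[of _ "\<lambda>i. a \<otimes> c i"]) (auto simp: Pi_def)
  qed
qed

lemma bij_mod_hom_finitely_generated:
  assumes M: "left_module A M" and U: "left_module A U" and f: "f \<in> mod_hom A M U"
    and bij: "bij_betw f (carrier M) (carrier U)" and fg: "finitely_generated A M"
  shows "finitely_generated A U"
proof -
  interpret M: left_module A M by (rule M)
  interpret U: left_module A U by (rule U)
  have zero: "f \<zero>\<^bsub>M\<^esub> = \<zero>\<^bsub>U\<^esub>"
  proof -
    have hom: "f \<in> carrier M \<rightarrow> carrier U"
      "\<And>x y. \<lbrakk>x \<in> carrier M; y \<in> carrier M\<rbrakk> \<Longrightarrow> f (x \<oplus>\<^bsub>M\<^esub> y) = f x \<oplus>\<^bsub>U\<^esub> f y"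
      using f unfolding mod_hom_def by blast+
    have "f \<zero>\<^bsub>M\<^esub> \<oplus>\<^bsub>U\<^esub> f \<zero>\<^bsub>M\<^esub> = f \<zero>\<^bsub>M\<^esub>"
      using hom(2)[of "\<zero>\<^bsub>M\<^esub>" "\<zero>\<^bsub>M\<^esub>"] by simp
    moreover have "f \<zero>\<^bsub>M\<^esub> \<in> carrier U"
      using hom(1) M.M.zero_closed by (rule funcset_mem)
    ultimately show ?thesis
      by (simp only: U.M.add.r_cancel_one)
  qed
  obtain X where X: "finite X" "X \<subseteq> carrier M" "generated_submodule A M X = carrier M"
    using fg by (auto simp: finitely_generated_def)
  have "carrier U \<subseteq> N" if N: "submodule N A U" "f ` X \<subseteq> N" for N
  proof -
    have N_closed: "\<zero>\<^bsub>U\<^esub> \<in> N" "\<And>x y. \<lbrakk>x \<in> N; y \<in> N\<rbrakk> \<Longrightarrow> x \<oplus>\<^bsub>U\<^esub> y \<in> N"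
      "\<And>a x. \<lbrakk>a \<in> carrier A; x \<in> N\<rbrakk> \<Longrightarrow> a \<odot>\<^bsub>U\<^esub> x \<in> N"
      using subgroup.one_closed[OF submodule.axioms(1)[OF N(1)]]
        subgroup.m_closed[OF submodule.axioms(1)[OF N(1)]] submodule.smult_closed[OF N(1)]
      by auto
    have "submodule {x \<in> carrier M. f x \<in> N} A M"
      using f N_closed zero by (intro M.submoduleI) (auto simp: mod_hom_def)
    then have "generated_submodule A M X \<subseteq> {x \<in> carrier M. f x \<in> N}"
      unfolding generated_submodule_def using X(2) N(2) by (intro Inter_lower) auto
    then have "f ` carrier M \<subseteq> N" unfolding X(3) by auto
    then show ?thesis unfolding bij_betw_imp_surj_on[OF bij] .
  qed
  moreover have "submodule (carrier U) A U" by (rule U.submoduleI) auto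
  moreover have "f ` X \<subseteq> carrier U" using X bij by (auto simp: bij_betw_def)
  ultimately have "generated_submodule A U (f ` X) = carrier U"
    unfolding generated_submodule_def by (intro equalityI Inter_lower Inter_greatest) auto
  then show ?thesis
    unfolding finitely_generated_def using X(1) \<open>f ` X \<subseteq> carrier U\<close>
    by (intro exI[of _ "f ` X"]) simp
qed

lemma fg_left_module_isomorphic_mod_obj:
  fixes A :: "('a, 'x) ring_scheme" and M :: "('a, 'm, 'y) module_scheme"
  assumes "fg_left_module A M"
  shows "\<exists>(U :: 'a mod_obj) \<phi>. fg_left_module A U \<and> \<phi> \<in> mod_hom A M U \<and>
    bij_betw \<phi> (carrier M) (carrier U)"
proof -
  have M: "left_module A M" and fg: "finitely_generated A M"
    using assms by (auto simp: fg_left_module_def)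
  interpret left_module A M by (rule M)
  obtain X where X: "finite X" "X \<subseteq> carrier M" "generated_submodule A M X = carrier M"
    using fg by (auto simp: finitely_generated_def)
  obtain n and x :: "nat \<Rightarrow> 'm" where "X = x ` {i. i < n}"
    using finite_imp_nat_seg_image_inj_on[OF X(1)] by blast
  then have Xx: "X = x ` {..<n}" by (simp add: lessThan_def)
  then have x: "x \<in> {..<n} \<rightarrow> carrier M" using X by auto
  define \<phi> where "\<phi> = (\<lambda>m. {c :: nat \<Rightarrow> 'a. c \<in> {..<n} \<rightarrow> carrier A \<and>
      (\<Oplus>\<^bsub>M\<^esub>i\<in>{..<n}. c i \<odot>\<^bsub>M\<^esub> x i) = m})"
  have "carrier M \<subseteq> {(\<Oplus>\<^bsub>M\<^esub>i\<in>{..<n}. c i \<odot>\<^bsub>M\<^esub> x i) | c. c \<in> {..<n} \<rightarrow> carrier A}"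
    using linear_combinations_submodule[OF x] X(3) Xx
    unfolding generated_submodule_def by blast
  then have "\<phi> m \<noteq> {}" if "m \<in> carrier M" for m
    using that unfolding \<phi>_def by blast
  moreover have "m = m'" if "c \<in> \<phi> m" "c \<in> \<phi> m'" for c m m'
    using that by (simp add: \<phi>_def)
  ultimately have "inj_on \<phi> (carrier M)"
    unfolding inj_on_def by (metis ex_in_conv)
  note U = transported_left_module[OF M this]
  show ?thesis
    using U bij_mod_hom_finitely_generated[OF M U fg] unfolding fg_left_module_def by blast
qed

end

theory Submission
  imports Defs
begin

text \<open>
  Write \<open>L = top\<^sup>s M\<close>, \<open>S = rad\<^sup>s\<^sup>-\<^sup>1 M / rad\<^sup>s M\<close> and \<open>N = P / rad\<^sup>s\<^sup>-\<^sup>1 M\<close>. The sequence is exact for every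
  submodule \<open>M\<close> of \<open>P\<close>, because \<open>N\<close> is the pushout of \<open>L \<subseteq> P / rad\<^sup>s M\<close> along the projection
  \<open>L \<rightarrow> top\<^sup>s\<^sup>-\<^sup>1 M\<close>. The point is the almost split property.

  An indecomposable projective module is local (\<open>indecomposable_projective_local\<close>), so \<open>M\<close> lies in
  \<open>rad P\<close>. As \<open>L\<close> is uniserial, its socle is \<open>S\<close>, and \<open>S\<close> is simple. It follows that \<open>rad\<^sup>s\<^sup>-\<^sup>1 M\<close> is
  generated by one element \<open>a\<close> of \<open>rad\<^sup>s P\<close> outside \<open>rad\<^sup>s\<^sup>+\<^sup>1 P\<close>, and there is an idempotent \<open>e\<close> with
  \<open>e a = a\<close> such that \<open>A e\<close> is a projective cover of \<open>S\<close> (\<open>generator\<close>).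

  Let \<open>u : L \<rightarrow> U\<close> not be a split monomorphism. If \<open>u\<close> is not injective, it kills \<open>S\<close> and factors
  through \<open>top\<^sup>s\<^sup>-\<^sup>1 M\<close>. If \<open>u\<close> is injective, then \<open>u\<close> maps \<open>S\<close> into \<open>rad\<^sup>s U\<close>. Otherwise \<open>L\<close> would embed into
  \<open>U / rad\<^sup>s U\<close>, and an extension of \<open>L \<rightarrow> I\<close> to this module would have its values in \<open>soc\<^sup>s I\<close>, which is
  \<open>L\<close> because \<open>soc\<^sup>s\<^sup>+\<^sup>1 I\<close> is uniserial; that is a retraction of \<open>u\<close>. It remains to find \<open>v : P \<rightarrow> U\<close> which
  agrees with \<open>u\<close> on \<open>a\<close>. Then \<open>v\<close> kills \<open>rad\<^sup>s M\<close>, and the difference of \<open>u\<close> and \<open>v\<close> on \<open>L\<close> kills \<open>S\<close>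
  (\<open>f_extends\<close>).

  The existence of \<open>v\<close> is the core of the proof: for each \<open>b\<close> in \<open>rad\<^sup>s U\<close> with \<open>e b = b\<close> there is
  \<open>v : P \<rightarrow> U\<close> with \<open>v a = b\<close> (\<open>hom_hitting_radical_element\<close>). It suffices to consider local modules
  \<open>U\<close> and to solve the equation modulo \<open>rad\<^sup>s\<^sup>+\<^sup>1 U\<close>. If \<open>b\<close> is not zero there, then \<open>U\<close> maps onto
  \<open>V = soc\<^sup>s\<^sup>+\<^sup>1 I\<close>, and so does \<open>P\<close> (\<open>onto_V\<close>); hence \<open>U\<close> is an image of \<open>P\<close>, and one may take \<open>U = P\<close>. Let
  \<open>Y = rad\<^sup>s P / rad\<^sup>s\<^sup>+\<^sup>1 P\<close>. All homomorphisms \<open>Y \<rightarrow> S\<close> are induced by \<open>g v\<close> with \<open>v \<in> End P\<close>, for a fixed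
  surjection \<open>g : P \<rightarrow> V\<close>, and \<open>g v \<mapsto> v a\<close> embeds \<open>Hom(Y, S)\<close> into \<open>e Y\<close>. As \<open>Y\<close> is semisimple, both have
  the same finite length over the base ring \<open>R\<close>, and the embedding is onto
  (\<open>radical_multiples_of_generator\<close>). The equality of lengths is used in the form of an \<open>R\<close>-linear
  embedding of \<open>e Y\<close> into \<open>Hom(Y, S)\<close> (\<open>pairing_exists\<close>), together with the fact that an injective
  endomorphism of an artinian \<open>R\<close>-module is onto (\<open>injective_stable_endo_surj\<close>). This is where it matters
  that \<open>A\<close> is an artin algebra, and not only an artinian ring.

  The right almost split property follows from the left one, since \<open>N\<close> is local and its surjective
  endomorphisms are bijective (\<open>right_almost_split_if_left\<close>).
\<close>

section \<open>Modules, submodules, quotients and homomorphisms\<close>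

lemma submodule_subset: "submodule N A M \<Longrightarrow> N \<subseteq> carrier M"
  by (rule subgroup.subset[OF submodule.axioms(1), simplified])

lemma submodule_mem: "submodule N A M \<Longrightarrow> x \<in> N \<Longrightarrow> x \<in> carrier M"
  using submodule_subset by blast

lemma submodule_zero: "submodule N A M \<Longrightarrow> \<zero>\<^bsub>M\<^esub> \<in> N"
  using subgroup.one_closed[OF submodule.axioms(1)] by fastforce

lemma submodule_add: "submodule N A M \<Longrightarrow> x \<in> N \<Longrightarrow> y \<in> N \<Longrightarrow> x \<oplus>\<^bsub>M\<^esub> y \<in> N"
  using subgroup.m_closed[OF submodule.axioms(1)] by fastforce

lemma submodule_smult: "submodule N A M \<Longrightarrow> a \<in> carrier A \<Longrightarrow> x \<in> N \<Longrightarrow> a \<odot>\<^bsub>M\<^esub> x \<in> N"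
  by (rule submodule.smult_closed)

lemma mem_set_add: "z \<in> X <+>\<^bsub>M\<^esub> Y \<longleftrightarrow> (\<exists>x\<in>X. \<exists>y\<in>Y. z = x \<oplus>\<^bsub>M\<^esub> y)"
  by (auto simp: set_add_def')

lemma mem_a_r_coset: "z \<in> X +>\<^bsub>M\<^esub> y \<longleftrightarrow> (\<exists>x\<in>X. z = x \<oplus>\<^bsub>M\<^esub> y)"
  by (auto simp: a_r_coset_def')

context left_module
begin

lemma smult_zero_left [simp]: "x \<in> carrier M \<Longrightarrow> \<zero> \<odot>\<^bsub>M\<^esub> x = \<zero>\<^bsub>M\<^esub>"
  using smult_l_distr[of \<zero> \<zero> x]
  by (metis M.add.r_cancel_one' R.l_zero R.zero_closed smult_closed)

lemma smult_zero_right [simp]: "a \<in> carrier R \<Longrightarrow> a \<odot>\<^bsub>M\<^esub> \<zero>\<^bsub>M\<^esub> = \<zero>\<^bsub>M\<^esub>"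
  using smult_r_distr[of a "\<zero>\<^bsub>M\<^esub>" "\<zero>\<^bsub>M\<^esub>"]
  by (metis M.add.r_cancel_one' M.l_zero M.zero_closed smult_closed)

lemma smult_minus_left:
  "a \<in> carrier R \<Longrightarrow> x \<in> carrier M \<Longrightarrow> (\<ominus> a) \<odot>\<^bsub>M\<^esub> x = \<ominus>\<^bsub>M\<^esub> (a \<odot>\<^bsub>M\<^esub> x)"
  using smult_l_distr[of "\<ominus> a" a x]
  by (metis M.minus_equality R.a_inv_closed R.l_neg smult_closed smult_zero_left)

lemma smult_minus_right:
  "a \<in> carrier R \<Longrightarrow> x \<in> carrier M \<Longrightarrow> a \<odot>\<^bsub>M\<^esub> (\<ominus>\<^bsub>M\<^esub> x) = \<ominus>\<^bsub>M\<^esub> (a \<odot>\<^bsub>M\<^esub> x)"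
  using smult_r_distr[of a "\<ominus>\<^bsub>M\<^esub> x" x]
  by (metis M.minus_equality M.a_inv_closed M.l_neg smult_closed smult_zero_right)

lemma diff_self [simp]: "x \<in> carrier M \<Longrightarrow> x \<ominus>\<^bsub>M\<^esub> x = \<zero>\<^bsub>M\<^esub>"
  by (simp add: a_minus_def M.r_neg)

lemma minus_zero_module [simp]: "\<ominus>\<^bsub>M\<^esub> \<zero>\<^bsub>M\<^esub> = \<zero>\<^bsub>M\<^esub>"
  by (rule M.minus_equality) auto

lemma diff_add_cancel: "x \<in> carrier M \<Longrightarrow> y \<in> carrier M \<Longrightarrow> (x \<ominus>\<^bsub>M\<^esub> y) \<oplus>\<^bsub>M\<^esub> y = x"
  by (simp add: a_minus_def M.a_assoc M.l_neg)

lemma diff_eq_zero_iff [simp]: 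
  "x \<in> carrier M \<Longrightarrow> y \<in> carrier M \<Longrightarrow> x \<ominus>\<^bsub>M\<^esub> y = \<zero>\<^bsub>M\<^esub> \<longleftrightarrow> x = y"
  using diff_add_cancel[of x y] by auto

lemma add_diff_cancel: "x \<in> carrier M \<Longrightarrow> y \<in> carrier M \<Longrightarrow> y \<oplus>\<^bsub>M\<^esub> (x \<ominus>\<^bsub>M\<^esub> y) = x"
  by (metis M.a_comm M.minus_closed diff_add_cancel)

lemma smult_diff: 
  "a \<in> carrier R \<Longrightarrow> x \<in> carrier M \<Longrightarrow> y \<in> carrier M \<Longrightarrow> a \<odot>\<^bsub>M\<^esub> (x \<ominus>\<^bsub>M\<^esub> y) = a \<odot>\<^bsub>M\<^esub> x \<ominus>\<^bsub>M\<^esub> a \<odot>\<^bsub>M\<^esub> y"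
  by (simp add: a_minus_def smult_r_distr smult_minus_right)

lemma submodule_iff:
  "submodule N R M \<longleftrightarrow> N \<subseteq> carrier M \<and> \<zero>\<^bsub>M\<^esub> \<in> N \<and>
    (\<forall>x\<in>N. \<forall>y\<in>N. x \<oplus>\<^bsub>M\<^esub> y \<in> N) \<and> (\<forall>a\<in>carrier R. \<forall>x\<in>N. a \<odot>\<^bsub>M\<^esub> x \<in> N)"
proof
  assume "submodule N R M"
  then show "N \<subseteq> carrier M \<and> \<zero>\<^bsub>M\<^esub> \<in> N \<and>
    (\<forall>x\<in>N. \<forall>y\<in>N. x \<oplus>\<^bsub>M\<^esub> y \<in> N) \<and> (\<forall>a\<in>carrier R. \<forall>x\<in>N. a \<odot>\<^bsub>M\<^esub> x \<in> N)"
    using submodule_subset submodule_zero submodule_add submodule_smult by metis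
qed (auto intro!: submoduleI)

lemma submodule_minus: 
  assumes "submodule N R M" "x \<in> N" shows "\<ominus>\<^bsub>M\<^esub> x \<in> N"
proof -
  have "(\<ominus> \<one>) \<odot>\<^bsub>M\<^esub> x \<in> N" using assms by (intro submodule_smult) auto
  then show ?thesis using smult_minus_left[of \<one> x] submodule_mem[OF assms] by simp
qed

lemma submodule_diff: 
  assumes "submodule N R M" "x \<in> N" "y \<in> N" shows "x \<ominus>\<^bsub>M\<^esub> y \<in> N"
  unfolding a_minus_def using assms by (intro submodule_add submodule_minus)

lemma submodule_cancel:
  assumes "submodule N R M" "x \<in> carrier M" "y \<in> N" "x \<oplus>\<^bsub>M\<^esub> y \<in> N" shows "x \<in> N"
proof -
  have y: "y \<in> carrier M" using assms submodule_mem by metis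
  have "(x \<oplus>\<^bsub>M\<^esub> y) \<ominus>\<^bsub>M\<^esub> y \<in> N" using assms by (intro submodule_diff)
  also have "(x \<oplus>\<^bsub>M\<^esub> y) \<ominus>\<^bsub>M\<^esub> y = x" using assms(2) y
    by (simp add: a_minus_def M.a_assoc M.r_neg)
  finally show ?thesis .
qed

lemma submodule_cancel_left:
  assumes "submodule N R M" "x \<in> carrier M" "y \<in> N" "y \<oplus>\<^bsub>M\<^esub> x \<in> N" shows "x \<in> N"
  using submodule_cancel[OF assms(1-3)] assms(4) M.a_comm[of x y] assms(2) submodule_mem[OF assms(1,3)] by simp

lemma submodule_carrier [simp]: "submodule (carrier M) R M"
  by (rule submoduleI) auto

lemma submodule_null [simp]: "submodule {\<zero>\<^bsub>M\<^esub>} R M"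
  by (rule submoduleI) auto

lemma submodule_Int:
  "submodule N R M \<Longrightarrow> submodule N' R M \<Longrightarrow> submodule (N \<inter> N') R M"
  unfolding submodule_iff by auto

lemma submodule_Inter:
  "\<NN> \<noteq> {} \<Longrightarrow> (\<And>N. N \<in> \<NN> \<Longrightarrow> submodule N R M) \<Longrightarrow> submodule (\<Inter> \<NN>) R M"
  unfolding submodule_iff by blast

lemma submodule_sum:
  assumes N: "submodule N R M" and N': "submodule N' R M"
  shows "submodule (N <+>\<^bsub>M\<^esub> N') R M"
proof (rule submoduleI)
  note sub = submodule_mem[OF N] submodule_mem[OF N']
  show "N <+>\<^bsub>M\<^esub> N' \<subseteq> carrier M" using sub by (auto simp: mem_set_add)
  show "\<zero>\<^bsub>M\<^esub> \<in> N <+>\<^bsub>M\<^esub> N'"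
    using submodule_zero[OF N] submodule_zero[OF N'] by (force simp: mem_set_add)
next
  fix u v assume "u \<in> N <+>\<^bsub>M\<^esub> N'" "v \<in> N <+>\<^bsub>M\<^esub> N'"
  then obtain x y x' y' where h: "x \<in> N" "y \<in> N'" "u = x \<oplus>\<^bsub>M\<^esub> y" "x' \<in> N" "y' \<in> N'" "v = x' \<oplus>\<^bsub>M\<^esub> y'"
    by (auto simp: mem_set_add)
  then have "u \<oplus>\<^bsub>M\<^esub> v = (x \<oplus>\<^bsub>M\<^esub> x') \<oplus>\<^bsub>M\<^esub> (y \<oplus>\<^bsub>M\<^esub> y')"
    using submodule_mem[OF N] submodule_mem[OF N'] by (simp add: M.a_ac)
  then show "u \<oplus>\<^bsub>M\<^esub> v \<in> N <+>\<^bsub>M\<^esub> N'"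
    using h submodule_add[OF N] submodule_add[OF N'] unfolding mem_set_add by blast
next
  fix a u assume a: "a \<in> carrier R" and "u \<in> N <+>\<^bsub>M\<^esub> N'"
  then obtain x y where h: "x \<in> N" "y \<in> N'" "u = x \<oplus>\<^bsub>M\<^esub> y" by (auto simp: mem_set_add)
  then have "a \<odot>\<^bsub>M\<^esub> u = a \<odot>\<^bsub>M\<^esub> x \<oplus>\<^bsub>M\<^esub> a \<odot>\<^bsub>M\<^esub> y"
    using a submodule_mem[OF N] submodule_mem[OF N'] by (simp add: smult_r_distr)
  then show "a \<odot>\<^bsub>M\<^esub> u \<in> N <+>\<^bsub>M\<^esub> N'"
    using h a submodule_smult[OF N] submodule_smult[OF N'] unfolding mem_set_add by blast
qed

lemma sum_incl1:
  assumes N: "submodule N R M" and N': "submodule N' R M" shows "N \<subseteq> N <+>\<^bsub>M\<^esub> N'"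
  using submodule_zero[OF N'] submodule_mem[OF N] by (force simp: mem_set_add)

lemma sum_incl2:
  assumes N: "submodule N R M" and N': "submodule N' R M" shows "N' \<subseteq> N <+>\<^bsub>M\<^esub> N'"
  using submodule_zero[OF N] submodule_mem[OF N'] by (force simp: mem_set_add)

lemma sum_least: "submodule K R M \<Longrightarrow> N \<subseteq> K \<Longrightarrow> N' \<subseteq> K \<Longrightarrow> N <+>\<^bsub>M\<^esub> N' \<subseteq> K"
  unfolding set_add_def' using submodule_add by fast

lemma sum_mono: "N \<subseteq> K \<Longrightarrow> N' \<subseteq> K' \<Longrightarrow> N <+>\<^bsub>M\<^esub> N' \<subseteq> K <+>\<^bsub>M\<^esub> K'"
  unfolding set_add_def' by blast

lemma sum_comm:
  assumes N: "submodule N R M" and N': "submodule N' R M" shows "N <+>\<^bsub>M\<^esub> N' = N' <+>\<^bsub>M\<^esub> N"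
proof -
  have "x \<oplus>\<^bsub>M\<^esub> y = y \<oplus>\<^bsub>M\<^esub> x" if "x \<in> N" "y \<in> N'" for x y
    using that submodule_mem[OF N] submodule_mem[OF N'] by (simp add: M.a_comm)
  then show ?thesis unfolding set_eq_iff mem_set_add by metis
qed

lemma submodule_generated: 
  assumes "X \<subseteq> carrier M" shows "submodule (generated_submodule R M X) R M"
  unfolding generated_submodule_def
proof (rule submodule_Inter)
  show "{N. submodule N R M \<and> X \<subseteq> N} \<noteq> {}" using assms submodule_carrier by blast
qed auto

lemma generated_incl: "X \<subseteq> generated_submodule R M X"
  unfolding generated_submodule_def by auto

lemma generated_least: "submodule N R M \<Longrightarrow> X \<subseteq> N \<Longrightarrow> generated_submodule R M X \<subseteq> N"
  unfolding generated_submodule_def by auto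

lemma generated_mono: "X \<subseteq> Y \<Longrightarrow> generated_submodule R M X \<subseteq> generated_submodule R M Y"
  unfolding generated_submodule_def by auto

lemma generated_submodule_eq: "submodule N R M \<Longrightarrow> generated_submodule R M N = N"
  unfolding generated_submodule_def by auto

lemma restrict_left_module:
  assumes N: "submodule N R M" shows "left_module R (M\<lparr>carrier := N\<rparr>)"
proof -
  have "abelian_group (M\<lparr>carrier := N\<rparr>)"
  proof (rule abelian_groupI)
    fix x assume "x \<in> carrier (M\<lparr>carrier := N\<rparr>)"
    then show "\<exists>y\<in>carrier (M\<lparr>carrier := N\<rparr>). y \<oplus>\<^bsub>M\<lparr>carrier := N\<rparr>\<^esub> x = \<zero>\<^bsub>M\<lparr>carrier := N\<rparr>\<^esub>"
      using submodule_minus[OF N] submodule_mem[OF N] M.l_neg by auto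
  qed (use submodule_mem[OF N] submodule_add[OF N] submodule_zero[OF N] in \<open>auto simp: M.a_ac\<close>)
  then show ?thesis
    using R.ring_axioms submodule_mem[OF N] submodule_smult[OF N]
    by (intro left_module.intro left_module_axioms.intro)
       (auto simp: smult_l_distr smult_r_distr smult_assoc1)
qed

lemma submodule_restrict_iff:
  assumes N: "submodule N R M"
  shows "submodule K R (M\<lparr>carrier := N\<rparr>) \<longleftrightarrow> submodule K R M \<and> K \<subseteq> N"
proof -
  interpret N: left_module R "M\<lparr>carrier := N\<rparr>" by (rule restrict_left_module[OF N])
  show ?thesis
    using submodule_subset[OF N] unfolding submodule_iff N.submodule_iff by auto
qed

lemma generated_restrict:
  assumes N: "submodule N R M" and X: "X \<subseteq> N"
  shows "generated_submodule R (M\<lparr>carrier := N\<rparr>) X = generated_submodule R M X"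
proof
  have XM: "X \<subseteq> carrier M" using X submodule_subset[OF N] by blast
  have "generated_submodule R M X \<subseteq> N" using generated_least[OF N X] .
  then have "submodule (generated_submodule R M X) R (M\<lparr>carrier := N\<rparr>)"
    using submodule_generated[OF XM] submodule_restrict_iff[OF N] by blast
  then show "generated_submodule R (M\<lparr>carrier := N\<rparr>) X \<subseteq> generated_submodule R M X"
    using generated_incl unfolding generated_submodule_def by blast
  show "generated_submodule R M X \<subseteq> generated_submodule R (M\<lparr>carrier := N\<rparr>) X"
    using submodule_restrict_iff[OF N] unfolding generated_submodule_def by blast
qed

end

definition cyclic_submodule :: "('a, 'x) ring_scheme \<Rightarrow> ('a, 'm, 'y) module_scheme \<Rightarrow> 'm \<Rightarrow> 'm set"
  where "cyclic_submodule A M x = (\<lambda>a. a \<odot>\<^bsub>M\<^esub> x) ` carrier A"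

lemma (in left_module) cyclic_submodule:
  assumes x: "x \<in> carrier M" shows "submodule (cyclic_submodule R M x) R M"
  unfolding cyclic_submodule_def
proof (rule submoduleI)
  show "(\<lambda>a. a \<odot>\<^bsub>M\<^esub> x) ` carrier R \<subseteq> carrier M" using x by auto
  show "\<zero>\<^bsub>M\<^esub> \<in> (\<lambda>a. a \<odot>\<^bsub>M\<^esub> x) ` carrier R" using x by (intro image_eqI[of _ _ \<zero>]) auto
next
  fix u v assume "u \<in> (\<lambda>a. a \<odot>\<^bsub>M\<^esub> x) ` carrier R" "v \<in> (\<lambda>a. a \<odot>\<^bsub>M\<^esub> x) ` carrier R"
  then obtain a b where "a \<in> carrier R" "b \<in> carrier R" "u = a \<odot>\<^bsub>M\<^esub> x" "v = b \<odot>\<^bsub>M\<^esub> x" by auto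
  then show "u \<oplus>\<^bsub>M\<^esub> v \<in> (\<lambda>a. a \<odot>\<^bsub>M\<^esub> x) ` carrier R"
    using x by (intro image_eqI[of _ _ "a \<oplus> b"]) (auto simp: smult_l_distr)
next
  fix c u assume c: "c \<in> carrier R" and "u \<in> (\<lambda>a. a \<odot>\<^bsub>M\<^esub> x) ` carrier R"
  then obtain a where "a \<in> carrier R" "u = a \<odot>\<^bsub>M\<^esub> x" by auto
  then show "c \<odot>\<^bsub>M\<^esub> u \<in> (\<lambda>a. a \<odot>\<^bsub>M\<^esub> x) ` carrier R"
    using x c by (intro image_eqI[of _ _ "c \<otimes> a"]) (auto simp: smult_assoc1)
qed

lemma (in left_module) cyclic_mem: "x \<in> carrier M \<Longrightarrow> x \<in> cyclic_submodule R M x"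
  unfolding cyclic_submodule_def by (rule image_eqI[of _ _ \<one>]) auto

lemma cyclic_least: "submodule N A M \<Longrightarrow> x \<in> N \<Longrightarrow> cyclic_submodule A M x \<subseteq> N"
  unfolding cyclic_submodule_def by (auto intro: submodule_smult)

lemma mod_homI:
  assumes "\<And>x. x \<in> carrier M \<Longrightarrow> f x \<in> carrier N"
    and "\<And>x y. x \<in> carrier M \<Longrightarrow> y \<in> carrier M \<Longrightarrow> f (x \<oplus>\<^bsub>M\<^esub> y) = f x \<oplus>\<^bsub>N\<^esub> f y"
    and "\<And>a x. a \<in> carrier A \<Longrightarrow> x \<in> carrier M \<Longrightarrow> f (a \<odot>\<^bsub>M\<^esub> x) = a \<odot>\<^bsub>N\<^esub> f x"
  shows "f \<in> mod_hom A M N"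
  unfolding mod_hom_def using assms by blast

lemma mod_hom_closed: "f \<in> mod_hom A M N \<Longrightarrow> x \<in> carrier M \<Longrightarrow> f x \<in> carrier N"
  by (auto simp: mod_hom_def)

lemma mod_hom_add:
  "f \<in> mod_hom A M N \<Longrightarrow> x \<in> carrier M \<Longrightarrow> y \<in> carrier M \<Longrightarrow> f (x \<oplus>\<^bsub>M\<^esub> y) = f x \<oplus>\<^bsub>N\<^esub> f y"
  by (auto simp: mod_hom_def)

lemma mod_hom_smult:
  "f \<in> mod_hom A M N \<Longrightarrow> a \<in> carrier A \<Longrightarrow> x \<in> carrier M \<Longrightarrow> f (a \<odot>\<^bsub>M\<^esub> x) = a \<odot>\<^bsub>N\<^esub> f x"
  by (auto simp: mod_hom_def)

lemma mod_hom_comp: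
  "f \<in> mod_hom A M N \<Longrightarrow> g \<in> mod_hom A N K \<Longrightarrow> (\<lambda>x. g (f x)) \<in> mod_hom A M K"
  by (rule mod_homI) (auto simp: mod_hom_closed mod_hom_add mod_hom_smult)

lemma mod_hom_restrict:
  "f \<in> mod_hom A M N \<Longrightarrow> X \<subseteq> carrier M \<Longrightarrow> f \<in> mod_hom A (M\<lparr>carrier := X\<rparr>) N"
  by (rule mod_homI) (auto simp: mod_hom_closed mod_hom_add mod_hom_smult subset_iff)

lemma mod_hom_corestrict:
  "f \<in> mod_hom A M N \<Longrightarrow> f ` carrier M \<subseteq> Y \<Longrightarrow> f \<in> mod_hom A M (N\<lparr>carrier := Y\<rparr>)"
  by (auto simp: mod_hom_def)

lemma mod_hom_extend_codomain:
  "f \<in> mod_hom A M (N\<lparr>carrier := Y\<rparr>) \<Longrightarrow> Y \<subseteq> carrier N \<Longrightarrow> f \<in> mod_hom A M N"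
  by (auto simp: mod_hom_def)

lemma mod_hom_incl: "X \<subseteq> carrier M \<Longrightarrow> (\<lambda>x. x) \<in> mod_hom A (M\<lparr>carrier := X\<rparr>) M"
  by (auto simp: mod_hom_def)

lemma mod_hom_id: "(\<lambda>x. x) \<in> mod_hom A M M"
  by (auto simp: mod_hom_def)

lemma mod_hom_zero:
  assumes "left_module A M" "left_module A N" "f \<in> mod_hom A M N"
  shows "f \<zero>\<^bsub>M\<^esub> = \<zero>\<^bsub>N\<^esub>"
proof -
  interpret M: left_module A M by fact
  interpret N: left_module A N by fact
  show ?thesis
    using mod_hom_smult[OF assms(3), of "\<zero>\<^bsub>A\<^esub>" "\<zero>\<^bsub>M\<^esub>"] mod_hom_closed[OF assms(3), of "\<zero>\<^bsub>M\<^esub>"] by simp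
qed

lemma mod_hom_minus:
  assumes "left_module A M" "left_module A N" "f \<in> mod_hom A M N" "x \<in> carrier M"
  shows "f (\<ominus>\<^bsub>M\<^esub> x) = \<ominus>\<^bsub>N\<^esub> f x"
proof -
  interpret M: left_module A M by fact
  interpret N: left_module A N by fact
  show ?thesis
    using mod_hom_smult[OF assms(3), of "\<ominus>\<^bsub>A\<^esub> \<one>\<^bsub>A\<^esub>" x] mod_hom_closed[OF assms(3,4)] assms(4)
    by (simp add: M.smult_minus_left N.smult_minus_left)
qed

lemma mod_hom_diff:
  assumes "left_module A M" "left_module A N" "f \<in> mod_hom A M N" "x \<in> carrier M" "y \<in> carrier M"
  shows "f (x \<ominus>\<^bsub>M\<^esub> y) = f x \<ominus>\<^bsub>N\<^esub> f y"
proof -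
  interpret M: left_module A M by fact
  show ?thesis
    using assms mod_hom_add[OF assms(3), of x "\<ominus>\<^bsub>M\<^esub> y"] mod_hom_minus[OF assms(1-3,5)]
    by (simp add: a_minus_def)
qed

lemma mod_hom_sum_hom:
  assumes "left_module A N" "f \<in> mod_hom A M N" "g \<in> mod_hom A M N"
  shows "(\<lambda>x. f x \<oplus>\<^bsub>N\<^esub> g x) \<in> mod_hom A M N"
proof -
  interpret N: left_module A N by fact
  show ?thesis
    using assms(2,3) by (intro mod_homI)
     (auto simp: mod_hom_closed mod_hom_add mod_hom_smult N.M.a_ac N.smult_r_distr)
qed

lemma mod_hom_minus_hom:
  assumes "left_module A N" "f \<in> mod_hom A M N"
  shows "(\<lambda>x. \<ominus>\<^bsub>N\<^esub> f x) \<in> mod_hom A M N"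
proof -
  interpret N: left_module A N by fact
  show ?thesis
    using assms(2) by (intro mod_homI)
     (auto simp: mod_hom_closed mod_hom_add mod_hom_smult N.M.minus_add N.smult_minus_right)
qed

lemma mod_hom_diff_hom:
  assumes "left_module A N" "f \<in> mod_hom A M N" "g \<in> mod_hom A M N"
  shows "(\<lambda>x. f x \<ominus>\<^bsub>N\<^esub> g x) \<in> mod_hom A M N"
  unfolding a_minus_def using assms by (intro mod_hom_sum_hom mod_hom_minus_hom)

lemma mod_hom_image_submodule:
  assumes "left_module A M" "left_module A N" "f \<in> mod_hom A M N" "submodule X A M"
  shows "submodule (f ` X) A N"
proof -
  interpret M: left_module A M by fact
  interpret N: left_module A N by fact
  note X = submodule_mem[OF assms(4)]
  show ?thesis
  proof (rule N.submoduleI)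
    show "f ` X \<subseteq> carrier N" using X mod_hom_closed[OF assms(3)] by auto
    show "\<zero>\<^bsub>N\<^esub> \<in> f ` X" using submodule_zero[OF assms(4)] mod_hom_zero[OF assms(1-3)] by force
  next
    fix x y assume "x \<in> f ` X" "y \<in> f ` X"
    then obtain u v where "u \<in> X" "v \<in> X" "x = f u" "y = f v" by auto
    then show "x \<oplus>\<^bsub>N\<^esub> y \<in> f ` X" using X submodule_add[OF assms(4)] mod_hom_add[OF assms(3), symmetric] by auto
  next
    fix a x assume "a \<in> carrier A" "x \<in> f ` X"
    then obtain u where "a \<in> carrier A" "u \<in> X" "x = f u" by auto
    then show "a \<odot>\<^bsub>N\<^esub> x \<in> f ` X" using X submodule_smult[OF assms(4)] mod_hom_smult[OF assms(3), symmetric] by auto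
  qed
qed

lemma mod_hom_preimage_submodule:
  assumes "left_module A M" "left_module A N" "f \<in> mod_hom A M N" "submodule X A M" "submodule Y A N"
  shows "submodule {x \<in> X. f x \<in> Y} A M"
proof -
  interpret M: left_module A M by fact
  interpret N: left_module A N by fact
  show ?thesis
    using assms(4,5) mod_hom_zero[OF assms(1-3)] assms(3) unfolding M.submodule_iff N.submodule_iff
    by (auto simp: mod_hom_add mod_hom_smult subset_iff)
qed

lemma mod_hom_kernel_submodule:
  assumes "left_module A M" "left_module A N" "f \<in> mod_hom A M N" 
  shows "submodule {x \<in> carrier M. f x = \<zero>\<^bsub>N\<^esub>} A M"
  using mod_hom_preimage_submodule[OF assms left_module.submodule_carrier[OF assms(1)] 
      left_module.submodule_null[OF assms(2)]] by simp

lemma mod_hom_inj_iff: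
  assumes "left_module A M" "left_module A N" "f \<in> mod_hom A M N" 
  shows "inj_on f (carrier M) \<longleftrightarrow> (\<forall>x\<in>carrier M. f x = \<zero>\<^bsub>N\<^esub> \<longrightarrow> x = \<zero>\<^bsub>M\<^esub>)"
proof -
  interpret M: left_module A M by fact
  interpret N: left_module A N by fact
  show ?thesis
  proof
    assume "inj_on f (carrier M)"
    then show "\<forall>x\<in>carrier M. f x = \<zero>\<^bsub>N\<^esub> \<longrightarrow> x = \<zero>\<^bsub>M\<^esub>"
      using mod_hom_zero[OF assms] by (metis M.M.zero_closed inj_onD)
  next
    assume *: "\<forall>x\<in>carrier M. f x = \<zero>\<^bsub>N\<^esub> \<longrightarrow> x = \<zero>\<^bsub>M\<^esub>"
    show "inj_on f (carrier M)"
    proof (rule inj_onI)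
      fix x y assume xy: "x \<in> carrier M" "y \<in> carrier M" "f x = f y"
      have "f (x \<ominus>\<^bsub>M\<^esub> y) = \<zero>\<^bsub>N\<^esub>"
        using mod_hom_diff[OF assms xy(1,2)] xy mod_hom_closed[OF assms(3)] N.diff_self by simp
      then have "x \<ominus>\<^bsub>M\<^esub> y = \<zero>\<^bsub>M\<^esub>" using * xy by blast
      then show "x = y" using M.diff_eq_zero_iff[OF xy(1,2)] by blast
    qed
  qed
qed

text \<open>
  The homomorphism theorem for an arbitrary surjection instead of a quotient map. All maps out
  of quotients and images below are built with it.
\<close>

lemma mod_hom_factor:
  assumes M: "left_module A M" and Q: "left_module A Q" and K: "left_module A K"
    and p: "p \<in> mod_hom A M Q" "p ` carrier M = carrier Q" and f: "f \<in> mod_hom A M K"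
    and ker: "\<And>x. x \<in> carrier M \<Longrightarrow> p x = \<zero>\<^bsub>Q\<^esub> \<Longrightarrow> f x = \<zero>\<^bsub>K\<^esub>"
  shows "\<exists>g \<in> mod_hom A Q K. \<forall>x\<in>carrier M. g (p x) = f x"
proof -
  interpret M: left_module A M by fact
  interpret Q: left_module A Q by fact
  interpret K: left_module A K by fact
  define g where "g = (\<lambda>y. f (SOME x. x \<in> carrier M \<and> p x = y))"
  have gp: "g (p x) = f x" if x: "x \<in> carrier M" for x
  proof -
    define z where "z = (SOME z. z \<in> carrier M \<and> p z = p x)"
    have z: "z \<in> carrier M" "p z = p x"
      using someI[of "\<lambda>z. z \<in> carrier M \<and> p z = p x" x] x unfolding z_def by auto
    have "p (z \<ominus>\<^bsub>M\<^esub> x) = \<zero>\<^bsub>Q\<^esub>" 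
      using mod_hom_diff[OF M Q p(1) z(1) x] z x mod_hom_closed[OF p(1)] Q.diff_self by simp
    then have "f (z \<ominus>\<^bsub>M\<^esub> x) = \<zero>\<^bsub>K\<^esub>" using ker z x by simp
    then have "f z = f x"
      using mod_hom_diff[OF M K f z(1) x] z x mod_hom_closed[OF f] K.diff_eq_zero_iff by simp
    then show ?thesis unfolding g_def z_def .
  qed
  have "g \<in> mod_hom A Q K"
  proof (rule mod_homI)
    fix y assume "y \<in> carrier Q"
    then obtain x where "x \<in> carrier M" "y = p x" using p(2) by blast
    then show "g y \<in> carrier K" using gp mod_hom_closed[OF f] by simp
  next
    fix y y' assume "y \<in> carrier Q" "y' \<in> carrier Q"
    then obtain x x' where "x \<in> carrier M" "y = p x" "x' \<in> carrier M" "y' = p x'" using p(2) by blast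
    then show "g (y \<oplus>\<^bsub>Q\<^esub> y') = g y \<oplus>\<^bsub>K\<^esub> g y'"
      using gp[of x] gp[of x'] gp[of "x \<oplus>\<^bsub>M\<^esub> x'"] mod_hom_add[OF f] mod_hom_add[OF p(1)] by simp
  next
    fix a y assume "a \<in> carrier A" "y \<in> carrier Q"
    then obtain x where "a \<in> carrier A" "x \<in> carrier M" "y = p x" using p(2) by blast
    then show "g (a \<odot>\<^bsub>Q\<^esub> y) = a \<odot>\<^bsub>K\<^esub> g y"
      using gp[of x] gp[of "a \<odot>\<^bsub>M\<^esub> x"] mod_hom_smult[OF f] mod_hom_smult[OF p(1)] by simp
  qed
  then show ?thesis using gp by blast
qed

context left_module
begin

lemma coset_eq_iff:
  assumes N: "submodule N R M" and "x \<in> carrier M" "y \<in> carrier M"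
  shows "N +>\<^bsub>M\<^esub> x = N +>\<^bsub>M\<^esub> y \<longleftrightarrow> x \<ominus>\<^bsub>M\<^esub> y \<in> N"
proof
  assume *: "N +>\<^bsub>M\<^esub> x = N +>\<^bsub>M\<^esub> y"
  have "x \<in> N +>\<^bsub>M\<^esub> x" using submodule_zero[OF N] assms(2) by (force simp: mem_a_r_coset)
  then obtain n where n: "n \<in> N" "x = n \<oplus>\<^bsub>M\<^esub> y" using * by (auto simp: mem_a_r_coset)
  then have "x \<ominus>\<^bsub>M\<^esub> y = n"
    using assms submodule_mem[OF N] by (simp add: a_minus_def M.a_assoc M.r_neg)
  then show "x \<ominus>\<^bsub>M\<^esub> y \<in> N" using n by simp
next
  have aux: "N +>\<^bsub>M\<^esub> u \<subseteq> N +>\<^bsub>M\<^esub> v" if "u \<in> carrier M" "v \<in> carrier M" "u \<ominus>\<^bsub>M\<^esub> v \<in> N" for u v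
  proof
    fix z assume "z \<in> N +>\<^bsub>M\<^esub> u"
    then obtain n where n: "n \<in> N" "z = n \<oplus>\<^bsub>M\<^esub> u" by (auto simp: mem_a_r_coset)
    have "z = (n \<oplus>\<^bsub>M\<^esub> (u \<ominus>\<^bsub>M\<^esub> v)) \<oplus>\<^bsub>M\<^esub> v"
      using n that submodule_mem[OF N] by (simp add: a_minus_def M.a_assoc M.l_neg)
    then show "z \<in> N +>\<^bsub>M\<^esub> v" using submodule_add[OF N n(1) that(3)] by (auto simp: mem_a_r_coset)
  qed
  assume *: "x \<ominus>\<^bsub>M\<^esub> y \<in> N"
  have "y \<ominus>\<^bsub>M\<^esub> x = \<ominus>\<^bsub>M\<^esub> (x \<ominus>\<^bsub>M\<^esub> y)"
    using assms by (simp add: a_minus_def M.minus_add M.a_comm)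
  then have "y \<ominus>\<^bsub>M\<^esub> x \<in> N" using submodule_minus[OF N *] by simp
  then show "N +>\<^bsub>M\<^esub> x = N +>\<^bsub>M\<^esub> y" using aux * assms by blast
qed

lemma coset_zero [simp]: "submodule N R M \<Longrightarrow> N +>\<^bsub>M\<^esub> \<zero>\<^bsub>M\<^esub> = N"
  using submodule_mem by (force simp: set_eq_iff mem_a_r_coset)

lemma coset_zero_iff:
  assumes N: "submodule N R M" and "x \<in> carrier M"
  shows "N +>\<^bsub>M\<^esub> x = N \<longleftrightarrow> x \<in> N"
  using coset_eq_iff[OF N assms(2), of "\<zero>\<^bsub>M\<^esub>"] assms by (simp add: a_minus_def)

lemma coset_add:
  assumes N: "submodule N R M" and x: "x \<in> carrier M" "y \<in> carrier M"
  shows "(N +>\<^bsub>M\<^esub> x) <+>\<^bsub>M\<^esub> (N +>\<^bsub>M\<^esub> y) = N +>\<^bsub>M\<^esub> (x \<oplus>\<^bsub>M\<^esub> y)"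
proof -
  note Nm = submodule_mem[OF N]
  have "z \<in> (N +>\<^bsub>M\<^esub> x) <+>\<^bsub>M\<^esub> (N +>\<^bsub>M\<^esub> y)" if z: "z \<in> N +>\<^bsub>M\<^esub> (x \<oplus>\<^bsub>M\<^esub> y)" for z
  proof -
    obtain n where n: "n \<in> N" "z = n \<oplus>\<^bsub>M\<^esub> (x \<oplus>\<^bsub>M\<^esub> y)" using z by (auto simp: mem_a_r_coset)
    then have "z = (n \<oplus>\<^bsub>M\<^esub> x) \<oplus>\<^bsub>M\<^esub> (\<zero>\<^bsub>M\<^esub> \<oplus>\<^bsub>M\<^esub> y)" using x Nm by (simp add: M.a_ac)
    moreover have "n \<oplus>\<^bsub>M\<^esub> x \<in> N +>\<^bsub>M\<^esub> x" "\<zero>\<^bsub>M\<^esub> \<oplus>\<^bsub>M\<^esub> y \<in> N +>\<^bsub>M\<^esub> y"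
      using n submodule_zero[OF N] unfolding mem_a_r_coset by blast+
    ultimately show ?thesis unfolding mem_set_add by blast
  qed
  moreover have "z \<in> N +>\<^bsub>M\<^esub> (x \<oplus>\<^bsub>M\<^esub> y)" if z: "z \<in> (N +>\<^bsub>M\<^esub> x) <+>\<^bsub>M\<^esub> (N +>\<^bsub>M\<^esub> y)" for z
  proof -
    obtain n n' where n: "n \<in> N" "n' \<in> N" "z = (n \<oplus>\<^bsub>M\<^esub> x) \<oplus>\<^bsub>M\<^esub> (n' \<oplus>\<^bsub>M\<^esub> y)" 
      using z by (auto simp: mem_a_r_coset mem_set_add)
    then have "z = (n \<oplus>\<^bsub>M\<^esub> n') \<oplus>\<^bsub>M\<^esub> (x \<oplus>\<^bsub>M\<^esub> y)" using x Nm by (simp add: M.a_ac)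
    then show ?thesis using n submodule_add[OF N] unfolding mem_a_r_coset by blast
  qed
  ultimately show ?thesis by blast
qed

lemma coset_smult:
  assumes N: "submodule N R M" and x: "x \<in> carrier M" and a: "a \<in> carrier R"
  shows "(\<Union>z\<in>N +>\<^bsub>M\<^esub> x. N +>\<^bsub>M\<^esub> (a \<odot>\<^bsub>M\<^esub> z)) = N +>\<^bsub>M\<^esub> (a \<odot>\<^bsub>M\<^esub> x)"
proof -
  have "N +>\<^bsub>M\<^esub> (a \<odot>\<^bsub>M\<^esub> z) = N +>\<^bsub>M\<^esub> (a \<odot>\<^bsub>M\<^esub> x)" if z: "z \<in> N +>\<^bsub>M\<^esub> x" for z
  proof -
    obtain n where n: "n \<in> N" "z = n \<oplus>\<^bsub>M\<^esub> x" using z by (auto simp: mem_a_r_coset)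
    have "a \<odot>\<^bsub>M\<^esub> z \<ominus>\<^bsub>M\<^esub> a \<odot>\<^bsub>M\<^esub> x = a \<odot>\<^bsub>M\<^esub> n"
      using n submodule_mem[OF N] x a by (simp add: smult_r_distr a_minus_def M.a_assoc M.r_neg)
    then show ?thesis
      using coset_eq_iff[OF N, of "a \<odot>\<^bsub>M\<^esub> z" "a \<odot>\<^bsub>M\<^esub> x"] n submodule_mem[OF N] x a submodule_smult[OF N] by simp
  qed
  moreover have "x \<in> N +>\<^bsub>M\<^esub> x" using submodule_zero[OF N] x by (force simp: mem_a_r_coset)
  ultimately show ?thesis by blast
qed

lemma quotient_carrier: "carrier (quotient_module M N) = (\<lambda>x. N +>\<^bsub>M\<^esub> x) ` carrier M"
  by (auto simp: quotient_module_def A_RCOSETS_def')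

lemma quotient_zero [simp]: "\<zero>\<^bsub>quotient_module M N\<^esub> = N"
  by (simp add: quotient_module_def)

lemma quotient_add:
  "submodule N R M \<Longrightarrow> x \<in> carrier M \<Longrightarrow> y \<in> carrier M \<Longrightarrow>
    (N +>\<^bsub>M\<^esub> x) \<oplus>\<^bsub>quotient_module M N\<^esub> (N +>\<^bsub>M\<^esub> y) = N +>\<^bsub>M\<^esub> (x \<oplus>\<^bsub>M\<^esub> y)"
  by (simp add: quotient_module_def coset_add)

lemma quotient_smult:
  "submodule N R M \<Longrightarrow> x \<in> carrier M \<Longrightarrow> a \<in> carrier R \<Longrightarrow>
    a \<odot>\<^bsub>quotient_module M N\<^esub> (N +>\<^bsub>M\<^esub> x) = N +>\<^bsub>M\<^esub> (a \<odot>\<^bsub>M\<^esub> x)"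
  by (simp add: quotient_module_def coset_smult)

lemma quotient_left_module:
  assumes N: "submodule N R M" shows "left_module R (quotient_module M N)"
proof -
  note rules = quotient_carrier quotient_add[OF N] quotient_smult[OF N]
  have z: "(N +>\<^bsub>M\<^esub> x) \<oplus>\<^bsub>quotient_module M N\<^esub> N = N +>\<^bsub>M\<^esub> x"
    "N \<oplus>\<^bsub>quotient_module M N\<^esub> (N +>\<^bsub>M\<^esub> x) = N +>\<^bsub>M\<^esub> x" if "x \<in> carrier M" for x
    using quotient_add[OF N that M.zero_closed] quotient_add[OF N M.zero_closed that] that N by auto
  have "abelian_group (quotient_module M N)"
  proof (rule abelian_groupI)
    show "\<zero>\<^bsub>quotient_module M N\<^esub> \<in> carrier (quotient_module M N)"
      unfolding quotient_carrier quotient_zero using coset_zero[OF N] 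
      by (intro image_eqI[of _ _ "\<zero>\<^bsub>M\<^esub>"]) auto
    fix x assume "x \<in> carrier (quotient_module M N)"
    then obtain y where "y \<in> carrier M" "x = N +>\<^bsub>M\<^esub> y" by (auto simp: rules)
    then show "\<exists>y\<in>carrier (quotient_module M N). y \<oplus>\<^bsub>quotient_module M N\<^esub> x = \<zero>\<^bsub>quotient_module M N\<^esub>"
      using N by (intro bexI[of _ "N +>\<^bsub>M\<^esub> (\<ominus>\<^bsub>M\<^esub> y)"]) (auto simp: rules M.l_neg)
  qed (auto simp: rules z M.a_ac)
  then show ?thesis
    using R.ring_axioms N
    by (intro left_module.intro left_module_axioms.intro)
       (auto simp: rules smult_l_distr smult_r_distr smult_assoc1)
qed

lemma quotient_proj_hom:
  assumes N: "submodule N R M" shows "(\<lambda>x. N +>\<^bsub>M\<^esub> x) \<in> mod_hom R M (quotient_module M N)"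
  by (rule mod_homI) (auto simp: quotient_carrier quotient_add[OF N] quotient_smult[OF N])

lemma quotient_proj_surj: "(\<lambda>x. N +>\<^bsub>M\<^esub> x) ` carrier M = carrier (quotient_module M N)"
  by (simp add: quotient_carrier)

lemma quotient_proj_zero_iff:
  "submodule N R M \<Longrightarrow> x \<in> carrier M \<Longrightarrow> N +>\<^bsub>M\<^esub> x = \<zero>\<^bsub>quotient_module M N\<^esub> \<longleftrightarrow> x \<in> N"
  by (simp add: coset_zero_iff)

lemma regular_hom: "x \<in> carrier M \<Longrightarrow> (\<lambda>a. a \<odot>\<^bsub>M\<^esub> x) \<in> mod_hom R (regular_module R) M"
  by (rule mod_homI) (auto simp: regular_module_def smult_l_distr smult_assoc1)

end

lemma regular_simps [simp]: "carrier (regular_module A) = carrier A" "\<zero>\<^bsub>regular_module A\<^esub> = \<zero>\<^bsub>A\<^esub>"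
  "x \<oplus>\<^bsub>regular_module A\<^esub> y = x \<oplus>\<^bsub>A\<^esub> y" "x \<odot>\<^bsub>regular_module A\<^esub> y = x \<otimes>\<^bsub>A\<^esub> y"
  by (simp_all add: regular_module_def)

lemma (in ring) regular_left_module: "left_module R (regular_module R)"
proof -
  have "abelian_group (regular_module R)"
    by (rule abelian_groupI) (auto simp: a_ac intro: l_neg)
  then show ?thesis
    by (intro left_module.intro left_module_axioms.intro)
      (auto simp: ring_axioms l_distr r_distr m_assoc)
qed

section \<open>Chain conditions over the base ring\<close>

locale artin_alg =
  fixes R :: "('r, 'x) ring_scheme" and A :: "('r, 'a, 'y) module_scheme"
  assumes artin: "artin_algebra R A"
begin

sublocale ring A
  using artin by (simp add: artin_algebra_def)

lemma R_cring: "cring R"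
  using artin by (simp add: artin_algebra_def artinian_cring_def)

lemma A_module: "module R A"
  using artin by (simp add: artin_algebra_def)

text \<open>
  The central image of the base ring in \<open>A\<close>. It makes every \<open>A\<close>-module
  an \<open>R\<close>-module.
\<close>

definition scalar :: "'r \<Rightarrow> 'a" where "scalar r = r \<odot>\<^bsub>A\<^esub> \<one>\<^bsub>A\<^esub>"

lemma scalar_closed [simp]: "r \<in> carrier R \<Longrightarrow> scalar r \<in> carrier A"
  unfolding scalar_def using A_module by (simp add: module.smult_closed)

lemma scalar_mult: "r \<in> carrier R \<Longrightarrow> a \<in> carrier A \<Longrightarrow> scalar r \<otimes>\<^bsub>A\<^esub> a = r \<odot>\<^bsub>A\<^esub> a"
  unfolding scalar_def using artin by (simp add: artin_algebra_def)

lemma scalar_central: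
  "r \<in> carrier R \<Longrightarrow> a \<in> carrier A \<Longrightarrow> a \<otimes>\<^bsub>A\<^esub> scalar r = scalar r \<otimes>\<^bsub>A\<^esub> a"
  unfolding scalar_def using artin by (simp add: artin_algebra_def)

lemma scalar_hom:
  shows "scalar \<zero>\<^bsub>R\<^esub> = \<zero>\<^bsub>A\<^esub>" and "scalar \<one>\<^bsub>R\<^esub> = \<one>\<^bsub>A\<^esub>"
    and "r \<in> carrier R \<Longrightarrow> scalar (\<ominus>\<^bsub>R\<^esub> r) = \<ominus>\<^bsub>A\<^esub> scalar r"
    and "r \<in> carrier R \<Longrightarrow> s \<in> carrier R \<Longrightarrow> scalar (r \<oplus>\<^bsub>R\<^esub> s) = scalar r \<oplus>\<^bsub>A\<^esub> scalar s"
    and "r \<in> carrier R \<Longrightarrow> s \<in> carrier R \<Longrightarrow> scalar (r \<otimes>\<^bsub>R\<^esub> s) = scalar r \<otimes>\<^bsub>A\<^esub> scalar s"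
  using module.smult_l_distr[OF A_module] module.smult_assoc1[OF A_module]
    module.smult_l_minus[OF A_module] module.smult_l_null[OF A_module] module.smult_one[OF A_module]
    scalar_mult[of r "scalar s"] scalar_closed[of s]
  by (simp_all add: scalar_def)

text \<open>
  The \<open>R\<close>-submodules of an \<open>A\<close>-module.
\<close>

definition stable :: "('a, 'm, 'z) module_scheme \<Rightarrow> 'm set \<Rightarrow> bool" where
  "stable U N \<longleftrightarrow> N \<subseteq> carrier U \<and> \<zero>\<^bsub>U\<^esub> \<in> N \<and> (\<forall>x\<in>N. \<forall>y\<in>N. x \<oplus>\<^bsub>U\<^esub> y \<in> N) \<and>
    (\<forall>r\<in>carrier R. \<forall>x\<in>N. scalar r \<odot>\<^bsub>U\<^esub> x \<in> N)"

lemma stableD: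
  assumes "stable U N"
  shows "N \<subseteq> carrier U" "\<zero>\<^bsub>U\<^esub> \<in> N" "\<And>x y. x \<in> N \<Longrightarrow> y \<in> N \<Longrightarrow> x \<oplus>\<^bsub>U\<^esub> y \<in> N"
    "\<And>r x. r \<in> carrier R \<Longrightarrow> x \<in> N \<Longrightarrow> scalar r \<odot>\<^bsub>U\<^esub> x \<in> N"
  using assms unfolding stable_def by auto

lemma stable_submodule: "submodule N A U \<Longrightarrow> stable U N"
  unfolding stable_def
  using submodule_subset submodule_zero submodule_add submodule_smult scalar_closed by metis

lemma stable_minus:
  assumes U: "left_module A U" and N: "stable U N" "x \<in> N" shows "\<ominus>\<^bsub>U\<^esub> x \<in> N"
proof -
  interpret U: left_module A U by fact
  interpret R: cring R by (rule R_cring)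
  have "scalar (\<ominus>\<^bsub>R\<^esub> \<one>\<^bsub>R\<^esub>) \<odot>\<^bsub>U\<^esub> x \<in> N" using N unfolding stable_def by auto
  moreover have "x \<in> carrier U" using N unfolding stable_def by auto
  ultimately show ?thesis by (simp add: scalar_hom U.smult_minus_left)
qed

text \<open>
  The chain condition is relative to a bound \<open>W\<close>, so that \<open>W\<close> can be
  enlarged by one generator at a time.
\<close>

definition dcc_below :: "('a, 'm, 'z) module_scheme \<Rightarrow> 'm set \<Rightarrow> bool" where
  "dcc_below U W \<longleftrightarrow> (\<forall>f. (\<forall>n. stable U (f n) \<and> f (Suc n) \<subseteq> f n \<and> f n \<subseteq> W) \<longrightarrow>
    (\<exists>k. \<forall>n\<ge>k. f n = f k))"

text \<open>
  A chain below \<open>W + R x\<close> is determined by its intersections with \<open>W\<close>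
  and by the ideals of those \<open>r\<close> for which some \<open>w + r x\<close> belongs to
  the member of the chain. The ideals become stationary because \<open>R\<close> is artinian.
\<close>

lemma dcc_below_extend:
  fixes U :: "('a, 'm, 'z) module_scheme"
  assumes U: "left_module A U" and W: "stable U W" "dcc_below U W" and x: "x \<in> carrier U"
  defines "W' \<equiv> {w \<oplus>\<^bsub>U\<^esub> scalar r \<odot>\<^bsub>U\<^esub> x | w r. w \<in> W \<and> r \<in> carrier R}"
  shows "stable U W'" "dcc_below U W'" "W \<subseteq> W'" "x \<in> W'"
proof -
  interpret U: left_module A U by fact
  interpret R: cring R by (rule R_cring)
  have WU: "w \<in> carrier U" if "w \<in> W" for w using W that unfolding stable_def by auto
  have W0: "\<zero>\<^bsub>U\<^esub> \<in> W" using W unfolding stable_def by auto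
  have Wadd: "v \<oplus>\<^bsub>U\<^esub> w \<in> W" if "v \<in> W" "w \<in> W" for v w using W that unfolding stable_def by auto
  have Wsm: "scalar r \<odot>\<^bsub>U\<^esub> w \<in> W" if "r \<in> carrier R" "w \<in> W" for r w using W that unfolding stable_def by auto
  have W'I: "w \<oplus>\<^bsub>U\<^esub> scalar r \<odot>\<^bsub>U\<^esub> x \<in> W'" if "w \<in> W" "r \<in> carrier R" for w r
    using that unfolding W'_def by blast
  show "W \<subseteq> W'"
  proof
    fix w assume "w \<in> W"
    then show "w \<in> W'" using W'I[of w "\<zero>\<^bsub>R\<^esub>"] WU x by (simp add: scalar_hom)
  qed
  show "x \<in> W'" using W'I[OF W0, of "\<one>\<^bsub>R\<^esub>"] x by (simp add: scalar_hom)
  show "stable U W'"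
    unfolding stable_def
  proof (intro conjI ballI)
    show "W' \<subseteq> carrier U" using WU x unfolding W'_def by auto
    show "\<zero>\<^bsub>U\<^esub> \<in> W'" using \<open>W \<subseteq> W'\<close> W0 by blast
  next
    fix u v assume "u \<in> W'" "v \<in> W'"
    then obtain w r w' r' where h: "w \<in> W" "r \<in> carrier R" "u = w \<oplus>\<^bsub>U\<^esub> scalar r \<odot>\<^bsub>U\<^esub> x"
      "w' \<in> W" "r' \<in> carrier R" "v = w' \<oplus>\<^bsub>U\<^esub> scalar r' \<odot>\<^bsub>U\<^esub> x" unfolding W'_def by blast
    then have "u \<oplus>\<^bsub>U\<^esub> v = (w \<oplus>\<^bsub>U\<^esub> w') \<oplus>\<^bsub>U\<^esub> scalar (r \<oplus>\<^bsub>R\<^esub> r') \<odot>\<^bsub>U\<^esub> x"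
      using WU x by (simp add: scalar_hom U.smult_l_distr U.M.a_ac)
    then show "u \<oplus>\<^bsub>U\<^esub> v \<in> W'" using W'I Wadd h by simp
  next
    fix s u assume s: "s \<in> carrier R" and "u \<in> W'"
    then obtain w r where h: "w \<in> W" "r \<in> carrier R" "u = w \<oplus>\<^bsub>U\<^esub> scalar r \<odot>\<^bsub>U\<^esub> x" 
      unfolding W'_def by blast
    then have "scalar s \<odot>\<^bsub>U\<^esub> u = scalar s \<odot>\<^bsub>U\<^esub> w \<oplus>\<^bsub>U\<^esub> scalar (s \<otimes>\<^bsub>R\<^esub> r) \<odot>\<^bsub>U\<^esub> x"
      using WU x s by (simp add: scalar_hom U.smult_r_distr U.smult_assoc1)
    then show "scalar s \<odot>\<^bsub>U\<^esub> u \<in> W'" using W'I Wsm h s by simp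
  qed
  show "dcc_below U W'"
    unfolding dcc_below_def
  proof (intro allI impI)
    fix f assume f: "\<forall>n. stable U (f n) \<and> f (Suc n) \<subseteq> f n \<and> f n \<subseteq> W'"
    have dec: "f n \<subseteq> f m" if "m \<le> n" for m n
      using that by (rule lift_Suc_antimono_le[of f, rotated]) (use f in auto)
    have fU: "u \<in> carrier U" if "u \<in> f n" for u n using f that unfolding stable_def by blast
    have fadd: "u \<oplus>\<^bsub>U\<^esub> v \<in> f n" if "u \<in> f n" "v \<in> f n" for u v n using f that unfolding stable_def by blast
    have fsm: "scalar r \<odot>\<^bsub>U\<^esub> u \<in> f n" if "r \<in> carrier R" "u \<in> f n" for r u n using f that unfolding stable_def by blast
    have f0: "\<zero>\<^bsub>U\<^esub> \<in> f n" for n using f unfolding stable_def by blast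
    define I where "I n = {r \<in> carrier R. \<exists>w\<in>W. w \<oplus>\<^bsub>U\<^esub> scalar r \<odot>\<^bsub>U\<^esub> x \<in> f n}" for n
    have I: "ideal (I n) R" for n
    proof (rule idealI)
      show "ring R" by (rule R.ring_axioms)
      have I_smult: "s \<otimes>\<^bsub>R\<^esub> r \<in> I n" if "r \<in> I n" "s \<in> carrier R" for r s
      proof -
        obtain w where w: "r \<in> carrier R" "w \<in> W" "w \<oplus>\<^bsub>U\<^esub> scalar r \<odot>\<^bsub>U\<^esub> x \<in> f n"
          using \<open>r \<in> I n\<close> unfolding I_def by blast
        have "scalar s \<odot>\<^bsub>U\<^esub> (w \<oplus>\<^bsub>U\<^esub> scalar r \<odot>\<^bsub>U\<^esub> x) = 
          scalar s \<odot>\<^bsub>U\<^esub> w \<oplus>\<^bsub>U\<^esub> scalar (s \<otimes>\<^bsub>R\<^esub> r) \<odot>\<^bsub>U\<^esub> x"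
          using w WU x \<open>s \<in> carrier R\<close> by (simp add: scalar_hom U.smult_r_distr U.smult_assoc1)
        then show ?thesis
          using fsm[OF \<open>s \<in> carrier R\<close> w(3)] Wsm[OF \<open>s \<in> carrier R\<close> w(2)] w \<open>s \<in> carrier R\<close> 
          unfolding I_def by auto
      qed
      show "subgroup (I n) (add_monoid R)"
      proof (rule R.add.subgroupI)
        show "I n \<subseteq> carrier R" unfolding I_def by auto
        have "\<zero>\<^bsub>R\<^esub> \<in> I n" unfolding I_def using W0 f0 x
          by (auto simp: scalar_hom intro!: bexI[of _ "\<zero>\<^bsub>U\<^esub>"])
        then show "I n \<noteq> {}" by blast
      next
        fix r assume r: "r \<in> I n"
        then have "r \<in> carrier R" unfolding I_def by blast
        then have "\<ominus>\<^bsub>R\<^esub> r = (\<ominus>\<^bsub>R\<^esub> \<one>\<^bsub>R\<^esub>) \<otimes>\<^bsub>R\<^esub> r" by (simp add: R.l_minus)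
        then show "\<ominus>\<^bsub>R\<^esub> r \<in> I n" using I_smult[OF r, of "\<ominus>\<^bsub>R\<^esub> \<one>\<^bsub>R\<^esub>"] by simp
      next
        fix r r' assume "r \<in> I n" "r' \<in> I n"
        then obtain w w' where w: "r \<in> carrier R" "w \<in> W" "w \<oplus>\<^bsub>U\<^esub> scalar r \<odot>\<^bsub>U\<^esub> x \<in> f n"
          "r' \<in> carrier R" "w' \<in> W" "w' \<oplus>\<^bsub>U\<^esub> scalar r' \<odot>\<^bsub>U\<^esub> x \<in> f n"
          unfolding I_def by blast
        have "(w \<oplus>\<^bsub>U\<^esub> scalar r \<odot>\<^bsub>U\<^esub> x) \<oplus>\<^bsub>U\<^esub> (w' \<oplus>\<^bsub>U\<^esub> scalar r' \<odot>\<^bsub>U\<^esub> x) =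
          (w \<oplus>\<^bsub>U\<^esub> w') \<oplus>\<^bsub>U\<^esub> scalar (r \<oplus>\<^bsub>R\<^esub> r') \<odot>\<^bsub>U\<^esub> x"
          using w WU x by (simp add: scalar_hom U.smult_l_distr U.M.a_ac)
        then show "r \<oplus>\<^bsub>R\<^esub> r' \<in> I n"
          using fadd[OF w(3,6)] Wadd[OF w(2,5)] w unfolding I_def by auto
      qed
      fix r s assume *: "r \<in> I n" "s \<in> carrier R"
      then show "s \<otimes>\<^bsub>R\<^esub> r \<in> I n" by (rule I_smult)
      then show "r \<otimes>\<^bsub>R\<^esub> s \<in> I n" using * unfolding I_def by (auto simp: R.m_comm)
    qed
    have "I (Suc n) \<subseteq> I n" for n using f unfolding I_def by blast
    then obtain k1 where k1: "\<forall>n\<ge>k1. I n = I k1"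
      using artin I unfolding artin_algebra_def artinian_cring_def by meson
    have "\<forall>n. stable U (f n \<inter> W) \<and> f (Suc n) \<inter> W \<subseteq> f n \<inter> W \<and> f n \<inter> W \<subseteq> W"
      using f W unfolding stable_def by blast
    then obtain k2 where k2: "\<forall>n\<ge>k2. f n \<inter> W = f k2 \<inter> W"
      using spec[OF W(2)[unfolded dcc_below_def], of "\<lambda>n. f n \<inter> W"] by blast
    define k where "k = max k1 k2"
    have "f k \<subseteq> f n" if n: "n \<ge> k" for n
    proof
      fix y assume y: "y \<in> f k"
      then obtain w r where h: "w \<in> W" "r \<in> carrier R" "y = w \<oplus>\<^bsub>U\<^esub> scalar r \<odot>\<^bsub>U\<^esub> x"
        using f unfolding W'_def by blast
      then have "r \<in> I k" using y unfolding I_def by blast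
      also have "I k = I n" using k1 n unfolding k_def by (metis max.bounded_iff max.cobounded1)
      finally obtain w' where w': "w' \<in> W" "w' \<oplus>\<^bsub>U\<^esub> scalar r \<odot>\<^bsub>U\<^esub> x \<in> f n" unfolding I_def by blast
      let ?z = "w' \<oplus>\<^bsub>U\<^esub> scalar r \<odot>\<^bsub>U\<^esub> x"
      have "?z \<in> f k" using dec[OF n] w' by blast
      then have zk: "\<ominus>\<^bsub>U\<^esub> ?z \<in> f k" using stable_minus[OF U] f by blast
      have "y \<oplus>\<^bsub>U\<^esub> \<ominus>\<^bsub>U\<^esub> ?z = w \<oplus>\<^bsub>U\<^esub> \<ominus>\<^bsub>U\<^esub> w'"
        using h w' WU x by (simp add: U.M.minus_add U.M.a_ac U.M.r_neg U.M.r_neg1 U.M.r_neg2)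
      moreover have "w \<oplus>\<^bsub>U\<^esub> \<ominus>\<^bsub>U\<^esub> w' \<in> W" using h w' Wadd stable_minus[OF U W(1)] by blast
      ultimately have "y \<oplus>\<^bsub>U\<^esub> \<ominus>\<^bsub>U\<^esub> ?z \<in> f k \<inter> W" using fadd[OF y zk] by simp
      also have "f k \<inter> W = f n \<inter> W" using k2 n unfolding k_def by (metis max.bounded_iff max.cobounded2)
      finally have "(y \<oplus>\<^bsub>U\<^esub> \<ominus>\<^bsub>U\<^esub> ?z) \<oplus>\<^bsub>U\<^esub> ?z \<in> f n" using fadd w' by blast
      also have "(y \<oplus>\<^bsub>U\<^esub> \<ominus>\<^bsub>U\<^esub> ?z) \<oplus>\<^bsub>U\<^esub> ?z = y"
        using fU[OF y] fU[OF w'(2)] by (simp add: U.M.a_assoc U.M.l_neg)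
      finally show "y \<in> f n" .
    qed
    then show "\<exists>k. \<forall>n\<ge>k. f n = f k" using dec by blast
  qed
qed

lemma finite_in_dcc_below:
  assumes U: "left_module A U" and "finite Z" "Z \<subseteq> carrier U"
  shows "\<exists>W. stable U W \<and> dcc_below U W \<and> Z \<subseteq> W"
  using assms(2,3)
proof (induction Z rule: finite_induct)
  case empty
  interpret U: left_module A U by fact
  have "stable U {\<zero>\<^bsub>U\<^esub>}" by (rule stable_submodule) simp
  moreover have "dcc_below U {\<zero>\<^bsub>U\<^esub>}"
    unfolding dcc_below_def stable_def by blast
  ultimately show ?case by blast
next
  case (insert x Z)
  then obtain W where W: "stable U W" "dcc_below U W" "Z \<subseteq> W" by blast
  have x: "x \<in> carrier U" using insert.prems by blast
  show ?case using dcc_below_extend[OF U W(1,2) x] W(3) by blast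
qed

text \<open>
  If the \<open>x\<close> generate \<open>A\<close> over \<open>R\<close> and the
  \<open>y\<close> generate \<open>U\<close> over \<open>A\<close>, then the products \<open>x
  y\<close> generate \<open>U\<close> over \<open>R\<close>.
\<close>

lemma fg_dcc:
  assumes "fg_left_module A U" shows "dcc_below U (carrier U)"
proof -
  have U: "left_module A U" using assms by (simp add: fg_left_module_def)
  interpret U: left_module A U by fact
  interpret RA: module R A by (rule A_module)
  obtain X where X: "finite X" "X \<subseteq> carrier A" "generated_submodule R A X = carrier A"
    using artin unfolding artin_algebra_def finitely_generated_def by blast
  obtain Y where Y: "finite Y" "Y \<subseteq> carrier U" "generated_submodule A U Y = carrier U"
    using assms unfolding fg_left_module_def finitely_generated_def by blast
  have "finite ((\<lambda>(x, y). x \<odot>\<^bsub>U\<^esub> y) ` (X \<times> Y))" "(\<lambda>(x, y). x \<odot>\<^bsub>U\<^esub> y) ` (X \<times> Y) \<subseteq> carrier U"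
    using X Y by auto
  from finite_in_dcc_below[OF U this] obtain W where W: "stable U W" "dcc_below U W"
    "(\<lambda>(x, y). x \<odot>\<^bsub>U\<^esub> y) ` (X \<times> Y) \<subseteq> W" by blast
  have Wc: "\<zero>\<^bsub>U\<^esub> \<in> W" "\<And>v w. v \<in> W \<Longrightarrow> w \<in> W \<Longrightarrow> v \<oplus>\<^bsub>U\<^esub> w \<in> W"
      "\<And>r w. r \<in> carrier R \<Longrightarrow> w \<in> W \<Longrightarrow> scalar r \<odot>\<^bsub>U\<^esub> w \<in> W"
    using W(1) unfolding stable_def by blast+
  have Ay: "a \<odot>\<^bsub>U\<^esub> y \<in> W" if y: "y \<in> Y" and a: "a \<in> carrier A" for a y
  proof -
    have yU: "y \<in> carrier U" using y Y by blast
    have "submodule {a \<in> carrier A. a \<odot>\<^bsub>U\<^esub> y \<in> W} R A"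
    proof (rule RA.submoduleI)
      fix b assume b: "b \<in> {a \<in> carrier A. a \<odot>\<^bsub>U\<^esub> y \<in> W}"
      then show "\<ominus>\<^bsub>A\<^esub> b \<in> {a \<in> carrier A. a \<odot>\<^bsub>U\<^esub> y \<in> W}"
        using stable_minus[OF U W(1)] yU by (simp add: U.smult_minus_left)
    next
      fix r b assume "r \<in> carrier R" "b \<in> {a \<in> carrier A. a \<odot>\<^bsub>U\<^esub> y \<in> W}"
      then show "r \<odot>\<^bsub>A\<^esub> b \<in> {a \<in> carrier A. a \<odot>\<^bsub>U\<^esub> y \<in> W}"
        using Wc(3) yU by (auto simp: scalar_mult[symmetric] U.smult_assoc1)
    qed (use Wc yU in \<open>auto simp: U.smult_l_distr\<close>)
    moreover have "X \<subseteq> {a \<in> carrier A. a \<odot>\<^bsub>U\<^esub> y \<in> W}" using X W(3) y by auto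
    ultimately have "carrier A \<subseteq> {a \<in> carrier A. a \<odot>\<^bsub>U\<^esub> y \<in> W}"
      using X(3) unfolding generated_submodule_def by blast
    then show ?thesis using a by blast
  qed
  have "submodule {u \<in> carrier U. \<forall>a\<in>carrier A. a \<odot>\<^bsub>U\<^esub> u \<in> W} A U"
    by (rule U.submoduleI) (use Wc in \<open>auto simp: U.smult_r_distr U.smult_assoc1[symmetric]\<close>)
  moreover have "Y \<subseteq> {u \<in> carrier U. \<forall>a\<in>carrier A. a \<odot>\<^bsub>U\<^esub> u \<in> W}" using Y Ay by auto
  ultimately have "carrier U \<subseteq> {u \<in> carrier U. \<forall>a\<in>carrier A. a \<odot>\<^bsub>U\<^esub> u \<in> W}"
    using Y(3) unfolding generated_submodule_def by blast
  then have "\<one>\<^bsub>A\<^esub> \<odot>\<^bsub>U\<^esub> u \<in> W" if "u \<in> carrier U" for u using that one_closed by blast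
  then have "carrier U \<subseteq> W" by auto
  moreover have "W \<subseteq> carrier U" using W(1) unfolding stable_def by blast
  ultimately show ?thesis using W(2) by simp
qed

lemma minimal_submodule:
  assumes U: "fg_left_module A U" and X: "Q X" and sub: "\<And>Y. Q Y \<Longrightarrow> submodule Y A U"
  obtains Y where "Q Y" "\<And>Z. Q Z \<Longrightarrow> Z \<subseteq> Y \<Longrightarrow> Z = Y"
proof (rule ccontr)
  assume no: "\<not> thesis"
  note minimal = that
  have *: "\<exists>Z. Q Z \<and> Z \<subset> Y" if Y: "Q Y" for Y
  proof (rule ccontr)
    assume "\<nexists>Z. Q Z \<and> Z \<subset> Y"
    then have "Z = Y" if "Q Z" "Z \<subseteq> Y" for Z using that by blast
    from minimal[OF Y this] no show False by blast
  qed
  have "\<exists>f. \<forall>n. Q (f n) \<and> f (Suc n) \<subset> f n"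
    using X * by (intro dependent_nat_choice) blast+
  then obtain f where f: "\<And>n. Q (f n)" "\<And>n. f (Suc n) \<subset> f n" by blast
  have "\<forall>n. stable U (f n) \<and> f (Suc n) \<subseteq> f n \<and> f n \<subseteq> carrier U"
    using f stable_submodule[OF sub] submodule_subset[OF sub] by blast
  then obtain k where "\<forall>n\<ge>k. f n = f k"
    using spec[OF fg_dcc[OF U, unfolded dcc_below_def], of f] by blast
  then have "f (Suc k) = f k" by (meson le_SucI order_refl)
  then show False using f(2)[of k] by blast
qed

text \<open>
  The images of the iterates of \<open>T\<close> form a descending chain. Once it is stationary,
  injectivity allows \<open>T\<close> to be cancelled. This takes the place of comparing lengths
  over \<open>R\<close>.
\<close>

lemma injective_stable_endo_surj:
  assumes U: "fg_left_module A U" and B: "stable U B"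
    and T: "\<And>x. x \<in> B \<Longrightarrow> T x \<in> B" "inj_on T B"
    and add: "\<And>x y. x \<in> B \<Longrightarrow> y \<in> B \<Longrightarrow> T (x \<oplus>\<^bsub>U\<^esub> y) = T x \<oplus>\<^bsub>U\<^esub> T y"
    and sm: "\<And>r x. r \<in> carrier R \<Longrightarrow> x \<in> B \<Longrightarrow> T (scalar r \<odot>\<^bsub>U\<^esub> x) = scalar r \<odot>\<^bsub>U\<^esub> T x"
  shows "T ` B = B"
proof -
  interpret U: left_module A U using U by (simp add: fg_left_module_def)
  interpret R: cring R by (rule R_cring)
  have st: "stable U (T ` C)" if C: "stable U C" "C \<subseteq> B" for C
  proof -
    have z: "\<zero>\<^bsub>U\<^esub> \<in> C" using C unfolding stable_def by blast
    then have zB: "\<zero>\<^bsub>U\<^esub> \<in> B" using C(2) by blast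
    then have "T \<zero>\<^bsub>U\<^esub> \<in> carrier U" using T(1) B unfolding stable_def by blast
    then have "T \<zero>\<^bsub>U\<^esub> = \<zero>\<^bsub>U\<^esub>" using sm[OF R.zero_closed zB] by (simp add: scalar_hom)
    then have "\<zero>\<^bsub>U\<^esub> \<in> T ` C" using z by (intro image_eqI[of _ _ "\<zero>\<^bsub>U\<^esub>"]) auto
    moreover have "T ` C \<subseteq> carrier U"
      using C(2) T(1) stableD(1)[OF B] by auto
    moreover have "u \<oplus>\<^bsub>U\<^esub> v \<in> T ` C" if uv: "u \<in> T ` C" "v \<in> T ` C" for u v
    proof -
      obtain x y where xy: "x \<in> C" "y \<in> C" "u = T x" "v = T y" using uv by blast
      then have "u \<oplus>\<^bsub>U\<^esub> v = T (x \<oplus>\<^bsub>U\<^esub> y)" using add[of x y] subsetD[OF C(2)] by simp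
      then show ?thesis using stableD(3)[OF C(1) xy(1,2)] by simp
    qed
    moreover have "scalar r \<odot>\<^bsub>U\<^esub> u \<in> T ` C" if r: "r \<in> carrier R" and u: "u \<in> T ` C" for r u
    proof -
      obtain x where x: "x \<in> C" "u = T x" using u by blast
      then have "scalar r \<odot>\<^bsub>U\<^esub> u = T (scalar r \<odot>\<^bsub>U\<^esub> x)" using sm[OF r, of x] subsetD[OF C(2)] by simp
      then show ?thesis using stableD(4)[OF C(1) r x(1)] by simp
    qed
    ultimately show ?thesis unfolding stable_def by blast
  qed
  define f where "f n = (T ^^ n) ` B" for n
  have f_Suc: "f (Suc n) = T ` f n" for n unfolding f_def by (simp add: image_comp)
  have fB: "stable U (f n) \<and> f n \<subseteq> B \<and> f (Suc n) \<subseteq> f n" for n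
  proof (induction n)
    case 0 then show ?case using B T(1) by (auto simp: f_def)
  next
    case (Suc n)
    then show ?case unfolding f_Suc using st[of "f n"] T(1) by blast
  qed
  moreover have "B \<subseteq> carrier U" by (rule stableD[OF B])
  ultimately obtain k where k: "\<forall>n\<ge>k. f n = f k"
    using spec[OF fg_dcc[OF U, unfolded dcc_below_def], of f] by (meson order_trans)
  have "B = T ` B" if "f n = f (Suc n)" for n using that
  proof (induction n)
    case 0 then show ?case by (simp add: f_def)
  next
    case (Suc n)
    then have "T ` f n = T ` f (Suc n)" using f_Suc by metis
    then have "f n = f (Suc n)" using T(2) fB by (meson inj_on_image_eq_iff)
    then show ?case by (rule Suc.IH)
  qed
  moreover have "f k = f (Suc k)" using k by (metis le_SucI order_refl)
  ultimately show ?thesis by metis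
qed

end

section \<open>The Jacobson radical and the socle\<close>

lemma (in left_module) simple_submodule_iff:
  assumes S: "submodule S R M"
  shows "simple_module R (M\<lparr>carrier := S\<rparr>) \<longleftrightarrow>
    S \<noteq> {\<zero>\<^bsub>M\<^esub>} \<and> (\<forall>N. submodule N R M \<and> N \<subseteq> S \<longrightarrow> N = {\<zero>\<^bsub>M\<^esub>} \<or> N = S)"
  unfolding simple_module_def submodule_restrict_iff[OF S] by simp

lemma (in left_module) simple_quotient:
  assumes W: "submodule W R M" "W \<noteq> carrier M"
    and max: "\<And>K. submodule K R M \<Longrightarrow> W \<subseteq> K \<Longrightarrow> K = W \<or> K = carrier M"
  shows "simple_module R (quotient_module M W)"
proof -
  let ?Q = "quotient_module M W" let ?p = "\<lambda>x. W +>\<^bsub>M\<^esub> x"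
  interpret Q: left_module R ?Q by (rule quotient_left_module[OF W(1)])
  have p: "?p \<in> mod_hom R M ?Q" by (rule quotient_proj_hom[OF W(1)])
  have "carrier ?Q \<noteq> {\<zero>\<^bsub>?Q\<^esub>}"
  proof
    assume *: "carrier ?Q = {\<zero>\<^bsub>?Q\<^esub>}"
    have "x \<in> W" if x: "x \<in> carrier M" for x
      using mod_hom_closed[OF p x] * quotient_proj_zero_iff[OF W(1) x] by blast
    then show False using W submodule_subset by blast
  qed
  moreover have "N = {\<zero>\<^bsub>?Q\<^esub>} \<or> N = carrier ?Q" if N: "submodule N R ?Q" for N
  proof -
    let ?K = "{x \<in> carrier M. ?p x \<in> N}"
    have K: "submodule ?K R M"
      by (rule mod_hom_preimage_submodule[OF left_module_axioms Q.left_module_axioms p submodule_carrier N])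
    have "W \<subseteq> ?K"
    proof
      fix x assume x: "x \<in> W"
      then have "x \<in> carrier M" by (rule submodule_mem[OF W(1)])
      moreover from this have "?p x = W" using coset_zero_iff[OF W(1)] x by blast
      ultimately show "x \<in> ?K" using submodule_zero[OF N] by simp
    qed
    have "N \<subseteq> ?p ` carrier M" unfolding quotient_proj_surj using submodule_subset[OF N] .
    then have N_eq: "N = ?p ` ?K" by auto
    from max[OF K \<open>W \<subseteq> ?K\<close>] show ?thesis
    proof
      assume KW: "?K = W"
      have "\<forall>x\<in>W. ?p x = W" using coset_zero_iff[OF W(1)] submodule_mem[OF W(1)] by blast
      moreover have "N = ?p ` W" using N_eq unfolding KW .
      ultimately have "N \<subseteq> {W}" by blast
      then show ?thesis using submodule_zero[OF N] by auto
    next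
      assume KM: "?K = carrier M"
      have "N = ?p ` carrier M" using N_eq unfolding KM .
      then show ?thesis unfolding quotient_proj_surj by blast
    qed
  qed
  ultimately show ?thesis unfolding simple_module_def by blast
qed

lemma (in left_module) submodule_chain_Union:
  assumes "\<C> \<noteq> {}" "\<And>C. C \<in> \<C> \<Longrightarrow> submodule C R M"
    and chain: "\<And>C D. C \<in> \<C> \<Longrightarrow> D \<in> \<C> \<Longrightarrow> C \<subseteq> D \<or> D \<subseteq> C"
  shows "submodule (\<Union>\<C>) R M"
proof (rule submoduleI)
  show "\<Union> \<C> \<subseteq> carrier M" using assms(2) submodule_subset by blast
  show "\<zero>\<^bsub>M\<^esub> \<in> \<Union> \<C>" using assms(1,2) submodule_zero by blast
next
  fix x y assume "x \<in> \<Union> \<C>" "y \<in> \<Union> \<C>"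
  then obtain C D where CD: "C \<in> \<C>" "D \<in> \<C>" "x \<in> C" "y \<in> D" by blast
  from chain[OF CD(1,2)] show "x \<oplus>\<^bsub>M\<^esub> y \<in> \<Union> \<C>"
    using submodule_add[OF assms(2)] CD by blast
next
  fix a x assume "a \<in> carrier R" "x \<in> \<Union> \<C>"
  then show "a \<odot>\<^bsub>M\<^esub> x \<in> \<Union> \<C>" using submodule_smult[OF assms(2)] by blast
qed

context artin_alg
begin

abbreviation J :: "'a set" where "J \<equiv> jacobson_radical A"

abbreviation reg :: "('a, 'a) module" where "reg \<equiv> regular_module A"

sublocale reg: left_module A reg by (rule regular_left_module)

lemma fg_regular: "fg_left_module A reg"
proof -
  have "generated_submodule A reg {\<one>\<^bsub>A\<^esub>} = carrier A"
  proof
    show "generated_submodule A reg {\<one>\<^bsub>A\<^esub>} \<subseteq> carrier A"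
      using reg.generated_least[OF reg.submodule_carrier, of "{\<one>\<^bsub>A\<^esub>}"] by simp
    have "a \<in> generated_submodule A reg {\<one>\<^bsub>A\<^esub>}" if "a \<in> carrier A" for a
      using submodule_smult[OF reg.submodule_generated, of "{\<one>\<^bsub>A\<^esub>}" a "\<one>\<^bsub>A\<^esub>"] 
        reg.generated_incl[of "{\<one>\<^bsub>A\<^esub>}"] that by simp
    then show "carrier A \<subseteq> generated_submodule A reg {\<one>\<^bsub>A\<^esub>}" by blast
  qed
  then show ?thesis
    unfolding fg_left_module_def finitely_generated_def
    using regular_left_module by (auto intro!: exI[of _ "{\<one>\<^bsub>A\<^esub>}"])
qed

lemma J_mem: "a \<in> J \<Longrightarrow> a \<in> carrier A"
  by (simp add: jacobson_radical_def)

lemma J_submodule: "submodule J A reg"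
proof -
  have "J = \<Inter> (insert (carrier A) {I. maximal_left_ideal I A})"
    by (simp add: jacobson_radical_def)
  moreover have "submodule (\<Inter> (insert (carrier A) {I. maximal_left_ideal I A})) A reg"
    by (rule reg.submodule_Inter) (use reg.submodule_carrier in \<open>auto simp: maximal_left_ideal_def\<close>)
  ultimately show ?thesis by simp
qed

text \<open>
  The annihilator of a nonzero element of a simple module is a maximal left ideal.
\<close>

lemma J_kills_simple:
  assumes S: "left_module A S" "simple_module A S" and a: "a \<in> J" and x: "x \<in> carrier S"
  shows "a \<odot>\<^bsub>S\<^esub> x = \<zero>\<^bsub>S\<^esub>"
proof (cases "x = \<zero>\<^bsub>S\<^esub>")
  case True
  interpret S: left_module A S by fact
  show ?thesis using True J_mem[OF a] by simp
next
  case False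
  interpret S: left_module A S by fact
  let ?h = "\<lambda>a. a \<odot>\<^bsub>S\<^esub> x"
  have h: "?h \<in> mod_hom A reg S" by (rule S.regular_hom[OF x])
  define I where "I = {a \<in> carrier reg. ?h a = \<zero>\<^bsub>S\<^esub>}"
  have I: "submodule I A reg"
    unfolding I_def by (rule mod_hom_kernel_submodule[OF regular_left_module S(1) h])
  have "maximal_left_ideal I A"
    unfolding maximal_left_ideal_def
  proof (intro conjI allI impI)
    show "I \<noteq> carrier A" using False x S.smult_one[OF x] one_closed unfolding I_def by (metis (mono_tags, lifting) mem_Collect_eq)
    fix K assume K: "submodule K A reg \<and> I \<subseteq> K"
    have img: "submodule (?h ` K) A S"
      by (rule mod_hom_image_submodule[OF regular_left_module S(1) h]) (use K in blast)
    show "K = I \<or> K = carrier A"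
    proof (cases "?h ` K = {\<zero>\<^bsub>S\<^esub>}")
      case True
      then have "K \<subseteq> I" using K submodule_subset[of K A reg] unfolding I_def by auto
      then show ?thesis using K by blast
    next
      case False
      then have "?h ` K = carrier S" using S(2) img unfolding simple_module_def by blast
      then obtain k where k: "k \<in> K" "x = k \<odot>\<^bsub>S\<^esub> x" using x by blast
      have kA: "k \<in> carrier A" using k K submodule_subset[of K A reg] by auto
      have "(\<one>\<^bsub>A\<^esub> \<oplus>\<^bsub>A\<^esub> \<ominus>\<^bsub>A\<^esub> k) \<odot>\<^bsub>S\<^esub> x = x \<oplus>\<^bsub>S\<^esub> \<ominus>\<^bsub>S\<^esub> x"
        using kA x k(2) by (simp add: S.smult_l_distr S.smult_minus_left)
      then have "\<one>\<^bsub>A\<^esub> \<oplus>\<^bsub>A\<^esub> \<ominus>\<^bsub>A\<^esub> k \<in> K" using K kA x S.M.r_neg unfolding I_def by auto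
      then have "(\<one>\<^bsub>A\<^esub> \<oplus>\<^bsub>A\<^esub> \<ominus>\<^bsub>A\<^esub> k) \<oplus>\<^bsub>A\<^esub> k \<in> K" using submodule_add[of K A reg] K k by simp
      then have "\<one>\<^bsub>A\<^esub> \<in> K" using kA by (simp add: a_assoc l_neg)
      then have "carrier A \<subseteq> K" using submodule_smult[of K A reg _ "\<one>\<^bsub>A\<^esub>"] K by auto
      then show ?thesis using K submodule_subset[of K A reg] by auto
    qed
  qed (rule I)
  then have "a \<in> I" using a unfolding jacobson_radical_def by blast
  then show ?thesis unfolding I_def by blast
qed

lemma J_maps_into_maximal:
  assumes M: "left_module A M" and W: "submodule W A M" "W \<noteq> carrier M"
    and max: "\<And>K. submodule K A M \<Longrightarrow> W \<subseteq> K \<Longrightarrow> K = W \<or> K = carrier M"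
    and a: "a \<in> J" and x: "x \<in> carrier M"
  shows "a \<odot>\<^bsub>M\<^esub> x \<in> W"
proof -
  interpret M: left_module A M by fact
  have "a \<odot>\<^bsub>quotient_module M W\<^esub> (W +>\<^bsub>M\<^esub> x) = \<zero>\<^bsub>quotient_module M W\<^esub>"
  proof (rule J_kills_simple)
    show "simple_module A (quotient_module M W)" by (rule M.simple_quotient[OF W max])
    show "left_module A (quotient_module M W)" by (rule M.quotient_left_module[OF W(1)])
    show "W +>\<^bsub>M\<^esub> x \<in> carrier (quotient_module M W)" using x M.quotient_carrier by blast
  qed (rule a)
  then show ?thesis
    using M.quotient_smult[OF W(1) x J_mem[OF a]] M.coset_zero_iff[OF W(1), of "a \<odot>\<^bsub>M\<^esub> x"] x J_mem[OF a] by simp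
qed

text \<open>
  The radical is closed under multiplication from the right because for a maximal left ideal
  \<open>I\<close> the module \<open>A/I\<close> is simple, hence killed by \<open>J\<close>.
\<close>

lemma J_ideal: "ideal J A"
proof (rule idealI)
  show "subgroup J (add_monoid A)"
  proof (rule add.subgroupI)
    show "J \<subseteq> carrier A" using J_mem by blast
    show "J \<noteq> {}" using submodule_zero[OF J_submodule] by blast
    show "\<ominus>\<^bsub>A\<^esub> a \<in> J" if "a \<in> J" for a
      using submodule_smult[OF J_submodule, of "\<ominus>\<^bsub>A\<^esub> \<one>\<^bsub>A\<^esub>" a] that J_mem[OF that] by (simp add: l_minus)
    show "a \<oplus>\<^bsub>A\<^esub> b \<in> J" if "a \<in> J" "b \<in> J" for a b
      using submodule_add[OF J_submodule that] by simp
  qed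
  fix a x assume a: "a \<in> J" and x: "x \<in> carrier A"
  show "x \<otimes>\<^bsub>A\<^esub> a \<in> J" using submodule_smult[OF J_submodule x a] by simp
  have "a \<otimes>\<^bsub>A\<^esub> x \<in> I" if I: "maximal_left_ideal I A" for I
    using J_maps_into_maximal[OF regular_left_module, of I a x] a x I 
    unfolding maximal_left_ideal_def by simp
  then show "a \<otimes>\<^bsub>A\<^esub> x \<in> J" using J_mem[OF a] x unfolding jacobson_radical_def by simp
qed (rule ring_axioms)

lemma J_right: "a \<in> J \<Longrightarrow> x \<in> carrier A \<Longrightarrow> a \<otimes>\<^bsub>A\<^esub> x \<in> J"
  by (rule ideal.I_r_closed[OF J_ideal])

text \<open>
  The left ideals \<open>W\<close> for which \<open>W/J\<close> is a simple submodule of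
  \<open>A/J\<close>.
\<close>

definition minimal_over_J :: "'a set \<Rightarrow> bool" where
  "minimal_over_J W \<longleftrightarrow> submodule W A reg \<and> J \<subset> W \<and>
    (\<forall>K. submodule K A reg \<and> J \<subseteq> K \<and> K \<subseteq> W \<longrightarrow> K = J \<or> K = W)"

text \<open>
  This is the semisimplicity of \<open>A/J\<close>. Let \<open>C\<close> be minimal above
  \<open>J\<close> with \<open>Z + C = A\<close>. If \<open>C\<close> is not \<open>J\<close>,
  it contains some \<open>W\<close> that is minimal over \<open>J\<close>, and some maximal left
  ideal \<open>m\<close> does not contain \<open>W\<close>. Then \<open>C\<close> is the sum of
  \<open>W \<subseteq> Z\<close> and \<open>C \<inter> m\<close>, so \<open>C \<inter> m\<close>
  is a smaller choice.
\<close>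

lemma sum_minimal_over_J:
  assumes Z: "submodule Z A reg" "J \<subseteq> Z" and W: "\<And>W. minimal_over_J W \<Longrightarrow> W \<subseteq> Z"
  shows "Z = carrier A"
proof -
  define F where "F C \<longleftrightarrow> submodule C A reg \<and> J \<subseteq> C \<and> Z <+>\<^bsub>reg\<^esub> C = carrier A" for C
  have "Z <+>\<^bsub>reg\<^esub> carrier A = carrier A"
    using reg.sum_incl2[OF Z(1) reg.submodule_carrier] submodule_subset[OF reg.submodule_sum[OF Z(1) reg.submodule_carrier]] by auto
  then have "F (carrier A)" using reg.submodule_carrier J_mem by (auto simp: F_def)
  from minimal_submodule[OF fg_regular, of F, OF this] obtain C where
    C: "F C" and Cmin: "\<And>Y. F Y \<Longrightarrow> Y \<subseteq> C \<Longrightarrow> Y = C" unfolding F_def by metis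
  have C': "submodule C A reg" "J \<subseteq> C" "Z <+>\<^bsub>reg\<^esub> C = carrier A" using C by (auto simp: F_def)
  have "C = J"
  proof (rule ccontr)
    assume "C \<noteq> J"
    then have "submodule C A reg \<and> J \<subset> C \<and> C \<subseteq> C" using C' by auto
    from minimal_submodule[OF fg_regular, of "\<lambda>W. submodule W A reg \<and> J \<subset> W \<and> W \<subseteq> C", OF this]
    obtain W where W1: "submodule W A reg" "J \<subset> W" "W \<subseteq> C" and 
      Wmin: "\<And>Y. submodule Y A reg \<and> J \<subset> Y \<and> Y \<subseteq> C \<Longrightarrow> Y \<subseteq> W \<Longrightarrow> Y = W" by metis
    have "K = J \<or> K = W" if "submodule K A reg" "J \<subseteq> K" "K \<subseteq> W" for K
      using Wmin[of K] that W1(3) by blast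
    then have "minimal_over_J W" unfolding minimal_over_J_def using W1 by blast
    then have WZ: "W \<subseteq> Z" by (rule W)
    obtain w where w: "w \<in> W" "w \<notin> J" using W1 by blast
    have wA: "w \<in> carrier A" using submodule_mem[OF W1(1) w(1)] by simp
    obtain m where m: "maximal_left_ideal m A" "w \<notin> m" using w wA unfolding jacobson_radical_def by blast
    have mm: "submodule m A reg" "\<And>K. submodule K A reg \<Longrightarrow> m \<subseteq> K \<Longrightarrow> K = m \<or> K = carrier A"
      using m unfolding maximal_left_ideal_def by auto
    have Jm: "J \<subseteq> m" using m unfolding jacobson_radical_def by blast
    have Wm: "W <+>\<^bsub>reg\<^esub> m = carrier A"
      using mm(2)[OF reg.submodule_sum[OF W1(1) mm(1)] reg.sum_incl2[OF W1(1) mm(1)]] 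
        reg.sum_incl1[OF W1(1) mm(1)] w m(2) by blast
    have "Z <+>\<^bsub>reg\<^esub> (C \<inter> m) = carrier A"
    proof
      show "Z <+>\<^bsub>reg\<^esub> (C \<inter> m) \<subseteq> carrier A"
        using submodule_subset[OF reg.submodule_sum[OF Z(1) reg.submodule_Int[OF C'(1) mm(1)]]] by simp
      show "carrier A \<subseteq> Z <+>\<^bsub>reg\<^esub> (C \<inter> m)"
      proof
        fix a assume "a \<in> carrier A"
        then obtain z c where zc: "z \<in> Z" "c \<in> C" "a = z \<oplus>\<^bsub>A\<^esub> c" 
          using C'(3) by (metis mem_set_add regular_simps(3))
        have cA: "c \<in> carrier A" using submodule_mem[OF C'(1) zc(2)] by simp
        then obtain w' c' where wc: "w' \<in> W" "c' \<in> m" "c = w' \<oplus>\<^bsub>A\<^esub> c'"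
          using Wm by (metis mem_set_add regular_simps(3))
        have carr: "w' \<in> carrier A" "c' \<in> carrier A" "z \<in> carrier A"
          using submodule_mem[OF W1(1) wc(1)] submodule_mem[OF mm(1) wc(2)] submodule_mem[OF Z(1) zc(1)] by auto
        have "c' \<in> C" using reg.submodule_cancel_left[OF C'(1), of c' w'] wc zc W1(3) carr by auto
        moreover have "z \<oplus>\<^bsub>A\<^esub> w' \<in> Z" using submodule_add[OF Z(1) zc(1), of w'] wc WZ by auto
        moreover have "a = (z \<oplus>\<^bsub>A\<^esub> w') \<oplus>\<^bsub>A\<^esub> c'" using zc wc carr by (simp add: a_assoc)
        ultimately show "a \<in> Z <+>\<^bsub>reg\<^esub> (C \<inter> m)" using wc(2) unfolding mem_set_add by auto
      qed
    qed
    then have "F (C \<inter> m)" using reg.submodule_Int[OF C'(1) mm(1)] C'(2) Jm by (simp add: F_def)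
    then have "C \<inter> m = C" by (rule Cmin) simp
    then show False using W1(3) w(1) m(2) by blast
  qed
  then have "carrier A \<subseteq> Z" using C'(3) reg.sum_least[OF Z(1) subset_refl Z(2)] by simp
  then show ?thesis using submodule_subset[OF Z(1)] by auto
qed

lemma socle_submodule:
  assumes "left_module A U" shows "submodule (socle A U) A U"
  unfolding socle_def
  by (rule left_module.submodule_generated[OF assms]) (use submodule_subset in blast)

text \<open>
  The module \<open>A x\<close> is a quotient of \<open>A/J\<close>, hence the sum of the
  submodules \<open>W x\<close> with \<open>W\<close> minimal over \<open>J\<close>, each of
  which is zero or simple.
\<close>

lemma killed_in_socle:
  assumes U: "left_module A U" and x: "x \<in> carrier U" and kill: "\<And>a. a \<in> J \<Longrightarrow> a \<odot>\<^bsub>U\<^esub> x = \<zero>\<^bsub>U\<^esub>"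
  shows "x \<in> socle A U"
proof -
  interpret U: left_module A U by fact
  note soc = socle_submodule[OF U]
  let ?h = "\<lambda>a. a \<odot>\<^bsub>U\<^esub> x"
  have h: "?h \<in> mod_hom A reg U" by (rule U.regular_hom[OF x])
  define K where "K = {a \<in> carrier reg. ?h a \<in> socle A U}"
  have K: "submodule K A reg"
    unfolding K_def by (rule mod_hom_preimage_submodule[OF regular_left_module U h reg.submodule_carrier soc])
  have JK: "J \<subseteq> K" using kill submodule_zero[OF soc] J_mem unfolding K_def by auto
  have "K = carrier A"
  proof (rule sum_minimal_over_J[OF K JK])
    fix W assume W: "minimal_over_J W"
    then have W1: "submodule W A reg" "J \<subset> W"
      and Wmin: "\<And>K. submodule K A reg \<Longrightarrow> J \<subseteq> K \<Longrightarrow> K \<subseteq> W \<Longrightarrow> K = J \<or> K = W"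
      unfolding minimal_over_J_def by auto
    have Wx: "submodule (?h ` W) A U" by (rule mod_hom_image_submodule[OF regular_left_module U h W1(1)])
    have "?h ` W \<subseteq> socle A U"
    proof (cases "?h ` W = {\<zero>\<^bsub>U\<^esub>}")
      case True
      then show ?thesis using submodule_zero[OF soc] by simp
    next
      case False
      have "N = {\<zero>\<^bsub>U\<^esub>} \<or> N = ?h ` W" if N: "submodule N A U" "N \<subseteq> ?h ` W" for N
      proof -
        let ?L = "{a \<in> W. ?h a \<in> N}"
        have L: "submodule ?L A reg"
          by (rule mod_hom_preimage_submodule[OF regular_left_module U h W1(1) N(1)])
        have JL: "J \<subseteq> ?L" using W1(2) kill submodule_zero[OF N(1)] by auto
        have NL: "N = ?h ` ?L" using N(2) by blast
        have "?L = J \<or> ?L = W" by (rule Wmin[OF L JL]) blast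
        then show ?thesis
        proof
          assume LJ: "?L = J"
          have "N = ?h ` J" using NL unfolding LJ .
          then have "N \<subseteq> {\<zero>\<^bsub>U\<^esub>}" using kill by auto
          then show ?thesis using submodule_zero[OF N(1)] by blast
        next
          assume LW: "?L = W"
          have "N = ?h ` W" using NL unfolding LW .
          then show ?thesis by blast
        qed
      qed
      then have "simple_module A (U\<lparr>carrier := ?h ` W\<rparr>)"
        using False U.simple_submodule_iff[OF Wx] by blast
      then show ?thesis
        unfolding socle_def using Wx by (intro order_trans[OF _ U.generated_incl] Union_upper) blast
    qed
    then show "W \<subseteq> K" using submodule_subset[OF W1(1)] unfolding K_def by blast
  qed
  then have "?h \<one>\<^bsub>A\<^esub> \<in> socle A U" unfolding K_def by auto
  then show ?thesis using x by simp
qed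

lemma socle_eq:
  assumes U: "left_module A U"
  shows "socle A U = {x \<in> carrier U. \<forall>a\<in>J. a \<odot>\<^bsub>U\<^esub> x = \<zero>\<^bsub>U\<^esub>}" (is "_ = ?K")
proof
  interpret U: left_module A U by fact
  have "submodule ?K A U"
  proof (rule U.submoduleI)
    fix r x assume r: "r \<in> carrier A" and x: "x \<in> ?K"
    have "a \<odot>\<^bsub>U\<^esub> (r \<odot>\<^bsub>U\<^esub> x) = \<zero>\<^bsub>U\<^esub>" if a: "a \<in> J" for a
      using r x J_right[OF a r] J_mem[OF a] by (simp add: U.smult_assoc1[symmetric])
    then show "r \<odot>\<^bsub>U\<^esub> x \<in> ?K" using r x by simp
  qed (auto simp: U.smult_r_distr J_mem)
  moreover have "S \<subseteq> ?K" if S: "submodule S A U" "simple_module A (U\<lparr>carrier := S\<rparr>)" for S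
    using J_kills_simple[OF U.restrict_left_module[OF S(1)] S(2)] submodule_mem[OF S(1)] by auto
  ultimately show "socle A U \<subseteq> ?K"
    unfolding socle_def by (intro U.generated_least) auto
  show "?K \<subseteq> socle A U" using killed_in_socle[OF U] by blast
qed

text \<open>
  Zorn's lemma gives \<open>C\<close> maximal among the submodules above \<open>Y\<close> that
  avoid \<open>x\<close>, so that every nonzero submodule of \<open>U/C\<close> contains the
  class of \<open>x\<close>. The quotient is killed by \<open>J\<close>, hence generated by
  simple submodules, and a simple submodule lies in every submodule that it meets nontrivially.
  So every nonzero submodule of \<open>U/C\<close> is the whole quotient.
\<close>

lemma maximal_submodule_avoiding:
  assumes U: "left_module A U" and x: "x \<in> carrier U" "x \<notin> Y" and Y: "submodule Y A U"
    and JY: "\<And>a u. a \<in> J \<Longrightarrow> u \<in> carrier U \<Longrightarrow> a \<odot>\<^bsub>U\<^esub> u \<in> Y"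
  shows "\<exists>C. submodule C A U \<and> Y \<subseteq> C \<and> x \<notin> C \<and>
    (\<forall>D. submodule D A U \<and> C \<subseteq> D \<longrightarrow> D = C \<or> D = carrier U)"
proof -
  interpret U: left_module A U by fact
  let ?F = "{C. submodule C A U \<and> Y \<subseteq> C \<and> x \<notin> C}"
  have "\<exists>C\<in>?F. \<forall>D\<in>?F. C \<subseteq> D \<longrightarrow> D = C"
  proof (rule subset_Zorn_nonempty)
    show "?F \<noteq> {}" using x Y by blast
    fix \<C> assume ne: "\<C> \<noteq> {}" and ch: "subset.chain ?F \<C>"
    have sub: "\<C> \<subseteq> ?F" and tot: "\<And>C D. C \<in> \<C> \<Longrightarrow> D \<in> \<C> \<Longrightarrow> C \<subseteq> D \<or> D \<subseteq> C"
      using ch unfolding subset_chain_def by auto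
    have "submodule (\<Union>\<C>) A U"
      by (rule U.submodule_chain_Union[OF ne _ tot]) (use sub in auto)
    then show "\<Union>\<C> \<in> ?F" using ne sub by blast
  qed
  then obtain C where CF: "C \<in> ?F" and CM: "\<forall>D\<in>?F. C \<subseteq> D \<longrightarrow> D = C" by (rule bexE)
  then have C: "submodule C A U" "Y \<subseteq> C" "x \<notin> C" by auto
  have Cmax: "D = C" if "submodule D A U" "C \<subseteq> D" "x \<notin> D" for D
    using bspec[OF CM, of D] that C(2) by simp
  let ?Q = "quotient_module U C" let ?p = "\<lambda>x. C +>\<^bsub>U\<^esub> x"
  interpret Q: left_module A ?Q by (rule U.quotient_left_module[OF C(1)])
  have p: "?p \<in> mod_hom A U ?Q" by (rule U.quotient_proj_hom[OF C(1)])
  have soc: "carrier ?Q \<subseteq> socle A ?Q"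
  proof
    fix q assume "q \<in> carrier ?Q"
    then obtain u where u: "u \<in> carrier U" "q = ?p u" using U.quotient_carrier by blast
    have "a \<odot>\<^bsub>?Q\<^esub> q = \<zero>\<^bsub>?Q\<^esub>" if a: "a \<in> J" for a
      using U.quotient_smult[OF C(1) u(1) J_mem[OF a]] u JY[OF a u(1)] C(2) J_mem[OF a]
        U.coset_zero_iff[OF C(1), of "a \<odot>\<^bsub>U\<^esub> u"] by auto
    then show "q \<in> socle A ?Q" using \<open>q \<in> carrier ?Q\<close> unfolding socle_eq[OF Q.left_module_axioms] by blast
  qed
  have "D = carrier U" if D: "submodule D A U" "C \<subseteq> D" "D \<noteq> C" for D
  proof -
    have xD: "x \<in> D" using Cmax[OF D(1,2)] D(3) by blast
    let ?D = "?p ` D"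
    have pD: "submodule ?D A ?Q" by (rule mod_hom_image_submodule[OF U Q.left_module_axioms p D(1)])
    have "S \<subseteq> ?D" if S: "submodule S A ?Q" "simple_module A (?Q\<lparr>carrier := S\<rparr>)" for S
    proof -
      have Ssimple: "S \<noteq> {\<zero>\<^bsub>?Q\<^esub>}" "\<And>N. submodule N A ?Q \<Longrightarrow> N \<subseteq> S \<Longrightarrow> N = {\<zero>\<^bsub>?Q\<^esub>} \<or> N = S"
        using Q.simple_submodule_iff[OF S(1)] S(2) by auto
      let ?T = "{u \<in> carrier U. ?p u \<in> S}"
      have T: "submodule ?T A U"
        by (rule mod_hom_preimage_submodule[OF U Q.left_module_axioms p U.submodule_carrier S(1)])
      have "?p c = C" if "c \<in> C" for c
        using U.coset_zero_iff[OF C(1) submodule_mem[OF C(1) that]] that by simp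
      then have CT: "C \<subseteq> ?T" using submodule_zero[OF S(1)] submodule_mem[OF C(1)] by auto
      have "?T \<noteq> C"
      proof
        assume TC: "?T = C"
        have "s = \<zero>\<^bsub>?Q\<^esub>" if s: "s \<in> S" for s
        proof -
          obtain u where u: "u \<in> carrier U" "s = ?p u" 
            using submodule_mem[OF S(1) s] U.quotient_carrier by blast
          then have "u \<in> C" using s TC by blast
          then show ?thesis using u U.coset_zero_iff[OF C(1) u(1)] by simp
        qed
        then show False using Ssimple(1) submodule_zero[OF S(1)] by blast
      qed
      then have "x \<in> ?T" using Cmax[OF T CT] by blast
      then have "?p x \<in> S \<inter> ?D" using xD by blast
      moreover have "?p x \<noteq> \<zero>\<^bsub>?Q\<^esub>" using U.coset_zero_iff[OF C(1) x(1)] C(3) by simp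
      ultimately have "S \<inter> ?D \<noteq> {\<zero>\<^bsub>?Q\<^esub>}" by blast
      then have "S \<inter> ?D = S" using Ssimple(2)[OF Q.submodule_Int[OF S(1) pD]] by blast
      then show ?thesis by blast
    qed
    then have "socle A ?Q \<subseteq> ?D" unfolding socle_def by (intro Q.generated_least[OF pD]) blast
    then have QD: "carrier ?Q \<subseteq> ?D" using soc by blast
    have "u \<in> D" if u: "u \<in> carrier U" for u
    proof -
      obtain d where d: "d \<in> D" "?p u = ?p d" using QD mod_hom_closed[OF p u] by blast
      then have "u \<ominus>\<^bsub>U\<^esub> d \<in> D" using U.coset_eq_iff[OF C(1) u submodule_mem[OF D(1) d(1)]] D(2) by blast
      then show ?thesis using submodule_add[OF D(1) _ d(1)] U.diff_add_cancel[OF u submodule_mem[OF D(1) d(1)]] by metis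
    qed
    then show ?thesis using submodule_subset[OF D(1)] by blast
  qed
  then show ?thesis using C by blast
qed

end

section \<open>Radical and socle series; nilpotency of the radical\<close>

context artin_alg
begin

text \<open>
  The submodule \<open>J X\<close>. Its iterates are the radical series, see
  \<open>generated_jacobson_power\<close>.
\<close>

definition radical_of :: "('a, 'm, 'z) module_scheme \<Rightarrow> 'm set \<Rightarrow> 'm set" where
  "radical_of U X = generated_submodule A U {a \<odot>\<^bsub>U\<^esub> x | a x. a \<in> J \<and> x \<in> X}"

lemma radical_of_submodule:
  assumes "left_module A U" "X \<subseteq> carrier U" shows "submodule (radical_of U X) A U"
proof -
  interpret U: left_module A U by fact
  show ?thesis unfolding radical_of_def 
    by (rule U.submodule_generated) (use assms(2) J_mem in auto)
qed

lemma radical_of_mem: 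
  assumes "left_module A U" "a \<in> J" "x \<in> X" shows "a \<odot>\<^bsub>U\<^esub> x \<in> radical_of U X"
  unfolding radical_of_def
  by (rule subsetD[OF left_module.generated_incl[OF assms(1)]]) (use assms(2,3) in blast)

lemma radical_of_least:
  assumes "submodule N A U" "\<And>a x. a \<in> J \<Longrightarrow> x \<in> X \<Longrightarrow> a \<odot>\<^bsub>U\<^esub> x \<in> N" 
  shows "radical_of U X \<subseteq> N"
  unfolding radical_of_def generated_submodule_def using assms by (intro Inter_lower) auto

lemma radical_of_mono:
  assumes "X \<subseteq> Y" shows "radical_of U X \<subseteq> radical_of U Y"
  unfolding radical_of_def generated_submodule_def using assms by (intro Inter_anti_mono) auto

lemma radical_of_subset: "submodule X A U \<Longrightarrow> radical_of U X \<subseteq> X"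
  by (rule radical_of_least) (auto intro: submodule_smult J_mem)

lemma radical_of_image:
  assumes M: "left_module A M" and N: "left_module A N" and f: "f \<in> mod_hom A M N" and X: "X \<subseteq> carrier M"
  shows "f ` radical_of M X = radical_of N (f ` X)"
proof
  interpret M: left_module A M by fact
  have rM: "submodule (radical_of M X) A M" by (rule radical_of_submodule[OF M X])
  have rN: "submodule (radical_of N (f ` X)) A N" 
    by (rule radical_of_submodule[OF N]) (use X mod_hom_closed[OF f] in auto)
  have "submodule {x \<in> carrier M. f x \<in> radical_of N (f ` X)} A M"
    by (rule mod_hom_preimage_submodule[OF M N f M.submodule_carrier rN])
  then have "radical_of M X \<subseteq> {x \<in> carrier M. f x \<in> radical_of N (f ` X)}"
  proof (rule radical_of_least)
    fix a x assume a: "a \<in> J" and x: "x \<in> X"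
    have "f (a \<odot>\<^bsub>M\<^esub> x) = a \<odot>\<^bsub>N\<^esub> f x" using mod_hom_smult[OF f J_mem[OF a]] X x by auto
    then show "a \<odot>\<^bsub>M\<^esub> x \<in> {x \<in> carrier M. f x \<in> radical_of N (f ` X)}"
      using radical_of_mem[OF N a imageI[OF x, of f]] X x J_mem[OF a] by auto
  qed
  then show "f ` radical_of M X \<subseteq> radical_of N (f ` X)" by blast
  show "radical_of N (f ` X) \<subseteq> f ` radical_of M X"
  proof (rule radical_of_least[OF mod_hom_image_submodule[OF M N f rM]])
    fix a y assume a: "a \<in> J" and "y \<in> f ` X"
    then obtain x where x: "x \<in> X" "y = f x" by blast
    then have "a \<odot>\<^bsub>N\<^esub> y = f (a \<odot>\<^bsub>M\<^esub> x)" using mod_hom_smult[OF f J_mem[OF a]] X by auto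
    then show "a \<odot>\<^bsub>N\<^esub> y \<in> f ` radical_of M X" using radical_of_mem[OF M a x(1)] by simp
  qed
qed

lemma radical_of_restrict:
  assumes U: "left_module A U" and N: "submodule N A U" and X: "X \<subseteq> N"
  shows "radical_of (U\<lparr>carrier := N\<rparr>) X = radical_of U X"
proof -
  have "{a \<odot>\<^bsub>U\<^esub> x | a x. a \<in> J \<and> x \<in> X} \<subseteq> N" using submodule_smult[OF N] J_mem X by auto
  then show ?thesis 
    unfolding radical_of_def by (simp add: left_module.generated_restrict[OF U N])
qed

lemma radical_of_sum:
  assumes U: "left_module A U" and X: "submodule X A U" and Y: "submodule Y A U"
  shows "radical_of U (X <+>\<^bsub>U\<^esub> Y) \<subseteq> radical_of U X <+>\<^bsub>U\<^esub> radical_of U Y"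
proof -
  interpret U: left_module A U by fact
  have r: "submodule (radical_of U X) A U" "submodule (radical_of U Y) A U"
    using radical_of_submodule[OF U] submodule_subset[OF X] submodule_subset[OF Y] by auto
  show ?thesis
  proof (rule radical_of_least[OF U.submodule_sum[OF r]])
    fix a z assume a: "a \<in> J" and "z \<in> X <+>\<^bsub>U\<^esub> Y"
    then obtain x y where z: "x \<in> X" "y \<in> Y" "z = x \<oplus>\<^bsub>U\<^esub> y" unfolding mem_set_add by blast
    then have "a \<odot>\<^bsub>U\<^esub> z = a \<odot>\<^bsub>U\<^esub> x \<oplus>\<^bsub>U\<^esub> a \<odot>\<^bsub>U\<^esub> y"
      using submodule_mem[OF X] submodule_mem[OF Y] J_mem[OF a] by (simp add: U.smult_r_distr)
    then show "a \<odot>\<^bsub>U\<^esub> z \<in> radical_of U X <+>\<^bsub>U\<^esub> radical_of U Y"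
      using radical_of_mem[OF U a z(1)] radical_of_mem[OF U a z(2)] by (auto simp: mem_set_add)
  qed
qed

abbreviation rads :: "('a, 'm, 'z) module_scheme \<Rightarrow> nat \<Rightarrow> 'm set \<Rightarrow> 'm set" where
  "rads U i X \<equiv> (radical_of U ^^ i) X"

lemma rads_Suc_right: "rads U (Suc i) X = rads U i (radical_of U X)"
  by (simp add: funpow_swap1)

lemma rads_submodule: "left_module A U \<Longrightarrow> submodule X A U \<Longrightarrow> submodule (rads U i X) A U"
  by (induction i) (simp_all add: radical_of_submodule submodule_subset)

lemma rads_mono: "X \<subseteq> Y \<Longrightarrow> rads U i X \<subseteq> rads U i Y"
  by (induction i) (auto dest: radical_of_mono)

lemma rads_Suc_subset: "left_module A U \<Longrightarrow> submodule X A U \<Longrightarrow> rads U (Suc i) X \<subseteq> rads U i X"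
  using radical_of_subset[OF rads_submodule] by simp

lemma rads_subset: "left_module A U \<Longrightarrow> submodule X A U \<Longrightarrow> rads U i X \<subseteq> X"
proof (induction i)
  case (Suc i)
  then show ?case using rads_Suc_subset[of U X i] by blast
qed simp

lemma rads_image:
  assumes M: "left_module A M" and N: "left_module A N" and f: "f \<in> mod_hom A M N" and X: "submodule X A M"
  shows "f ` rads M i X = rads N i (f ` X)"
proof (induction i)
  case (Suc i)
  then show ?case
    using radical_of_image[OF M N f submodule_subset[OF rads_submodule[OF M X, of i]]] by simp
qed simp

lemma rads_restrict:
  assumes U: "left_module A U" and N: "submodule N A U" and X: "submodule X A U" "X \<subseteq> N"
  shows "rads (U\<lparr>carrier := N\<rparr>) i X = rads U i X"
proof (induction i)
  case (Suc i)
  then show ?case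
    using radical_of_restrict[OF U N, of "rads U i X"] rads_subset[OF U X(1), of i] X(2) by simp
qed simp

lemma rads_sum:
  assumes U: "left_module A U" and X: "submodule X A U" and Y: "submodule Y A U"
  shows "rads U i (X <+>\<^bsub>U\<^esub> Y) \<subseteq> rads U i X <+>\<^bsub>U\<^esub> rads U i Y"
proof (induction i)
  case (Suc i)
  have "radical_of U (rads U i (X <+>\<^bsub>U\<^esub> Y)) \<subseteq> radical_of U (rads U i X <+>\<^bsub>U\<^esub> rads U i Y)"
    by (rule radical_of_mono[OF Suc])
  also have "\<dots> \<subseteq> radical_of U (rads U i X) <+>\<^bsub>U\<^esub> radical_of U (rads U i Y)"
    by (rule radical_of_sum[OF U rads_submodule[OF U X] rads_submodule[OF U Y]])
  finally show ?case by simp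
qed simp

lemma jacobson_power_ideal: "ideal (jacobson_power A i) A"
  by (induction i) (auto intro: ideal_prod_is_ideal J_ideal oneideal)

text \<open>
  The powers of the radical satisfy \<open>J\<^sup>i\<^sup>+\<^sup>1 = J\<^sup>i J\<close>, so
  \<open>J\<^sup>i\<^sup>+\<^sup>1 X\<close> is \<open>J\<^sup>i\<close> applied to \<open>J
  X\<close>. The iterated form is the one that is compatible with homomorphisms and sums.
\<close>

lemma generated_jacobson_power:
  assumes U: "left_module A U" and X: "submodule X A U"
  shows "generated_submodule A U {a \<odot>\<^bsub>U\<^esub> x | a x. a \<in> jacobson_power A i \<and> x \<in> X} = rads U i X"
  using X
proof (induction i arbitrary: X)
  case 0
  interpret U: left_module A U by fact
  have "{a \<odot>\<^bsub>U\<^esub> x | a x. a \<in> jacobson_power A 0 \<and> x \<in> X} = X"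
  proof
    show "{a \<odot>\<^bsub>U\<^esub> x | a x. a \<in> jacobson_power A 0 \<and> x \<in> X} \<subseteq> X"
      using submodule_smult[OF 0] by auto
    have "x = \<one>\<^bsub>A\<^esub> \<odot>\<^bsub>U\<^esub> x" if "x \<in> X" for x using submodule_mem[OF 0 that] by simp
    then show "X \<subseteq> {a \<odot>\<^bsub>U\<^esub> x | a x. a \<in> jacobson_power A 0 \<and> x \<in> X}" using one_closed by fastforce
  qed
  then show ?case using U.generated_submodule_eq[OF 0] by simp
next
  case (Suc i)
  interpret U: left_module A U by fact
  note X = submodule_mem[OF Suc.prems]
  let ?gen = "\<lambda>i X. {a \<odot>\<^bsub>U\<^esub> x | a x. a \<in> jacobson_power A i \<and> x \<in> X}"
  have JC: "a \<in> carrier A" if "a \<in> jacobson_power A i" for a i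
    using ideal.Icarr[OF jacobson_power_ideal that] .
  have genU: "?gen i Y \<subseteq> carrier U" if "Y \<subseteq> carrier U" for i Y using JC that by auto
  have rX: "submodule (radical_of U X) A U" 
    by (rule radical_of_submodule[OF U submodule_subset[OF Suc.prems]])
  let ?G = "generated_submodule A U (?gen (Suc i) X)" and ?H = "generated_submodule A U (?gen i (radical_of U X))"
  have G: "submodule ?G A U" by (rule U.submodule_generated[OF genU[OF submodule_subset[OF Suc.prems]]])
  have H: "submodule ?H A U" by (rule U.submodule_generated[OF genU[OF submodule_subset[OF rX]]])
  have "?G \<subseteq> ?H"
  proof (rule U.generated_least[OF H])
    have "a \<in> carrier A \<and> a \<odot>\<^bsub>U\<^esub> x \<in> ?H" if "a \<in> jacobson_power A (Suc i)" and x: "x \<in> X" for a x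
      using that(1) unfolding jacobson_power.simps
    proof (induction rule: ideal_prod.induct)
      case (prod k j)
      have "k \<odot>\<^bsub>U\<^esub> (j \<odot>\<^bsub>U\<^esub> x) \<in> ?gen i (radical_of U X)"
        using prod radical_of_mem[OF U prod(2) x] by blast
      then have "k \<odot>\<^bsub>U\<^esub> (j \<odot>\<^bsub>U\<^esub> x) \<in> ?H" by (rule subsetD[OF U.generated_incl])
      then show ?case using prod JC J_mem X[OF x] by (simp add: U.smult_assoc1)
    next
      case (sum s1 s2)
      then show ?case using X[OF x] submodule_add[OF H] by (simp add: U.smult_l_distr)
    qed
    then show "?gen (Suc i) X \<subseteq> ?H" by blast
  qed
  moreover have "?H \<subseteq> ?G"
  proof (rule U.generated_least[OF G])
    let ?N = "{y \<in> carrier U. \<forall>a\<in>jacobson_power A i. a \<odot>\<^bsub>U\<^esub> y \<in> ?G}"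
    have "submodule ?N A U"
    proof (rule U.submoduleI)
      show "\<zero>\<^bsub>U\<^esub> \<in> ?N" using JC submodule_zero[OF G] by simp
      fix x y assume "x \<in> ?N" "y \<in> ?N"
      then show "x \<oplus>\<^bsub>U\<^esub> y \<in> ?N" using JC submodule_add[OF G] by (simp add: U.smult_r_distr)
    next
      fix r y assume r: "r \<in> carrier A" and y: "y \<in> ?N"
      have "a \<odot>\<^bsub>U\<^esub> (r \<odot>\<^bsub>U\<^esub> y) \<in> ?G" if a: "a \<in> jacobson_power A i" for a
      proof -
        have "a \<otimes>\<^bsub>A\<^esub> r \<in> jacobson_power A i" by (rule ideal.I_r_closed[OF jacobson_power_ideal a r])
        then have "(a \<otimes>\<^bsub>A\<^esub> r) \<odot>\<^bsub>U\<^esub> y \<in> ?G" using y by blast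
        then show ?thesis using r y JC[OF a] by (simp add: U.smult_assoc1)
      qed
      then show "r \<odot>\<^bsub>U\<^esub> y \<in> ?N" using r y by simp
    qed simp
    then have "radical_of U X \<subseteq> ?N"
    proof (rule radical_of_least)
      fix j x assume j: "j \<in> J" and x: "x \<in> X"
      have "a \<odot>\<^bsub>U\<^esub> (j \<odot>\<^bsub>U\<^esub> x) \<in> ?G" if a: "a \<in> jacobson_power A i" for a
      proof -
        have "(a \<otimes>\<^bsub>A\<^esub> j) \<odot>\<^bsub>U\<^esub> x \<in> ?gen (Suc i) X" using a j x ideal_prod.prod[of a _ j J A] by auto
        then have "(a \<otimes>\<^bsub>A\<^esub> j) \<odot>\<^bsub>U\<^esub> x \<in> ?G" by (rule subsetD[OF U.generated_incl])
        then show ?thesis using JC[OF a] J_mem[OF j] X[OF x] by (simp add: U.smult_assoc1)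
      qed
      then show "j \<odot>\<^bsub>U\<^esub> x \<in> ?N" using J_mem[OF j] X[OF x] by simp
    qed
    then show "?gen i (radical_of U X) \<subseteq> ?G" by blast
  qed
  ultimately have "?G = ?H" by (rule equalityI)
  also have "\<dots> = rads U i (radical_of U X)" by (rule Suc.IH[OF rX])
  finally show ?case by (simp only: rads_Suc_right)
qed

lemma rad_eq: "left_module A U \<Longrightarrow> rad A i U = rads U i (carrier U)"
  unfolding rad_def by (rule generated_jacobson_power) (auto intro: left_module.submodule_carrier)

lemma rad_restrict_eq:
  assumes "left_module A U" "submodule X A U"
  shows "rad A i (U\<lparr>carrier := X\<rparr>) = rads U i X"
  using rad_eq[OF left_module.restrict_left_module[OF assms], of i] 
    rads_restrict[OF assms(1,2,2), of i] by simp

text \<open>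
  The socle of \<open>U/soc\<^sup>i U\<close> consists of the classes that \<open>J\<close>
  kills. The two claims need a common induction, because this description of the next socle term
  requires the previous one to be a submodule.
\<close>

lemma soc_submodule_and_Suc:
  assumes U: "left_module A U"
  shows "submodule (soc A i U) A U \<and> soc A (Suc i) U = {x \<in> carrier U. \<forall>a\<in>J. a \<odot>\<^bsub>U\<^esub> x \<in> soc A i U}"
proof (induction i)
  interpret U: left_module A U by fact
  have S: "soc A (Suc i) U = {x \<in> carrier U. \<forall>a\<in>J. a \<odot>\<^bsub>U\<^esub> x \<in> soc A i U}" if i: "submodule (soc A i U) A U" for i
  proof -
    let ?Q = "quotient_module U (soc A i U)"
    have "soc A i U +>\<^bsub>U\<^esub> x \<in> socle A ?Q \<longleftrightarrow> (\<forall>a\<in>J. a \<odot>\<^bsub>U\<^esub> x \<in> soc A i U)" if x: "x \<in> carrier U" for x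
    proof -
      have "soc A i U +>\<^bsub>U\<^esub> x \<in> carrier ?Q" using x U.quotient_carrier by blast
      moreover have "a \<odot>\<^bsub>?Q\<^esub> (soc A i U +>\<^bsub>U\<^esub> x) = \<zero>\<^bsub>?Q\<^esub> \<longleftrightarrow> a \<odot>\<^bsub>U\<^esub> x \<in> soc A i U" if "a \<in> J" for a
        using U.quotient_smult[OF i x J_mem[OF that]] U.coset_zero_iff[OF i, of "a \<odot>\<^bsub>U\<^esub> x"] x J_mem[OF that] by simp
      ultimately show ?thesis unfolding socle_eq[OF U.quotient_left_module[OF i]] by blast
    qed
    then show ?thesis by auto
  qed
  case 0
  show ?case using S[of 0] by simp
  case (Suc i)
  have "submodule (soc A (Suc i) U) A U"
    unfolding conjunct2[OF Suc]
  proof (rule U.submoduleI)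
    note i = conjunct1[OF Suc]
    let ?N = "{x \<in> carrier U. \<forall>a\<in>J. a \<odot>\<^bsub>U\<^esub> x \<in> soc A i U}"
    show "\<zero>\<^bsub>U\<^esub> \<in> ?N" using J_mem submodule_zero[OF i] by simp
    show "x \<oplus>\<^bsub>U\<^esub> y \<in> ?N" if "x \<in> ?N" "y \<in> ?N" for x y
      using that J_mem submodule_add[OF i] by (simp add: U.smult_r_distr)
    fix r x assume r: "r \<in> carrier A" and x: "x \<in> ?N"
    have "a \<odot>\<^bsub>U\<^esub> (r \<odot>\<^bsub>U\<^esub> x) \<in> soc A i U" if a: "a \<in> J" for a
    proof -
      have "(a \<otimes>\<^bsub>A\<^esub> r) \<odot>\<^bsub>U\<^esub> x \<in> soc A i U" using x J_right[OF a r] by blast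
      then show ?thesis using r x J_mem[OF a] by (simp add: U.smult_assoc1)
    qed
    then show "r \<odot>\<^bsub>U\<^esub> x \<in> ?N" using r x by simp
  qed simp
  then show ?case using S[of "Suc i"] by blast
qed

lemma soc_submodule: "left_module A U \<Longrightarrow> submodule (soc A i U) A U"
  using soc_submodule_and_Suc by blast

lemma soc_Suc: "left_module A U \<Longrightarrow> soc A (Suc i) U = {x \<in> carrier U. \<forall>a\<in>J. a \<odot>\<^bsub>U\<^esub> x \<in> soc A i U}"
  using soc_submodule_and_Suc by blast

text \<open>
  The link between the two series: \<open>X\<close> lies in \<open>soc\<^sup>i\<^sup>+\<^sup>1
  U\<close> exactly when \<open>J X\<close> lies in \<open>soc\<^sup>i U\<close>.
\<close>

lemma subset_soc_iff:
  assumes U: "left_module A U" and X: "submodule X A U"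
  shows "X \<subseteq> soc A i U \<longleftrightarrow> rads U i X = {\<zero>\<^bsub>U\<^esub>}"
  using X
proof (induction i arbitrary: X)
  case 0
  then show ?case using submodule_zero[OF 0] by auto
next
  case (Suc i)
  note X = Suc.prems
  have "X \<subseteq> soc A (Suc i) U \<longleftrightarrow> radical_of U X \<subseteq> soc A i U"
  proof
    assume "X \<subseteq> soc A (Suc i) U"
    then show "radical_of U X \<subseteq> soc A i U"
      unfolding soc_Suc[OF U] by (intro radical_of_least[OF soc_submodule[OF U]]) auto
  next
    assume "radical_of U X \<subseteq> soc A i U"
    then show "X \<subseteq> soc A (Suc i) U"
      unfolding soc_Suc[OF U] using radical_of_mem[OF U] submodule_mem[OF X] by blast
  qed
  also have "\<dots> \<longleftrightarrow> rads U i (radical_of U X) = {\<zero>\<^bsub>U\<^esub>}"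
    by (rule Suc.IH[OF radical_of_submodule[OF U submodule_subset[OF X]]])
  finally show ?case by (simp only: rads_Suc_right)
qed

lemma soc_hom:
  assumes "left_module A M" "left_module A N" and f: "f \<in> mod_hom A M N" and "x \<in> soc A i M"
  shows "f x \<in> soc A i N"
  using assms(4)
proof (induction i arbitrary: x)
  case 0
  then show ?case using mod_hom_zero[OF assms(1-3)] by simp
next
  case (Suc i)
  then have x: "x \<in> carrier M" "\<And>a. a \<in> J \<Longrightarrow> a \<odot>\<^bsub>M\<^esub> x \<in> soc A i M" unfolding soc_Suc[OF assms(1)] by auto
  have "a \<odot>\<^bsub>N\<^esub> f x \<in> soc A i N" if a: "a \<in> J" for a
    using Suc.IH[OF x(2)[OF a]] mod_hom_smult[OF f J_mem[OF a] x(1)] by simp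
  then show ?case unfolding soc_Suc[OF assms(2)] using mod_hom_closed[OF f x(1)] by blast
qed

text \<open>
  The quotient by \<open>rad\<^sup>n U\<close> is equal to its own \<open>n\<close>-th socle
  term, and homomorphisms respect socle terms.
\<close>

lemma quotient_by_rads_hom_into_soc:
  assumes U: "left_module A U" and N: "left_module A N"
    and h: "h \<in> mod_hom A (quotient_module U (rads U n (carrier U))) N"
  shows "(\<lambda>x. h (rads U n (carrier U) +>\<^bsub>U\<^esub> x)) ` carrier U \<subseteq> soc A n N"
proof -
  interpret U: left_module A U by (rule U)
  define H where "H = rads U n (carrier U)"
  let ?Q = "quotient_module U H" and ?k = "\<lambda>x. H +>\<^bsub>U\<^esub> x"
  have H: "submodule H A U" unfolding H_def by (rule rads_submodule[OF U U.submodule_carrier])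
  have Q: "left_module A ?Q" by (rule U.quotient_left_module[OF H])
  interpret Q: left_module A ?Q by (rule Q)
  have k: "?k \<in> mod_hom A U ?Q" by (rule U.quotient_proj_hom[OF H])
  have "?k ` H = rads ?Q n (carrier ?Q)"
    using rads_image[OF U Q k U.submodule_carrier, of n] unfolding U.quotient_proj_surj H_def[symmetric] .
  moreover have "?k x = \<zero>\<^bsub>?Q\<^esub>" if "x \<in> H" for x
    using U.quotient_proj_zero_iff[OF H submodule_mem[OF H that]] that by blast
  ultimately have "rads ?Q n (carrier ?Q) = {\<zero>\<^bsub>?Q\<^esub>}" using submodule_zero[OF H] by force
  then have "carrier ?Q \<subseteq> soc A n ?Q" using subset_soc_iff[OF Q Q.submodule_carrier] by blast
  then have "h (?k x) \<in> soc A n N" if "x \<in> carrier U" for x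
    using soc_hom[OF Q N h[folded H_def]] mod_hom_closed[OF k that] by blast
  then show ?thesis unfolding H_def by blast
qed

lemma soc_Suc_mono: "left_module A U \<Longrightarrow> soc A i U \<subseteq> soc A (Suc i) U"
  unfolding soc_Suc
  by (auto intro: submodule_mem[OF soc_submodule] submodule_smult[OF soc_submodule] J_mem)

text \<open>
  This is the nilpotency of \<open>J\<close>. The series \<open>rad\<^sup>k A\<close> becomes
  stationary, and then so does \<open>soc\<^sup>k A\<close>, because \<open>x\<close> lies in
  \<open>soc\<^sup>k\<close> exactly if \<open>r \<mapsto> r x\<close> kills \<open>rad\<^sup>k
  A\<close>. If \<open>soc\<^sup>k A\<close> were proper, take a left ideal \<open>W\<close>
  that is minimal among those outside it. All proper submodules of \<open>W\<close> lie in
  \<open>W \<inter> soc\<^sup>k A\<close>, so \<open>J W\<close> does, and \<open>W\<close> lies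
  in \<open>soc\<^sup>k\<^sup>+\<^sup>1 A = soc\<^sup>k A\<close>.
\<close>

lemma regular_soc_exhausts: "\<exists>n. soc A n reg = carrier A"
proof -
  let ?f = "\<lambda>n. rads reg n (carrier reg)"
  have "stable reg (?f n) \<and> ?f (Suc n) \<subseteq> ?f n \<and> ?f n \<subseteq> carrier reg" for n
    using stable_submodule[OF rads_submodule[OF regular_left_module reg.submodule_carrier]]
      rads_Suc_subset[OF regular_left_module reg.submodule_carrier] 
      rads_subset[OF regular_left_module reg.submodule_carrier] by blast
  then obtain k where k: "\<forall>n\<ge>k. ?f n = ?f k"
    using spec[OF fg_dcc[OF fg_regular, unfolded dcc_below_def], of ?f] by blast
  then have fk: "?f (Suc k) = ?f k" by (meson le_SucI order_refl)
  let ?S = "soc A k reg"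
  have S: "submodule ?S A reg" by (rule soc_submodule[OF regular_left_module])
  have stab: "x \<in> ?S" if x: "x \<in> soc A (Suc k) reg" for x
  proof -
    have xr: "x \<in> carrier reg" using submodule_mem[OF soc_submodule[OF regular_left_module] x] .
    let ?h = "\<lambda>a. a \<odot>\<^bsub>reg\<^esub> x"
    have h: "?h \<in> mod_hom A reg reg" by (rule reg.regular_hom[OF xr])
    have hA: "submodule (?h ` carrier reg) A reg"
      by (rule mod_hom_image_submodule[OF regular_left_module regular_left_module h reg.submodule_carrier])
    have "?h ` carrier reg \<subseteq> soc A (Suc k) reg"
      using submodule_smult[OF soc_submodule[OF regular_left_module] _ x] by (intro image_subsetI) simp
    then have "rads reg (Suc k) (?h ` carrier reg) = {\<zero>\<^bsub>reg\<^esub>}"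
      using subset_soc_iff[OF regular_left_module hA] by blast
    then have "rads reg k (?h ` carrier reg) = {\<zero>\<^bsub>reg\<^esub>}"
      using rads_image[OF regular_left_module regular_left_module h reg.submodule_carrier, of "Suc k"]
        rads_image[OF regular_left_module regular_left_module h reg.submodule_carrier, of k] fk by metis
    then have "?h ` carrier reg \<subseteq> ?S" using subset_soc_iff[OF regular_left_module hA] by blast
    then have "?h \<one>\<^bsub>A\<^esub> \<in> ?S" using one_closed by (metis image_subset_iff regular_simps(1))
    then show ?thesis using xr by simp
  qed
  have "?S = carrier A"
  proof (rule ccontr)
    assume "?S \<noteq> carrier A"
    then have "submodule (carrier reg) A reg \<and> \<not> carrier reg \<subseteq> ?S"
      using submodule_subset[OF S] reg.submodule_carrier by simp
    from minimal_submodule[OF fg_regular, of "\<lambda>W. submodule W A reg \<and> \<not> W \<subseteq> ?S", OF this]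
    obtain W where W: "submodule W A reg" "\<not> W \<subseteq> ?S"
      and Wmin: "\<And>Z. submodule Z A reg \<and> \<not> Z \<subseteq> ?S \<Longrightarrow> Z \<subseteq> W \<Longrightarrow> Z = W" by metis
    let ?W = "reg\<lparr>carrier := W\<rparr>"
    have "a \<odot>\<^bsub>?W\<^esub> w \<in> W \<inter> ?S" if a: "a \<in> J" and w: "w \<in> W" for a w
    proof (rule J_maps_into_maximal[OF reg.restrict_left_module[OF W(1)]])
      show "submodule (W \<inter> ?S) A ?W"
        using reg.submodule_restrict_iff[OF W(1)] reg.submodule_Int[OF W(1) S] by blast
      show "W \<inter> ?S \<noteq> carrier ?W" using W(2) by auto
      show "K = W \<inter> ?S \<or> K = carrier ?W" if "submodule K A ?W" "W \<inter> ?S \<subseteq> K" for K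
        using Wmin[of K] that reg.submodule_restrict_iff[OF W(1), of K] by auto
    qed (use a w in auto)
    then have "W \<subseteq> soc A (Suc k) reg"
      unfolding soc_Suc[OF regular_left_module] using submodule_mem[OF W(1)] by auto
    then show False using W(2) stab by blast
  qed
  then show ?thesis by blast
qed

text \<open>
  An exponent \<open>n\<close> with \<open>J\<^sup>n = 0\<close>, not necessarily the least one.
\<close>

definition loewy :: nat where "loewy = (SOME n. soc A n reg = carrier A)"

lemma soc_loewy:
  assumes U: "left_module A U" shows "soc A loewy U = carrier U"
proof
  interpret U: left_module A U by fact
  have "soc A loewy reg = carrier A" unfolding loewy_def by (rule someI_ex[OF regular_soc_exhausts])
  then have one: "\<one>\<^bsub>A\<^esub> \<in> soc A loewy reg" by simp
  show "carrier U \<subseteq> soc A loewy U"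
  proof
    fix x assume x: "x \<in> carrier U"
    show "x \<in> soc A loewy U" using soc_hom[OF regular_left_module U U.regular_hom[OF x] one] x by simp
  qed
qed (rule submodule_subset[OF soc_submodule[OF U]])

lemma rads_loewy: "left_module A U \<Longrightarrow> submodule X A U \<Longrightarrow> rads U loewy X = {\<zero>\<^bsub>U\<^esub>}"
  using subset_soc_iff[of U X loewy] soc_loewy[of U] submodule_subset by blast

text \<open>
  Substituting the hypothesis into itself gives \<open>X \<subseteq> Y + rad\<^sup>n X\<close>
  for every \<open>n\<close>, and \<open>J\<close> is nilpotent.
\<close>

lemma nakayama:
  assumes U: "left_module A U" and X: "submodule X A U" and Y: "submodule Y A U"
    and XY: "X \<subseteq> Y <+>\<^bsub>U\<^esub> radical_of U X"
  shows "X \<subseteq> Y"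
proof -
  interpret U: left_module A U by fact
  have r: "submodule (rads U n Z) A U" if "submodule Z A U" for n Z by (rule rads_submodule[OF U that])
  have "X \<subseteq> Y <+>\<^bsub>U\<^esub> rads U n X" for n
  proof (induction n)
    case 0
    show ?case using U.sum_incl2[OF Y X] by simp
  next
    case (Suc n)
    have "rads U n X \<subseteq> rads U n (Y <+>\<^bsub>U\<^esub> radical_of U X)" by (rule rads_mono[OF XY])
    also have "\<dots> \<subseteq> rads U n Y <+>\<^bsub>U\<^esub> rads U n (radical_of U X)"
      by (rule rads_sum[OF U Y radical_of_submodule[OF U submodule_subset[OF X]]])
    also have "\<dots> \<subseteq> Y <+>\<^bsub>U\<^esub> rads U (Suc n) X"
      unfolding rads_Suc_right by (rule U.sum_mono[OF rads_subset[OF U Y] subset_refl])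
    finally have *: "rads U n X \<subseteq> Y <+>\<^bsub>U\<^esub> rads U (Suc n) X" .
    have "Y <+>\<^bsub>U\<^esub> rads U n X \<subseteq> Y <+>\<^bsub>U\<^esub> rads U (Suc n) X"
      by (rule U.sum_least[OF U.submodule_sum[OF Y r[OF X]] U.sum_incl1[OF Y r[OF X]] *])
    then show ?case using Suc by blast
  qed
  from this[of loewy] have "X \<subseteq> Y <+>\<^bsub>U\<^esub> {\<zero>\<^bsub>U\<^esub>}" unfolding rads_loewy[OF U X] .
  also have "\<dots> \<subseteq> Y" by (rule U.sum_least[OF Y]) (use submodule_zero[OF Y] in auto)
  finally show ?thesis .
qed

lemma nakayama_zero:
  assumes U: "left_module A U" and X: "submodule X A U" and "X \<subseteq> radical_of U X"
  shows "X = {\<zero>\<^bsub>U\<^esub>}"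
proof -
  interpret U: left_module A U by fact
  have r: "submodule (radical_of U X) A U" by (rule radical_of_submodule[OF U submodule_subset[OF X]])
  have "X \<subseteq> {\<zero>\<^bsub>U\<^esub>}"
    by (rule nakayama[OF U X U.submodule_null order_trans[OF assms(3) U.sum_incl2[OF U.submodule_null r]]])
  then show ?thesis using submodule_zero[OF X] by blast
qed

end

section \<open>Finitely generated, projective and injective modules\<close>

lemma fg_image:
  assumes M: "fg_left_module A M" and N: "left_module A N" and f: "f \<in> mod_hom A M N" "f ` carrier M = carrier N"
  shows "fg_left_module A N"
proof -
  have M': "left_module A M" using M by (simp add: fg_left_module_def)
  interpret M: left_module A M by fact
  interpret N: left_module A N by fact
  obtain X where X: "finite X" "X \<subseteq> carrier M" "generated_submodule A M X = carrier M"
    using M unfolding fg_left_module_def finitely_generated_def by blast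
  have fX: "f ` X \<subseteq> carrier N" using X(2) mod_hom_closed[OF f(1)] by auto
  let ?G = "generated_submodule A N (f ` X)"
  have G: "submodule ?G A N" by (rule N.submodule_generated[OF fX])
  have pre: "submodule {x \<in> carrier M. f x \<in> ?G} A M"
    by (rule mod_hom_preimage_submodule[OF M' N f(1) M.submodule_carrier G])
  have "X \<subseteq> {x \<in> carrier M. f x \<in> ?G}" using X(2) N.generated_incl[of "f ` X"] by auto
  from M.generated_least[OF pre this] have "carrier M \<subseteq> {x \<in> carrier M. f x \<in> ?G}" unfolding X(3) .
  then have "carrier N \<subseteq> ?G" unfolding f(2)[symmetric] by blast
  then have "?G = carrier N" using submodule_subset[OF G] by blast
  then show ?thesis
    unfolding fg_left_module_def finitely_generated_def using N fX X(1) finite_imageI by blast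
qed

lemma fg_quotient:
  assumes M: "fg_left_module A M" and N: "submodule N A M"
  shows "fg_left_module A (quotient_module M N)"
proof -
  have "left_module A M" using M by (simp add: fg_left_module_def)
  then interpret M: left_module A M .
  show ?thesis
  proof (rule fg_image)
    show "fg_left_module A M" by (rule M)
    show "left_module A (quotient_module M N)" by (rule M.quotient_left_module[OF N])
    show "(\<lambda>x. N +>\<^bsub>M\<^esub> x) \<in> mod_hom A M (quotient_module M N)" by (rule M.quotient_proj_hom[OF N])
    show "(\<lambda>x. N +>\<^bsub>M\<^esub> x) ` carrier M = carrier (quotient_module M N)" by (rule M.quotient_proj_surj)
  qed
qed

lemma direct_sum_simps:
  "carrier (direct_sum_module M N) = carrier M \<times> carrier N"
  "\<zero>\<^bsub>direct_sum_module M N\<^esub> = (\<zero>\<^bsub>M\<^esub>, \<zero>\<^bsub>N\<^esub>)"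
  "(x, y) \<oplus>\<^bsub>direct_sum_module M N\<^esub> (x', y') = (x \<oplus>\<^bsub>M\<^esub> x', y \<oplus>\<^bsub>N\<^esub> y')"
  "a \<odot>\<^bsub>direct_sum_module M N\<^esub> (x, y) = (a \<odot>\<^bsub>M\<^esub> x, a \<odot>\<^bsub>N\<^esub> y)"
  by (simp_all add: direct_sum_module_def)

lemma direct_sum_left_module:
  assumes M: "left_module A M" and N: "left_module A N"
  shows "left_module A (direct_sum_module M N)"
proof -
  interpret M: left_module A M by fact
  interpret N: left_module A N by fact
  have "abelian_group (direct_sum_module M N)"
  proof (rule abelian_groupI)
    fix z assume "z \<in> carrier (direct_sum_module M N)"
    then obtain x y where "z = (x, y)" "x \<in> carrier M" "y \<in> carrier N" by (auto simp: direct_sum_simps)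
    then show "\<exists>w\<in>carrier (direct_sum_module M N). w \<oplus>\<^bsub>direct_sum_module M N\<^esub> z = \<zero>\<^bsub>direct_sum_module M N\<^esub>"
      by (intro bexI[of _ "(\<ominus>\<^bsub>M\<^esub> x, \<ominus>\<^bsub>N\<^esub> y)"]) (auto simp: direct_sum_simps M.M.l_neg N.M.l_neg)
  qed (auto simp: direct_sum_simps M.M.a_ac N.M.a_ac)
  then show ?thesis
    using M.R.ring_axioms
    by (intro left_module.intro left_module_axioms.intro)
       (auto simp: direct_sum_simps M.smult_l_distr M.smult_r_distr M.smult_assoc1
          N.smult_l_distr N.smult_r_distr N.smult_assoc1)
qed

lemma direct_sum_homs:
  assumes M: "left_module A M" and N: "left_module A N"
  shows "(\<lambda>x. (x, \<zero>\<^bsub>N\<^esub>)) \<in> mod_hom A M (direct_sum_module M N)"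
    and "(\<lambda>y. (\<zero>\<^bsub>M\<^esub>, y)) \<in> mod_hom A N (direct_sum_module M N)"
    and "fst \<in> mod_hom A (direct_sum_module M N) M"
    and "snd \<in> mod_hom A (direct_sum_module M N) N"
proof -
  interpret M: left_module A M by fact
  interpret N: left_module A N by fact
  show "(\<lambda>x. (x, \<zero>\<^bsub>N\<^esub>)) \<in> mod_hom A M (direct_sum_module M N)"
    "(\<lambda>y. (\<zero>\<^bsub>M\<^esub>, y)) \<in> mod_hom A N (direct_sum_module M N)"
    "fst \<in> mod_hom A (direct_sum_module M N) M"
    "snd \<in> mod_hom A (direct_sum_module M N) N"
    by (rule mod_homI; force simp: direct_sum_simps)+
qed

lemma mod_hom_pair:
  assumes "f \<in> mod_hom A K M" "g \<in> mod_hom A K N"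
  shows "(\<lambda>x. (f x, g x)) \<in> mod_hom A K (direct_sum_module M N)"
  by (rule mod_homI)
    (simp_all add: direct_sum_simps mod_hom_closed[OF assms(1)] mod_hom_closed[OF assms(2)] mod_hom_add[OF assms(1)]
      mod_hom_add[OF assms(2)] mod_hom_smult[OF assms(1)] mod_hom_smult[OF assms(2)])

lemma fg_direct_sum:
  assumes "fg_left_module A M" "fg_left_module A N"
  shows "fg_left_module A (direct_sum_module M N)"
proof -
  have M: "left_module A M" and N: "left_module A N" using assms by (auto simp: fg_left_module_def)
  interpret M: left_module A M by fact
  interpret N: left_module A N by fact
  let ?D = "direct_sum_module M N"
  have Dm: "left_module A ?D" by (rule direct_sum_left_module[OF M N])
  interpret D: left_module A ?D by (rule Dm)
  obtain X where X: "finite X" "X \<subseteq> carrier M" "generated_submodule A M X = carrier M"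
    using assms(1) unfolding fg_left_module_def finitely_generated_def by blast
  obtain Y where Y: "finite Y" "Y \<subseteq> carrier N" "generated_submodule A N Y = carrier N"
    using assms(2) unfolding fg_left_module_def finitely_generated_def by blast
  let ?Z = "(\<lambda>x. (x, \<zero>\<^bsub>N\<^esub>)) ` X \<union> (\<lambda>y. (\<zero>\<^bsub>M\<^esub>, y)) ` Y"
  have ZD: "?Z \<subseteq> carrier ?D" using X Y by (auto simp: direct_sum_simps)
  let ?G = "generated_submodule A ?D ?Z"
  have G: "submodule ?G A ?D" by (rule D.submodule_generated[OF ZD])
  have p1: "submodule {x \<in> carrier M. (x, \<zero>\<^bsub>N\<^esub>) \<in> ?G} A M"
    by (rule mod_hom_preimage_submodule[OF M Dm direct_sum_homs(1)[OF M N] M.submodule_carrier G])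
  have p2: "submodule {y \<in> carrier N. (\<zero>\<^bsub>M\<^esub>, y) \<in> ?G} A N"
    by (rule mod_hom_preimage_submodule[OF N Dm direct_sum_homs(2)[OF M N] N.submodule_carrier G])
  have "X \<subseteq> {x \<in> carrier M. (x, \<zero>\<^bsub>N\<^esub>) \<in> ?G}" using X(2) D.generated_incl[of ?Z] by auto
  from M.generated_least[OF p1 this] have c1: "carrier M \<subseteq> {x \<in> carrier M. (x, \<zero>\<^bsub>N\<^esub>) \<in> ?G}" unfolding X(3) .
  have "Y \<subseteq> {y \<in> carrier N. (\<zero>\<^bsub>M\<^esub>, y) \<in> ?G}" using Y(2) D.generated_incl[of ?Z] by auto
  from N.generated_least[OF p2 this] have c2: "carrier N \<subseteq> {y \<in> carrier N. (\<zero>\<^bsub>M\<^esub>, y) \<in> ?G}" unfolding Y(3) .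
  have "(x, y) \<in> ?G" if "x \<in> carrier M" "y \<in> carrier N" for x y
  proof -
    have "(x, \<zero>\<^bsub>N\<^esub>) \<oplus>\<^bsub>?D\<^esub> (\<zero>\<^bsub>M\<^esub>, y) \<in> ?G" using c1 c2 that by (intro submodule_add[OF G]) auto
    then show ?thesis using that by (simp add: direct_sum_simps)
  qed
  then have "carrier ?D \<subseteq> ?G" by (auto simp: direct_sum_simps)
  then have "?G = carrier ?D" using submodule_subset[OF G] by blast
  moreover have "finite ?Z" using X(1) Y(1) by simp
  ultimately show ?thesis
    unfolding fg_left_module_def finitely_generated_def using Dm ZD by blast
qed

lemma mod_hom_inverse:
  assumes M: "left_module A M" and N: "left_module A N" and f: "f \<in> mod_hom A M N" and bij: "bij_betw f (carrier M) (carrier N)"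
  shows "\<exists>g \<in> mod_hom A N M. (\<forall>x\<in>carrier M. g (f x) = x) \<and> (\<forall>y\<in>carrier N. f (g y) = y)"
proof -
  have inj: "inj_on f (carrier M)" and surj: "f ` carrier M = carrier N" using bij by (auto simp: bij_betw_def)
  have "\<And>x. x \<in> carrier M \<Longrightarrow> f x = \<zero>\<^bsub>N\<^esub> \<Longrightarrow> x = \<zero>\<^bsub>M\<^esub>" using inj mod_hom_inj_iff[OF M N f] by blast
  from mod_hom_factor[OF M N M f surj mod_hom_id this] obtain g where
    g: "g \<in> mod_hom A N M" "\<forall>x\<in>carrier M. g (f x) = x" by blast
  have "f (g y) = y" if y: "y \<in> carrier N" for y
  proof -
    obtain x where "x \<in> carrier M" "y = f x" using y surj by blast
    then show ?thesis using g(2) by simp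
  qed
  then show ?thesis using g by blast
qed

lemma iso_mod_obj:
  fixes A :: "('a, 'x) ring_scheme"
  assumes M: "fg_left_module A M"
  obtains U :: "'a mod_obj" and \<phi> \<psi> where "fg_left_module A U" "\<phi> \<in> mod_hom A M U" "\<psi> \<in> mod_hom A U M"
    "\<And>x. x \<in> carrier M \<Longrightarrow> \<psi> (\<phi> x) = x" "\<And>u. u \<in> carrier U \<Longrightarrow> \<phi> (\<psi> u) = u"
proof -
  from fg_left_module_isomorphic_mod_obj[OF M] obtain U :: "'a mod_obj" and \<phi> where
    U: "fg_left_module A U" "\<phi> \<in> mod_hom A M U" "bij_betw \<phi> (carrier M) (carrier U)" by blast
  have "left_module A M" "left_module A U" using M U(1) by (auto simp: fg_left_module_def)
  from mod_hom_inverse[OF this U(2,3)] obtain g where "g \<in> mod_hom A U M"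
    "\<forall>x\<in>carrier M. g (\<phi> x) = x" "\<forall>y\<in>carrier U. \<phi> (g y) = y" by (elim bexE conjE)
  then show thesis using U by (intro that[of U \<phi> g]) simp_all
qed

text \<open>
  Projectivity is defined by test objects whose elements have one fixed type. Every finitely
  generated module is isomorphic to such an object, so the lifting property holds for all types.
\<close>

lemma projective_lift:
  assumes P: "projective_in_mod A P" and X: "fg_left_module A X" and Y: "fg_left_module A Y"
    and g: "g \<in> mod_hom A X Y" "g ` carrier X = carrier Y" and f: "f \<in> mod_hom A P Y"
  shows "\<exists>h \<in> mod_hom A P X. \<forall>x\<in>carrier P. g (h x) = f x"
proof -
  obtain X' :: "'a mod_obj" and \<phi> \<phi>' where X': "fg_left_module A X'" "\<phi> \<in> mod_hom A X X'" "\<phi>' \<in> mod_hom A X' X"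
    "\<And>x. x \<in> carrier X \<Longrightarrow> \<phi>' (\<phi> x) = x" "\<And>u. u \<in> carrier X' \<Longrightarrow> \<phi> (\<phi>' u) = u"
    using iso_mod_obj[OF X] by metis
  obtain Y' :: "'a mod_obj" and \<psi> \<psi>' where Y': "fg_left_module A Y'" "\<psi> \<in> mod_hom A Y Y'" "\<psi>' \<in> mod_hom A Y' Y"
    "\<And>x. x \<in> carrier Y \<Longrightarrow> \<psi>' (\<psi> x) = x" "\<And>u. u \<in> carrier Y' \<Longrightarrow> \<psi> (\<psi>' u) = u"
    using iso_mod_obj[OF Y] by metis
  let ?g = "\<lambda>x. \<psi> (g (\<phi>' x))"
  have g': "?g \<in> mod_hom A X' Y'"
    using mod_hom_comp[OF mod_hom_comp[OF X'(3) g(1)] Y'(2)] .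
  have "?g ` carrier X' = carrier Y'"
  proof
    show "?g ` carrier X' \<subseteq> carrier Y'" using mod_hom_closed[OF g'] by auto
    show "carrier Y' \<subseteq> ?g ` carrier X'"
    proof
      fix y assume y: "y \<in> carrier Y'"
      then obtain x where x: "x \<in> carrier X" "\<psi>' y = g x" using mod_hom_closed[OF Y'(3) y] g(2) by blast
      then have "?g (\<phi> x) = y" using X'(4) Y'(5)[OF y] by simp
      then show "y \<in> ?g ` carrier X'" using mod_hom_closed[OF X'(2) x(1)] by blast
    qed
  qed
  moreover have "(\<lambda>x. \<psi> (f x)) \<in> mod_hom A P Y'" by (rule mod_hom_comp[OF f Y'(2)])
  ultimately have "\<exists>h \<in> mod_hom A P X'. \<forall>x\<in>carrier P. ?g (h x) = \<psi> (f x)"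
    using conjunct2[OF P[unfolded projective_in_mod_def], rule_format, of X' Y' ?g "\<lambda>x. \<psi> (f x)"]
      X'(1) Y'(1) g' by simp
  then obtain h where h: "h \<in> mod_hom A P X'" "\<forall>x\<in>carrier P. ?g (h x) = \<psi> (f x)" by (rule bexE)
  have "g (\<phi>' (h x)) = f x" if x: "x \<in> carrier P" for x
    using h(2) x Y'(4)[OF mod_hom_closed[OF f x]] 
      Y'(4)[OF mod_hom_closed[OF g(1) mod_hom_closed[OF X'(3) mod_hom_closed[OF h(1) x]]]] by metis
  then show ?thesis using mod_hom_comp[OF h(1) X'(3)] by (intro bexI[of _ "\<lambda>x. \<phi>' (h x)"]) auto
qed

lemma injective_extend:
  assumes I: "injective_in_mod A I" and X: "fg_left_module A X" and Y: "fg_left_module A Y"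
    and g: "g \<in> mod_hom A X Y" "inj_on g (carrier X)" and f: "f \<in> mod_hom A X I"
  shows "\<exists>h \<in> mod_hom A Y I. \<forall>x\<in>carrier X. h (g x) = f x"
proof -
  obtain X' :: "'a mod_obj" and \<phi> \<phi>' where X': "fg_left_module A X'" "\<phi> \<in> mod_hom A X X'" "\<phi>' \<in> mod_hom A X' X"
    "\<And>x. x \<in> carrier X \<Longrightarrow> \<phi>' (\<phi> x) = x" "\<And>u. u \<in> carrier X' \<Longrightarrow> \<phi> (\<phi>' u) = u"
    using iso_mod_obj[OF X] by metis
  obtain Y' :: "'a mod_obj" and \<psi> \<psi>' where Y': "fg_left_module A Y'" "\<psi> \<in> mod_hom A Y Y'" "\<psi>' \<in> mod_hom A Y' Y"
    "\<And>x. x \<in> carrier Y \<Longrightarrow> \<psi>' (\<psi> x) = x" "\<And>u. u \<in> carrier Y' \<Longrightarrow> \<psi> (\<psi>' u) = u"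
    using iso_mod_obj[OF Y] by metis
  let ?g = "\<lambda>x. \<psi> (g (\<phi>' x))"
  have g': "?g \<in> mod_hom A X' Y'"
    using mod_hom_comp[OF mod_hom_comp[OF X'(3) g(1)] Y'(2)] .
  have "inj_on ?g (carrier X')"
  proof (rule inj_onI)
    fix x y assume xy: "x \<in> carrier X'" "y \<in> carrier X'" "?g x = ?g y"
    have c: "\<phi>' x \<in> carrier X" "\<phi>' y \<in> carrier X" using mod_hom_closed[OF X'(3)] xy by auto
    have "g (\<phi>' x) = g (\<phi>' y)" using Y'(4) mod_hom_closed[OF g(1)] c xy(3) by metis
    then have "\<phi>' x = \<phi>' y" using inj_onD[OF g(2)] c by blast
    then show "x = y" using X'(5) xy by metis
  qed
  moreover have "(\<lambda>x. f (\<phi>' x)) \<in> mod_hom A X' I" by (rule mod_hom_comp[OF X'(3) f])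
  ultimately have "\<exists>h \<in> mod_hom A Y' I. \<forall>x\<in>carrier X'. h (?g x) = f (\<phi>' x)"
    using conjunct2[OF I[unfolded injective_in_mod_def], rule_format, of X' Y' ?g "\<lambda>x. f (\<phi>' x)"]
      X'(1) Y'(1) g' by simp
  then obtain h where h: "h \<in> mod_hom A Y' I" "\<forall>x\<in>carrier X'. h (?g x) = f (\<phi>' x)" by (rule bexE)
  have "h (\<psi> (g x)) = f x" if x: "x \<in> carrier X" for x
    using h(2) X'(4)[OF x] mod_hom_closed[OF X'(2) x] by metis
  then show ?thesis using mod_hom_comp[OF Y'(2) h(1)] by (intro bexI[of _ "\<lambda>x. h (\<psi> x)"]) auto
qed

context artin_alg
begin

text \<open>
  Let \<open>C\<close> be minimal such that \<open>W\<close> is the sum of \<open>C\<close> and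
  a finitely generated submodule. A maximal submodule \<open>D\<close> of \<open>C\<close> would
  give \<open>C = A x + D\<close> and thereby a smaller choice. So \<open>C\<close> has no
  maximal submodule above \<open>J C\<close>, which means \<open>C = J C\<close>, and
  \<open>C\<close> is zero by nilpotency.
\<close>

lemma fg_submodule:
  assumes U: "fg_left_module A U" and W: "submodule W A U"
  shows "fg_left_module A (U\<lparr>carrier := W\<rparr>)"
proof -
  have Um: "left_module A U" using U by (simp add: fg_left_module_def)
  interpret U: left_module A U by (rule Um)
  let ?gen = "generated_submodule A U"
  have gen: "submodule (?gen X) A U" if "X \<subseteq> W" for X
    using U.submodule_generated submodule_subset[OF W] that by blast
  define Q where "Q C \<longleftrightarrow> submodule C A U \<and> C \<subseteq> W \<and> (\<exists>X. finite X \<and> X \<subseteq> W \<and> W \<subseteq> ?gen X <+>\<^bsub>U\<^esub> C)" for C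
  have "Q W"
    unfolding Q_def using W U.sum_incl2[OF gen[of "{}"] W] by blast
  from minimal_submodule[OF U, of Q, OF this] obtain C where
    C: "Q C" and Cmin: "\<And>Z. Q Z \<Longrightarrow> Z \<subseteq> C \<Longrightarrow> Z = C" unfolding Q_def by metis
  obtain X where X: "finite X" "X \<subseteq> W" "W \<subseteq> ?gen X <+>\<^bsub>U\<^esub> C" and C': "submodule C A U" "C \<subseteq> W"
    using C unfolding Q_def by blast
  have "C \<subseteq> radical_of U C"
  proof
    fix x assume x: "x \<in> C"
    show "x \<in> radical_of U C"
    proof (rule ccontr)
      assume nx: "x \<notin> radical_of U C"
      let ?C = "U\<lparr>carrier := C\<rparr>"
      have Cm: "left_module A ?C" by (rule U.restrict_left_module[OF C'(1)])
      have r: "submodule (radical_of U C) A ?C"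
        using U.submodule_restrict_iff[OF C'(1)] radical_of_submodule[OF Um submodule_subset[OF C'(1)]] 
          radical_of_subset[OF C'(1)] by blast
      have "\<exists>D. submodule D A ?C \<and> radical_of U C \<subseteq> D \<and> x \<notin> D \<and>
        (\<forall>E. submodule E A ?C \<and> D \<subseteq> E \<longrightarrow> E = D \<or> E = carrier ?C)"
        by (rule maximal_submodule_avoiding[OF Cm _ nx r]) (use x radical_of_mem[OF Um] in auto)
      then obtain D where D: "submodule D A ?C" "x \<notin> D" 
        and Dmax: "\<And>E. submodule E A ?C \<Longrightarrow> D \<subseteq> E \<Longrightarrow> E = D \<or> E = C" by auto
      have D': "submodule D A U" "D \<subseteq> C" using D(1) U.submodule_restrict_iff[OF C'(1)] by auto
      have xU: "x \<in> carrier U" by (rule submodule_mem[OF C'(1) x])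
      have xW: "insert x X \<subseteq> W" using x C'(2) X(2) by blast
      let ?G = "?gen (insert x X)"
      have G: "submodule ?G A U" by (rule gen[OF xW])
      have xG: "x \<in> ?G" and XG: "?gen X \<subseteq> ?G" 
        using U.generated_incl[of "insert x X"] U.generated_mono[of X "insert x X"] by auto
      have s: "submodule (cyclic_submodule A U x <+>\<^bsub>U\<^esub> D) A U"
        by (rule U.submodule_sum[OF U.cyclic_submodule[OF xU] D'(1)])
      have sC: "cyclic_submodule A U x <+>\<^bsub>U\<^esub> D \<subseteq> C"
        by (rule U.sum_least[OF C'(1) cyclic_least[OF C'(1) x] D'(2)])
      have "x \<in> cyclic_submodule A U x <+>\<^bsub>U\<^esub> D"
        using U.sum_incl1[OF U.cyclic_submodule[OF xU] D'(1)] U.cyclic_mem[OF xU] by blast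
      then have eq: "cyclic_submodule A U x <+>\<^bsub>U\<^esub> D = C"
        using Dmax[of "cyclic_submodule A U x <+>\<^bsub>U\<^esub> D"] s sC U.submodule_restrict_iff[OF C'(1)] D(2)
          U.sum_incl2[OF U.cyclic_submodule[OF xU] D'(1)] by blast
      have "cyclic_submodule A U x <+>\<^bsub>U\<^esub> D \<subseteq> ?G <+>\<^bsub>U\<^esub> D"
        by (rule U.sum_mono[OF cyclic_least[OF G xG] subset_refl])
      then have "C \<subseteq> ?G <+>\<^bsub>U\<^esub> D" unfolding eq .
      then have "?gen X <+>\<^bsub>U\<^esub> C \<subseteq> ?G <+>\<^bsub>U\<^esub> D"
        by (rule U.sum_least[OF U.submodule_sum[OF G D'(1)] order_trans[OF XG U.sum_incl1[OF G D'(1)]]])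
      then have "W \<subseteq> ?G <+>\<^bsub>U\<^esub> D" using X(3) by (rule order_trans[rotated])
      moreover have "finite (insert x X)" using X(1) by simp
      ultimately have "Q D" unfolding Q_def using D' C'(2) xW by blast
      then have "D = C" using Cmin D'(2) by blast
      then show False using D(2) x by blast
    qed
  qed
  then have "C = {\<zero>\<^bsub>U\<^esub>}" by (rule nakayama_zero[OF Um C'(1)])
  then have "W \<subseteq> ?gen X <+>\<^bsub>U\<^esub> {\<zero>\<^bsub>U\<^esub>}" using X(3) by simp
  also have "\<dots> \<subseteq> ?gen X"
    by (rule U.sum_least[OF gen[OF X(2)] subset_refl]) (use submodule_zero[OF gen[OF X(2)]] in auto)
  finally have "?gen X = W" using U.generated_least[OF W X(2)] by blast
  then have "generated_submodule A (U\<lparr>carrier := W\<rparr>) X = carrier (U\<lparr>carrier := W\<rparr>)"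
    using U.generated_restrict[OF W X(2)] by simp
  then show ?thesis
    unfolding fg_left_module_def finitely_generated_def
    using U.restrict_left_module[OF W] X(1,2) by auto
qed

lemma regular_projective: "projective_in_mod A reg"
  unfolding projective_in_mod_def
proof (intro conjI allI impI)
  show "fg_left_module A reg" by (rule fg_regular)
  fix X Y :: "'a mod_obj" and g f
  assume *: "fg_left_module A X \<and> fg_left_module A Y \<and> g \<in> mod_hom A X Y \<and> g ` carrier X = carrier Y
    \<and> f \<in> mod_hom A reg Y"
  interpret X: left_module A X using * by (simp add: fg_left_module_def)
  have f: "f \<in> mod_hom A reg Y" and g: "g \<in> mod_hom A X Y" using * by auto
  have "f \<one>\<^bsub>A\<^esub> \<in> carrier Y" using mod_hom_closed[OF f] by simp
  then obtain x where x: "x \<in> carrier X" "g x = f \<one>\<^bsub>A\<^esub>" using * by (metis imageE)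
  have "g (a \<odot>\<^bsub>X\<^esub> x) = f a" if a: "a \<in> carrier A" for a
    using mod_hom_smult[OF g a x(1)] mod_hom_smult[OF f a, of "\<one>\<^bsub>A\<^esub>"] x(2) a by simp
  then show "\<exists>h\<in>mod_hom A reg X. \<forall>x\<in>carrier reg. g (h x) = f x"
    using X.regular_hom[OF x(1)] by (intro bexI[of _ "\<lambda>a. a \<odot>\<^bsub>X\<^esub> x"]) auto
qed

text \<open>
  The maps \<open>f\<close> and \<open>g\<close> are the components of a section of \<open>X
  \<times> Y \<rightarrow> P\<close>. Minimality of \<open>Y\<close> yields \<open>g Y =
  Y\<close>, so each element of \<open>X\<close> can be changed by an element of \<open>X
  \<inter> Y\<close> into one that \<open>g\<close> kills. The kernel of \<open>g\<close> on
  \<open>X\<close> is therefore still a supplement of \<open>Y\<close>, and by minimality it is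
  \<open>X\<close>.
\<close>

lemma section_identity_on_supplement:
  assumes P: "left_module A P" and X: "submodule X A P" and Y: "submodule Y A P"
    and XY: "carrier P \<subseteq> X <+>\<^bsub>P\<^esub> Y"
    and Xmin: "\<And>Z. submodule Z A P \<Longrightarrow> Z \<subseteq> X \<Longrightarrow> carrier P \<subseteq> Z <+>\<^bsub>P\<^esub> Y \<Longrightarrow> Z = X"
    and Ymin: "\<And>Z. submodule Z A P \<Longrightarrow> Z \<subseteq> Y \<Longrightarrow> carrier P \<subseteq> X <+>\<^bsub>P\<^esub> Z \<Longrightarrow> Z = Y"
    and f: "f \<in> mod_hom A P P" "\<And>x. x \<in> carrier P \<Longrightarrow> f x \<in> X"
    and g: "g \<in> mod_hom A P P" "\<And>x. x \<in> carrier P \<Longrightarrow> g x \<in> Y"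
    and fg: "\<And>x. x \<in> carrier P \<Longrightarrow> f x \<oplus>\<^bsub>P\<^esub> g x = x"
    and x: "x \<in> X"
  shows "f x = x"
proof -
  interpret P: left_module A P by (rule P)
  note cX = submodule_mem[OF X] and cY = submodule_mem[OF Y]
  have decomp: "\<exists>u\<in>X. \<exists>v\<in>Y. z = u \<oplus>\<^bsub>P\<^esub> v" if "z \<in> carrier P" for z
    using XY that unfolding mem_set_add[symmetric] by blast
  have gimg: "g ` Y = Y"
  proof (rule Ymin)
    show "submodule (g ` Y) A P" by (rule mod_hom_image_submodule[OF P P g(1) Y])
    show "g ` Y \<subseteq> Y" using g(2) cY by auto
    show "carrier P \<subseteq> X <+>\<^bsub>P\<^esub> g ` Y"
    proof
      fix z assume "z \<in> carrier P"
      then obtain u v where uv: "u \<in> X" "v \<in> Y" "z = u \<oplus>\<^bsub>P\<^esub> v" using decomp by blast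
      have "z = (u \<oplus>\<^bsub>P\<^esub> f v) \<oplus>\<^bsub>P\<^esub> g v"
        using fg[OF cY[OF uv(2)]] uv cX cY f(2) g(2) by (simp add: P.M.a_assoc)
      moreover have "u \<oplus>\<^bsub>P\<^esub> f v \<in> X" using submodule_add[OF X uv(1) f(2)[OF cY[OF uv(2)]]] .
      ultimately show "z \<in> X <+>\<^bsub>P\<^esub> g ` Y" unfolding mem_set_add using uv(2) by blast
    qed
  qed
  let ?K = "{x \<in> carrier P. g x \<in> {\<zero>\<^bsub>P\<^esub>}} \<inter> X"
  have K: "submodule ?K A P"
    by (rule P.submodule_Int[OF mod_hom_preimage_submodule[OF P P g(1) P.submodule_carrier P.submodule_null] X])
  have "?K = X"
  proof (rule Xmin[OF K])
    show "carrier P \<subseteq> ?K <+>\<^bsub>P\<^esub> Y"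
    proof
      fix z assume "z \<in> carrier P"
      then obtain u v where uv: "u \<in> X" "v \<in> Y" "z = u \<oplus>\<^bsub>P\<^esub> v" using decomp by blast
      have "g u \<in> Y" by (rule g(2)[OF cX[OF uv(1)]])
      then obtain y where y: "y \<in> Y" "g u = g y" using gimg by blast
      have c: "u \<in> carrier P" "y \<in> carrier P" "v \<in> carrier P" using cX cY uv y by auto
      let ?d = "u \<ominus>\<^bsub>P\<^esub> y"
      have d: "?d \<in> carrier P" using c by simp
      have gd: "g ?d = \<zero>\<^bsub>P\<^esub>" using mod_hom_diff[OF P P g(1) c(1,2)] y(2) mod_hom_closed[OF g(1) c(2)] by simp
      then have "f ?d = ?d" using fg[OF d] mod_hom_closed[OF f(1) d] by simp
      then have "?d \<in> X" using f(2)[OF d] by simp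
      then have "?d \<in> ?K" using gd d by simp
      moreover have "z = ?d \<oplus>\<^bsub>P\<^esub> (y \<oplus>\<^bsub>P\<^esub> v)"
        using P.diff_add_cancel[OF c(1,2)] uv(3) c d by (simp add: P.M.a_assoc[symmetric])
      moreover have "y \<oplus>\<^bsub>P\<^esub> v \<in> Y" by (rule submodule_add[OF Y y(1) uv(2)])
      ultimately show "z \<in> ?K <+>\<^bsub>P\<^esub> Y" unfolding mem_set_add by blast
    qed
  qed simp
  then have "g x = \<zero>\<^bsub>P\<^esub>" using x by blast
  then show ?thesis using fg[OF cX[OF x]] mod_hom_closed[OF f(1) cX[OF x]] by simp
qed

text \<open>
  Shrink both summands until each is a minimal supplement of the other, and split the surjection
  from their product onto \<open>P\<close>. The components of the section are the identity on
  \<open>X'\<close> and on \<open>Y'\<close>, so an element \<open>z\<close> of both satisfies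
  \<open>z = z + z\<close>.
\<close>

lemma projective_sum_contains_direct:
  assumes P: "projective_in_mod A P" and X: "submodule X A P" and Y: "submodule Y A P"
    and XY: "X <+>\<^bsub>P\<^esub> Y = carrier P"
  obtains X' Y' where "submodule X' A P" "submodule Y' A P" "X' \<subseteq> X" "Y' \<subseteq> Y"
    "X' <+>\<^bsub>P\<^esub> Y' = carrier P" "X' \<inter> Y' = {\<zero>\<^bsub>P\<^esub>}"
proof -
  have Pfg: "fg_left_module A P" using P by (simp add: projective_in_mod_def)
  then have Pm: "left_module A P" by (simp add: fg_left_module_def)
  interpret P: left_module A P by (rule Pm)
  have "submodule Y A P \<and> Y \<subseteq> Y \<and> X <+>\<^bsub>P\<^esub> Y = carrier P" using Y XY by blast
  from minimal_submodule[OF Pfg, of "\<lambda>Z. submodule Z A P \<and> Z \<subseteq> Y \<and> X <+>\<^bsub>P\<^esub> Z = carrier P", OF this]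
  obtain Y' where Y': "submodule Y' A P" "Y' \<subseteq> Y" "X <+>\<^bsub>P\<^esub> Y' = carrier P"
    and Ymin0: "\<And>Z. submodule Z A P \<and> Z \<subseteq> Y \<and> X <+>\<^bsub>P\<^esub> Z = carrier P \<Longrightarrow> Z \<subseteq> Y' \<Longrightarrow> Z = Y'" by metis
  have "submodule X A P \<and> X \<subseteq> X \<and> X <+>\<^bsub>P\<^esub> Y' = carrier P" using X Y' by blast
  from minimal_submodule[OF Pfg, of "\<lambda>Z. submodule Z A P \<and> Z \<subseteq> X \<and> Z <+>\<^bsub>P\<^esub> Y' = carrier P", OF this]
  obtain X' where X': "submodule X' A P" "X' \<subseteq> X" "X' <+>\<^bsub>P\<^esub> Y' = carrier P"
    and Xmin0: "\<And>Z. submodule Z A P \<and> Z \<subseteq> X \<and> Z <+>\<^bsub>P\<^esub> Y' = carrier P \<Longrightarrow> Z \<subseteq> X' \<Longrightarrow> Z = X'" by metis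
  have sub: "Z <+>\<^bsub>P\<^esub> W \<subseteq> carrier P" if "submodule Z A P" "submodule W A P" for Z W
    using submodule_subset[OF P.submodule_sum[OF that]] .
  have Xmin: "Z = X'" if "submodule Z A P" "Z \<subseteq> X'" "carrier P \<subseteq> Z <+>\<^bsub>P\<^esub> Y'" for Z
    using Xmin0[of Z] that X'(2) sub[OF that(1) Y'(1)] by blast
  have Ymin: "Z = Y'" if "submodule Z A P" "Z \<subseteq> Y'" "carrier P \<subseteq> X' <+>\<^bsub>P\<^esub> Z" for Z
  proof -
    have "carrier P \<subseteq> X <+>\<^bsub>P\<^esub> Z" using P.sum_mono[OF X'(2) subset_refl] that(3) by blast
    then show ?thesis using Ymin0[of Z] that Y'(2) sub[OF X that(1)] by blast
  qed
  note cX = submodule_mem[OF X'(1)] and cY = submodule_mem[OF Y'(1)]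
  let ?X = "P\<lparr>carrier := X'\<rparr>" and ?Y = "P\<lparr>carrier := Y'\<rparr>"
  let ?D = "direct_sum_module ?X ?Y"
  have fgX: "fg_left_module A ?X" and fgY: "fg_left_module A ?Y"
    by (rule fg_submodule[OF Pfg X'(1)], rule fg_submodule[OF Pfg Y'(1)])
  have Xm: "left_module A ?X" and Ym: "left_module A ?Y" using fgX fgY by (auto simp: fg_left_module_def)
  let ?s = "\<lambda>z. fst z \<oplus>\<^bsub>P\<^esub> snd z"
  have "fst \<in> mod_hom A ?D P" "snd \<in> mod_hom A ?D P"
    using mod_hom_extend_codomain[OF direct_sum_homs(3)[OF Xm Ym]] mod_hom_extend_codomain[OF direct_sum_homs(4)[OF Xm Ym]]
      submodule_subset[OF X'(1)] submodule_subset[OF Y'(1)] by auto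
  then have s: "?s \<in> mod_hom A ?D P" by (rule mod_hom_sum_hom[OF Pm])
  have "?s ` carrier ?D = carrier P"
  proof
    show "?s ` carrier ?D \<subseteq> carrier P" using mod_hom_closed[OF s] by auto
    show "carrier P \<subseteq> ?s ` carrier ?D"
    proof
      fix x assume "x \<in> carrier P"
      then have "x \<in> X' <+>\<^bsub>P\<^esub> Y'" using X'(3) by simp
      then obtain u v where "u \<in> X'" "v \<in> Y'" "x = u \<oplus>\<^bsub>P\<^esub> v" unfolding mem_set_add by blast
      then show "x \<in> ?s ` carrier ?D" by (intro image_eqI[of _ _ "(u, v)"]) (auto simp: direct_sum_simps)
    qed
  qed
  from projective_lift[OF P fg_direct_sum[OF fgX fgY] Pfg s this mod_hom_id] obtain h where
    h: "h \<in> mod_hom A P ?D" "\<And>x. x \<in> carrier P \<Longrightarrow> fst (h x) \<oplus>\<^bsub>P\<^esub> snd (h x) = x" by blast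
  define f g where "f = (\<lambda>x. fst (h x))" and "g = (\<lambda>x. snd (h x))"
  have f: "f \<in> mod_hom A P ?X" unfolding f_def by (rule mod_hom_comp[OF h(1) direct_sum_homs(3)[OF Xm Ym]])
  have g: "g \<in> mod_hom A P ?Y" unfolding g_def by (rule mod_hom_comp[OF h(1) direct_sum_homs(4)[OF Xm Ym]])
  have fX: "f x \<in> X'" and gY: "g x \<in> Y'" if "x \<in> carrier P" for x
    using mod_hom_closed[OF f that] mod_hom_closed[OF g that] by auto
  have fg: "f x \<oplus>\<^bsub>P\<^esub> g x = x" if "x \<in> carrier P" for x unfolding f_def g_def using h(2) that by simp
  have f': "f \<in> mod_hom A P P" and g': "g \<in> mod_hom A P P"
    using mod_hom_extend_codomain[OF f submodule_subset[OF X'(1)]] 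
      mod_hom_extend_codomain[OF g submodule_subset[OF Y'(1)]] by auto
  have f_id: "f x = x" if "x \<in> X'" for x
    by (rule section_identity_on_supplement[OF Pm X'(1) Y'(1) _ Xmin Ymin f' fX g' gY fg that]) (use X'(3) in simp_all)
  have g_id: "g x = x" if "x \<in> Y'" for x
  proof (rule section_identity_on_supplement[OF Pm Y'(1) X'(1) _ _ _ g' gY f' fX _ that])
    show "carrier P \<subseteq> Y' <+>\<^bsub>P\<^esub> X'" using X'(3) P.sum_comm[OF X'(1) Y'(1)] by simp
    show "Z = Y'" if "submodule Z A P" "Z \<subseteq> Y'" "carrier P \<subseteq> Z <+>\<^bsub>P\<^esub> X'" for Z
      using Ymin that P.sum_comm[OF that(1) X'(1)] by simp
    show "Z = X'" if "submodule Z A P" "Z \<subseteq> X'" "carrier P \<subseteq> Y' <+>\<^bsub>P\<^esub> Z" for Z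
      using Xmin that P.sum_comm[OF that(1) Y'(1)] by simp
    show "g x \<oplus>\<^bsub>P\<^esub> f x = x" if "x \<in> carrier P" for x
      using fg[OF that] P.M.a_comm mod_hom_closed[OF f' that] mod_hom_closed[OF g' that] by simp
  qed
  have "z = \<zero>\<^bsub>P\<^esub>" if z: "z \<in> X'" "z \<in> Y'" for z
  proof -
    have "z \<oplus>\<^bsub>P\<^esub> z = z" using fg[OF cX[OF z(1)]] f_id[OF z(1)] g_id[OF z(2)] by simp
    then show ?thesis using cX[OF z(1)] by simp
  qed
  then have "X' \<inter> Y' = {\<zero>\<^bsub>P\<^esub>}" using submodule_zero[OF X'(1)] submodule_zero[OF Y'(1)] by blast
  then show thesis using that X' Y' by blast
qed

end

section \<open>Local modules, primitive idempotents and uniserial socle layers\<close>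

lemma direct_decomposition:
  assumes U: "left_module A U" and X: "submodule X A U" and Y: "submodule Y A U"
    and XY: "X \<inter> Y = {\<zero>\<^bsub>U\<^esub>}"
  obtains p q where "p \<in> mod_hom A (U\<lparr>carrier := X <+>\<^bsub>U\<^esub> Y\<rparr>) U" "q \<in> mod_hom A (U\<lparr>carrier := X <+>\<^bsub>U\<^esub> Y\<rparr>) U"
    "\<And>x y. x \<in> X \<Longrightarrow> y \<in> Y \<Longrightarrow> p (x \<oplus>\<^bsub>U\<^esub> y) = x"
    "\<And>x y. x \<in> X \<Longrightarrow> y \<in> Y \<Longrightarrow> q (x \<oplus>\<^bsub>U\<^esub> y) = y"
proof -
  interpret U: left_module A U by (rule U)
  let ?S = "U\<lparr>carrier := X <+>\<^bsub>U\<^esub> Y\<rparr>" and ?X = "U\<lparr>carrier := X\<rparr>" and ?Y = "U\<lparr>carrier := Y\<rparr>"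
  let ?D = "direct_sum_module ?X ?Y"
  have Xm: "left_module A ?X" and Ym: "left_module A ?Y"
    by (rule U.restrict_left_module[OF X], rule U.restrict_left_module[OF Y])
  have Dm: "left_module A ?D" by (rule direct_sum_left_module[OF Xm Ym])
  have Sm: "left_module A ?S" by (rule U.restrict_left_module[OF U.submodule_sum[OF X Y]])
  let ?s = "\<lambda>z. fst z \<oplus>\<^bsub>U\<^esub> snd z"
  have "fst \<in> mod_hom A ?D U" "snd \<in> mod_hom A ?D U"
    using mod_hom_extend_codomain[OF direct_sum_homs(3)[OF Xm Ym]] mod_hom_extend_codomain[OF direct_sum_homs(4)[OF Xm Ym]]
      submodule_subset[OF X] submodule_subset[OF Y] by auto
  then have s0: "?s \<in> mod_hom A ?D U" by (rule mod_hom_sum_hom[OF U])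
  have surj: "?s ` carrier ?D = X <+>\<^bsub>U\<^esub> Y"
    by (auto simp: direct_sum_simps set_add_def' image_iff) blast+
  have s: "?s \<in> mod_hom A ?D ?S" by (rule mod_hom_corestrict[OF s0]) (simp add: surj)
  have "\<forall>z\<in>carrier ?D. ?s z = \<zero>\<^bsub>?S\<^esub> \<longrightarrow> z = \<zero>\<^bsub>?D\<^esub>"
  proof (intro ballI impI)
    fix z assume "z \<in> carrier ?D" and 0: "?s z = \<zero>\<^bsub>?S\<^esub>"
    then obtain x y where z: "z = (x, y)" "x \<in> X" "y \<in> Y" by (auto simp: direct_sum_simps)
    have c: "x \<in> carrier U" "y \<in> carrier U" using z submodule_mem[OF X] submodule_mem[OF Y] by auto
    have "x = \<ominus>\<^bsub>U\<^esub> y" using 0 z c by (simp add: U.M.minus_equality)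
    then have "x \<in> X \<inter> Y" using z U.submodule_minus[OF Y z(3)] by simp
    then have x0: "x = \<zero>\<^bsub>U\<^esub>" using XY by blast
    then have "y = \<zero>\<^bsub>U\<^esub>" using 0 z c by simp
    then show "z = \<zero>\<^bsub>?D\<^esub>" using x0 z by (simp add: direct_sum_simps)
  qed
  then have "inj_on ?s (carrier ?D)" using mod_hom_inj_iff[OF Dm Sm s] by blast
  then have "bij_betw ?s (carrier ?D) (carrier ?S)" using surj by (simp add: bij_betw_def)
  from mod_hom_inverse[OF Dm Sm s this] obtain g where
    g: "g \<in> mod_hom A ?S ?D" "\<forall>z\<in>carrier ?D. g (?s z) = z" by (elim bexE conjE)
  show thesis
  proof (rule that)
    show "(\<lambda>z. fst (g z)) \<in> mod_hom A ?S U"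
      by (rule mod_hom_extend_codomain[OF mod_hom_comp[OF g(1) direct_sum_homs(3)[OF Xm Ym]] submodule_subset[OF X]])
    show "(\<lambda>z. snd (g z)) \<in> mod_hom A ?S U"
      by (rule mod_hom_extend_codomain[OF mod_hom_comp[OF g(1) direct_sum_homs(4)[OF Xm Ym]] submodule_subset[OF Y]])
    fix x y assume "x \<in> X" "y \<in> Y"
    then have "g (?s (x, y)) = (x, y)" by (intro bspec[OF g(2)]) (simp add: direct_sum_simps)
    then show "fst (g (x \<oplus>\<^bsub>U\<^esub> y)) = x" "snd (g (x \<oplus>\<^bsub>U\<^esub> y)) = y" by simp_all
  qed
qed

context artin_alg
begin

definition local_module :: "('a, 'm, 'z) module_scheme \<Rightarrow> bool" where
  "local_module U \<longleftrightarrow> carrier U \<noteq> {\<zero>\<^bsub>U\<^esub>} \<and>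
    (\<forall>X. submodule X A U \<and> X \<noteq> carrier U \<longrightarrow> X \<subseteq> radical_of U (carrier U))"

text \<open>
  A point of a proper submodule \<open>X\<close> outside the radical is avoided by a maximal
  submodule \<open>C\<close>, and then \<open>X + C = U\<close>.
\<close>

lemma hollow_imp_local:
  assumes U: "left_module A U" "carrier U \<noteq> {\<zero>\<^bsub>U\<^esub>}"
    and hollow: "\<And>X Y. submodule X A U \<Longrightarrow> submodule Y A U \<Longrightarrow> X <+>\<^bsub>U\<^esub> Y = carrier U \<Longrightarrow>
      X = carrier U \<or> Y = carrier U"
  shows "local_module U"
proof -
  interpret U: left_module A U by (rule U(1))
  have r: "submodule (radical_of U (carrier U)) A U" by (rule radical_of_submodule[OF U(1) subset_refl])
  have "X \<subseteq> radical_of U (carrier U)" if X: "submodule X A U" "X \<noteq> carrier U" for X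
  proof
    fix x assume x: "x \<in> X"
    show "x \<in> radical_of U (carrier U)"
    proof (rule ccontr)
      assume nx: "x \<notin> radical_of U (carrier U)"
      obtain C where C: "submodule C A U" "x \<notin> C"
        and max: "\<And>D. submodule D A U \<Longrightarrow> C \<subseteq> D \<Longrightarrow> D = C \<or> D = carrier U"
        using maximal_submodule_avoiding[OF U(1) submodule_mem[OF X(1) x] nx r] radical_of_mem[OF U(1)] by auto
      have "X <+>\<^bsub>U\<^esub> C = carrier U"
        using max[OF U.submodule_sum[OF X(1) C(1)] U.sum_incl2[OF X(1) C(1)]]
          U.sum_incl1[OF X(1) C(1)] x C(2) by auto
      from hollow[OF X(1) C(1) this] X(2) have "C = carrier U" by blast
      then show False using C(2) submodule_mem[OF X(1) x] by blast
    qed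
  qed
  then show ?thesis unfolding local_module_def using U(2) by blast
qed

text \<open>
  Two proper submodules with sum \<open>P\<close> would contain the summands of a nontrivial
  direct decomposition.
\<close>

lemma indecomposable_projective_local:
  assumes P: "projective_in_mod A P" and ind: "indecomposable A P"
  shows "local_module P"
proof -
  have Pm: "left_module A P" using P by (simp add: projective_in_mod_def fg_left_module_def)
  interpret P: left_module A P by (rule Pm)
  show ?thesis
  proof (rule hollow_imp_local[OF Pm])
    show "carrier P \<noteq> {\<zero>\<^bsub>P\<^esub>}" using ind by (simp add: indecomposable_def)
    fix X Y assume X: "submodule X A P" and Y: "submodule Y A P" and XY: "X <+>\<^bsub>P\<^esub> Y = carrier P"
    obtain X' Y' where d: "submodule X' A P" "submodule Y' A P" "X' \<subseteq> X" "Y' \<subseteq> Y"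
      "X' <+>\<^bsub>P\<^esub> Y' = carrier P" "X' \<inter> Y' = {\<zero>\<^bsub>P\<^esub>}"
      by (rule projective_sum_contains_direct[OF P X Y XY])
    have "X' = {\<zero>\<^bsub>P\<^esub>} \<or> Y' = {\<zero>\<^bsub>P\<^esub>}" using ind d unfolding indecomposable_def by blast
    then show "X = carrier P \<or> Y = carrier P"
    proof
      assume "X' = {\<zero>\<^bsub>P\<^esub>}"
      then have "carrier P \<subseteq> Y"
        using P.sum_least[OF Y _ d(4), of X'] submodule_zero[OF Y] d(5) by simp
      then show ?thesis using submodule_subset[OF Y] by blast
    next
      assume "Y' = {\<zero>\<^bsub>P\<^esub>}"
      then have "carrier P \<subseteq> X"
        using P.sum_least[OF X d(3), of Y'] submodule_zero[OF X] d(5) by simp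
      then show ?thesis using submodule_subset[OF X] by blast
    qed
  qed
qed

lemma local_module_radical_neq:
  assumes U: "left_module A U" "local_module U" shows "\<not> carrier U \<subseteq> radical_of U (carrier U)"
  using nakayama_zero[OF U(1) left_module.submodule_carrier[OF U(1)]] U(2) by (auto simp: local_module_def)

text \<open>
  A section of \<open>v\<close> does not have its image in the radical, so it is onto as well.
\<close>

lemma local_projective_surj_endo_inj:
  assumes P: "projective_in_mod A P" "local_module P" and v: "v \<in> mod_hom A P P" "v ` carrier P = carrier P"
  shows "inj_on v (carrier P)"
proof -
  have Pfg: "fg_left_module A P" and Pm: "left_module A P" 
    using P by (auto simp: projective_in_mod_def fg_left_module_def)
  interpret P: left_module A P by (rule Pm)
  obtain w where w: "w \<in> mod_hom A P P" "\<forall>x\<in>carrier P. v (w x) = x"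
    using projective_lift[OF P(1) Pfg Pfg v mod_hom_id] by blast
  have wP: "submodule (w ` carrier P) A P" by (rule mod_hom_image_submodule[OF Pm Pm w(1) P.submodule_carrier])
  have vw: "v ` w ` carrier P = carrier P" using w(2) by (force simp: image_iff)
  have "w ` carrier P = carrier P"
  proof (rule ccontr)
    assume "w ` carrier P \<noteq> carrier P"
    then have "w ` carrier P \<subseteq> radical_of P (carrier P)" using P(2) wP unfolding local_module_def by blast
    then have "v ` w ` carrier P \<subseteq> v ` radical_of P (carrier P)" by blast
    then have "carrier P \<subseteq> radical_of P (carrier P)"
      unfolding vw radical_of_image[OF Pm Pm v(1) subset_refl] v(2) .
    then show False using local_module_radical_neq[OF Pm P(2)] by blast
  qed
  then have "v x = \<zero>\<^bsub>P\<^esub> \<Longrightarrow> x = \<zero>\<^bsub>P\<^esub>" if x: "x \<in> carrier P" for x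
  proof -
    assume 0: "v x = \<zero>\<^bsub>P\<^esub>"
    obtain y where y: "y \<in> carrier P" "x = w y" using x \<open>w ` carrier P = carrier P\<close> by blast
    then have "y = \<zero>\<^bsub>P\<^esub>" using 0 w(2) by simp
    then show "x = \<zero>\<^bsub>P\<^esub>" using y mod_hom_zero[OF Pm Pm w(1)] by simp
  qed
  then show ?thesis using mod_hom_inj_iff[OF Pm Pm v(1)] by blast
qed

text \<open>
  Let \<open>K\<close> be the annihilator of \<open>s0\<close> and \<open>Q\<close> a minimal
  left ideal with \<open>Q + K = A\<close>. Then \<open>A\<close> is the direct sum of
  \<open>Q\<close> and a left ideal inside \<open>K\<close>, and \<open>e\<close> is the
  component of \<open>1\<close> in \<open>Q\<close>. If \<open>r\<close> kills
  \<open>s0\<close>, then \<open>r e\<close> lies in \<open>Q \<inter> K\<close>. Were it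
  outside a maximal left ideal \<open>m\<close>, then \<open>(Q \<inter> K) + m = A\<close>, and
  \<open>Q \<inter> m\<close> would be a smaller choice for \<open>Q\<close>.
\<close>

lemma primitive_idempotent:
  assumes S: "left_module A S" "simple_module A S" and s0: "s0 \<in> carrier S" "s0 \<noteq> \<zero>\<^bsub>S\<^esub>"
  obtains e where "e \<in> carrier A" "e \<otimes>\<^bsub>A\<^esub> e = e" "e \<odot>\<^bsub>S\<^esub> s0 = s0"
    "\<And>r. r \<in> carrier A \<Longrightarrow> r \<odot>\<^bsub>S\<^esub> s0 = \<zero>\<^bsub>S\<^esub> \<Longrightarrow> r \<otimes>\<^bsub>A\<^esub> e \<in> J"
proof -
  interpret S: left_module A S by (rule S(1))
  note rm = regular_left_module
  let ?h = "\<lambda>a. a \<odot>\<^bsub>S\<^esub> s0"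
  have h: "?h \<in> mod_hom A reg S" by (rule S.regular_hom[OF s0(1)])
  define K where "K = {a \<in> carrier reg. ?h a = \<zero>\<^bsub>S\<^esub>}"
  have K: "submodule K A reg" unfolding K_def by (rule mod_hom_kernel_submodule[OF rm S(1) h])
  have "carrier reg <+>\<^bsub>reg\<^esub> K = carrier reg"
    using reg.sum_incl1[OF reg.submodule_carrier K] submodule_subset[OF reg.submodule_sum[OF reg.submodule_carrier K]] by blast
  then have "submodule (carrier reg) A reg \<and> carrier reg <+>\<^bsub>reg\<^esub> K = carrier reg" using reg.submodule_carrier by blast
  from minimal_submodule[OF fg_regular, of "\<lambda>Q. submodule Q A reg \<and> Q <+>\<^bsub>reg\<^esub> K = carrier reg", OF this]
  obtain Q where Q: "submodule Q A reg" "Q <+>\<^bsub>reg\<^esub> K = carrier reg"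
    and Qmin0: "\<And>Z. submodule Z A reg \<and> Z <+>\<^bsub>reg\<^esub> K = carrier reg \<Longrightarrow> Z \<subseteq> Q \<Longrightarrow> Z = Q" by metis
  have Qmin: "Z = Q" if "submodule Z A reg" "Z \<subseteq> Q" "carrier A \<subseteq> Z <+>\<^bsub>reg\<^esub> K" for Z
    using Qmin0[of Z] that submodule_subset[OF reg.submodule_sum[OF that(1) K]] by auto
  obtain Q' C where d: "submodule Q' A reg" "submodule C A reg" "Q' \<subseteq> Q" "C \<subseteq> K"
      "Q' <+>\<^bsub>reg\<^esub> C = carrier reg" "Q' \<inter> C = {\<zero>\<^bsub>reg\<^esub>}"
    by (rule projective_sum_contains_direct[OF regular_projective Q(1) K Q(2)])
  have "Q' = Q"
    using Qmin[OF d(1,3)] reg.sum_mono[OF subset_refl d(4), of Q'] d(5) by auto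
  then have QC: "Q <+>\<^bsub>reg\<^esub> C = carrier A" "Q \<inter> C = {\<zero>\<^bsub>A\<^esub>}" using d(5,6) by simp_all
  have "\<one>\<^bsub>A\<^esub> \<in> Q <+>\<^bsub>reg\<^esub> C" unfolding QC(1) by simp
  then obtain e c where ec: "e \<in> Q" "c \<in> C" "\<one>\<^bsub>A\<^esub> = e \<oplus>\<^bsub>A\<^esub> c" unfolding mem_set_add by auto
  have eA: "e \<in> carrier A" and cA: "c \<in> carrier A"
    using submodule_mem[OF Q(1) ec(1)] submodule_mem[OF d(2) ec(2)] by auto
  have sum: "e = e \<otimes>\<^bsub>A\<^esub> e \<oplus>\<^bsub>A\<^esub> e \<otimes>\<^bsub>A\<^esub> c" using r_distr[OF eA cA eA] eA unfolding ec(3)[symmetric] by simp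
  have "e \<otimes>\<^bsub>A\<^esub> c \<in> C" using submodule_smult[OF d(2) eA ec(2)] by simp
  moreover have "e \<otimes>\<^bsub>A\<^esub> c \<in> Q"
  proof (rule reg.submodule_cancel_left[OF Q(1)])
    show "e \<otimes>\<^bsub>A\<^esub> e \<in> Q" using submodule_smult[OF Q(1) eA ec(1)] by simp
    show "e \<otimes>\<^bsub>A\<^esub> e \<oplus>\<^bsub>reg\<^esub> e \<otimes>\<^bsub>A\<^esub> c \<in> Q" using sum ec(1) by simp
  qed (use eA cA in simp)
  ultimately have "e \<otimes>\<^bsub>A\<^esub> c = \<zero>\<^bsub>A\<^esub>" using QC(2) by blast
  then have ee: "e \<otimes>\<^bsub>A\<^esub> e = e" using sum eA by simp
  have "c \<odot>\<^bsub>S\<^esub> s0 = \<zero>\<^bsub>S\<^esub>" using ec(2) d(4) unfolding K_def by auto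
  then have es: "e \<odot>\<^bsub>S\<^esub> s0 = s0"
    using S.smult_l_distr[OF eA cA s0(1)] S.smult_one[OF s0(1)] eA s0(1) unfolding ec(3)[symmetric] by simp
  have "r \<otimes>\<^bsub>A\<^esub> e \<in> J" if r: "r \<in> carrier A" "r \<odot>\<^bsub>S\<^esub> s0 = \<zero>\<^bsub>S\<^esub>" for r
  proof (rule ccontr)
    assume "r \<otimes>\<^bsub>A\<^esub> e \<notin> J"
    then obtain m where m: "maximal_left_ideal m A" "r \<otimes>\<^bsub>A\<^esub> e \<notin> m"
      using r(1) eA unfolding jacobson_radical_def by blast
    have mm: "submodule m A reg" "\<And>L. submodule L A reg \<Longrightarrow> m \<subseteq> L \<Longrightarrow> L = m \<or> L = carrier A"
      using m(1) unfolding maximal_left_ideal_def by auto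
    have reQ: "r \<otimes>\<^bsub>A\<^esub> e \<in> Q" using submodule_smult[OF Q(1) r(1) ec(1)] by simp
    have reK: "r \<otimes>\<^bsub>A\<^esub> e \<in> K" unfolding K_def using r eA es s0 by (simp add: S.smult_assoc1)
    let ?L = "Q \<inter> K"
    have L: "submodule ?L A reg" by (rule reg.submodule_Int[OF Q(1) K])
    have Lm: "?L <+>\<^bsub>reg\<^esub> m = carrier A"
      using mm(2)[OF reg.submodule_sum[OF L mm(1)] reg.sum_incl2[OF L mm(1)]]
        reg.sum_incl1[OF L mm(1)] reQ reK m(2) by blast
    have Qm: "submodule (Q \<inter> m) A reg" by (rule reg.submodule_Int[OF Q(1) mm(1)])
    have "carrier A \<subseteq> (Q \<inter> m) <+>\<^bsub>reg\<^esub> K"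
    proof
      fix x assume "x \<in> carrier A"
      then have "x \<in> Q <+>\<^bsub>reg\<^esub> K" using Q(2) by simp
      then obtain q k where qk: "q \<in> Q" "k \<in> K" "x = q \<oplus>\<^bsub>A\<^esub> k" unfolding mem_set_add by auto
      have qA: "q \<in> carrier A" and kA: "k \<in> carrier A" 
        using submodule_mem[OF Q(1) qk(1)] submodule_mem[OF K qk(2)] by auto
      have "q \<in> ?L <+>\<^bsub>reg\<^esub> m" using Lm qA by simp
      then obtain l n where ln: "l \<in> Q" "l \<in> K" "n \<in> m" "q = l \<oplus>\<^bsub>A\<^esub> n" unfolding mem_set_add by auto
      have c: "l \<in> carrier A" "n \<in> carrier A" 
        using submodule_mem[OF Q(1) ln(1)] submodule_mem[OF mm(1) ln(3)] by auto
      have "n \<in> Q" by (rule reg.submodule_cancel_left[OF Q(1) _ ln(1)]) (use c ln qk in auto)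
      moreover have "x = n \<oplus>\<^bsub>A\<^esub> (l \<oplus>\<^bsub>A\<^esub> k)" using qk(3) ln(4) c kA by (simp add: a_ac)
      moreover have "l \<oplus>\<^bsub>A\<^esub> k \<in> K" using submodule_add[OF K ln(2) qk(2)] by simp
      ultimately show "x \<in> (Q \<inter> m) <+>\<^bsub>reg\<^esub> K" using ln(3) unfolding mem_set_add by auto
    qed
    then have "Q \<inter> m = Q" by (intro Qmin[OF Qm]) auto
    then show False using reQ m(2) by blast
  qed
  then show thesis by (rule that[OF eA ee es])
qed

lemma soc_mono: "left_module A U \<Longrightarrow> i \<le> j \<Longrightarrow> soc A i U \<subseteq> soc A j U"
  by (rule lift_Suc_mono_le[of "\<lambda>i. soc A i U"]) (auto dest: soc_Suc_mono simp del: soc.simps)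

text \<open>
  A maximal submodule \<open>C\<close> of \<open>soc\<^sup>k\<^sup>+\<^sup>1 U\<close> that
  contains \<open>soc\<^sup>k U\<close> and avoids a point of \<open>W\<close> is comparable
  with \<open>W\<close>, hence properly contained in it.
\<close>

lemma uniserial_soc_layer:
  assumes U: "left_module A U" and uni: "uniserial A (U\<lparr>carrier := soc A n U\<rparr>)" and k: "k < n"
    and W: "submodule W A U" "W \<subseteq> soc A (Suc k) U" "\<not> W \<subseteq> soc A k U"
  shows "W = soc A (Suc k) U"
proof -
  interpret U: left_module A U by (rule U)
  let ?Z = "soc A (Suc k) U"
  have Z: "submodule ?Z A U" and Zk: "submodule (soc A k U) A U" and Zn: "submodule (soc A n U) A U"
    by (rule soc_submodule[OF U])+
  have Zsub: "?Z \<subseteq> soc A n U" by (rule soc_mono[OF U]) (use k in simp)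
  let ?R = "U\<lparr>carrier := ?Z\<rparr>"
  note iff = U.submodule_restrict_iff[OF Z]
  obtain x where x: "x \<in> W" "x \<notin> soc A k U" using W(3) by blast
  have xR: "x \<in> carrier ?R" using x(1) W(2) by (auto simp del: soc.simps)
  have JZ: "a \<odot>\<^bsub>?R\<^esub> u \<in> soc A k U" if "a \<in> J" "u \<in> carrier ?R" for a u
    using that soc_Suc[OF U, of k] by (auto simp del: soc.simps)
  have "submodule (soc A k U) A ?R" using iff Zk soc_Suc_mono[OF U, of k] by blast
  from maximal_submodule_avoiding[OF U.restrict_left_module[OF Z] xR x(2) this JZ]
  obtain C where C: "submodule C A ?R" "x \<notin> C"
    and max: "\<And>D. submodule D A ?R \<Longrightarrow> C \<subseteq> D \<Longrightarrow> D = C \<or> D = ?Z" by (auto simp del: soc.simps)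
  have C': "submodule C A U" "C \<subseteq> ?Z" using C(1) iff by auto
  have "submodule C A (U\<lparr>carrier := soc A n U\<rparr>)" "submodule W A (U\<lparr>carrier := soc A n U\<rparr>)"
    unfolding U.submodule_restrict_iff[OF Zn] using C' W Zsub by auto
  then have "C \<subseteq> W" using uni x(1) C(2) unfolding uniserial_def by blast
  moreover have "submodule W A ?R" using iff W by blast
  ultimately have "W = C \<or> W = ?Z" by (rule max[rotated])
  then show ?thesis using x(1) C(2) by blast
qed

text \<open>
  A nonzero point of \<open>N\<close> is avoided by a maximal submodule, which by comparability
  lies properly in \<open>N\<close>.
\<close>

lemma uniserial_killed_imp_simple:
  assumes U: "left_module A U" and uni: "uniserial A U" and ne: "carrier U \<noteq> {\<zero>\<^bsub>U\<^esub>}"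
    and kill: "\<And>a u. a \<in> J \<Longrightarrow> u \<in> carrier U \<Longrightarrow> a \<odot>\<^bsub>U\<^esub> u = \<zero>\<^bsub>U\<^esub>"
  shows "simple_module A U"
proof -
  interpret U: left_module A U by (rule U)
  have "N = {\<zero>\<^bsub>U\<^esub>} \<or> N = carrier U" if N: "submodule N A U" for N
  proof (cases "N = {\<zero>\<^bsub>U\<^esub>}")
    case False
    then obtain x where x: "x \<in> N" "x \<noteq> \<zero>\<^bsub>U\<^esub>" using submodule_zero[OF N] by blast
    have JZ: "a \<odot>\<^bsub>U\<^esub> u \<in> {\<zero>\<^bsub>U\<^esub>}" if "a \<in> J" "u \<in> carrier U" for a u using kill[OF that] by simp
    have "x \<notin> {\<zero>\<^bsub>U\<^esub>}" using x(2) by simp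
    from maximal_submodule_avoiding[OF U submodule_mem[OF N x(1)] this U.submodule_null JZ]
    obtain C where C: "submodule C A U" "x \<notin> C"
      and max: "\<And>D. submodule D A U \<Longrightarrow> C \<subseteq> D \<Longrightarrow> D = C \<or> D = carrier U" by auto
    have "C \<subseteq> N" using uni C x(1) N unfolding uniserial_def by blast
    then have "N = C \<or> N = carrier U" by (rule max[OF N])
    then show ?thesis using x(1) C(2) by blast
  qed simp
  then show ?thesis using ne unfolding simple_module_def by blast
qed

end

section \<open>A nondegenerate pairing on a semisimple module\<close>

lemma mod_hom_zero_map: "left_module A N \<Longrightarrow> (\<lambda>x. \<zero>\<^bsub>N\<^esub>) \<in> mod_hom A M N"
proof -
  assume "left_module A N"
  then interpret N: left_module A N .
  show ?thesis by (rule mod_homI) simp_all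
qed

text \<open>
  The last assumption says that the kernel of \<open>A e \<rightarrow> S\<close>, \<open>r e
  \<mapsto> r s0\<close>, lies in the radical: \<open>A e\<close> is a projective cover of
  \<open>S\<close>.
\<close>

locale simple_idempotent = artin_alg R A
  for R :: "('r, 'x) ring_scheme" and A :: "('r, 'a, 'y) module_scheme" +
  fixes S :: "('a, 'q, 'w) module_scheme" and s0 :: 'q and e :: 'a
  assumes S_module: "left_module A S" and S_simple: "simple_module A S"
    and s0: "s0 \<in> carrier S" "s0 \<noteq> \<zero>\<^bsub>S\<^esub>"
    and e: "e \<in> carrier A" "e \<otimes>\<^bsub>A\<^esub> e = e" "e \<odot>\<^bsub>S\<^esub> s0 = s0"
    and ann: "\<And>r. r \<in> carrier A \<Longrightarrow> r \<odot>\<^bsub>S\<^esub> s0 = \<zero>\<^bsub>S\<^esub> \<Longrightarrow> r \<otimes>\<^bsub>A\<^esub> e \<in> J"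
begin

sublocale S: left_module A S by (rule S_module)

lemma ann_kills:
  assumes U: "left_module A U" and b: "b \<in> carrier U" "e \<odot>\<^bsub>U\<^esub> b = b" "\<forall>j\<in>J. j \<odot>\<^bsub>U\<^esub> b = \<zero>\<^bsub>U\<^esub>"
    and r: "r \<in> carrier A" "r \<odot>\<^bsub>S\<^esub> s0 = \<zero>\<^bsub>S\<^esub>"
  shows "r \<odot>\<^bsub>U\<^esub> b = \<zero>\<^bsub>U\<^esub>"
proof -
  interpret U: left_module A U by (rule U)
  have "r \<odot>\<^bsub>U\<^esub> b = (r \<otimes>\<^bsub>A\<^esub> e) \<odot>\<^bsub>U\<^esub> b" using b r e by (simp add: U.smult_assoc1)
  then show ?thesis using bspec[OF b(3) ann[OF r]] by simp
qed

lemma generator_s0: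
  assumes "s \<in> carrier S" "s \<noteq> \<zero>\<^bsub>S\<^esub>" shows "\<exists>t\<in>carrier A. s0 = t \<odot>\<^bsub>S\<^esub> s"
proof -
  have "cyclic_submodule A S s \<noteq> {\<zero>\<^bsub>S\<^esub>}" using S.cyclic_mem[OF assms(1)] assms(2) by blast
  then have "cyclic_submodule A S s = carrier S"
    using S_simple S.cyclic_submodule[OF assms(1)] unfolding simple_module_def by blast
  then show ?thesis using s0(1) unfolding cyclic_submodule_def by blast
qed

text \<open>
  Since \<open>S\<close> is simple, \<open>c r s0 = s0\<close> for some \<open>c\<close>. Then
  \<open>1 - c r\<close> annihilates \<open>s0\<close>, and therefore \<open>b\<close>.
\<close>

lemma generator_recovered:
  assumes U: "left_module A U" and b: "b \<in> carrier U" "e \<odot>\<^bsub>U\<^esub> b = b" "\<forall>j\<in>J. j \<odot>\<^bsub>U\<^esub> b = \<zero>\<^bsub>U\<^esub>"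
    and r: "r \<in> carrier A" "r \<odot>\<^bsub>S\<^esub> s0 \<noteq> \<zero>\<^bsub>S\<^esub>"
  obtains c where "c \<in> carrier A" "b = c \<odot>\<^bsub>U\<^esub> (r \<odot>\<^bsub>U\<^esub> b)"
proof -
  interpret U: left_module A U by (rule U)
  obtain c where c: "c \<in> carrier A" "s0 = c \<odot>\<^bsub>S\<^esub> (r \<odot>\<^bsub>S\<^esub> s0)" using generator_s0 r s0(1) by blast
  let ?u = "\<one>\<^bsub>A\<^esub> \<oplus>\<^bsub>A\<^esub> \<ominus>\<^bsub>A\<^esub> (c \<otimes>\<^bsub>A\<^esub> r)"
  have u: "?u \<in> carrier A" using c r by simp
  have "?u \<odot>\<^bsub>S\<^esub> s0 = s0 \<oplus>\<^bsub>S\<^esub> \<ominus>\<^bsub>S\<^esub> (c \<odot>\<^bsub>S\<^esub> (r \<odot>\<^bsub>S\<^esub> s0))"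
    using c(1) r s0(1) by (simp add: S.smult_l_distr S.smult_minus_left S.smult_assoc1)
  then have "?u \<odot>\<^bsub>S\<^esub> s0 = \<zero>\<^bsub>S\<^esub>" unfolding c(2)[symmetric] using S.M.r_neg[OF s0(1)] by simp
  then have "?u \<odot>\<^bsub>U\<^esub> b = \<zero>\<^bsub>U\<^esub>" by (rule ann_kills[OF U b(1-3) u])
  then have "b \<ominus>\<^bsub>U\<^esub> c \<odot>\<^bsub>U\<^esub> (r \<odot>\<^bsub>U\<^esub> b) = \<zero>\<^bsub>U\<^esub>"
    using c(1) r(1) b(1) by (simp add: U.smult_l_distr U.smult_minus_left U.smult_assoc1 a_minus_def)
  then have "b = c \<odot>\<^bsub>U\<^esub> (r \<odot>\<^bsub>U\<^esub> b)"
    using U.diff_eq_zero_iff[OF b(1), of "c \<odot>\<^bsub>U\<^esub> (r \<odot>\<^bsub>U\<^esub> b)"] c(1) r(1) b(1) by simp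
  then show thesis by (rule that[OF c(1)])
qed

lemma ann_iff:
  assumes U: "left_module A U" and b: "b \<in> carrier U" "e \<odot>\<^bsub>U\<^esub> b = b" "\<forall>j\<in>J. j \<odot>\<^bsub>U\<^esub> b = \<zero>\<^bsub>U\<^esub>" "b \<noteq> \<zero>\<^bsub>U\<^esub>"
    and r: "r \<in> carrier A"
  shows "r \<odot>\<^bsub>U\<^esub> b = \<zero>\<^bsub>U\<^esub> \<longleftrightarrow> r \<odot>\<^bsub>S\<^esub> s0 = \<zero>\<^bsub>S\<^esub>"
proof
  interpret U: left_module A U by (rule U)
  assume rb: "r \<odot>\<^bsub>U\<^esub> b = \<zero>\<^bsub>U\<^esub>"
  show "r \<odot>\<^bsub>S\<^esub> s0 = \<zero>\<^bsub>S\<^esub>"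
  proof (rule ccontr)
    assume "r \<odot>\<^bsub>S\<^esub> s0 \<noteq> \<zero>\<^bsub>S\<^esub>"
    then obtain c where "c \<in> carrier A" "b = c \<odot>\<^bsub>U\<^esub> (r \<odot>\<^bsub>U\<^esub> b)"
      using generator_recovered[OF U b(1-3) r] by metis
    then show False using b(4) rb by simp
  qed
qed (rule ann_kills[OF U b(1-3) r])

lemma cyclic_iso_S:
  assumes U: "left_module A U" and b: "b \<in> carrier U" "e \<odot>\<^bsub>U\<^esub> b = b" "\<forall>j\<in>J. j \<odot>\<^bsub>U\<^esub> b = \<zero>\<^bsub>U\<^esub>" "b \<noteq> \<zero>\<^bsub>U\<^esub>"
  obtains \<kappa> where "\<kappa> \<in> mod_hom A (U\<lparr>carrier := cyclic_submodule A U b\<rparr>) S"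
    "\<And>r. r \<in> carrier A \<Longrightarrow> \<kappa> (r \<odot>\<^bsub>U\<^esub> b) = r \<odot>\<^bsub>S\<^esub> s0"
proof -
  interpret U: left_module A U by (rule U)
  let ?B = "cyclic_submodule A U b"
  let ?h = "\<lambda>a. a \<odot>\<^bsub>U\<^esub> b"
  have img: "?h ` carrier reg = carrier (U\<lparr>carrier := ?B\<rparr>)" by (simp add: cyclic_submodule_def)
  have h: "?h \<in> mod_hom A reg (U\<lparr>carrier := ?B\<rparr>)"
    by (rule mod_hom_corestrict[OF U.regular_hom[OF b(1)]]) (use img in simp)
  have Bm: "left_module A (U\<lparr>carrier := ?B\<rparr>)" by (rule U.restrict_left_module[OF U.cyclic_submodule[OF b(1)]])
  have "x \<odot>\<^bsub>S\<^esub> s0 = \<zero>\<^bsub>S\<^esub>" if "x \<in> carrier reg" "?h x = \<zero>\<^bsub>U\<lparr>carrier := ?B\<rparr>\<^esub>" for x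
    using ann_iff[OF U b, of x] that by simp
  from mod_hom_factor[OF regular_left_module Bm S_module h img S.regular_hom[OF s0(1)] this]
  obtain \<kappa> where \<kappa>: "\<kappa> \<in> mod_hom A (U\<lparr>carrier := ?B\<rparr>) S" "\<forall>x\<in>carrier reg. \<kappa> (?h x) = x \<odot>\<^bsub>S\<^esub> s0" by blast
  show thesis
  proof (rule that[OF \<kappa>(1)])
    fix r assume "r \<in> carrier A"
    then show "\<kappa> (r \<odot>\<^bsub>U\<^esub> b) = r \<odot>\<^bsub>S\<^esub> s0" using bspec[OF \<kappa>(2), of r] by simp
  qed
qed

definition fixed :: "('a, 'm, 'z) module_scheme \<Rightarrow> 'm set \<Rightarrow> 'm set" where
  "fixed U X = {x \<in> X. e \<odot>\<^bsub>U\<^esub> x = x}"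

text \<open>
  A pairing of \<open>e X\<close> and \<open>X\<close> with values in \<open>S\<close>,
  nondegenerate in the first argument. Equivalently, an \<open>R\<close>-linear embedding of
  \<open>e X\<close> into \<open>Hom(X, S)\<close>.
\<close>

definition pairing :: "('a, 'm, 'z) module_scheme \<Rightarrow> 'm set \<Rightarrow> ('m \<Rightarrow> 'm \<Rightarrow> 'q) \<Rightarrow> bool" where
  "pairing U X \<beta> \<longleftrightarrow>
    (\<forall>x\<in>fixed U X. \<beta> x \<in> mod_hom A (U\<lparr>carrier := X\<rparr>) S) \<and>
    (\<forall>x\<in>fixed U X. \<forall>x'\<in>fixed U X. \<forall>y\<in>X. \<beta> (x \<oplus>\<^bsub>U\<^esub> x') y = \<beta> x y \<oplus>\<^bsub>S\<^esub> \<beta> x' y) \<and>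
    (\<forall>r\<in>carrier R. \<forall>x\<in>fixed U X. \<forall>y\<in>X. \<beta> (scalar r \<odot>\<^bsub>U\<^esub> x) y = scalar r \<odot>\<^bsub>S\<^esub> \<beta> x y) \<and>
    (\<forall>x\<in>fixed U X. (\<forall>y\<in>X. \<beta> x y = \<zero>\<^bsub>S\<^esub>) \<longrightarrow> x = \<zero>\<^bsub>U\<^esub>)"

text \<open>
  The module \<open>X\<close> is the direct sum of \<open>C\<close> and of \<open>A b\<close>,
  which is a copy of \<open>S\<close>. On \<open>A b\<close> the pairing sends \<open>d
  b\<close> and \<open>r b\<close> to \<open>r d s0\<close>.
\<close>

lemma pairing_extend:
  assumes U: "left_module A U" and X: "submodule X A U"
    and kill: "\<And>j x. j \<in> J \<Longrightarrow> x \<in> X \<Longrightarrow> j \<odot>\<^bsub>U\<^esub> x = \<zero>\<^bsub>U\<^esub>"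
    and b: "b \<in> fixed U X" "b \<noteq> \<zero>\<^bsub>U\<^esub>"
    and C: "submodule C A U" "C \<subseteq> X" "b \<notin> C" "cyclic_submodule A U b <+>\<^bsub>U\<^esub> C = X"
    and \<beta>: "pairing U C \<beta>"
  shows "\<exists>\<beta>. pairing U X \<beta>"
proof -
  interpret U: left_module A U by (rule U)
  let ?B = "cyclic_submodule A U b"
  have bX: "b \<in> X" "e \<odot>\<^bsub>U\<^esub> b = b" using b(1) unfolding fixed_def by auto
  have bU: "b \<in> carrier U" by (rule submodule_mem[OF X bX(1)])
  have B: "submodule ?B A U" by (rule U.cyclic_submodule[OF bU])
  have kb: "\<forall>j\<in>J. j \<odot>\<^bsub>U\<^esub> b = \<zero>\<^bsub>U\<^esub>" using kill bX(1) by blast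
  obtain \<kappa> where \<kappa>: "\<kappa> \<in> mod_hom A (U\<lparr>carrier := ?B\<rparr>) S"
    "\<And>r. r \<in> carrier A \<Longrightarrow> \<kappa> (r \<odot>\<^bsub>U\<^esub> b) = r \<odot>\<^bsub>S\<^esub> s0"
    using cyclic_iso_S[OF U bU bX(2) kb b(2)] by metis
  have BC: "?B \<inter> C = {\<zero>\<^bsub>U\<^esub>}"
  proof -
    have "z = \<zero>\<^bsub>U\<^esub>" if z: "z \<in> ?B" "z \<in> C" for z
    proof (rule ccontr)
      assume nz: "z \<noteq> \<zero>\<^bsub>U\<^esub>"
      obtain r where r: "r \<in> carrier A" "z = r \<odot>\<^bsub>U\<^esub> b" using z(1) unfolding cyclic_submodule_def by blast
      then have "r \<odot>\<^bsub>S\<^esub> s0 \<noteq> \<zero>\<^bsub>S\<^esub>" using ann_iff[OF U bU bX(2) kb b(2) r(1)] nz by simp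
      then obtain c where c: "c \<in> carrier A" "b = c \<odot>\<^bsub>U\<^esub> (r \<odot>\<^bsub>U\<^esub> b)"
        using generator_recovered[OF U bU bX(2) kb r(1)] by metis
      have "c \<odot>\<^bsub>U\<^esub> z \<in> C" by (rule submodule_smult[OF C(1) c(1) z(2)])
      then show False using c(2) r(2) C(3) by simp
    qed
    then show ?thesis using submodule_zero[OF B] submodule_zero[OF C(1)] by blast
  qed
  obtain p q where p: "p \<in> mod_hom A (U\<lparr>carrier := ?B <+>\<^bsub>U\<^esub> C\<rparr>) U"
    and q: "q \<in> mod_hom A (U\<lparr>carrier := ?B <+>\<^bsub>U\<^esub> C\<rparr>) U"
    and pq: "\<And>x y. x \<in> ?B \<Longrightarrow> y \<in> C \<Longrightarrow> p (x \<oplus>\<^bsub>U\<^esub> y) = x" "\<And>x y. x \<in> ?B \<Longrightarrow> y \<in> C \<Longrightarrow> q (x \<oplus>\<^bsub>U\<^esub> y) = y"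
    using direct_decomposition[OF U B C(1) BC] by metis
  note p = p[unfolded C(4)] and q = q[unfolded C(4)]
  have XX: "x \<in> carrier (U\<lparr>carrier := X\<rparr>)" if "x \<in> X" for x using that by simp
  have pB: "p x \<in> ?B" and qC: "q x \<in> C" and xpq: "x = p x \<oplus>\<^bsub>U\<^esub> q x" if "x \<in> X" for x
  proof -
    have "x \<in> ?B <+>\<^bsub>U\<^esub> C" using that C(4) by simp
    then obtain u v where "u \<in> ?B" "v \<in> C" "x = u \<oplus>\<^bsub>U\<^esub> v" unfolding mem_set_add by blast
    then show "p x \<in> ?B" "q x \<in> C" "x = p x \<oplus>\<^bsub>U\<^esub> q x" using pq by simp_all
  qed
  have p_add: "p (x \<oplus>\<^bsub>U\<^esub> y) = p x \<oplus>\<^bsub>U\<^esub> p y" and q_add: "q (x \<oplus>\<^bsub>U\<^esub> y) = q x \<oplus>\<^bsub>U\<^esub> q y" if "x \<in> X" "y \<in> X" for x y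
    using mod_hom_add[OF p XX XX] mod_hom_add[OF q XX XX] that by auto
  have p_sm: "p (r \<odot>\<^bsub>U\<^esub> x) = r \<odot>\<^bsub>U\<^esub> p x" and q_sm: "q (r \<odot>\<^bsub>U\<^esub> x) = r \<odot>\<^bsub>U\<^esub> q x" if "r \<in> carrier A" "x \<in> X" for r x
    using mod_hom_smult[OF p that(1) XX] mod_hom_smult[OF q that(1) XX] that by auto
  have pfix: "e \<odot>\<^bsub>U\<^esub> p x = p x" and qfix: "q x \<in> fixed U C" if "x \<in> fixed U X" for x
    using p_sm[OF e(1), of x] q_sm[OF e(1), of x] qC[of x] that unfolding fixed_def by auto
  have \<kappa>c: "\<kappa> x \<in> carrier S" if "x \<in> ?B" for x using mod_hom_closed[OF \<kappa>(1)] that by simp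
  have \<kappa>add: "\<kappa> (x \<oplus>\<^bsub>U\<^esub> y) = \<kappa> x \<oplus>\<^bsub>S\<^esub> \<kappa> y" if "x \<in> ?B" "y \<in> ?B" for x y
    using mod_hom_add[OF \<kappa>(1), of x y] that by simp
  have \<kappa>sm: "\<kappa> (r \<odot>\<^bsub>U\<^esub> x) = r \<odot>\<^bsub>S\<^esub> \<kappa> x" if "r \<in> carrier A" "x \<in> ?B" for r x
    using mod_hom_smult[OF \<kappa>(1), of r x] that by simp
  \<comment> \<open>\<open>act t\<close> is the homomorphism \<open>A b \<rightarrow> S\<close> that sends \<open>b\<close> to \<open>t\<close>; it exists if \<open>e\<close> fixes \<open>t\<close>.\<close>
  define act where "act = (\<lambda>t y. (SOME r. r \<in> carrier A \<and> y = r \<odot>\<^bsub>U\<^esub> b) \<odot>\<^bsub>S\<^esub> t)"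
  have act: "act t (r \<odot>\<^bsub>U\<^esub> b) = r \<odot>\<^bsub>S\<^esub> t"
    if t: "t \<in> carrier S" "e \<odot>\<^bsub>S\<^esub> t = t" and r: "r \<in> carrier A" for t r
  proof -
    define r' where "r' = (SOME r'. r' \<in> carrier A \<and> r \<odot>\<^bsub>U\<^esub> b = r' \<odot>\<^bsub>U\<^esub> b)"
    have r': "r' \<in> carrier A" "r \<odot>\<^bsub>U\<^esub> b = r' \<odot>\<^bsub>U\<^esub> b"
      using someI[of "\<lambda>r'. r' \<in> carrier A \<and> r \<odot>\<^bsub>U\<^esub> b = r' \<odot>\<^bsub>U\<^esub> b" r] r unfolding r'_def by auto
    let ?d = "r' \<oplus>\<^bsub>A\<^esub> \<ominus>\<^bsub>A\<^esub> r"
    have "?d \<odot>\<^bsub>U\<^esub> b = \<zero>\<^bsub>U\<^esub>" using r r' bU by (simp add: U.smult_l_distr U.smult_minus_left U.M.r_neg)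
    then have "?d \<odot>\<^bsub>S\<^esub> s0 = \<zero>\<^bsub>S\<^esub>" using ann_iff[OF U bU bX(2) kb b(2), of ?d] r r' by simp
    then have "?d \<odot>\<^bsub>S\<^esub> t = \<zero>\<^bsub>S\<^esub>"
      using r r' t J_kills_simple[OF S_module S_simple] by (intro ann_kills[OF S_module t]) auto
    then have "r' \<odot>\<^bsub>S\<^esub> t \<ominus>\<^bsub>S\<^esub> r \<odot>\<^bsub>S\<^esub> t = \<zero>\<^bsub>S\<^esub>"
      using r r' t by (simp add: S.smult_l_distr S.smult_minus_left a_minus_def)
    then have "r' \<odot>\<^bsub>S\<^esub> t = r \<odot>\<^bsub>S\<^esub> t" using r r' t S.diff_eq_zero_iff by simp
    then show ?thesis unfolding act_def r'_def .
  qed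
  have Bex: "\<exists>r\<in>carrier A. y = r \<odot>\<^bsub>U\<^esub> b" if "y \<in> ?B" for y using that unfolding cyclic_submodule_def by blast
  define \<gamma> where "\<gamma> = (\<lambda>x y. act (\<kappa> (p x)) (p y) \<oplus>\<^bsub>S\<^esub> \<beta> (q x) (q y))"
  have \<kappa>fix: "\<kappa> (p x) \<in> carrier S" "e \<odot>\<^bsub>S\<^esub> \<kappa> (p x) = \<kappa> (p x)" if x: "x \<in> fixed U X" for x
  proof -
    have xX: "x \<in> X" using x unfolding fixed_def by simp
    show "\<kappa> (p x) \<in> carrier S" by (rule \<kappa>c[OF pB[OF xX]])
    show "e \<odot>\<^bsub>S\<^esub> \<kappa> (p x) = \<kappa> (p x)" using \<kappa>sm[OF e(1) pB[OF xX]] pfix[OF x] by simp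
  qed
  have \<beta>hom: "\<beta> x \<in> mod_hom A (U\<lparr>carrier := C\<rparr>) S" if "x \<in> fixed U C" for x using \<beta> that unfolding pairing_def by blast
  have \<beta>c: "\<beta> x y \<in> carrier S" if "x \<in> fixed U C" "y \<in> C" for x y using mod_hom_closed[OF \<beta>hom[OF that(1)]] that(2) by simp
  have actc: "act t y \<in> carrier S" if "t \<in> carrier S" "e \<odot>\<^bsub>S\<^esub> t = t" "y \<in> ?B" for t y
    using Bex[OF that(3)] act[OF that(1,2)] that(1) by auto
  have "pairing U X \<gamma>"
    unfolding pairing_def
  proof (intro conjI ballI impI)
    fix x assume x: "x \<in> fixed U X"
    note t = \<kappa>fix[OF x] and qx = qfix[OF x]
    show "\<gamma> x \<in> mod_hom A (U\<lparr>carrier := X\<rparr>) S"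
    proof (rule mod_homI)
      fix y assume "y \<in> carrier (U\<lparr>carrier := X\<rparr>)"
      then show "\<gamma> x y \<in> carrier S" unfolding \<gamma>_def using actc[OF t pB] \<beta>c[OF qx qC] by simp
    next
      fix y z assume "y \<in> carrier (U\<lparr>carrier := X\<rparr>)" "z \<in> carrier (U\<lparr>carrier := X\<rparr>)"
      then have yz: "y \<in> X" "z \<in> X" by simp_all
      obtain u v where uv: "u \<in> carrier A" "p y = u \<odot>\<^bsub>U\<^esub> b" "v \<in> carrier A" "p z = v \<odot>\<^bsub>U\<^esub> b"
        using Bex[OF pB[OF yz(1)]] Bex[OF pB[OF yz(2)]] by blast
      have "p (y \<oplus>\<^bsub>U\<^esub> z) = (u \<oplus>\<^bsub>A\<^esub> v) \<odot>\<^bsub>U\<^esub> b" using p_add[OF yz] uv bU by (simp add: U.smult_l_distr)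
      then have a: "act (\<kappa> (p x)) (p (y \<oplus>\<^bsub>U\<^esub> z)) = act (\<kappa> (p x)) (p y) \<oplus>\<^bsub>S\<^esub> act (\<kappa> (p x)) (p z)"
        using act[OF t] uv t(1) by (simp add: S.smult_l_distr)
      have "\<beta> (q x) (q y \<oplus>\<^bsub>U\<^esub> q z) = \<beta> (q x) (q y) \<oplus>\<^bsub>S\<^esub> \<beta> (q x) (q z)"
        using mod_hom_add[OF \<beta>hom[OF qx], of "q y" "q z"] qC yz by simp
      then show "\<gamma> x (y \<oplus>\<^bsub>U\<lparr>carrier := X\<rparr>\<^esub> z) = \<gamma> x y \<oplus>\<^bsub>S\<^esub> \<gamma> x z"
        unfolding \<gamma>_def using a q_add[OF yz] actc[OF t pB[OF yz(1)]] actc[OF t pB[OF yz(2)]]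
          \<beta>c[OF qx qC[OF yz(1)]] \<beta>c[OF qx qC[OF yz(2)]] by (simp add: S.M.a_ac)
    next
      fix r y assume r: "r \<in> carrier A" and "y \<in> carrier (U\<lparr>carrier := X\<rparr>)"
      then have y: "y \<in> X" by simp
      obtain u where u: "u \<in> carrier A" "p y = u \<odot>\<^bsub>U\<^esub> b" using Bex[OF pB[OF y]] by blast
      have "p (r \<odot>\<^bsub>U\<^esub> y) = (r \<otimes>\<^bsub>A\<^esub> u) \<odot>\<^bsub>U\<^esub> b" using p_sm[OF r y] u r bU by (simp add: U.smult_assoc1)
      then have a: "act (\<kappa> (p x)) (p (r \<odot>\<^bsub>U\<^esub> y)) = r \<odot>\<^bsub>S\<^esub> act (\<kappa> (p x)) (p y)"
        using act[OF t] u r t(1) by (simp add: S.smult_assoc1)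
      have "\<beta> (q x) (r \<odot>\<^bsub>U\<^esub> q y) = r \<odot>\<^bsub>S\<^esub> \<beta> (q x) (q y)"
        using mod_hom_smult[OF \<beta>hom[OF qx] r, of "q y"] qC[OF y] by simp
      then show "\<gamma> x (r \<odot>\<^bsub>U\<lparr>carrier := X\<rparr>\<^esub> y) = r \<odot>\<^bsub>S\<^esub> \<gamma> x y"
        unfolding \<gamma>_def using a q_sm[OF r y] r actc[OF t pB[OF y]] \<beta>c[OF qx qC[OF y]]
        by (simp add: S.smult_r_distr)
    qed
  next
    fix x x' y assume x: "x \<in> fixed U X" and x': "x' \<in> fixed U X" and y: "y \<in> X"
    note t = \<kappa>fix[OF x] and t' = \<kappa>fix[OF x']
    have xX: "x \<in> X" "x' \<in> X" using x x' unfolding fixed_def by auto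
    obtain u where u: "u \<in> carrier A" "p y = u \<odot>\<^bsub>U\<^esub> b" using Bex[OF pB[OF y]] by blast
    have \<kappa>s: "\<kappa> (p (x \<oplus>\<^bsub>U\<^esub> x')) = \<kappa> (p x) \<oplus>\<^bsub>S\<^esub> \<kappa> (p x')"
      using p_add[OF xX] \<kappa>add[OF pB[OF xX(1)] pB[OF xX(2)]] by simp
    have "e \<odot>\<^bsub>S\<^esub> (\<kappa> (p x) \<oplus>\<^bsub>S\<^esub> \<kappa> (p x')) = \<kappa> (p x) \<oplus>\<^bsub>S\<^esub> \<kappa> (p x')"
      using t t' e(1) by (simp add: S.smult_r_distr)
    then have a: "act (\<kappa> (p (x \<oplus>\<^bsub>U\<^esub> x'))) (p y) = act (\<kappa> (p x)) (p y) \<oplus>\<^bsub>S\<^esub> act (\<kappa> (p x')) (p y)"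
      unfolding \<kappa>s u(2) using act[OF _ _ u(1)] t t' u(1) by (simp add: S.smult_r_distr)
    have "\<beta> (q x \<oplus>\<^bsub>U\<^esub> q x') (q y) = \<beta> (q x) (q y) \<oplus>\<^bsub>S\<^esub> \<beta> (q x') (q y)"
      using \<beta> qfix[OF x] qfix[OF x'] qC[OF y] unfolding pairing_def by blast
    then show "\<gamma> (x \<oplus>\<^bsub>U\<^esub> x') y = \<gamma> x y \<oplus>\<^bsub>S\<^esub> \<gamma> x' y"
      unfolding \<gamma>_def using a q_add[OF xX] actc[OF t pB[OF y]] actc[OF t' pB[OF y]]
          \<beta>c[OF qfix[OF x] qC[OF y]] \<beta>c[OF qfix[OF x'] qC[OF y]] by (simp add: S.M.a_ac)
  next
    fix r x y assume r: "r \<in> carrier R" and x: "x \<in> fixed U X" and y: "y \<in> X"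
    note t = \<kappa>fix[OF x] and sr = scalar_closed[OF r]
    have xX: "x \<in> X" using x unfolding fixed_def by auto
    obtain u where u: "u \<in> carrier A" "p y = u \<odot>\<^bsub>U\<^esub> b" using Bex[OF pB[OF y]] by blast
    have \<kappa>s: "\<kappa> (p (scalar r \<odot>\<^bsub>U\<^esub> x)) = scalar r \<odot>\<^bsub>S\<^esub> \<kappa> (p x)"
      using p_sm[OF sr xX] \<kappa>sm[OF sr pB[OF xX]] by simp
    have sw: "c \<odot>\<^bsub>S\<^esub> (scalar r \<odot>\<^bsub>S\<^esub> z) = scalar r \<odot>\<^bsub>S\<^esub> (c \<odot>\<^bsub>S\<^esub> z)" if "c \<in> carrier A" "z \<in> carrier S" for c z
      using that sr scalar_central[OF r that(1)] by (simp add: S.smult_assoc1[symmetric])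
    have "e \<odot>\<^bsub>S\<^esub> (scalar r \<odot>\<^bsub>S\<^esub> \<kappa> (p x)) = scalar r \<odot>\<^bsub>S\<^esub> \<kappa> (p x)"
      using sw[OF e(1) t(1)] t(2) by simp
    then have a: "act (\<kappa> (p (scalar r \<odot>\<^bsub>U\<^esub> x))) (p y) = scalar r \<odot>\<^bsub>S\<^esub> act (\<kappa> (p x)) (p y)"
      unfolding \<kappa>s u(2) using act[OF _ _ u(1)] t sr sw[OF u(1) t(1)] by simp
    have "\<beta> (scalar r \<odot>\<^bsub>U\<^esub> q x) (q y) = scalar r \<odot>\<^bsub>S\<^esub> \<beta> (q x) (q y)"
      using \<beta> r qfix[OF x] qC[OF y] unfolding pairing_def by blast
    then show "\<gamma> (scalar r \<odot>\<^bsub>U\<^esub> x) y = scalar r \<odot>\<^bsub>S\<^esub> \<gamma> x y"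
      unfolding \<gamma>_def using a q_sm[OF sr xX] actc[OF t pB[OF y]] \<beta>c[OF qfix[OF x] qC[OF y]] sr
      by (simp add: S.smult_r_distr)
  next
    fix x assume x: "x \<in> fixed U X" and 0: "\<forall>y\<in>X. \<gamma> x y = \<zero>\<^bsub>S\<^esub>"
    note t = \<kappa>fix[OF x] and qx = qfix[OF x]
    have xX: "x \<in> X" using x unfolding fixed_def by auto
    have \<beta>0: "\<beta> (q x) \<zero>\<^bsub>U\<^esub> = \<zero>\<^bsub>S\<^esub>"
      using mod_hom_zero[OF U.restrict_left_module[OF C(1)] S_module \<beta>hom[OF qx]] by simp
    have bB: "b \<in> ?B" by (rule U.cyclic_mem[OF bU])
    have "p b = b" "q b = \<zero>\<^bsub>U\<^esub>" using pq(1,2)[OF bB submodule_zero[OF C(1)]] bU by simp_all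
    then have "act (\<kappa> (p x)) b \<oplus>\<^bsub>S\<^esub> \<zero>\<^bsub>S\<^esub> = \<zero>\<^bsub>S\<^esub>" using bspec[OF 0 bX(1)] \<beta>0 unfolding \<gamma>_def by simp
    then have \<kappa>0: "\<kappa> (p x) = \<zero>\<^bsub>S\<^esub>" using act[OF t one_closed] bU t(1) by simp
    obtain d where d: "d \<in> carrier A" "p x = d \<odot>\<^bsub>U\<^esub> b" using Bex[OF pB[OF xX]] by blast
    then have "d \<odot>\<^bsub>S\<^esub> s0 = \<zero>\<^bsub>S\<^esub>" using \<kappa>(2) \<kappa>0 by simp
    then have p0: "p x = \<zero>\<^bsub>U\<^esub>" using ann_iff[OF U bU bX(2) kb b(2) d(1)] d(2) by simp
    have "\<beta> (q x) y = \<zero>\<^bsub>S\<^esub>" if y: "y \<in> C" for y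
    proof -
      have "p y = \<zero>\<^bsub>U\<^esub>" "q y = y" using pq(1,2)[OF submodule_zero[OF B] y] submodule_mem[OF C(1) y] by simp_all
      moreover have "act (\<kappa> (p x)) \<zero>\<^bsub>U\<^esub> = \<zero>\<^bsub>S\<^esub>" using act[OF t zero_closed] bU t(1) by simp
      moreover have "y \<in> X" using y C(2) by blast
      ultimately show ?thesis using bspec[OF 0, of y] \<beta>c[OF qx y] unfolding \<gamma>_def by simp
    qed
    then have "q x = \<zero>\<^bsub>U\<^esub>" using \<beta> qx unfolding pairing_def by blast
    then show "x = \<zero>\<^bsub>U\<^esub>" using xpq[OF xX] p0 by simp
  qed
  then show ?thesis by blast
qed

text \<open>
  For a semisimple module \<open>Y\<close> the \<open>R\<close>-modules \<open>e Y\<close> and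
  \<open>Hom(Y, S)\<close> have the same length. The pairing is what is needed from this fact.
  Copies of \<open>S\<close> are split off one by one, until no element other than zero is fixed
  by \<open>e\<close> and the zero pairing serves.
\<close>

lemma pairing_exists:
  assumes U: "fg_left_module A U" and Y: "submodule Y A U"
    and kill: "\<And>j x. j \<in> J \<Longrightarrow> x \<in> Y \<Longrightarrow> j \<odot>\<^bsub>U\<^esub> x = \<zero>\<^bsub>U\<^esub>"
  shows "\<exists>\<beta>. pairing U Y \<beta>"
proof (rule ccontr)
  assume no: "\<nexists>\<beta>. pairing U Y \<beta>"
  have Um: "left_module A U" using U by (simp add: fg_left_module_def)
  interpret U: left_module A U by (rule Um)
  have "submodule Y A U \<and> Y \<subseteq> Y \<and> (\<nexists>\<beta>. pairing U Y \<beta>)" using Y no by blast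
  from minimal_submodule[OF U, of "\<lambda>X. submodule X A U \<and> X \<subseteq> Y \<and> (\<nexists>\<beta>. pairing U X \<beta>)", OF this]
  obtain X where X: "submodule X A U" "X \<subseteq> Y" "\<nexists>\<beta>. pairing U X \<beta>"
    and min: "\<And>Z. submodule Z A U \<and> Z \<subseteq> Y \<and> (\<nexists>\<beta>. pairing U Z \<beta>) \<Longrightarrow> Z \<subseteq> X \<Longrightarrow> Z = X" by metis
  have kX: "\<And>j x. j \<in> J \<Longrightarrow> x \<in> X \<Longrightarrow> j \<odot>\<^bsub>U\<^esub> x = \<zero>\<^bsub>U\<^esub>" using kill X(2) by blast
  show False
  proof (cases "fixed U X \<subseteq> {\<zero>\<^bsub>U\<^esub>}")
    case True
    then have "pairing U X (\<lambda>x y. \<zero>\<^bsub>S\<^esub>)"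
      unfolding pairing_def using mod_hom_zero_map[OF S_module] by auto
    then show False using X(3) by blast
  next
    case False
    then obtain b where b: "b \<in> fixed U X" "b \<noteq> \<zero>\<^bsub>U\<^esub>" by blast
    have bX: "b \<in> X" using b(1) unfolding fixed_def by simp
    have bU: "b \<in> carrier U" by (rule submodule_mem[OF X(1) bX])
    let ?R = "U\<lparr>carrier := X\<rparr>"
    note iff = U.submodule_restrict_iff[OF X(1)]
    have "submodule {\<zero>\<^bsub>U\<^esub>} A ?R" using iff submodule_zero[OF X(1)] by simp
    from maximal_submodule_avoiding[OF U.restrict_left_module[OF X(1)], of b "{\<zero>\<^bsub>U\<^esub>}", OF _ _ this]
    obtain C where C: "submodule C A ?R" "b \<notin> C"
      and max: "\<And>D. submodule D A ?R \<Longrightarrow> C \<subseteq> D \<Longrightarrow> D = C \<or> D = X" using bX b(2) kX by auto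
    have C': "submodule C A U" "C \<subseteq> X" using C(1) iff by auto
    note B = U.cyclic_submodule[OF bU]
    have "cyclic_submodule A U b <+>\<^bsub>U\<^esub> C \<subseteq> X" by (rule U.sum_least[OF X(1) cyclic_least[OF X(1) bX] C'(2)])
    then have "cyclic_submodule A U b <+>\<^bsub>U\<^esub> C = X"
      using max[of "cyclic_submodule A U b <+>\<^bsub>U\<^esub> C"] iff U.submodule_sum[OF B C'(1)] U.sum_incl2[OF B C'(1)]
        U.sum_incl1[OF B C'(1)] U.cyclic_mem[OF bU] C(2) by blast
    moreover obtain \<beta> where "pairing U C \<beta>" using min[of C] C' X(2) C(2) bX by blast
    ultimately show False using pairing_extend[OF Um X(1) kX b C' C(2)] X(3) by blast
  qed
qed

end

section \<open>Homomorphisms from a local projective module with prescribed values\<close>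

text \<open>
  Multiples of a homomorphism are homomorphisms because the scalars are central.
\<close>

lemma (in artin_alg) mod_hom_scalar:
  assumes N: "left_module A N" and f: "f \<in> mod_hom A M N" and r: "r \<in> carrier R"
  shows "(\<lambda>x. scalar r \<odot>\<^bsub>N\<^esub> f x) \<in> mod_hom A M N"
proof -
  interpret N: left_module A N by (rule N)
  note sr = scalar_closed[OF r]
  show ?thesis
  proof (rule mod_homI)
    fix a x assume a: "a \<in> carrier A" and x: "x \<in> carrier M"
    have "scalar r \<odot>\<^bsub>N\<^esub> (a \<odot>\<^bsub>N\<^esub> f x) = a \<odot>\<^bsub>N\<^esub> (scalar r \<odot>\<^bsub>N\<^esub> f x)"
      using sr a mod_hom_closed[OF f x] scalar_central[OF r a] by (simp add: N.smult_assoc1[symmetric])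
    then show "scalar r \<odot>\<^bsub>N\<^esub> f (a \<odot>\<^bsub>M\<^esub> x) = a \<odot>\<^bsub>N\<^esub> (scalar r \<odot>\<^bsub>N\<^esub> f x)"
      using mod_hom_smult[OF f a x] by simp
  qed (use sr in \<open>simp_all add: mod_hom_closed[OF f] mod_hom_add[OF f] N.smult_r_distr\<close>)
qed

lemma (in simple_idempotent) pairingD:
  assumes "pairing U X \<beta>" and "x \<in> fixed U X"
  shows "\<beta> x \<in> mod_hom A (U\<lparr>carrier := X\<rparr>) S"
    and "x' \<in> fixed U X \<Longrightarrow> y \<in> X \<Longrightarrow> \<beta> (x \<oplus>\<^bsub>U\<^esub> x') y = \<beta> x y \<oplus>\<^bsub>S\<^esub> \<beta> x' y"
    and "r \<in> carrier R \<Longrightarrow> y \<in> X \<Longrightarrow> \<beta> (scalar r \<odot>\<^bsub>U\<^esub> x) y = scalar r \<odot>\<^bsub>S\<^esub> \<beta> x y"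
    and "\<forall>y\<in>X. \<beta> x y = \<zero>\<^bsub>S\<^esub> \<Longrightarrow> x = \<zero>\<^bsub>U\<^esub>"
  using assms unfolding pairing_def by simp_all

text \<open>
  The data on which both almost split properties rest: a copy of \<open>S\<close> in an
  injective module whose socle term \<open>V = soc\<^sup>s\<^sup>+\<^sup>1 I\<close> is
  uniserial, and an element \<open>a\<close> of a local projective module \<open>P\<close> whose
  class generates a copy of \<open>S\<close> in \<open>rad\<^sup>s P /
  rad\<^sup>s\<^sup>+\<^sup>1 P\<close>.
\<close>

locale uniserial_dual = simple_idempotent R A S s0 e
  for R :: "('r, 'x) ring_scheme" and A :: "('r, 'a, 'y) module_scheme"
    and S :: "('a, 'q, 'w) module_scheme" and s0 :: 'q and e :: 'a +
  fixes I :: "('a, 'i, 'u) module_scheme" and \<iota> :: "'q \<Rightarrow> 'i" and s :: nat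
    and P :: "('a, 'm, 'z) module_scheme" and a :: 'm
  assumes I_injective: "injective_in_mod A I"
    and \<iota>: "\<iota> \<in> mod_hom A S I" "inj_on \<iota> (carrier S)"
    and uni: "uniserial A (I\<lparr>carrier := soc A (Suc s) I\<rparr>)"
    and P_projective: "projective_in_mod A P" and P_local: "local_module P"
    and a: "a \<in> rads P s (carrier P)" "a \<notin> rads P (Suc s) (carrier P)" "e \<odot>\<^bsub>P\<^esub> a = a"
begin

lemma P_fg: "fg_left_module A P" and I_fg: "fg_left_module A I"
  using P_projective I_injective by (simp_all add: projective_in_mod_def injective_in_mod_def)

lemma P_module: "left_module A P" and I_module: "left_module A I"
  using P_fg I_fg by (simp_all add: fg_left_module_def)

sublocale P: left_module A P by (rule P_module)
sublocale I: left_module A I by (rule I_module)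

abbreviation V :: "'i set" where "V \<equiv> soc A (Suc s) I"

lemma V_submodule: "submodule V A I" by (rule soc_submodule[OF I_module])

text \<open>
  The class of \<open>b\<close> in \<open>X / rad\<^sup>s\<^sup>+\<^sup>1 X\<close> generates a
  copy of \<open>S\<close>. The embedding of \<open>S\<close> into \<open>I\<close> extends from
  it to the whole quotient, with values in \<open>V\<close>. The image is not contained in
  \<open>soc\<^sup>s I\<close>, since the element \<open>b\<close> of \<open>rad\<^sup>s
  X\<close> is not killed, and \<open>V\<close> is the only submodule of \<open>V\<close> with
  this property.
\<close>

lemma onto_V:
  fixes X :: "('a, 'n, 'v) module_scheme"
  assumes X: "fg_left_module A X" and b: "b \<in> rads X s (carrier X)" "b \<notin> rads X (Suc s) (carrier X)" "e \<odot>\<^bsub>X\<^esub> b = b"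
  obtains g where "g \<in> mod_hom A X I" "g ` carrier X = V" "g b \<noteq> \<zero>\<^bsub>I\<^esub>"
proof -
  have Xm: "left_module A X" using X by (simp add: fg_left_module_def)
  interpret X: left_module A X by (rule Xm)
  define N where "N = rads X (Suc s) (carrier X)"
  have N: "submodule N A X" unfolding N_def by (rule rads_submodule[OF Xm X.submodule_carrier])
  have bX: "b \<in> carrier X" using submodule_mem[OF rads_submodule[OF Xm X.submodule_carrier] b(1)] .
  let ?Q = "quotient_module X N" and ?p = "\<lambda>x. N +>\<^bsub>X\<^esub> x"
  have Qfg: "fg_left_module A ?Q" by (rule fg_quotient[OF X N])
  have Qm: "left_module A ?Q" by (rule X.quotient_left_module[OF N])
  interpret Q: left_module A ?Q by (rule Qm)
  have p: "?p \<in> mod_hom A X ?Q" by (rule X.quotient_proj_hom[OF N])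
  let ?b = "?p b"
  have bQ: "?b \<in> carrier ?Q" by (rule mod_hom_closed[OF p bX])
  have be: "e \<odot>\<^bsub>?Q\<^esub> ?b = ?b" using mod_hom_smult[OF p e(1) bX] b(3) by simp
  have bn: "?b \<noteq> \<zero>\<^bsub>?Q\<^esub>" using X.quotient_proj_zero_iff[OF N bX] b(2) unfolding N_def by blast
  have bk: "\<forall>j\<in>J. j \<odot>\<^bsub>?Q\<^esub> ?b = \<zero>\<^bsub>?Q\<^esub>"
  proof
    fix j assume j: "j \<in> J"
    have "j \<odot>\<^bsub>X\<^esub> b \<in> N" using radical_of_mem[OF Xm j b(1)] by (simp add: N_def)
    moreover have "j \<odot>\<^bsub>X\<^esub> b \<in> carrier X" using J_mem[OF j] bX by simp
    ultimately have "?p (j \<odot>\<^bsub>X\<^esub> b) = \<zero>\<^bsub>?Q\<^esub>" using X.quotient_proj_zero_iff[OF N] by blast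
    then show "j \<odot>\<^bsub>?Q\<^esub> ?b = \<zero>\<^bsub>?Q\<^esub>" using mod_hom_smult[OF p J_mem[OF j] bX] by simp
  qed
  obtain \<kappa> where \<kappa>: "\<kappa> \<in> mod_hom A (?Q\<lparr>carrier := cyclic_submodule A ?Q ?b\<rparr>) S"
    "\<And>r. r \<in> carrier A \<Longrightarrow> \<kappa> (r \<odot>\<^bsub>?Q\<^esub> ?b) = r \<odot>\<^bsub>S\<^esub> s0"
    using cyclic_iso_S[OF Qm bQ be bk bn] by metis
  let ?B = "cyclic_submodule A ?Q ?b"
  have B: "submodule ?B A ?Q" by (rule Q.cyclic_submodule[OF bQ])
  have "\<exists>h\<in>mod_hom A ?Q I. \<forall>x\<in>carrier (?Q\<lparr>carrier := ?B\<rparr>). h x = \<iota> (\<kappa> x)"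
    by (rule injective_extend[OF I_injective fg_submodule[OF Qfg B] Qfg mod_hom_incl[OF submodule_subset[OF B]] _
        mod_hom_comp[OF \<kappa>(1) \<iota>(1)]]) (simp add: inj_on_def)
  then obtain h where h: "h \<in> mod_hom A ?Q I" "\<forall>x\<in>?B. h x = \<iota> (\<kappa> x)" by auto
  define g where "g = (\<lambda>x. h (?p x))"
  have g: "g \<in> mod_hom A X I" unfolding g_def by (rule mod_hom_comp[OF p h(1)])
  have "g b = \<iota> s0"
    unfolding g_def using bspec[OF h(2) Q.cyclic_mem[OF bQ]] \<kappa>(2)[OF one_closed]
    unfolding Q.smult_one[OF bQ] S.smult_one[OF s0(1)] by argo
  moreover have "\<forall>x\<in>carrier S. \<iota> x = \<zero>\<^bsub>I\<^esub> \<longrightarrow> x = \<zero>\<^bsub>S\<^esub>"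
    using mod_hom_inj_iff[OF S_module I_module \<iota>(1)] \<iota>(2) by blast
  ultimately have gb: "g b \<noteq> \<zero>\<^bsub>I\<^esub>" using s0 by metis
  have gX: "submodule (g ` carrier X) A I" by (rule mod_hom_image_submodule[OF Xm I_module g X.submodule_carrier])
  have img: "rads I i (g ` carrier X) = g ` rads X i (carrier X)" for i
    by (rule rads_image[OF Xm I_module g X.submodule_carrier, symmetric])
  have sub: "g ` carrier X \<subseteq> V"
    unfolding g_def N_def by (rule quotient_by_rads_hom_into_soc[OF Xm I_module h(1)[unfolded N_def]])
  have "\<not> g ` carrier X \<subseteq> soc A s I"
    unfolding subset_soc_iff[OF I_module gX] img using gb b(1) by blast
  then have "g ` carrier X = V" by (intro uniserial_soc_layer[OF I_module uni _ gX sub]) simp_all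
  then show thesis using that g gb by blast
qed

text \<open>
  Fix \<open>g\<close> from \<open>P\<close> onto \<open>V\<close> with \<open>g a \<noteq>
  0\<close>, and let \<open>Y = rad\<^sup>s P / rad\<^sup>s\<^sup>+\<^sup>1 P\<close>. By
  injectivity of \<open>I\<close> every homomorphism from \<open>Y\<close> to \<open>S\<close>
  comes from a homomorphism from \<open>P\<close> to \<open>V\<close>, and by projectivity the
  latter is \<open>g v\<close> for some endomorphism \<open>v\<close> of \<open>P\<close>. An
  endomorphism \<open>v\<close> fails to be onto exactly if \<open>g v\<close> kills
  \<open>rad\<^sup>s P\<close>, and also exactly if \<open>v a\<close> lies in
  \<open>rad\<^sup>s\<^sup>+\<^sup>1 P\<close>. So \<open>g v \<mapsto> v a\<close> embeds
  \<open>Hom(Y, S)\<close> into \<open>e Y\<close>, linearly over \<open>R\<close>. Preceded by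
  the embedding of \<open>e Y\<close> into \<open>Hom(Y, S)\<close> that the pairing provides,
  it is an injective endomorphism \<open>T\<close> of the artinian \<open>R\<close>-module
  \<open>e Y\<close>. Hence \<open>T\<close> is onto, and every element of \<open>e Y\<close> is
  the class of some \<open>v a\<close>.
\<close>

lemma radical_multiples_of_generator:
  assumes c: "c \<in> rads P s (carrier P)" "e \<odot>\<^bsub>P\<^esub> c = c"
  shows "\<exists>v \<in> mod_hom A P P. v a \<ominus>\<^bsub>P\<^esub> c \<in> rads P (Suc s) (carrier P)"
proof -
  define N where "N = rads P (Suc s) (carrier P)"
  let ?Y = "rads P s (carrier P)"
  have N: "submodule N A P" and Y: "submodule ?Y A P" unfolding N_def by (rule rads_submodule[OF P_module P.submodule_carrier])+
  have Ym: "y \<in> carrier P" if "y \<in> ?Y" for y by (rule submodule_mem[OF Y that])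
  obtain g where g: "g \<in> mod_hom A P I" "g ` carrier P = V" "g a \<noteq> \<zero>\<^bsub>I\<^esub>" using onto_V[OF P_fg a] by metis
  let ?Q = "quotient_module P N" and ?p = "\<lambda>x. N +>\<^bsub>P\<^esub> x"
  have Qfg: "fg_left_module A ?Q" by (rule fg_quotient[OF P_fg N])
  have Qm: "left_module A ?Q" by (rule P.quotient_left_module[OF N])
  interpret Q: left_module A ?Q by (rule Qm)
  have p: "?p \<in> mod_hom A P ?Q" by (rule P.quotient_proj_hom[OF N])
  have p0: "?p x = \<zero>\<^bsub>?Q\<^esub> \<longleftrightarrow> x \<in> N" if "x \<in> carrier P" for x by (rule P.quotient_proj_zero_iff[OF N that])
  let ?YQ = "?p ` ?Y"
  have YQ: "submodule ?YQ A ?Q" by (rule mod_hom_image_submodule[OF P_module Qm p Y])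
  have killY: "j \<odot>\<^bsub>?Q\<^esub> x = \<zero>\<^bsub>?Q\<^esub>" if j: "j \<in> J" and x: "x \<in> ?YQ" for j x
  proof -
    obtain y where y: "y \<in> ?Y" "x = ?p y" using x by blast
    have "j \<odot>\<^bsub>P\<^esub> y \<in> N" using radical_of_mem[OF P_module j y(1)] by (simp add: N_def)
    then have "?p (j \<odot>\<^bsub>P\<^esub> y) = \<zero>\<^bsub>?Q\<^esub>" using p0 submodule_mem[OF N] by blast
    then show ?thesis using mod_hom_smult[OF p J_mem[OF j] Ym[OF y(1)]] y(2) by simp
  qed
  obtain \<beta> where \<beta>: "pairing ?Q ?YQ \<beta>" using pairing_exists[OF Qfg YQ killY] by blast
  define B where "B = fixed ?Q ?YQ"
  have BY: "b \<in> ?YQ" "e \<odot>\<^bsub>?Q\<^esub> b = b" if "b \<in> B" for b using that unfolding B_def fixed_def by auto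
  have BQ: "b \<in> carrier ?Q" if "b \<in> B" for b by (rule submodule_mem[OF YQ BY(1)[OF that]])
  have \<beta>hom: "\<beta> b \<in> mod_hom A (?Q\<lparr>carrier := ?YQ\<rparr>) S" if "b \<in> B" for b
    using pairingD(1)[OF \<beta>] that unfolding B_def .
  have \<beta>c: "\<beta> b y \<in> carrier S" if "b \<in> B" "y \<in> ?YQ" for b y using mod_hom_closed[OF \<beta>hom[OF that(1)]] that(2) by simp
  have \<beta>add: "\<beta> (b \<oplus>\<^bsub>?Q\<^esub> b') y = \<beta> b y \<oplus>\<^bsub>S\<^esub> \<beta> b' y" if "b \<in> B" "b' \<in> B" "y \<in> ?YQ" for b b' y
    using pairingD(2)[OF \<beta>] that unfolding B_def .
  have \<beta>sm: "\<beta> (scalar r \<odot>\<^bsub>?Q\<^esub> b) y = scalar r \<odot>\<^bsub>S\<^esub> \<beta> b y" if "r \<in> carrier R" "b \<in> B" "y \<in> ?YQ" for r b y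
    using pairingD(3)[OF \<beta> that(2)[unfolded B_def] that(1,3)] .
  have \<beta>nd: "b = \<zero>\<^bsub>?Q\<^esub>" if "b \<in> B" "\<forall>y\<in>?YQ. \<beta> b y = \<zero>\<^bsub>S\<^esub>" for b
    using pairingD(4)[OF \<beta>] that unfolding B_def .
  have Bstable: "stable ?Q B"
    unfolding stable_def
  proof (intro conjI ballI)
    show "B \<subseteq> carrier ?Q" using BQ by blast
    show "\<zero>\<^bsub>?Q\<^esub> \<in> B" unfolding B_def fixed_def using submodule_zero[OF YQ] e(1) Q.smult_zero_right by blast
    show "x \<oplus>\<^bsub>?Q\<^esub> y \<in> B" if "x \<in> B" "y \<in> B" for x y
      using submodule_add[OF YQ BY(1)[OF that(1)] BY(1)[OF that(2)]] Q.smult_r_distr[OF e(1) BQ[OF that(1)] BQ[OF that(2)]]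
        BY(2)[OF that(1)] BY(2)[OF that(2)] unfolding B_def fixed_def by simp
    show "scalar r \<odot>\<^bsub>?Q\<^esub> x \<in> B" if r: "r \<in> carrier R" and x: "x \<in> B" for r x
    proof -
      have "e \<odot>\<^bsub>?Q\<^esub> (scalar r \<odot>\<^bsub>?Q\<^esub> x) = scalar r \<odot>\<^bsub>?Q\<^esub> (e \<odot>\<^bsub>?Q\<^esub> x)"
        using Q.smult_assoc1[OF e(1) scalar_closed[OF r] BQ[OF x]] Q.smult_assoc1[OF scalar_closed[OF r] e(1) BQ[OF x]]
          scalar_central[OF r e(1)] by simp
      then show ?thesis
        using submodule_smult[OF YQ scalar_closed[OF r] BY(1)[OF x]] BY(2)[OF x] unfolding B_def fixed_def by simp
    qed
  qed
  \<comment> \<open>Both vanishing conditions below, that of \<open>g v\<close> on \<open>rad\<^sup>s P\<close> and that of \<open>v a\<close> modulo \<open>rad\<^sup>s\<^sup>+\<^sup>1 P\<close>,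
    say that \<open>v\<close> is not onto.\<close>
  have end_img: "v ` rads P i (carrier P) = rads P i (v ` carrier P)" if "v \<in> mod_hom A P P" for v i
    by (rule rads_image[OF P_module P_module that P.submodule_carrier])
  have end_Y: "v y \<in> ?Y" if v: "v \<in> mod_hom A P P" and y: "y \<in> ?Y" for v y
  proof -
    have "v ` carrier P \<subseteq> carrier P" using mod_hom_closed[OF v] by blast
    then have "v ` ?Y \<subseteq> ?Y" unfolding end_img[OF v] by (rule rads_mono)
    then show ?thesis using y by blast
  qed
  have nonsurj: "v ` ?Y \<subseteq> N" if v: "v \<in> mod_hom A P P" "v ` carrier P \<noteq> carrier P" for v
  proof -
    have "v ` carrier P \<subseteq> radical_of P (carrier P)"
      using P_local mod_hom_image_submodule[OF P_module P_module v(1) P.submodule_carrier] v(2)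
      unfolding local_module_def by blast
    then show ?thesis unfolding end_img[OF v(1)] N_def rads_Suc_right by (rule rads_mono)
  qed
  have kills1: "v a \<in> N" if v: "v \<in> mod_hom A P P" and 0: "\<forall>y\<in>?Y. g (v y) = \<zero>\<^bsub>I\<^esub>" for v
  proof (cases "v ` carrier P = carrier P")
    case True
    then have "a \<in> v ` ?Y" using a(1) end_img[OF v, of s] by simp
    then show ?thesis using 0 g(3) by auto
  next
    case False
    then show ?thesis using nonsurj[OF v] a(1) by blast
  qed
  have gN: "g x = \<zero>\<^bsub>I\<^esub>" if "x \<in> N" for x
  proof -
    have "g ` N = rads I (Suc s) V"
      using rads_image[OF P_module I_module g(1) P.submodule_carrier, of "Suc s"] unfolding N_def g(2) .
    also have "\<dots> = {\<zero>\<^bsub>I\<^esub>}" using subset_soc_iff[OF I_module V_submodule, of "Suc s"] by blast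
    finally show ?thesis using that by blast
  qed
  have kills2: "\<forall>y\<in>?Y. g (v y) = \<zero>\<^bsub>I\<^esub>" if v: "v \<in> mod_hom A P P" and 0: "v a \<in> N" for v
  proof (cases "v ` carrier P = carrier P")
    case True
    have inj: "inj_on v (carrier P)" by (rule local_projective_surj_endo_inj[OF P_projective P_local v True])
    have "v a \<in> v ` N" using 0 end_img[OF v, of "Suc s"] unfolding N_def True by simp
    then obtain n where n: "n \<in> N" "v a = v n" by blast
    then have "a = n" using inj_onD[OF inj] Ym[OF a(1)] submodule_mem[OF N] by blast
    then show ?thesis using a(2) n(1) unfolding N_def by blast
  next
    case False
    then show ?thesis using nonsurj[OF v] gN by blast
  qed
  have diffP: "(\<lambda>x. v x \<ominus>\<^bsub>P\<^esub> w x) \<in> mod_hom A P P" if "v \<in> mod_hom A P P" "w \<in> mod_hom A P P" for v w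
    by (rule mod_hom_diff_hom[OF P_module that])
  have g_diff: "g (v y \<ominus>\<^bsub>P\<^esub> w y) = g (v y) \<ominus>\<^bsub>I\<^esub> g (w y)"
    if "v \<in> mod_hom A P P" "w \<in> mod_hom A P P" "y \<in> ?Y" for v w y
    using mod_hom_diff[OF P_module I_module g(1)] mod_hom_closed[OF that(1)] mod_hom_closed[OF that(2)] Ym[OF that(3)] by simp
  have same1: "?p (v a) = ?p (w a)"
    if v: "v \<in> mod_hom A P P" and w: "w \<in> mod_hom A P P" and eq: "\<forall>y\<in>?Y. g (v y) = g (w y)" for v w
  proof -
    have "\<forall>y\<in>?Y. g (v y \<ominus>\<^bsub>P\<^esub> w y) = \<zero>\<^bsub>I\<^esub>"
      using g_diff[OF v w] eq mod_hom_closed[OF g(1) mod_hom_closed[OF w Ym]] I.diff_self by simp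
    then have "v a \<ominus>\<^bsub>P\<^esub> w a \<in> N" by (rule kills1[OF diffP[OF v w]])
    then show ?thesis using P.coset_eq_iff[OF N] mod_hom_closed[OF v Ym[OF a(1)]] mod_hom_closed[OF w Ym[OF a(1)]] by blast
  qed
  have same2: "\<forall>y\<in>?Y. g (v y) = g (w y)"
    if v: "v \<in> mod_hom A P P" and w: "w \<in> mod_hom A P P" and eq: "?p (v a) = ?p (w a)" for v w
  proof
    fix y assume y: "y \<in> ?Y"
    have "v a \<ominus>\<^bsub>P\<^esub> w a \<in> N"
      using eq P.coset_eq_iff[OF N] mod_hom_closed[OF v Ym[OF a(1)]] mod_hom_closed[OF w Ym[OF a(1)]] by blast
    then have "g (v y) \<ominus>\<^bsub>I\<^esub> g (w y) = \<zero>\<^bsub>I\<^esub>" 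
      using bspec[OF kills2[OF diffP[OF v w]] y] g_diff[OF v w y] by simp
    then show "g (v y) = g (w y)"
      using I.diff_eq_zero_iff mod_hom_closed[OF g(1) mod_hom_closed[OF v Ym[OF y]]]
        mod_hom_closed[OF g(1) mod_hom_closed[OF w Ym[OF y]]] by blast
  qed
  have "\<forall>b\<in>B. \<exists>v\<in>mod_hom A P P. \<forall>y\<in>?Y. g (v y) = \<iota> (\<beta> b (?p y))"
  proof
    fix b assume b: "b \<in> B"
    have "\<exists>h\<in>mod_hom A ?Q I. \<forall>x\<in>carrier (?Q\<lparr>carrier := ?YQ\<rparr>). h x = \<iota> (\<beta> b x)"
      by (rule injective_extend[OF I_injective fg_submodule[OF Qfg YQ] Qfg mod_hom_incl[OF submodule_subset[OF YQ]] _
          mod_hom_comp[OF \<beta>hom[OF b] \<iota>(1)]]) (simp add: inj_on_def)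
    then obtain h where h: "h \<in> mod_hom A ?Q I" "\<forall>x\<in>?YQ. h x = \<iota> (\<beta> b x)" by auto
    let ?h = "\<lambda>x. h (?p x)"
    have hp: "?h \<in> mod_hom A P I" by (rule mod_hom_comp[OF p h(1)])
    have "?h ` carrier P \<subseteq> V"
      unfolding N_def by (rule quotient_by_rads_hom_into_soc[OF P_module I_module h(1)[unfolded N_def]])
    then have hV: "?h \<in> mod_hom A P (I\<lparr>carrier := V\<rparr>)" by (rule mod_hom_corestrict[OF hp])
    have gV: "g \<in> mod_hom A P (I\<lparr>carrier := V\<rparr>)" by (rule mod_hom_corestrict[OF g(1)]) (use g(2) in blast)
    have "g ` carrier P = carrier (I\<lparr>carrier := V\<rparr>)" using g(2) by (simp del: soc.simps)
    from projective_lift[OF P_projective P_fg fg_submodule[OF I_fg V_submodule] gV this hV]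
    obtain v where v: "v \<in> mod_hom A P P" "\<forall>x\<in>carrier P. g (v x) = ?h x" by blast
    have "\<forall>y\<in>?Y. g (v y) = \<iota> (\<beta> b (?p y))" using v(2) h(2) Ym by auto
    then show "\<exists>v\<in>mod_hom A P P. \<forall>y\<in>?Y. g (v y) = \<iota> (\<beta> b (?p y))" using v(1) by blast
  qed
  then have "\<forall>b\<in>B. \<exists>v. v \<in> mod_hom A P P \<and> (\<forall>y\<in>?Y. g (v y) = \<iota> (\<beta> b (?p y)))" unfolding Bex_def .
  from bchoice[OF this] obtain v where
    v0: "\<forall>b\<in>B. v b \<in> mod_hom A P P \<and> (\<forall>y\<in>?Y. g (v b y) = \<iota> (\<beta> b (?p y)))" by (rule exE)
  have v: "v b \<in> mod_hom A P P" "y \<in> ?Y \<Longrightarrow> g (v b y) = \<iota> (\<beta> b (?p y))" if "b \<in> B" for b y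
    using bspec[OF v0 that] by simp_all
  define T where "T b = ?p (v b a)" for b
  have aP: "a \<in> carrier P" by (rule Ym[OF a(1)])
  have TB: "T b \<in> B" if b: "b \<in> B" for b
  proof -
    have "T b \<in> ?YQ" unfolding T_def using end_Y[OF v(1)[OF b] a(1)] by blast
    moreover have "e \<odot>\<^bsub>?Q\<^esub> T b = T b"
      unfolding T_def using mod_hom_smult[OF p e(1) mod_hom_closed[OF v(1)[OF b] aP]] mod_hom_smult[OF v(1)[OF b] e(1) aP] a(3) by simp
    ultimately show ?thesis unfolding B_def fixed_def by blast
  qed
  have pY: "?p y \<in> ?YQ" if "y \<in> ?Y" for y using that by blast
  have "T ` B = B"
  proof (rule injective_stable_endo_surj[OF Qfg Bstable TB])
    show "T (x \<oplus>\<^bsub>?Q\<^esub> y) = T x \<oplus>\<^bsub>?Q\<^esub> T y" if x: "x \<in> B" and y: "y \<in> B" for x y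
    proof -
      let ?w = "\<lambda>z. v x z \<oplus>\<^bsub>P\<^esub> v y z"
      have xy: "x \<oplus>\<^bsub>?Q\<^esub> y \<in> B" by (rule stableD(3)[OF Bstable x y])
      have w: "?w \<in> mod_hom A P P" by (rule mod_hom_sum_hom[OF P_module v(1)[OF x] v(1)[OF y]])
      have "\<forall>z\<in>?Y. g (v (x \<oplus>\<^bsub>?Q\<^esub> y) z) = g (?w z)"
      proof
        fix z assume z: "z \<in> ?Y"
        have "g (?w z) = \<iota> (\<beta> x (?p z)) \<oplus>\<^bsub>I\<^esub> \<iota> (\<beta> y (?p z))"
          using mod_hom_add[OF g(1) mod_hom_closed[OF v(1)[OF x] Ym[OF z]] mod_hom_closed[OF v(1)[OF y] Ym[OF z]]]
            v(2)[OF x z] v(2)[OF y z] by simp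
        also have "\<dots> = \<iota> (\<beta> x (?p z) \<oplus>\<^bsub>S\<^esub> \<beta> y (?p z))"
          by (rule mod_hom_add[OF \<iota>(1) \<beta>c[OF x pY[OF z]] \<beta>c[OF y pY[OF z]], symmetric])
        also have "\<dots> = g (v (x \<oplus>\<^bsub>?Q\<^esub> y) z)" using \<beta>add[OF x y pY[OF z]] v(2)[OF xy z] by simp
        finally show "g (v (x \<oplus>\<^bsub>?Q\<^esub> y) z) = g (?w z)" by simp
      qed
      then have "?p (v (x \<oplus>\<^bsub>?Q\<^esub> y) a) = ?p (?w a)" by (rule same1[OF v(1)[OF xy] w])
      then show ?thesis
        unfolding T_def using mod_hom_add[OF p mod_hom_closed[OF v(1)[OF x] aP] mod_hom_closed[OF v(1)[OF y] aP]] by simp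
    qed
    show "T (scalar r \<odot>\<^bsub>?Q\<^esub> x) = scalar r \<odot>\<^bsub>?Q\<^esub> T x" if r: "r \<in> carrier R" and x: "x \<in> B" for r x
    proof -
      let ?w = "\<lambda>z. scalar r \<odot>\<^bsub>P\<^esub> v x z"
      have rx: "scalar r \<odot>\<^bsub>?Q\<^esub> x \<in> B" by (rule stableD(4)[OF Bstable r x])
      have w: "?w \<in> mod_hom A P P" by (rule mod_hom_scalar[OF P_module v(1)[OF x] r])
      note sr = scalar_closed[OF r]
      have "\<forall>z\<in>?Y. g (v (scalar r \<odot>\<^bsub>?Q\<^esub> x) z) = g (?w z)"
      proof
        fix z assume z: "z \<in> ?Y"
        have "g (?w z) = scalar r \<odot>\<^bsub>I\<^esub> \<iota> (\<beta> x (?p z))"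
          using mod_hom_smult[OF g(1) sr mod_hom_closed[OF v(1)[OF x] Ym[OF z]]] v(2)[OF x z] by simp
        also have "\<dots> = \<iota> (scalar r \<odot>\<^bsub>S\<^esub> \<beta> x (?p z))"
          by (rule mod_hom_smult[OF \<iota>(1) sr \<beta>c[OF x pY[OF z]], symmetric])
        also have "\<dots> = g (v (scalar r \<odot>\<^bsub>?Q\<^esub> x) z)" using \<beta>sm[OF r x pY[OF z]] v(2)[OF rx z] by simp
        finally show "g (v (scalar r \<odot>\<^bsub>?Q\<^esub> x) z) = g (?w z)" by simp
      qed
      then have "?p (v (scalar r \<odot>\<^bsub>?Q\<^esub> x) a) = ?p (?w a)" by (rule same1[OF v(1)[OF rx] w])
      then show ?thesis unfolding T_def using mod_hom_smult[OF p sr mod_hom_closed[OF v(1)[OF x] aP]] by simp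
    qed
    show "inj_on T B"
    proof (rule inj_onI)
      fix x y assume x: "x \<in> B" and y: "y \<in> B" and "T x = T y"
      then have "?p (v x a) = ?p (v y a)" unfolding T_def by simp
      from same2[OF v(1)[OF x] v(1)[OF y] this] have eq: "\<iota> (\<beta> x (?p z)) = \<iota> (\<beta> y (?p z))" if "z \<in> ?Y" for z
        using v(2)[OF x that] v(2)[OF y that] that by simp
      have \<beta>eq: "\<beta> x u = \<beta> y u" if u: "u \<in> ?YQ" for u
      proof -
        obtain z where z: "z \<in> ?Y" "u = ?p z" using u by blast
        show ?thesis using inj_onD[OF \<iota>(2) _ \<beta>c[OF x u] \<beta>c[OF y u]] eq[OF z(1)] z(2) by simp
      qed
      let ?d = "x \<oplus>\<^bsub>?Q\<^esub> \<ominus>\<^bsub>?Q\<^esub> y"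
      have dB: "?d \<in> B" by (rule stableD(3)[OF Bstable x stable_minus[OF Qm Bstable y]])
      have dy: "?d \<oplus>\<^bsub>?Q\<^esub> y = x" using BQ[OF x] BQ[OF y] by (simp add: Q.M.a_assoc Q.M.l_neg del: P.quotient_zero)
      have "\<forall>u\<in>?YQ. \<beta> ?d u = \<zero>\<^bsub>S\<^esub>"
      proof
        fix u assume u: "u \<in> ?YQ"
        have "\<beta> ?d u \<oplus>\<^bsub>S\<^esub> \<beta> y u = \<beta> y u" using \<beta>add[OF dB y u] \<beta>eq[OF u] unfolding dy by simp
        then show "\<beta> ?d u = \<zero>\<^bsub>S\<^esub>" using \<beta>c[OF dB u] \<beta>c[OF y u] by simp
      qed
      then have "?d = \<zero>\<^bsub>?Q\<^esub>" by (rule \<beta>nd[OF dB])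
      then show "x = y" using dy Q.M.l_zero[OF BQ[OF y]] by metis
    qed
  qed
  moreover have "?p c \<in> B"
  proof -
    have "e \<odot>\<^bsub>?Q\<^esub> ?p c = ?p c" using mod_hom_smult[OF p e(1) Ym[OF c(1)]] c(2) by simp
    then show ?thesis unfolding B_def fixed_def using pY[OF c(1)] by blast
  qed
  ultimately obtain b where b: "b \<in> B" "?p c = T b" by (metis imageE)
  have "v b a \<ominus>\<^bsub>P\<^esub> c \<in> N"
    using b(2) P.coset_eq_iff[OF N mod_hom_closed[OF v(1)[OF b(1)] aP] Ym[OF c(1)]] unfolding T_def by metis
  then show ?thesis using v(1)[OF b(1)] unfolding N_def by blast
qed

text \<open>
  Let \<open>X\<close> be a minimal submodule of \<open>U\<close> for which the claim fails. It
  is not the sum of two proper submodules, because \<open>b = e b\<close> could be distributed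
  over them; so \<open>X\<close> is local. The claim holds for \<open>rad X\<close>, so
  \<open>b\<close> is not in \<open>rad\<^sup>s\<^sup>+\<^sup>1 X = rad\<^sup>s (rad X)\<close>.
  Then \<open>X\<close> and \<open>P\<close> both map onto \<open>V\<close>, and a lift \<open>P
  \<rightarrow> X\<close> of \<open>P \<rightarrow> V\<close> is onto because \<open>X\<close>
  is local. This reduces the problem to \<open>P\<close>, where it is solved up to an element of
  \<open>rad\<^sup>s\<^sup>+\<^sup>1 P\<close>, and the error in \<open>rad\<^sup>s (rad
  X)\<close> is corrected by the claim for \<open>rad X\<close>.
\<close>

lemma hom_hitting_radical_element:
  fixes U :: "('a, 'n, 'v) module_scheme"
  assumes U: "fg_left_module A U" and b: "b \<in> rads U s (carrier U)" "e \<odot>\<^bsub>U\<^esub> b = b"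
  shows "\<exists>v \<in> mod_hom A P U. v a = b"
proof -
  have Um: "left_module A U" using U by (simp add: fg_left_module_def)
  interpret U: left_module A U by (rule Um)
  define good where "good X \<longleftrightarrow> (\<forall>b. b \<in> rads U s X \<and> e \<odot>\<^bsub>U\<^esub> b = b \<longrightarrow> (\<exists>v \<in> mod_hom A P U. v a = b))" for X
  have "good (carrier U)"
  proof (rule ccontr)
    assume "\<not> good (carrier U)"
    then have "submodule (carrier U) A U \<and> \<not> good (carrier U)" by simp
    from minimal_submodule[OF U, of "\<lambda>X. submodule X A U \<and> \<not> good X", OF this]
    obtain X where X: "submodule X A U" "\<not> good X"
      and min: "\<And>Z. submodule Z A U \<and> \<not> good Z \<Longrightarrow> Z \<subseteq> X \<Longrightarrow> Z = X" by metis
    have smaller: "good Z" if "submodule Z A U" "Z \<subseteq> X" "Z \<noteq> X" for Z using min that by blast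
    have aP: "a \<in> carrier P" using submodule_mem[OF rads_submodule[OF P_module P.submodule_carrier] a(1)] .
    have Xne: "X \<noteq> {\<zero>\<^bsub>U\<^esub>}"
    proof
      assume X0: "X = {\<zero>\<^bsub>U\<^esub>}"
      have "rads U s X \<subseteq> {\<zero>\<^bsub>U\<^esub>}" using rads_subset[OF Um X(1), of s] X0 by simp
      then have "\<exists>v \<in> mod_hom A P U. v a = b" if "b \<in> rads U s X" for b
        using that by (intro bexI[OF _ mod_hom_zero_map[OF Um]]) auto
      then have "good X" unfolding good_def by blast
      then show False using X(2) by blast
    qed
    have rX: "submodule (radical_of U X) A U" by (rule radical_of_submodule[OF Um submodule_subset[OF X(1)]])
    have rX_neq: "radical_of U X \<noteq> X" using nakayama_zero[OF Um X(1)] Xne by blast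
    have good_rX: "good (radical_of U X)" by (rule smaller[OF rX radical_of_subset[OF X(1)] rX_neq])
    have good_sum: "good X" if Y: "submodule Y A U" "Y \<subseteq> X" "Y \<noteq> X" and Z: "submodule Z A U" "Z \<subseteq> X" "Z \<noteq> X"
      and YZ: "Y <+>\<^bsub>U\<^esub> Z = X" for Y Z
      unfolding good_def
    proof (intro allI impI)
      fix b assume b: "b \<in> rads U s X \<and> e \<odot>\<^bsub>U\<^esub> b = b"
      have rY: "submodule (rads U s Y) A U" and rZ: "submodule (rads U s Z) A U"
        by (rule rads_submodule[OF Um Y(1)], rule rads_submodule[OF Um Z(1)])
      have "b \<in> rads U s Y <+>\<^bsub>U\<^esub> rads U s Z" using b rads_sum[OF Um Y(1) Z(1), of s] YZ by auto
      then obtain y z where yz: "y \<in> rads U s Y" "z \<in> rads U s Z" "b = y \<oplus>\<^bsub>U\<^esub> z" unfolding mem_set_add by blast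
      have c: "y \<in> carrier U" "z \<in> carrier U" using submodule_mem[OF rY yz(1)] submodule_mem[OF rZ yz(2)] by auto
      have ee: "e \<odot>\<^bsub>U\<^esub> (e \<odot>\<^bsub>U\<^esub> u) = e \<odot>\<^bsub>U\<^esub> u" if "u \<in> carrier U" for u
        using U.smult_assoc1[OF e(1,1) that] e(2) by simp
      obtain v1 where v1: "v1 \<in> mod_hom A P U" "v1 a = e \<odot>\<^bsub>U\<^esub> y"
        using smaller[OF Y] submodule_smult[OF rY e(1) yz(1)] ee[OF c(1)] unfolding good_def by blast
      obtain v2 where v2: "v2 \<in> mod_hom A P U" "v2 a = e \<odot>\<^bsub>U\<^esub> z"
        using smaller[OF Z] submodule_smult[OF rZ e(1) yz(2)] ee[OF c(2)] unfolding good_def by blast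
      have "v1 a \<oplus>\<^bsub>U\<^esub> v2 a = b" using U.smult_r_distr[OF e(1) c] b yz(3) v1(2) v2(2) by simp
      then show "\<exists>v \<in> mod_hom A P U. v a = b"
        by (intro bexI[OF _ mod_hom_sum_hom[OF Um v1(1) v2(1)]])
    qed
    let ?X = "U\<lparr>carrier := X\<rparr>"
    note iff = U.submodule_restrict_iff[OF X(1)]
    have Xm: "left_module A ?X" by (rule U.restrict_left_module[OF X(1)])
    have Xfg: "fg_left_module A ?X" by (rule fg_submodule[OF U X(1)])
    have loc: "local_module ?X"
    proof (rule hollow_imp_local[OF Xm])
      show "carrier ?X \<noteq> {\<zero>\<^bsub>?X\<^esub>}" using Xne by simp
      fix Y Z assume Y: "submodule Y A ?X" and Z: "submodule Z A ?X" and YZ: "Y <+>\<^bsub>?X\<^esub> Z = carrier ?X"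
      have "Y <+>\<^bsub>U\<^esub> Z = X" using YZ unfolding set_add_def' by simp
      then show "Y = carrier ?X \<or> Z = carrier ?X" using good_sum[of Y Z] Y Z iff X(2) by auto
    qed
    have radsX: "rads ?X i X = rads U i X" for i by (rule rads_restrict[OF Um X(1) X(1) subset_refl])
    have "good X"
      unfolding good_def
    proof (intro allI impI)
      fix b assume b: "b \<in> rads U s X \<and> e \<odot>\<^bsub>U\<^esub> b = b"
      show "\<exists>v \<in> mod_hom A P U. v a = b"
      proof (cases "b \<in> rads U (Suc s) X")
        case True
        then show ?thesis using good_rX b unfolding good_def rads_Suc_right by blast
      next
        case False
        have "b \<in> rads ?X s (carrier ?X)" "b \<notin> rads ?X (Suc s) (carrier ?X)" "e \<odot>\<^bsub>?X\<^esub> b = b"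
          using b False radsX[of s] radsX[of "Suc s"] by simp_all
        from onto_V[OF Xfg this] obtain f where f0: "f \<in> mod_hom A ?X I" "f ` carrier ?X = V" by metis
        then have f: "f \<in> mod_hom A ?X I" "f ` X = V" by (simp_all del: soc.simps)
        obtain g where g: "g \<in> mod_hom A P I" "g ` carrier P = V" "g a \<noteq> \<zero>\<^bsub>I\<^esub>" using onto_V[OF P_fg a] by metis
        have fV: "f \<in> mod_hom A ?X (I\<lparr>carrier := V\<rparr>)" "f ` carrier ?X = carrier (I\<lparr>carrier := V\<rparr>)"
          using f0 by (simp_all add: mod_hom_corestrict del: soc.simps)
        have gV: "g \<in> mod_hom A P (I\<lparr>carrier := V\<rparr>)" by (rule mod_hom_corestrict[OF g(1)]) (use g(2) in blast)
        from projective_lift[OF P_projective Xfg fg_submodule[OF I_fg V_submodule] fV gV]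
        obtain t where t: "t \<in> mod_hom A P ?X" "\<forall>x\<in>carrier P. f (t x) = g x" by blast
        have tP: "submodule (t ` carrier P) A ?X" by (rule mod_hom_image_submodule[OF P_module Xm t(1) P.submodule_carrier])
        have t_surj: "t ` carrier P = X"
        proof (rule ccontr)
          assume "t ` carrier P \<noteq> X"
          then have "t ` carrier P \<subseteq> radical_of ?X X" using loc tP unfolding local_module_def by auto
          then have "f ` t ` carrier P \<subseteq> f ` radical_of ?X X" by blast
          also have "f ` radical_of ?X X = radical_of I (f ` X)"
            by (rule radical_of_image[OF Xm I_module f(1)]) simp
          also have "f ` t ` carrier P = g ` carrier P" using t(2) by (simp add: image_image)
          finally have "V \<subseteq> radical_of I V" using f(2) g(2) by simp
          then have "V = {\<zero>\<^bsub>I\<^esub>}" by (rule nakayama_zero[OF I_module V_submodule])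
          then show False using g aP by blast
        qed
        have "t ` rads P s (carrier P) = rads U s X"
          using rads_image[OF P_module Xm t(1) P.submodule_carrier, of s] radsX[of s] t_surj by simp
        then obtain c0 where c0: "c0 \<in> rads P s (carrier P)" "b = t c0" using b by blast
        have rP: "submodule (rads P i (carrier P)) A P" for i by (rule rads_submodule[OF P_module P.submodule_carrier])
        define c where "c = e \<odot>\<^bsub>P\<^esub> c0"
        have c0P: "c0 \<in> carrier P" by (rule submodule_mem[OF rP c0(1)])
        have c: "c \<in> rads P s (carrier P)" "e \<odot>\<^bsub>P\<^esub> c = c"
          unfolding c_def using submodule_smult[OF rP e(1) c0(1)] P.smult_assoc1[OF e(1,1) c0P] e(2) by simp_all
        have cP: "c \<in> carrier P" by (rule submodule_mem[OF rP c(1)])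
        have tc: "t c = b" unfolding c_def using mod_hom_smult[OF t(1) e(1) c0P] c0(2) b by simp
        obtain v where v: "v \<in> mod_hom A P P" "v a \<ominus>\<^bsub>P\<^esub> c \<in> rads P (Suc s) (carrier P)"
          using radical_multiples_of_generator[OF c] by blast
        have t': "t \<in> mod_hom A P U" by (rule mod_hom_extend_codomain[OF t(1) submodule_subset[OF X(1)]])
        have va: "v a \<in> carrier P" by (rule mod_hom_closed[OF v(1) aP])
        have tva: "t (v a) \<in> carrier U" by (rule mod_hom_closed[OF t' va])
        have bU: "b \<in> carrier U" using tc mod_hom_closed[OF t' cP] by simp
        have rXs: "submodule (rads U s (radical_of U X)) A U" by (rule rads_submodule[OF Um rX])
        have "t ` rads P (Suc s) (carrier P) = rads U s (radical_of U X)"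
          using rads_image[OF P_module Xm t(1) P.submodule_carrier, of "Suc s"] radsX[of "Suc s"] t_surj
          unfolding rads_Suc_right[symmetric] by simp
        then have "t (v a \<ominus>\<^bsub>P\<^esub> c) \<in> rads U s (radical_of U X)" using v(2) by blast
        then have "t (v a) \<ominus>\<^bsub>U\<^esub> b \<in> rads U s (radical_of U X)"
          using mod_hom_diff[OF P_module Um t' va cP] tc by simp
        moreover have "e \<odot>\<^bsub>U\<^esub> (t (v a) \<ominus>\<^bsub>U\<^esub> b) = t (v a) \<ominus>\<^bsub>U\<^esub> b"
          using U.smult_diff[OF e(1) tva bU] mod_hom_smult[OF t' e(1) va] mod_hom_smult[OF v(1) e(1) aP] a(3) b by simp
        ultimately obtain w where w: "w \<in> mod_hom A P U" "w a = t (v a) \<ominus>\<^bsub>U\<^esub> b"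
          using good_rX unfolding good_def by blast
        let ?v = "\<lambda>x. t (v x) \<ominus>\<^bsub>U\<^esub> w x"
        have "?v \<in> mod_hom A P U" by (rule mod_hom_diff_hom[OF Um mod_hom_comp[OF v(1) t'] w(1)])
        moreover have "t (v a) \<ominus>\<^bsub>U\<^esub> w a = b"
        proof -
          have "t (v a) \<ominus>\<^bsub>U\<^esub> (t (v a) \<ominus>\<^bsub>U\<^esub> b) = t (v a) \<oplus>\<^bsub>U\<^esub> (\<ominus>\<^bsub>U\<^esub> t (v a) \<oplus>\<^bsub>U\<^esub> b)"
            using tva bU by (simp add: a_minus_def U.M.minus_add)
          also have "\<dots> = b" using tva bU by (simp add: U.M.a_assoc[symmetric] U.M.r_neg)
          finally show ?thesis using w(2) by simp
        qed
        ultimately show ?thesis by (intro bexI[of _ ?v])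
      qed
    qed
    then show False using X(2) by blast
  qed
  then show ?thesis using b unfolding good_def by blast
qed

end

section \<open>From left to right almost split maps\<close>

lemma inj_mod_hom_inverse:
  assumes M: "left_module A M" and N: "left_module A N" and f: "f \<in> mod_hom A M N" "inj_on f (carrier M)"
  obtains g where "g \<in> mod_hom A (N\<lparr>carrier := f ` carrier M\<rparr>) M" "\<And>x. x \<in> carrier M \<Longrightarrow> g (f x) = x"
proof -
  interpret M: left_module A M by (rule M)
  interpret N: left_module A N by (rule N)
  let ?N = "N\<lparr>carrier := f ` carrier M\<rparr>"
  have Nm: "left_module A ?N"
    by (rule N.restrict_left_module[OF mod_hom_image_submodule[OF M N f(1) M.submodule_carrier]])
  have f': "f \<in> mod_hom A M ?N" by (rule mod_hom_corestrict[OF f(1) subset_refl])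
  have "bij_betw f (carrier M) (carrier ?N)" using f(2) by (simp add: bij_betw_def)
  from mod_hom_inverse[OF M Nm f' this] obtain g where
    g: "g \<in> mod_hom A ?N M" "\<forall>x\<in>carrier M. g (f x) = x" by (elim bexE conjE)
  show thesis using g by (intro that[of g]) simp_all
qed

lemma split_mono_if_endo:
  assumes L: "left_module A L" and E: "left_module A E" and f: "f \<in> mod_hom A L E" "inj_on f (carrier L)"
    and t: "t \<in> mod_hom A E E" "t ` carrier E \<subseteq> f ` carrier L" "\<And>x. x \<in> carrier L \<Longrightarrow> t (f x) = f x"
  shows "split_mono A L E f"
proof -
  obtain g where g: "g \<in> mod_hom A (E\<lparr>carrier := f ` carrier L\<rparr>) L" "\<And>x. x \<in> carrier L \<Longrightarrow> g (f x) = x"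
    using inj_mod_hom_inverse[OF L E f] by metis
  have "(\<lambda>x. g (t x)) \<in> mod_hom A E L" by (rule mod_hom_comp[OF mod_hom_corestrict[OF t(1,2)] g(1)])
  moreover have "\<forall>x\<in>carrier L. g (t (f x)) = x" using g(2) t(3) by simp
  ultimately show ?thesis unfolding split_mono_def using f(1) by (intro conjI bexI[of _ "\<lambda>x. g (t x)"])
qed

lemma split_epi_imp_split_mono:
  assumes L: "left_module A L" and E: "left_module A E" and N: "left_module A N"
    and ex: "short_exact A L E N f g" and split: "split_epi A E N g"
  shows "split_mono A L E f"
proof -
  have f: "f \<in> mod_hom A L E" "inj_on f (carrier L)" and g: "g \<in> mod_hom A E N"
    and ker: "f ` carrier L = {x \<in> carrier E. g x = \<zero>\<^bsub>N\<^esub>}"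
    using ex unfolding short_exact_def a_kernel_def' by auto
  interpret L: left_module A L by (rule L)
  interpret E: left_module A E by (rule E)
  interpret N: left_module A N by (rule N)
  obtain r where r: "r \<in> mod_hom A N E" "\<forall>y\<in>carrier N. g (r y) = y" using split unfolding split_epi_def by blast
  let ?t = "\<lambda>x. x \<ominus>\<^bsub>E\<^esub> r (g x)"
  have rg: "(\<lambda>x. r (g x)) \<in> mod_hom A E E" by (rule mod_hom_comp[OF g r(1)])
  have t: "?t \<in> mod_hom A E E" by (rule mod_hom_diff_hom[OF E mod_hom_id rg])
  show ?thesis
  proof (rule split_mono_if_endo[OF L E f t])
    show "?t ` carrier E \<subseteq> f ` carrier L"
    proof (rule image_subsetI)
      fix x assume x: "x \<in> carrier E"
      have "g (?t x) = g x \<ominus>\<^bsub>N\<^esub> g (r (g x))" by (rule mod_hom_diff[OF E N g x mod_hom_closed[OF rg x]])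
      also have "\<dots> = \<zero>\<^bsub>N\<^esub>" using r(2) mod_hom_closed[OF g x] N.diff_self by simp
      finally show "?t x \<in> f ` carrier L" unfolding ker using mod_hom_closed[OF t x] by blast
    qed
    fix x assume x: "x \<in> carrier L"
    then have "f x \<in> {x \<in> carrier E. g x = \<zero>\<^bsub>N\<^esub>}" unfolding ker[symmetric] by blast
    then show "?t (f x) = f x" using mod_hom_zero[OF N E r(1)] by (simp add: a_minus_def)
  qed
qed

text \<open>
  As with projectivity, the restriction on the type of the test objects is removed by transport
  along an isomorphism.
\<close>

lemma left_almost_split_extends:
  fixes A :: "('a, 'x) ring_scheme"
  assumes las: "left_almost_split A L E f" and U: "fg_left_module A U" and u: "u \<in> mod_hom A L U" "\<not> split_mono A L U u"
  shows "\<exists>v \<in> mod_hom A E U. \<forall>x\<in>carrier L. v (f x) = u x"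
proof -
  obtain U' :: "'a mod_obj" and \<phi> \<psi> where U': "fg_left_module A U'" "\<phi> \<in> mod_hom A U U'" "\<psi> \<in> mod_hom A U' U"
    "\<And>x. x \<in> carrier U \<Longrightarrow> \<psi> (\<phi> x) = x"
    using iso_mod_obj[OF U] by metis
  have u': "(\<lambda>x. \<phi> (u x)) \<in> mod_hom A L U'" by (rule mod_hom_comp[OF u(1) U'(2)])
  have "\<not> split_mono A L U' (\<lambda>x. \<phi> (u x))"
  proof
    assume "split_mono A L U' (\<lambda>x. \<phi> (u x))"
    then obtain r where r: "r \<in> mod_hom A U' L" "\<forall>x\<in>carrier L. r (\<phi> (u x)) = x" unfolding split_mono_def by blast
    then have "split_mono A L U u"
      unfolding split_mono_def using u(1) by (intro conjI bexI[OF _ mod_hom_comp[OF U'(2) r(1)]])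
    then show False using u(2) by blast
  qed
  then have "\<exists>v \<in> mod_hom A E U'. \<forall>x\<in>carrier L. v (f x) = \<phi> (u x)"
    using conjunct2[OF conjunct2[OF las[unfolded left_almost_split_def]], rule_format, of U' "\<lambda>x. \<phi> (u x)"]
      U'(1) u' by simp
  then obtain v where v: "v \<in> mod_hom A E U'" "\<forall>x\<in>carrier L. v (f x) = \<phi> (u x)" by (rule bexE)
  have "\<forall>x\<in>carrier L. \<psi> (v (f x)) = u x" using v(2) U'(4)[OF mod_hom_closed[OF u(1)]] by simp
  then show ?thesis by (intro bexI[OF _ mod_hom_comp[OF v(1) U'(3)]])
qed

context artin_alg
begin

lemma local_module_image:
  assumes P: "left_module A P" "local_module P" and N: "left_module A N" "carrier N \<noteq> {\<zero>\<^bsub>N\<^esub>}"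
    and p: "p \<in> mod_hom A P N" "p ` carrier P = carrier N"
  shows "local_module N"
proof -
  interpret P: left_module A P by (rule P(1))
  have "X \<subseteq> radical_of N (carrier N)" if X: "submodule X A N" "X \<noteq> carrier N" for X
  proof -
    let ?Y = "{x \<in> carrier P. p x \<in> X}"
    have Y: "submodule ?Y A P" by (rule mod_hom_preimage_submodule[OF P(1) N(1) p(1) P.submodule_carrier X(1)])
    have "X \<subseteq> p ` carrier P" using submodule_subset[OF X(1)] p(2) by simp
    then have XY: "p ` ?Y = X" by auto
    have "?Y \<noteq> carrier P" using XY p(2) X(2) by auto
    then have "?Y \<subseteq> radical_of P (carrier P)" using P(2) Y unfolding local_module_def by blast
    then have "p ` ?Y \<subseteq> p ` radical_of P (carrier P)" by (rule image_mono)
    then show ?thesis unfolding XY radical_of_image[OF P(1) N(1) p(1) subset_refl] p(2) .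
  qed
  then show ?thesis unfolding local_module_def using N(2) by blast
qed

text \<open>
  The endomorphism lifts to an endomorphism \<open>w\<close> of \<open>P\<close>, which cannot
  map into the radical and so is bijective. It maps the kernel of \<open>P \<rightarrow>
  N\<close> into itself, and by the chain condition onto itself. So nothing outside the kernel
  is sent into it.
\<close>

lemma quotient_surj_endo_inj:
  assumes P: "projective_in_mod A P" "local_module P" and N: "fg_left_module A N" "carrier N \<noteq> {\<zero>\<^bsub>N\<^esub>}"
    and p: "p \<in> mod_hom A P N" "p ` carrier P = carrier N"
    and t: "t \<in> mod_hom A N N" "t ` carrier N = carrier N"
  shows "inj_on t (carrier N)"
proof -
  have Pfg: "fg_left_module A P" using P(1) by (simp add: projective_in_mod_def)
  have Pm: "left_module A P" and Nm: "left_module A N" using Pfg N(1) by (simp_all add: fg_left_module_def)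
  interpret P: left_module A P by (rule Pm)
  interpret N: left_module A N by (rule Nm)
  from projective_lift[OF P(1) Pfg N(1) p mod_hom_comp[OF p(1) t(1)]]
  obtain w where w: "w \<in> mod_hom A P P" "\<forall>x\<in>carrier P. p (w x) = t (p x)" by blast
  have ww: "p ` w ` carrier P = carrier N"
  proof -
    have "p ` w ` carrier P = t ` p ` carrier P" using w(2) by (simp add: image_image)
    then show ?thesis using p(2) t(2) by simp
  qed
  have "w ` carrier P = carrier P"
  proof (rule ccontr)
    assume "w ` carrier P \<noteq> carrier P"
    then have "w ` carrier P \<subseteq> radical_of P (carrier P)"
      using P(2) mod_hom_image_submodule[OF Pm Pm w(1) P.submodule_carrier] unfolding local_module_def by blast
    then have "p ` w ` carrier P \<subseteq> p ` radical_of P (carrier P)" by (rule image_mono)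
    then have "carrier N \<subseteq> radical_of N (carrier N)"
      unfolding ww radical_of_image[OF Pm Nm p(1) subset_refl] p(2) .
    then show False using local_module_radical_neq[OF Nm local_module_image[OF Pm P(2) Nm N(2) p]] by blast
  qed
  then have winj: "inj_on w (carrier P)" by (rule local_projective_surj_endo_inj[OF P w(1)])
  let ?K = "{x \<in> carrier P. p x = \<zero>\<^bsub>N\<^esub>}"
  have K: "submodule ?K A P" by (rule mod_hom_kernel_submodule[OF Pm Nm p(1)])
  have wKK: "w ` ?K = ?K"
  proof (rule injective_stable_endo_surj[OF Pfg stable_submodule[OF K]])
    show "w x \<in> ?K" if "x \<in> ?K" for x
      using that w(2) mod_hom_closed[OF w(1)] mod_hom_zero[OF Nm Nm t(1)] by simp
    show "inj_on w ?K" by (rule inj_on_subset[OF winj]) blast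
  qed (simp_all add: mod_hom_add[OF w(1)] mod_hom_smult[OF w(1)])
  have wK: "x \<in> ?K" if x: "x \<in> carrier P" "w x \<in> ?K" for x
  proof -
    have "w x \<in> w ` ?K" unfolding wKK by (rule x(2))
    then obtain k where k: "k \<in> ?K" "w x = w k" by (rule imageE)
    then have "x = k" using inj_onD[OF winj, of x k] x(1) by simp
    then show "x \<in> ?K" using k(1) by simp
  qed
  have "x = \<zero>\<^bsub>N\<^esub>" if x: "x \<in> carrier N" "t x = \<zero>\<^bsub>N\<^esub>" for x
  proof -
    obtain y where y: "y \<in> carrier P" "x = p y" using x(1) p(2) by blast
    then have "w y \<in> ?K" using w(2) x(2) mod_hom_closed[OF w(1)] by simp
    then show ?thesis using wK[OF y(1)] y(2) by simp
  qed
  then show ?thesis using mod_hom_inj_iff[OF Nm Nm t(1)] by blast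
qed

text \<open>
  Let \<open>v : V \<rightarrow> N\<close> not be a split epimorphism, and let \<open>X\<close>
  be the pullback of \<open>g\<close> and \<open>v\<close>, an extension of \<open>V\<close> by
  \<open>L\<close>. If the extension splits, \<open>v\<close> lifts to \<open>E\<close>.
  Otherwise the inclusion of \<open>L\<close> into \<open>X\<close> extends to \<open>E\<close>
  by the left property. The resulting endomorphism \<open>t1\<close> of \<open>E\<close> fixes
  the image of \<open>L\<close> and induces an endomorphism \<open>\<theta>\<close> of
  \<open>N\<close> that factors through \<open>v\<close>. If \<open>\<theta>\<close> is onto, it
  is bijective and \<open>v\<close> splits. If not, it maps into the radical and is nilpotent,
  so a power of \<open>t1\<close> retracts \<open>E\<close> onto the image of \<open>L\<close>
  and \<open>f\<close> splits. Both are excluded.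
\<close>

lemma right_almost_split_if_left:
  fixes L :: "('a, 'l, 'u) module_scheme" and E :: "('a, 'e, 'v) module_scheme" and N :: "('a, 'n, 'w) module_scheme"
  assumes L: "left_module A L" and E: "fg_left_module A E" and N: "left_module A N"
    and ex: "short_exact A L E N f g" and las: "left_almost_split A L E f"
    and loc: "local_module N"
    and endo: "\<And>t. t \<in> mod_hom A N N \<Longrightarrow> t ` carrier N = carrier N \<Longrightarrow> inj_on t (carrier N)"
  shows "right_almost_split A E N g"
proof -
  have Em: "left_module A E" using E by (simp add: fg_left_module_def)
  interpret L: left_module A L by (rule L)
  interpret E: left_module A E by (rule Em)
  interpret N: left_module A N by (rule N)
  have f: "f \<in> mod_hom A L E" "inj_on f (carrier L)" and g: "g \<in> mod_hom A E N" "g ` carrier E = carrier N"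
    and ker: "f ` carrier L = {x \<in> carrier E. g x = \<zero>\<^bsub>N\<^esub>}"
    using ex unfolding short_exact_def a_kernel_def' by auto
  have nsf: "\<not> split_mono A L E f" using las by (simp add: left_almost_split_def)
  have gf: "g (f x) = \<zero>\<^bsub>N\<^esub>" if "x \<in> carrier L" for x using that ker by blast
  have lift: "\<exists>w \<in> mod_hom A V E. \<forall>x\<in>carrier V. g (w x) = v x"
    if V: "fg_left_module A V" and v: "v \<in> mod_hom A V N" and nsv: "\<not> split_epi A V N v" for V :: "'a mod_obj" and v
  proof -
    have Vm: "left_module A V" using V by (simp add: fg_left_module_def)
    interpret V: left_module A V by (rule Vm)
    let ?D = "direct_sum_module E V"
    have Dfg: "fg_left_module A ?D" by (rule fg_direct_sum[OF E V])
    have Dm: "left_module A ?D" by (rule direct_sum_left_module[OF Em Vm])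
    interpret D: left_module A ?D by (rule Dm)
    let ?X = "{z \<in> carrier ?D. g (fst z) \<ominus>\<^bsub>N\<^esub> v (snd z) = \<zero>\<^bsub>N\<^esub>}"
    have X: "submodule ?X A ?D"
      by (rule mod_hom_kernel_submodule[OF Dm N mod_hom_diff_hom[OF N mod_hom_comp[OF direct_sum_homs(3)[OF Em Vm] g(1)]
          mod_hom_comp[OF direct_sum_homs(4)[OF Em Vm] v]]])
    have Xiff: "(x, y) \<in> ?X \<longleftrightarrow> x \<in> carrier E \<and> y \<in> carrier V \<and> g x = v y" for x y
      using N.diff_eq_zero_iff mod_hom_closed[OF g(1)] mod_hom_closed[OF v] by (auto simp: direct_sum_simps)
    let ?PB = "?D\<lparr>carrier := ?X\<rparr>"
    have PBfg: "fg_left_module A ?PB" by (rule fg_submodule[OF Dfg X])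
    have PBm: "left_module A ?PB" by (rule D.restrict_left_module[OF X])
    have fst: "fst \<in> mod_hom A ?PB E" and snd: "snd \<in> mod_hom A ?PB V"
      using mod_hom_restrict[OF direct_sum_homs(3)[OF Em Vm] submodule_subset[OF X]]
        mod_hom_restrict[OF direct_sum_homs(4)[OF Em Vm] submodule_subset[OF X]] by auto
    let ?f = "\<lambda>x. (f x, \<zero>\<^bsub>V\<^esub>)"
    have "?f \<in> mod_hom A L ?D" by (rule mod_hom_comp[OF f(1) direct_sum_homs(1)[OF Em Vm]])
    moreover have fX: "?f x \<in> ?X" if "x \<in> carrier L" for x
      unfolding Xiff using that mod_hom_closed[OF f(1)] gf mod_hom_zero[OF Vm N v] by simp
    ultimately have f': "?f \<in> mod_hom A L ?PB" by (intro mod_hom_corestrict) auto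
    show ?thesis
    proof (cases "split_mono A L ?PB ?f")
      case True
      then obtain r where r: "r \<in> mod_hom A ?PB L" "\<forall>x\<in>carrier L. r (?f x) = x" unfolding split_mono_def by blast
      let ?h = "\<lambda>z. fst z \<ominus>\<^bsub>E\<^esub> f (r z)"
      have h: "?h \<in> mod_hom A ?PB E" by (rule mod_hom_diff_hom[OF Em fst mod_hom_comp[OF r(1) f(1)]])
      have surj: "snd ` carrier ?PB = carrier V"
      proof
        show "snd ` carrier ?PB \<subseteq> carrier V" using mod_hom_closed[OF snd] by blast
        show "carrier V \<subseteq> snd ` carrier ?PB"
        proof
          fix y assume y: "y \<in> carrier V"
          then obtain x where "x \<in> carrier E" "g x = v y" using mod_hom_closed[OF v y] g(2) by (metis imageE)
          then have "(x, y) \<in> ?X" unfolding Xiff using y by blast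
          then show "y \<in> snd ` carrier ?PB" by force
        qed
      qed
      have hk: "?h z = \<zero>\<^bsub>E\<^esub>" if z: "z \<in> carrier ?PB" and z0: "snd z = \<zero>\<^bsub>V\<^esub>" for z
      proof -
        obtain x where x: "z = (x, \<zero>\<^bsub>V\<^esub>)" using z0 by (cases z) auto
        have "(x, \<zero>\<^bsub>V\<^esub>) \<in> ?X" using z unfolding x by simp
        then have "x \<in> carrier E" "g x = v \<zero>\<^bsub>V\<^esub>" unfolding Xiff by auto
        then have xE: "x \<in> carrier E" "g x = \<zero>\<^bsub>N\<^esub>" using mod_hom_zero[OF Vm N v] by simp_all
        then have "x \<in> f ` carrier L" unfolding ker by blast
        then obtain l where l: "l \<in> carrier L" "x = f l" by blast
        then show ?thesis using r(2) x mod_hom_closed[OF f(1) l(1)] E.diff_self by simp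
      qed
      from mod_hom_factor[OF PBm Vm Em snd surj h hk] obtain w where
        w: "w \<in> mod_hom A V E" "\<forall>z\<in>carrier ?PB. w (snd z) = ?h z" by blast
      have "g (w y) = v y" if y: "y \<in> carrier V" for y
      proof -
        obtain z where z: "z \<in> carrier ?PB" "y = snd z" using y surj by blast
        define x where "x = fst z"
        have "(x, y) \<in> ?X" using z(1) unfolding x_def z(2) by simp
        then have xE: "x \<in> carrier E" "g x = v y" unfolding Xiff by auto
        have rz: "r z \<in> carrier L" by (rule mod_hom_closed[OF r(1) z(1)])
        have "g (w y) = g (x \<ominus>\<^bsub>E\<^esub> f (r z))" using bspec[OF w(2) z(1)] unfolding x_def z(2) by simp
        also have "\<dots> = g x \<ominus>\<^bsub>N\<^esub> g (f (r z))" by (rule mod_hom_diff[OF Em N g(1) xE(1) mod_hom_closed[OF f(1) rz]])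
        also have "\<dots> = v y" using gf[OF rz] xE(2) mod_hom_closed[OF v y] by (simp add: a_minus_def)
        finally show ?thesis .
      qed
      then show ?thesis using w(1) by blast
    next
      case False
      from left_almost_split_extends[OF las PBfg f' this]
      obtain t where t: "t \<in> mod_hom A E ?PB" "\<forall>x\<in>carrier L. t (f x) = ?f x" by blast
      define t1 where "t1 = (\<lambda>x. fst (t x))"
      define t2 where "t2 = (\<lambda>x. snd (t x))"
      have t1: "t1 \<in> mod_hom A E E" unfolding t1_def by (rule mod_hom_comp[OF t(1) fst])
      have t2: "t2 \<in> mod_hom A E V" unfolding t2_def by (rule mod_hom_comp[OF t(1) snd])
      have t1f: "t1 (f x) = f x" and t2f: "t2 (f x) = \<zero>\<^bsub>V\<^esub>" if "x \<in> carrier L" for x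
        using t(2) that unfolding t1_def t2_def by auto
      have gt1: "g (t1 x) = v (t2 x)" if x: "x \<in> carrier E" for x
      proof -
        have "(t1 x, t2 x) \<in> ?X" unfolding t1_def t2_def using mod_hom_closed[OF t(1) x] by simp
        then show ?thesis unfolding Xiff by blast
      qed
      have "t2 x = \<zero>\<^bsub>V\<^esub>" if x: "x \<in> carrier E" "g x = \<zero>\<^bsub>N\<^esub>" for x
      proof -
        have "x \<in> f ` carrier L" unfolding ker using x by blast
        then show ?thesis using t2f by blast
      qed
      from mod_hom_factor[OF Em N Vm g t2 this] obtain \<tau> where
        \<tau>: "\<tau> \<in> mod_hom A N V" "\<forall>x\<in>carrier E. \<tau> (g x) = t2 x" by blast
      let ?\<theta> = "\<lambda>x. v (\<tau> x)"
      have \<theta>: "?\<theta> \<in> mod_hom A N N" by (rule mod_hom_comp[OF \<tau>(1) v])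
      have \<theta>g: "?\<theta> (g x) = g (t1 x)" if "x \<in> carrier E" for x using \<tau>(2) gt1 that by simp
      have False
      proof (cases "?\<theta> ` carrier N = carrier N")
        case True
        have "bij_betw ?\<theta> (carrier N) (carrier N)" using endo[OF \<theta> True] True by (simp add: bij_betw_def)
        from mod_hom_inverse[OF N N \<theta> this] obtain \<rho> where
          \<rho>: "\<rho> \<in> mod_hom A N N" "\<forall>y\<in>carrier N. ?\<theta> (\<rho> y) = y" by (elim bexE conjE)
        have "split_epi A V N v"
          unfolding split_epi_def using v \<rho>(2) by (intro conjI bexI[OF _ mod_hom_comp[OF \<rho>(1) \<tau>(1)]])
        then show False using nsv by blast
      next
        case False
        then have \<theta>rad: "?\<theta> ` carrier N \<subseteq> radical_of N (carrier N)"
          using loc mod_hom_image_submodule[OF N N \<theta> N.submodule_carrier] unfolding local_module_def by blast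
        have pow: "(t1 ^^ n) \<in> mod_hom A E E \<and> (\<forall>x\<in>carrier E. g ((t1 ^^ n) x) \<in> rads N n (carrier N)) \<and>
            (\<forall>x\<in>carrier L. (t1 ^^ n) (f x) = f x)" for n
        proof (induction n)
          case 0
          then show ?case using mod_hom_closed[OF g(1)] by (simp add: mod_hom_def)
        next
          case (Suc n)
          have "?\<theta> ` rads N n (carrier N) = rads N n (?\<theta> ` carrier N)"
            by (rule rads_image[OF N N \<theta> N.submodule_carrier])
          also have "\<dots> \<subseteq> rads N n (radical_of N (carrier N))" by (rule rads_mono[OF \<theta>rad])
          finally have r: "?\<theta> ` rads N n (carrier N) \<subseteq> rads N (Suc n) (carrier N)" unfolding rads_Suc_right .
          have "g ((t1 ^^ Suc n) x) \<in> rads N (Suc n) (carrier N)" if x: "x \<in> carrier E" for x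
          proof -
            have "(t1 ^^ n) x \<in> carrier E" by (rule mod_hom_closed[OF conjunct1[OF Suc] x])
            then have "g ((t1 ^^ Suc n) x) = ?\<theta> (g ((t1 ^^ n) x))" using \<theta>g by simp
            then show ?thesis using r Suc x by auto
          qed
          moreover have "(t1 ^^ Suc n) \<in> mod_hom A E E"
            using mod_hom_comp[of "t1 ^^ n" A E E t1 E] Suc t1 by (simp add: comp_def)
          moreover have "\<forall>x\<in>carrier L. (t1 ^^ Suc n) (f x) = f x" using Suc t1f by simp
          ultimately show ?case by blast
        qed
        have "split_mono A L E f"
        proof (rule split_mono_if_endo[OF L Em f])
          show "(t1 ^^ loewy) \<in> mod_hom A E E" using pow by blast
          show "(t1 ^^ loewy) ` carrier E \<subseteq> f ` carrier L"
          proof (rule image_subsetI)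
            fix x assume x: "x \<in> carrier E"
            have "g ((t1 ^^ loewy) x) \<in> {\<zero>\<^bsub>N\<^esub>}"
              using pow[of loewy] x unfolding rads_loewy[OF N N.submodule_carrier] by blast
            moreover have "(t1 ^^ loewy) x \<in> carrier E" by (rule mod_hom_closed[OF conjunct1[OF pow] x])
            ultimately show "(t1 ^^ loewy) x \<in> f ` carrier L" unfolding ker by blast
          qed
          show "(t1 ^^ loewy) (f x) = f x" if "x \<in> carrier L" for x using pow that by blast
        qed
        then show False using nsf by blast
      qed
      then show ?thesis by blast
    qed
  qed
  have "\<not> split_epi A E N g" using split_epi_imp_split_mono[OF L Em N ex] nsf by blast
  then show ?thesis unfolding right_almost_split_def using g(1) lift by blast
qed

end

section \<open>The almost split sequence\<close>

lemma mod_hom_via_surj: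
  assumes p: "p \<in> mod_hom A M Q" "p ` carrier M = carrier Q" and hp: "(\<lambda>x. h (p x)) \<in> mod_hom A M K"
  shows "h \<in> mod_hom A Q K"
proof (rule mod_homI)
  show "h y \<in> carrier K" if "y \<in> carrier Q" for y
    using that mod_hom_closed[OF hp] unfolding p(2)[symmetric] by blast
  fix y assume "y \<in> carrier Q"
  then obtain x where x: "x \<in> carrier M" "y = p x" unfolding p(2)[symmetric] by blast
  show "h (c \<odot>\<^bsub>Q\<^esub> y) = c \<odot>\<^bsub>K\<^esub> h y" if "c \<in> carrier A" for c
    using mod_hom_smult[OF hp that x(1)] mod_hom_smult[OF p(1) that x(1)] x(2) by simp
  fix y' assume "y' \<in> carrier Q"
  then obtain x' where x': "x' \<in> carrier M" "y' = p x'" unfolding p(2)[symmetric] by blast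
  show "h (y \<oplus>\<^bsub>Q\<^esub> y') = h y \<oplus>\<^bsub>K\<^esub> h y'"
    using mod_hom_add[OF hp x(1) x'(1)] mod_hom_add[OF p(1) x(1) x'(1)] x(2) x'(2) by simp
qed

lemma coset_restrict: "K +>\<^bsub>M\<lparr>carrier := X\<rparr>\<^esub> x = K +>\<^bsub>M\<^esub> x"
  by (simp add: a_r_coset_def')

lemma (in left_module) canonical_projection_coset:
  assumes N: "submodule N R M" and N': "submodule N' R M" and "N \<subseteq> N'" and x: "x \<in> carrier M"
  shows "canonical_projection M N' (N +>\<^bsub>M\<^esub> x) = N' +>\<^bsub>M\<^esub> x"
proof -
  note c = submodule_mem[OF N] submodule_mem[OF N']
  have "z \<in> N' +>\<^bsub>M\<^esub> x" if "z \<in> N' <+>\<^bsub>M\<^esub> (N +>\<^bsub>M\<^esub> x)" for z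
  proof -
    obtain m y where my: "m \<in> N'" "y \<in> N +>\<^bsub>M\<^esub> x" "z = m \<oplus>\<^bsub>M\<^esub> y"
      using \<open>z \<in> N' <+>\<^bsub>M\<^esub> (N +>\<^bsub>M\<^esub> x)\<close> unfolding mem_set_add by blast
    from my(2) obtain n where "n \<in> N" "y = n \<oplus>\<^bsub>M\<^esub> x" unfolding mem_a_r_coset by blast
    with my have mn: "m \<in> N'" "n \<in> N" "z = m \<oplus>\<^bsub>M\<^esub> (n \<oplus>\<^bsub>M\<^esub> x)" by simp_all
    then have "z = (m \<oplus>\<^bsub>M\<^esub> n) \<oplus>\<^bsub>M\<^esub> x" using c x by (simp add: M.a_assoc)
    moreover have "m \<oplus>\<^bsub>M\<^esub> n \<in> N'" using submodule_add[OF N' mn(1)] mn(2) \<open>N \<subseteq> N'\<close> by blast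
    ultimately show ?thesis unfolding mem_a_r_coset by blast
  qed
  moreover have "z \<in> N' <+>\<^bsub>M\<^esub> (N +>\<^bsub>M\<^esub> x)" if "z \<in> N' +>\<^bsub>M\<^esub> x" for z
  proof -
    obtain m where m: "m \<in> N'" "z = m \<oplus>\<^bsub>M\<^esub> x" using \<open>z \<in> N' +>\<^bsub>M\<^esub> x\<close> unfolding mem_a_r_coset by blast
    then have "z = m \<oplus>\<^bsub>M\<^esub> (\<zero>\<^bsub>M\<^esub> \<oplus>\<^bsub>M\<^esub> x)" using x by simp
    moreover have "\<zero>\<^bsub>M\<^esub> \<oplus>\<^bsub>M\<^esub> x \<in> N +>\<^bsub>M\<^esub> x" using submodule_zero[OF N] unfolding mem_a_r_coset by blast
    ultimately show ?thesis using m(1) unfolding mem_set_add by blast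
  qed
  ultimately show ?thesis unfolding canonical_projection_def by blast
qed

text \<open>
  The hypotheses of the theorem for \<open>s = t + 1\<close>, with the radical series in
  iterated form and with locality of \<open>P\<close> in place of indecomposability.
\<close>

locale uniserial_top = artin_alg R A
  for R :: "('r, 'x) ring_scheme" and A :: "('r, 'a, 'y) module_scheme" +
  fixes P :: "('a, 'm, 'z) module_scheme" and M :: "'m set" and t :: nat
    and I :: "('a, 'i, 'u) module_scheme" and \<iota> :: "'m set \<Rightarrow> 'i"
  assumes P_projective: "projective_in_mod A P" and P_local: "local_module P"
    and M: "submodule M A P" "M \<noteq> carrier P"
    and top_uniserial: "uniserial A (quotient_module (P\<lparr>carrier := M\<rparr>) (rads P (Suc t) M))"
    and not_deep: "\<not> rads P t M \<subseteq> rads P (Suc (Suc t)) (carrier P)"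
    and envelope: "injective_envelope A
      ((quotient_module (P\<lparr>carrier := M\<rparr>) (rads P (Suc t) M))
        \<lparr>carrier := socle A (quotient_module (P\<lparr>carrier := M\<rparr>) (rads P (Suc t) M))\<rparr>) I \<iota>"
    and V_uniserial: "uniserial A (I\<lparr>carrier := soc A (Suc (Suc t)) I\<rparr>)"
begin

definition K where "K = rads P (Suc t) M"
definition K' where "K' = rads P t M"
abbreviation Mm where "Mm \<equiv> P\<lparr>carrier := M\<rparr>"
abbreviation L where "L \<equiv> quotient_module Mm K"
abbreviation E1 where "E1 \<equiv> quotient_module P K"
abbreviation E2 where "E2 \<equiv> quotient_module Mm K'"
abbreviation N where "N \<equiv> quotient_module P K'"
abbreviation p where "p \<equiv> \<lambda>x. K +>\<^bsub>P\<^esub> x"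
abbreviation p' where "p' \<equiv> \<lambda>x. K' +>\<^bsub>P\<^esub> x"

lemma P_fg: "fg_left_module A P"
  using P_projective by (simp add: projective_in_mod_def)

lemma P_module: "left_module A P"
  using P_fg by (simp add: fg_left_module_def)

sublocale P: left_module A P by (rule P_module)

lemma M_fg: "fg_left_module A Mm" by (rule fg_submodule[OF P_fg M(1)])

sublocale Mm: left_module A Mm by (rule P.restrict_left_module[OF M(1)])

lemma K_sub: "submodule K A P" "submodule K' A P"
  unfolding K_def K'_def by (rule rads_submodule[OF P_module M(1)])+

lemma K_subset: "K \<subseteq> K'" "K' \<subseteq> M" "K \<subseteq> M"
  using rads_Suc_subset[OF P_module M(1)] rads_subset[OF P_module M(1)] unfolding K_def K'_def by blast+

lemma K_sub_M: "submodule K A Mm" "submodule K' A Mm"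
  unfolding P.submodule_restrict_iff[OF M(1)] using K_sub K_subset by blast+

lemma L_fg: "fg_left_module A L" and E1_fg: "fg_left_module A E1"
  and E2_fg: "fg_left_module A E2" and N_fg: "fg_left_module A N"
  by (rule fg_quotient[OF M_fg K_sub_M(1)] fg_quotient[OF P_fg K_sub(1)]
      fg_quotient[OF M_fg K_sub_M(2)] fg_quotient[OF P_fg K_sub(2)])+

sublocale L: left_module A L by (rule Mm.quotient_left_module[OF K_sub_M(1)])
sublocale E1: left_module A E1 by (rule P.quotient_left_module[OF K_sub(1)])
sublocale E2: left_module A E2 by (rule Mm.quotient_left_module[OF K_sub_M(2)])
sublocale N: left_module A N by (rule P.quotient_left_module[OF K_sub(2)])

lemmas mods = P.left_module_axioms Mm.left_module_axioms L.left_module_axioms E1.left_module_axioms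
  E2.left_module_axioms N.left_module_axioms

lemma proj_homs: "p \<in> mod_hom A Mm L" "p \<in> mod_hom A P E1" "p' \<in> mod_hom A Mm E2" "p' \<in> mod_hom A P N"
  using Mm.quotient_proj_hom[OF K_sub_M(1)] P.quotient_proj_hom[OF K_sub(1)]
    Mm.quotient_proj_hom[OF K_sub_M(2)] P.quotient_proj_hom[OF K_sub(2)] by (simp_all add: coset_restrict)

lemma proj_surj: "p ` M = carrier L" "p ` carrier P = carrier E1" "p' ` M = carrier E2" "p' ` carrier P = carrier N"
  using Mm.quotient_proj_surj[of K] P.quotient_proj_surj[of K]
    Mm.quotient_proj_surj[of K'] P.quotient_proj_surj[of K'] by (simp_all add: coset_restrict)

lemma proj_zero: "x \<in> carrier P \<Longrightarrow> p x = K \<longleftrightarrow> x \<in> K" "x \<in> carrier P \<Longrightarrow> p' x = K' \<longleftrightarrow> x \<in> K'"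
  using P.coset_zero_iff[OF K_sub(1)] P.coset_zero_iff[OF K_sub(2)] by blast+

lemma M_mem: "x \<in> M \<Longrightarrow> x \<in> carrier P" by (rule submodule_mem[OF M(1)])

abbreviation q1 where "q1 \<equiv> canonical_projection Mm K'"
abbreviation q2 where "q2 \<equiv> canonical_projection P K'"

lemma canonical: "x \<in> M \<Longrightarrow> q1 (p x) = p' x" "x \<in> carrier P \<Longrightarrow> q2 (p x) = p' x"
  using Mm.canonical_projection_coset[OF K_sub_M K_subset(1)] P.canonical_projection_coset[OF K_sub K_subset(1)]
  by (simp_all add: coset_restrict)

lemma incl_L: "(\<lambda>X. X) \<in> mod_hom A L E1"
proof (rule mod_hom_via_surj[OF proj_homs(1)])
  show "p ` carrier Mm = carrier L" using proj_surj(1) by simp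
  show "p \<in> mod_hom A Mm E1" by (rule mod_hom_restrict[OF proj_homs(2) submodule_subset[OF M(1)]])
qed

lemma incl_E2: "(\<lambda>X. X) \<in> mod_hom A E2 N"
proof (rule mod_hom_via_surj[OF proj_homs(3)])
  show "p' ` carrier Mm = carrier E2" using proj_surj(3) by simp
  show "p' \<in> mod_hom A Mm N" by (rule mod_hom_restrict[OF proj_homs(4) submodule_subset[OF M(1)]])
qed

lemma q1_hom: "q1 \<in> mod_hom A L E2"
proof (rule mod_hom_via_surj[OF proj_homs(1)])
  show "p ` carrier Mm = carrier L" using proj_surj(1) by simp
  show "(\<lambda>x. q1 (p x)) \<in> mod_hom A Mm E2"
    using proj_homs(3) canonical(1) by (simp add: mod_hom_def Pi_def P.M.add.m_closed submodule_add[OF M(1)] submodule_smult[OF M(1)])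
qed

lemma q2_hom: "q2 \<in> mod_hom A E1 N"
proof (rule mod_hom_via_surj[OF proj_homs(2) proj_surj(2)])
  show "(\<lambda>x. q2 (p x)) \<in> mod_hom A P N"
    using proj_homs(4) canonical(2) by (simp add: mod_hom_def Pi_def)
qed

lemma q1_surj: "q1 ` carrier L = carrier E2"
proof -
  have "q1 ` p ` M = p' ` M" using canonical(1) by (simp add: image_image)
  then show ?thesis unfolding proj_surj(1,3) .
qed

definition f where "f = (\<lambda>X. (X, q1 X))"
definition g where "g = (\<lambda>(Y, Z). (\<ominus>\<^bsub>N\<^esub> q2 Y) \<oplus>\<^bsub>N\<^esub> Z)"
abbreviation E where "E \<equiv> direct_sum_module E1 E2"

lemma E_fg: "fg_left_module A E" by (rule fg_direct_sum[OF E1_fg E2_fg])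

sublocale E: left_module A E by (rule direct_sum_left_module[OF mods(4,5)])

lemma f_hom: "f \<in> mod_hom A L E"
  unfolding f_def by (rule mod_hom_pair[OF incl_L q1_hom])

lemma g_hom: "g \<in> mod_hom A E N"
proof -
  have "g = (\<lambda>z. (\<ominus>\<^bsub>N\<^esub> q2 (fst z)) \<oplus>\<^bsub>N\<^esub> snd z)" unfolding g_def by (auto simp: fun_eq_iff)
  moreover have "\<dots> \<in> mod_hom A E N"
    by (intro mod_hom_sum_hom[OF mods(6)] mod_hom_minus_hom[OF mods(6)]
        mod_hom_comp[OF direct_sum_homs(3)[OF mods(4,5)] q2_hom] mod_hom_comp[OF direct_sum_homs(4)[OF mods(4,5)] incl_E2])
  ultimately show ?thesis by simp
qed

lemma exact: "short_exact A L E N f g"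
proof -
  have pc: "p' x \<in> carrier N" if "x \<in> carrier P" for x using mod_hom_closed[OF proj_homs(4) that] .
  have "f ` carrier L = {z \<in> carrier E. g z = \<zero>\<^bsub>N\<^esub>}"
  proof
    show "f ` carrier L \<subseteq> {z \<in> carrier E. g z = \<zero>\<^bsub>N\<^esub>}"
    proof
      fix z assume "z \<in> f ` carrier L"
      then obtain x where x: "x \<in> M" "z = f (p x)" unfolding proj_surj(1)[symmetric] by blast
      have "z \<in> carrier E" using mod_hom_closed[OF f_hom] mod_hom_closed[OF proj_homs(1)] x by simp
      moreover have "g z = \<ominus>\<^bsub>N\<^esub> p' x \<oplus>\<^bsub>N\<^esub> p' x"
        unfolding x(2) f_def g_def using canonical M_mem[OF x(1)] x(1) by simp
      ultimately show "z \<in> {z \<in> carrier E. g z = \<zero>\<^bsub>N\<^esub>}" using N.M.l_neg[OF pc[OF M_mem[OF x(1)]]] by simp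
    qed
    show "{z \<in> carrier E. g z = \<zero>\<^bsub>N\<^esub>} \<subseteq> f ` carrier L"
    proof
      fix z assume z: "z \<in> {z \<in> carrier E. g z = \<zero>\<^bsub>N\<^esub>}"
      then obtain Y Z where YZ: "z = (Y, Z)" "Y \<in> carrier E1" "Z \<in> carrier E2" by (auto simp: direct_sum_simps)
      obtain x where x: "x \<in> carrier P" "Y = p x" using YZ(2) unfolding proj_surj(2)[symmetric] by blast
      obtain m where m: "m \<in> M" "Z = p' m" using YZ(3) unfolding proj_surj(3)[symmetric] by blast
      have "\<ominus>\<^bsub>N\<^esub> p' x \<oplus>\<^bsub>N\<^esub> p' m = \<zero>\<^bsub>N\<^esub>"
        using z unfolding YZ(1) g_def x(2) m(2) using canonical(2)[OF x(1)] by simp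
      then have "\<ominus>\<^bsub>N\<^esub> (\<ominus>\<^bsub>N\<^esub> p' x) = p' m"
        using N.M.minus_equality[of "p' m" "\<ominus>\<^bsub>N\<^esub> p' x"] N.M.a_comm[of "p' m" "\<ominus>\<^bsub>N\<^esub> p' x"]
          N.M.a_inv_closed[OF pc[OF x(1)]] pc[OF M_mem[OF m(1)]] pc[OF x(1)] by metis
      then have eq: "p' x = p' m" using N.M.minus_minus[OF pc[OF x(1)]] by simp
      then have "x \<ominus>\<^bsub>P\<^esub> m \<in> K'" using P.coset_eq_iff[OF K_sub(2) x(1) M_mem[OF m(1)]] by blast
      then have "(x \<ominus>\<^bsub>P\<^esub> m) \<oplus>\<^bsub>P\<^esub> m \<in> M" using K_subset(2) m(1) by (intro submodule_add[OF M(1)]) auto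
      then have xM: "x \<in> M" using P.diff_add_cancel[OF x(1) M_mem[OF m(1)]] by simp
      have "z = f (p x)" unfolding f_def YZ(1) x(2) m(2) eq[symmetric] using canonical(1)[OF xM] by simp
      moreover have "p x \<in> carrier L" unfolding proj_surj(1)[symmetric] using xM by blast
      ultimately show "z \<in> f ` carrier L" by blast
    qed
  qed
  moreover have "g ` carrier E = carrier N"
  proof
    show "g ` carrier E \<subseteq> carrier N" using mod_hom_closed[OF g_hom] by blast
    show "carrier N \<subseteq> g ` carrier E"
    proof
      fix y assume "y \<in> carrier N"
      then obtain x where x: "x \<in> carrier P" "y = p' x" unfolding proj_surj(4)[symmetric] by blast
      let ?z = "(p (\<ominus>\<^bsub>P\<^esub> x), \<zero>\<^bsub>E2\<^esub>)"
      have "?z \<in> carrier E" unfolding direct_sum_simps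
        using mod_hom_closed[OF proj_homs(2), of "\<ominus>\<^bsub>P\<^esub> x"] E2.M.zero_closed x(1) by blast
      moreover have "g ?z = y"
      proof -
        have "g ?z = \<ominus>\<^bsub>N\<^esub> p' (\<ominus>\<^bsub>P\<^esub> x) \<oplus>\<^bsub>N\<^esub> \<zero>\<^bsub>N\<^esub>"
          unfolding g_def using canonical(2)[of "\<ominus>\<^bsub>P\<^esub> x"] x(1) by simp
        also have "\<dots> = \<ominus>\<^bsub>N\<^esub> p' (\<ominus>\<^bsub>P\<^esub> x)" by (rule N.M.r_zero) (use pc x(1) in simp)
        also have "\<dots> = \<ominus>\<^bsub>N\<^esub> (\<ominus>\<^bsub>N\<^esub> p' x)" using mod_hom_minus[OF mods(1,6) proj_homs(4) x(1)] by simp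
        also have "\<dots> = y" using N.M.minus_minus[OF pc[OF x(1)]] x(2) by simp
        finally show ?thesis .
      qed
      ultimately show "y \<in> g ` carrier E" by (intro image_eqI[of _ _ ?z]) simp_all
    qed
  qed
  moreover have "inj_on f (carrier L)" unfolding f_def inj_on_def by simp
  ultimately show ?thesis unfolding short_exact_def a_kernel_def' using f_hom g_hom by blast
qed

lemma L_uniserial: "uniserial A L"
  using top_uniserial unfolding K_def .

definition S where "S = p ` K'"

lemma rads_L: "rads L i (carrier L) = p ` rads P i M"
  using rads_image[OF mods(2,3) proj_homs(1) Mm.submodule_carrier, of i]
    rads_restrict[OF P_module M(1) M(1) subset_refl, of i] proj_surj(1) by simp

lemma rads_L_top: "rads L t (carrier L) = S"
  unfolding rads_L S_def K'_def ..

lemma p_zero: "x \<in> K \<Longrightarrow> p x = \<zero>\<^bsub>L\<^esub>"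
  using proj_zero(1)[of x] submodule_mem[OF K_sub(1)] by simp

lemma rads_L_Suc: "rads L (Suc t) (carrier L) = {\<zero>\<^bsub>L\<^esub>}"
  unfolding rads_L K_def[symmetric] using p_zero submodule_zero[OF K_sub(1)] by blast

lemma S_sub: "submodule S A L"
  unfolding rads_L_top[symmetric] by (rule rads_submodule[OF mods(3) L.submodule_carrier])

lemma M_rad: "M \<subseteq> radical_of P (carrier P)"
  using P_local M unfolding local_module_def by blast

lemma K'_rad: "K' \<subseteq> rads P (Suc t) (carrier P)"
  unfolding K'_def rads_Suc_right by (rule rads_mono[OF M_rad])

lemma K_rad: "K \<subseteq> rads P (Suc (Suc t)) (carrier P)"
  unfolding K_def rads_Suc_right[of "Suc t"] by (rule rads_mono[OF M_rad])

lemma S_nonzero: "S \<noteq> {\<zero>\<^bsub>L\<^esub>}"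
proof
  assume 0: "S = {\<zero>\<^bsub>L\<^esub>}"
  have "x \<in> K" if x: "x \<in> K'" for x
  proof -
    have "p x = K" using 0 x unfolding S_def by auto
    then show ?thesis using proj_zero(1) submodule_mem[OF K_sub(2) x] by blast
  qed
  then show False using K_rad not_deep unfolding K'_def by blast
qed

text \<open>
  The last nonzero term \<open>S\<close> of the radical series lies in the socle, and the socle
  of a uniserial module is simple.
\<close>

lemma socle_L_simple: "simple_module A (L\<lparr>carrier := socle A L\<rparr>)" and socle_L: "socle A L = S"
proof -
  have soc: "submodule (socle A L) A L" by (rule socle_submodule[OF mods(3)])
  have sub: "S \<subseteq> socle A L"
  proof
    fix y assume y: "y \<in> S"
    have "a \<odot>\<^bsub>L\<^esub> y = \<zero>\<^bsub>L\<^esub>" if a: "a \<in> J" for a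
    proof -
      have "a \<odot>\<^bsub>L\<^esub> y \<in> rads L (Suc t) (carrier L)"
        using radical_of_mem[OF mods(3) a y] by (simp add: rads_L_top)
      then show ?thesis unfolding rads_L_Suc by blast
    qed
    then show "y \<in> socle A L" unfolding socle_eq[OF mods(3)] using submodule_mem[OF S_sub y] by blast
  qed
  show simple: "simple_module A (L\<lparr>carrier := socle A L\<rparr>)"
  proof (rule uniserial_killed_imp_simple[OF L.restrict_left_module[OF soc]])
    show "uniserial A (L\<lparr>carrier := socle A L\<rparr>)"
      using L_uniserial unfolding uniserial_def L.submodule_restrict_iff[OF soc] by blast
    show "carrier (L\<lparr>carrier := socle A L\<rparr>) \<noteq> {\<zero>\<^bsub>L\<lparr>carrier := socle A L\<rparr>\<^esub>}"
      using sub S_nonzero submodule_zero[OF S_sub] by auto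
    show "a \<odot>\<^bsub>L\<lparr>carrier := socle A L\<rparr>\<^esub> u = \<zero>\<^bsub>L\<lparr>carrier := socle A L\<rparr>\<^esub>"
      if "a \<in> J" "u \<in> carrier (L\<lparr>carrier := socle A L\<rparr>)" for a u
      using that unfolding socle_eq[OF mods(3)] by simp
  qed
  show "socle A L = S"
    using simple S_nonzero S_sub sub unfolding L.simple_submodule_iff[OF soc] by blast
qed

lemma S_essential:
  assumes W: "submodule W A L" "W \<noteq> {\<zero>\<^bsub>L\<^esub>}" shows "S \<subseteq> W"
proof -
  have "W \<subseteq> S \<or> S \<subseteq> W" using L_uniserial W(1) S_sub unfolding uniserial_def by blast
  then show ?thesis
    using W socle_L_simple unfolding socle_L L.simple_submodule_iff[OF S_sub] by blast
qed

text \<open>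
  Choose \<open>e\<close> for the simple module \<open>S\<close> and let \<open>a = e m\<close>,
  where \<open>m\<close> represents a nonzero element of \<open>S\<close>. Since
  \<open>S\<close> is simple, a submodule of \<open>K'\<close> that contains \<open>a\<close>
  and \<open>K\<close> is all of \<open>K'\<close>. So \<open>a\<close> is outside
  \<open>rad\<^sup>t\<^sup>+\<^sup>2 P\<close>, which contains \<open>K\<close> but not
  \<open>K'\<close>. Moreover \<open>K' = A a + K\<close> with \<open>K = rad K'\<close>, and
  Nakayama's lemma gives \<open>K' = A a\<close>.
\<close>

lemma generator:
  obtains s0 e a where "uniserial_dual R A (L\<lparr>carrier := S\<rparr>) s0 e I \<iota> (Suc t) P a"
    "a \<in> K'" "p a \<noteq> \<zero>\<^bsub>L\<^esub>" "K' = cyclic_submodule A P a"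
proof -
  let ?S = "L\<lparr>carrier := S\<rparr>"
  have Sm: "left_module A ?S" by (rule L.restrict_left_module[OF S_sub])
  have simple: "simple_module A ?S" using socle_L_simple unfolding socle_L .
  have simpleD: "W = {\<zero>\<^bsub>L\<^esub>} \<or> W = S" if "submodule W A L" "W \<subseteq> S" for W
    using simple that unfolding L.simple_submodule_iff[OF S_sub] by blast
  obtain s0 where s0: "s0 \<in> S" "s0 \<noteq> \<zero>\<^bsub>L\<^esub>" using S_nonzero submodule_zero[OF S_sub] by blast
  then have s0': "s0 \<in> carrier ?S" "s0 \<noteq> \<zero>\<^bsub>?S\<^esub>" by simp_all
  obtain e where e: "e \<in> carrier A" "e \<otimes>\<^bsub>A\<^esub> e = e" "e \<odot>\<^bsub>?S\<^esub> s0 = s0"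
    "\<And>r. r \<in> carrier A \<Longrightarrow> r \<odot>\<^bsub>?S\<^esub> s0 = \<zero>\<^bsub>?S\<^esub> \<Longrightarrow> r \<otimes>\<^bsub>A\<^esub> e \<in> J"
    using primitive_idempotent[OF Sm simple s0'] by metis
  obtain m where m: "m \<in> K'" "s0 = p m" using s0(1) unfolding S_def by blast
  have mM: "m \<in> M" using m(1) K_subset(2) by blast
  define a where "a = e \<odot>\<^bsub>P\<^esub> m"
  have aK': "a \<in> K'" unfolding a_def by (rule submodule_smult[OF K_sub(2) e(1) m(1)])
  have aP: "a \<in> carrier P" by (rule submodule_mem[OF K_sub(2) aK'])
  have ea: "e \<odot>\<^bsub>P\<^esub> a = a"
    unfolding a_def using P.smult_assoc1[OF e(1,1) M_mem[OF mM]] e(2) by simp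
  have pa: "p a = s0"
    unfolding a_def using mod_hom_smult[OF proj_homs(1) e(1), of m] mM m(2) e(3) by simp
  have whole: "W = K'" if W: "submodule W A P" "W \<subseteq> K'" "a \<in> W" "K \<subseteq> W" for W
  proof -
    have "submodule W A Mm" unfolding P.submodule_restrict_iff[OF M(1)] using W(1,2) K_subset(2) by blast
    then have pW: "submodule (p ` W) A L" by (rule mod_hom_image_submodule[OF mods(2,3) proj_homs(1)])
    have "p ` W \<subseteq> S" unfolding S_def by (rule image_mono[OF W(2)])
    moreover have "p ` W \<noteq> {\<zero>\<^bsub>L\<^esub>}" using W(3) pa s0(2) by blast
    ultimately have "p ` W = S" using simpleD[OF pW] by blast
    have "x \<in> W" if x: "x \<in> K'" for x
    proof -
      have "p x \<in> p ` W" using \<open>p ` W = S\<close> x unfolding S_def by blast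
      then obtain w where w: "w \<in> W" "p x = p w" by blast
      have c: "x \<in> carrier P" "w \<in> carrier P" using submodule_mem[OF K_sub(2) x] submodule_mem[OF W(1) w(1)] by auto
      have "x \<ominus>\<^bsub>P\<^esub> w \<in> W" using P.coset_eq_iff[OF K_sub(1) c] w(2) W(4) by blast
      then have "(x \<ominus>\<^bsub>P\<^esub> w) \<oplus>\<^bsub>P\<^esub> w \<in> W" by (rule submodule_add[OF W(1) _ w(1)])
      then show ?thesis using P.diff_add_cancel[OF c] by simp
    qed
    then show ?thesis using W(2) by blast
  qed
  have a_not: "a \<notin> rads P (Suc (Suc t)) (carrier P)"
  proof
    assume *: "a \<in> rads P (Suc (Suc t)) (carrier P)"
    have R: "submodule (rads P (Suc (Suc t)) (carrier P)) A P" by (rule rads_submodule[OF P_module P.submodule_carrier])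
    have "K' \<inter> rads P (Suc (Suc t)) (carrier P) = K'"
      by (rule whole[OF P.submodule_Int[OF K_sub(2) R]]) (use aK' * K_subset(1) K_rad in blast)+
    then show False using not_deep unfolding K'_def by blast
  qed
  note cyc = P.cyclic_submodule[OF aP]
  have cK: "cyclic_submodule A P a \<subseteq> K'" by (rule cyclic_least[OF K_sub(2) aK'])
  have Kr: "K = radical_of P K'" unfolding K_def K'_def by simp
  have "cyclic_submodule A P a <+>\<^bsub>P\<^esub> K = K'"
  proof (rule whole[OF P.submodule_sum[OF cyc K_sub(1)]])
    show "cyclic_submodule A P a <+>\<^bsub>P\<^esub> K \<subseteq> K'" by (rule P.sum_least[OF K_sub(2) cK K_subset(1)])
    show "a \<in> cyclic_submodule A P a <+>\<^bsub>P\<^esub> K"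
      using P.sum_incl1[OF cyc K_sub(1)] P.cyclic_mem[OF aP] by blast
    show "K \<subseteq> cyclic_submodule A P a <+>\<^bsub>P\<^esub> K" by (rule P.sum_incl2[OF cyc K_sub(1)])
  qed
  then have "K' \<subseteq> cyclic_submodule A P a <+>\<^bsub>P\<^esub> radical_of P K'" unfolding Kr by simp
  then have "K' \<subseteq> cyclic_submodule A P a" by (rule nakayama[OF P_module K_sub(2) cyc])
  then have gen: "K' = cyclic_submodule A P a" using cK by (rule equalityI)
  have "uniserial_dual R A ?S s0 e I \<iota> (Suc t) P a"
  proof (intro uniserial_dual.intro simple_idempotent.intro simple_idempotent_axioms.intro uniserial_dual_axioms.intro)
    show "artin_alg R A" by (rule artin_alg_axioms)
    show "injective_in_mod A I" "\<iota> \<in> mod_hom A ?S I" "inj_on \<iota> (carrier ?S)"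
      using envelope unfolding injective_envelope_def K_def[symmetric] socle_L by simp_all
    show "uniserial A (I\<lparr>carrier := soc A (Suc (Suc t)) I\<rparr>)" by (rule V_uniserial)
    show "a \<in> rads P (Suc t) (carrier P)" using aK' K'_rad by blast
  qed (use Sm simple s0' e P_projective P_local a_not ea in blast)+
  then show thesis using that aK' pa s0(2) gen by blast
qed

text \<open>
  The class of \<open>a\<close> dies in \<open>E2\<close>, so a retraction of \<open>f\<close>
  restricts to a homomorphism \<open>E1 \<rightarrow> L\<close> that fixes the class of
  \<open>a\<close>. But \<open>a\<close> lies in \<open>rad\<^sup>t\<^sup>+\<^sup>1 P\<close>,
  while \<open>rad\<^sup>t\<^sup>+\<^sup>1 L = 0\<close>.
\<close>

lemma f_not_split: "\<not> split_mono A L E f"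
proof
  assume "split_mono A L E f"
  then obtain r where r: "r \<in> mod_hom A E L" "\<forall>x\<in>carrier L. r (f x) = x" unfolding split_mono_def by blast
  obtain a where a: "a \<in> K'" "p a \<noteq> \<zero>\<^bsub>L\<^esub>" using generator by metis
  have aM: "a \<in> M" and aP: "a \<in> carrier P" using a(1) K_subset(2) M_mem by blast+
  let ?r = "\<lambda>Y. r (Y, \<zero>\<^bsub>E2\<^esub>)"
  have r1: "?r \<in> mod_hom A E1 L" by (rule mod_hom_comp[OF direct_sum_homs(1)[OF mods(4,5)] r(1)])
  have "p' a = \<zero>\<^bsub>E2\<^esub>" using proj_zero(2)[OF aP] a(1) by simp
  then have "f (p a) = (p a, \<zero>\<^bsub>E2\<^esub>)" unfolding f_def using canonical(1)[OF aM] by simp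
  moreover have "p a \<in> carrier L" unfolding proj_surj(1)[symmetric] using aM by blast
  ultimately have ra: "?r (p a) = p a" using r(2) by metis
  have mem: "p a \<in> p ` rads P (Suc t) (carrier P)" using a(1) K'_rad by blast
  have img: "p ` rads P (Suc t) (carrier P) = rads E1 (Suc t) (carrier E1)"
    using rads_image[OF mods(1,4) proj_homs(2) P.submodule_carrier, of "Suc t"] unfolding proj_surj(2) .
  have "?r (p a) \<in> ?r ` rads E1 (Suc t) (carrier E1)" using mem unfolding img by (rule imageI)
  then have "p a \<in> ?r ` rads E1 (Suc t) (carrier E1)" unfolding ra .
  also have "\<dots> = rads L (Suc t) (?r ` carrier E1)" by (rule rads_image[OF mods(4,3) r1 E1.submodule_carrier])
  also have "\<dots> \<subseteq> rads L (Suc t) (carrier L)" by (rule rads_mono) (use mod_hom_closed[OF r1] in blast)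
  finally show False using a(2) unfolding rads_L_Suc by blast
qed

text \<open>
  If \<open>u\<close> is not injective, it kills \<open>S\<close> and factors through the
  projection to \<open>E2\<close>. If it is, then some \<open>v : P \<rightarrow> U\<close>
  agrees with \<open>u\<close> on the class of \<open>a\<close>, and the difference of
  \<open>u\<close> and \<open>v\<close> on \<open>L\<close> kills \<open>S\<close> and again
  factors through \<open>E2\<close>.
\<close>

lemma f_extends:
  fixes U :: "('a, 'n, 'v) module_scheme"
  assumes U: "fg_left_module A U" and u: "u \<in> mod_hom A L U" and ns: "\<not> split_mono A L U u"
  shows "\<exists>v \<in> mod_hom A E U. \<forall>x\<in>carrier L. v (f x) = u x"
proof -
  have Um: "left_module A U" using U by (simp add: fg_left_module_def)
  interpret U: left_module A U by (rule Um)
  note fstE = direct_sum_homs(3)[OF mods(4,5)] and sndE = direct_sum_homs(4)[OF mods(4,5)]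
  have q1_ker: "X \<in> S" if X: "X \<in> carrier L" "q1 X = \<zero>\<^bsub>E2\<^esub>" for X
  proof -
    obtain x where x: "x \<in> M" "X = p x" using X(1) unfolding proj_surj(1)[symmetric] by blast
    then have "p' x = K'" using X(2) canonical(1) by simp
    then have "x \<in> K'" using proj_zero(2)[OF M_mem[OF x(1)]] by blast
    then show ?thesis unfolding S_def x(2) by blast
  qed
  have factor: "\<exists>h \<in> mod_hom A E2 U. \<forall>x\<in>carrier L. h (q1 x) = d x"
    if d: "d \<in> mod_hom A L U" and 0: "\<And>X. X \<in> S \<Longrightarrow> d X = \<zero>\<^bsub>U\<^esub>" for d
    by (rule mod_hom_factor[OF mods(3,5) Um q1_hom q1_surj d]) (use 0 q1_ker in blast)
  show ?thesis
  proof (cases "inj_on u (carrier L)")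
    case False
    let ?W = "{x \<in> carrier L. u x = \<zero>\<^bsub>U\<^esub>}"
    have W: "submodule ?W A L" by (rule mod_hom_kernel_submodule[OF mods(3) Um u])
    have "?W \<noteq> {\<zero>\<^bsub>L\<^esub>}" using False unfolding mod_hom_inj_iff[OF mods(3) Um u] by blast
    then have SW: "S \<subseteq> ?W" by (rule S_essential[OF W])
    obtain h where h: "h \<in> mod_hom A E2 U" "\<forall>x\<in>carrier L. h (q1 x) = u x" using factor[OF u] SW by blast
    have "\<forall>x\<in>carrier L. h (snd (f x)) = u x" using h(2) unfolding f_def by simp
    then show ?thesis by (intro bexI[OF _ mod_hom_comp[OF sndE h(1)]])
  next
    case True
    obtain s0 e a where dual: "uniserial_dual R A (L\<lparr>carrier := S\<rparr>) s0 e I \<iota> (Suc t) P a"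
      and a: "a \<in> K'" "p a \<noteq> \<zero>\<^bsub>L\<^esub>" "K' = cyclic_submodule A P a" by (rule generator)
    interpret D: uniserial_dual R A "L\<lparr>carrier := S\<rparr>" s0 e I \<iota> "Suc t" P a by (rule dual)
    have aM: "a \<in> M" and aP: "a \<in> carrier P" using a(1) K_subset(2) M_mem by blast+
    have paS: "p a \<in> S" unfolding S_def using a(1) by blast
    have paL: "p a \<in> carrier L" by (rule submodule_mem[OF S_sub paS])
    \<comment> \<open>Uniseriality of \<open>V\<close> identifies \<open>L\<close> with \<open>soc\<^sup>t\<^sup>+\<^sup>1 I\<close>.\<close>
    have "\<exists>h\<in>mod_hom A L I. \<forall>x\<in>carrier (L\<lparr>carrier := S\<rparr>). h x = \<iota> x"
      by (rule injective_extend[OF D.I_injective fg_submodule[OF L_fg S_sub] L_fg mod_hom_incl[OF submodule_subset[OF S_sub]] _ D.\<iota>(1)])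
        (simp add: inj_on_def)
    then obtain j where j: "j \<in> mod_hom A L I" "\<forall>x\<in>S. j x = \<iota> x" by auto
    have \<iota>_inj: "x = \<zero>\<^bsub>L\<^esub>" if "x \<in> S" "\<iota> x = \<zero>\<^bsub>I\<^esub>" for x
      using D.\<iota>(2) that unfolding mod_hom_inj_iff[OF D.S_module D.I_module D.\<iota>(1)] by simp
    have j_inj: "inj_on j (carrier L)"
    proof (rule ccontr)
      assume ni: "\<not> inj_on j (carrier L)"
      let ?W = "{x \<in> carrier L. j x = \<zero>\<^bsub>I\<^esub>}"
      have W: "submodule ?W A L" by (rule mod_hom_kernel_submodule[OF mods(3) D.I_module j(1)])
      have "?W \<noteq> {\<zero>\<^bsub>L\<^esub>}" using ni unfolding mod_hom_inj_iff[OF mods(3) D.I_module j(1)] by blast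
      then have "S \<subseteq> ?W" by (rule S_essential[OF W])
      then have "j (p a) = \<zero>\<^bsub>I\<^esub>" using paS by blast
      then show False using \<iota>_inj[OF paS] j(2) paS a(2) by simp
    qed
    have jL: "submodule (j ` carrier L) A I" by (rule mod_hom_image_submodule[OF mods(3) D.I_module j(1) L.submodule_carrier])
    have j_rads: "rads I i (j ` carrier L) = j ` rads L i (carrier L)" for i
      by (rule rads_image[OF mods(3) D.I_module j(1) L.submodule_carrier, symmetric])
    have j_image: "j ` carrier L = soc A (Suc t) I"
    proof (rule uniserial_soc_layer[OF D.I_module D.uni _ jL])
      show "j ` carrier L \<subseteq> soc A (Suc t) I"
        unfolding subset_soc_iff[OF D.I_module jL] j_rads rads_L_Suc
        using mod_hom_zero[OF mods(3) D.I_module j(1)] by simp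
      have "j (p a) \<noteq> \<zero>\<^bsub>I\<^esub>" using \<iota>_inj[OF paS] j(2) paS a(2) by metis
      then show "\<not> j ` carrier L \<subseteq> soc A t I"
        unfolding subset_soc_iff[OF D.I_module jL] j_rads rads_L_top using paS by blast
    qed simp
    \<comment> \<open>Otherwise \<open>L\<close> embeds into \<open>U / rad\<^sup>t\<^sup>+\<^sup>1 U\<close>. All homomorphisms from there to \<open>I\<close> have values in
      \<open>soc\<^sup>t\<^sup>+\<^sup>1 I = j L\<close>, so an extension of \<open>j\<close> is a retraction of \<open>u\<close>.\<close>
    have upa: "u (p a) \<in> rads U (Suc t) (carrier U)"
    proof (rule ccontr)
      assume no: "u (p a) \<notin> rads U (Suc t) (carrier U)"
      define H where "H = rads U (Suc t) (carrier U)"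
      have H: "submodule H A U" unfolding H_def by (rule rads_submodule[OF Um U.submodule_carrier])
      let ?Q = "quotient_module U H" and ?k = "\<lambda>x. H +>\<^bsub>U\<^esub> x"
      have Qm: "left_module A ?Q" by (rule U.quotient_left_module[OF H])
      interpret Q: left_module A ?Q by (rule Qm)
      have k: "?k \<in> mod_hom A U ?Q" by (rule U.quotient_proj_hom[OF H])
      have ku: "(\<lambda>x. ?k (u x)) \<in> mod_hom A L ?Q" by (rule mod_hom_comp[OF u k])
      have "inj_on (\<lambda>x. ?k (u x)) (carrier L)"
      proof (rule ccontr)
        assume ni: "\<not> inj_on (\<lambda>x. ?k (u x)) (carrier L)"
        let ?W = "{x \<in> carrier L. ?k (u x) = \<zero>\<^bsub>?Q\<^esub>}"
        have W: "submodule ?W A L" by (rule mod_hom_kernel_submodule[OF mods(3) Qm ku])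
        have "?W \<noteq> {\<zero>\<^bsub>L\<^esub>}" using ni unfolding mod_hom_inj_iff[OF mods(3) Qm ku] by blast
        then have "S \<subseteq> ?W" by (rule S_essential[OF W])
        then have "?k (u (p a)) = \<zero>\<^bsub>?Q\<^esub>" using paS by blast
        then show False
          using no U.quotient_proj_zero_iff[OF H mod_hom_closed[OF u paL]] unfolding H_def by blast
      qed
      from injective_extend[OF D.I_injective L_fg fg_quotient[OF U H] ku this j(1)]
      obtain h where h: "h \<in> mod_hom A ?Q I" "\<forall>x\<in>carrier L. h (?k (u x)) = j x" by blast
      have hk: "(\<lambda>x. h (?k x)) \<in> mod_hom A U I" by (rule mod_hom_comp[OF k h(1)])
      let ?T = "(\<lambda>x. h (?k x)) ` carrier U"
      have "?T \<subseteq> j ` carrier L"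
        unfolding j_image H_def by (rule quotient_by_rads_hom_into_soc[OF Um D.I_module h(1)[unfolded H_def]])
      then have hk': "(\<lambda>x. h (?k x)) \<in> mod_hom A U (I\<lparr>carrier := j ` carrier L\<rparr>)" by (rule mod_hom_corestrict[OF hk])
      obtain i where i: "i \<in> mod_hom A (I\<lparr>carrier := j ` carrier L\<rparr>) L" "\<And>x. x \<in> carrier L \<Longrightarrow> i (j x) = x"
        using inj_mod_hom_inverse[OF mods(3) D.I_module j(1) j_inj] by metis
      have "\<forall>x\<in>carrier L. i (h (?k (u x))) = x" using h(2) i(2) by simp
      then have "split_mono A L U u"
        unfolding split_mono_def using u by (intro conjI bexI[OF _ mod_hom_comp[OF hk' i(1)]])
      then show False using ns by blast
    qed
    have e: "e \<odot>\<^bsub>U\<^esub> u (p a) = u (p a)"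
      using mod_hom_smult[OF u D.e(1) paL] mod_hom_smult[OF proj_homs(1) D.e(1), of a] aM D.a(3) by simp
    have "\<exists>v \<in> mod_hom A P U. v a = u (p a)" by (rule D.hom_hitting_radical_element[OF U upa e])
    then obtain v where v: "v \<in> mod_hom A P U" "v a = u (p a)" by (rule bexE)
    have vK': "v x = u (p x)" if x: "x \<in> K'" for x
    proof -
      obtain r where r: "r \<in> carrier A" "x = r \<odot>\<^bsub>P\<^esub> a" using x unfolding a(3) cyclic_submodule_def by blast
      have "p x = r \<odot>\<^bsub>L\<^esub> p a" using mod_hom_smult[OF proj_homs(1) r(1), of a] aM r(2) by simp
      then show ?thesis using mod_hom_smult[OF v(1) r(1) aP] mod_hom_smult[OF u r(1) paL] r(2) v(2) by simp
    qed
    have "v x = \<zero>\<^bsub>U\<^esub>" if x: "x \<in> carrier P" "p x = \<zero>\<^bsub>E1\<^esub>" for x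
    proof -
      have "x \<in> K" using x proj_zero(1)[OF x(1)] by simp
      then have "v x = u \<zero>\<^bsub>L\<^esub>" using vK'[of x] K_subset(1) p_zero[of x] by auto
      then show ?thesis using mod_hom_zero[OF mods(3) Um u] by simp
    qed
    from mod_hom_factor[OF mods(1,4) Um proj_homs(2) proj_surj(2) v(1) this]
    obtain w where w: "w \<in> mod_hom A E1 U" "\<forall>x\<in>carrier P. w (p x) = v x" by blast
    have wL: "w \<in> mod_hom A L U" using mod_hom_comp[OF incl_L w(1)] .
    let ?d = "\<lambda>X. u X \<ominus>\<^bsub>U\<^esub> w X"
    have "?d \<in> mod_hom A L U" by (rule mod_hom_diff_hom[OF Um u wL])
    moreover have "?d X = \<zero>\<^bsub>U\<^esub>" if X: "X \<in> S" for X
    proof -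
      obtain x where x: "x \<in> K'" "X = p x" using X unfolding S_def by blast
      have "w X = u X" using bspec[OF w(2) submodule_mem[OF K_sub(2) x(1)]] vK'[OF x(1)] x(2) by simp
      then show ?thesis using U.diff_self[OF mod_hom_closed[OF u submodule_mem[OF S_sub X]]] by simp
    qed
    ultimately obtain h where h: "h \<in> mod_hom A E2 U" "\<forall>x\<in>carrier L. h (q1 x) = ?d x" using factor by blast
    let ?v = "\<lambda>z. w (fst z) \<oplus>\<^bsub>U\<^esub> h (snd z)"
    have "?v \<in> mod_hom A E U"
      by (rule mod_hom_sum_hom[OF Um mod_hom_comp[OF fstE w(1)] mod_hom_comp[OF sndE h(1)]])
    moreover have "\<forall>x\<in>carrier L. ?v (f x) = u x"
    proof
      fix x assume x: "x \<in> carrier L"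
      have "?v (f x) = w x \<oplus>\<^bsub>U\<^esub> (u x \<ominus>\<^bsub>U\<^esub> w x)" using bspec[OF h(2) x] unfolding f_def by simp
      then show "?v (f x) = u x" using U.add_diff_cancel[OF mod_hom_closed[OF u x] mod_hom_closed[OF wL x]] by simp
    qed
    ultimately show ?thesis by (intro bexI[of _ ?v])
  qed
qed

lemma almost_split: "almost_split_sequence A L E N f g"
proof -
  have las: "left_almost_split A L E f"
    unfolding left_almost_split_def using f_hom f_not_split f_extends by blast
  have "carrier N \<noteq> {\<zero>\<^bsub>N\<^esub>}"
  proof
    assume 0: "carrier N = {\<zero>\<^bsub>N\<^esub>}"
    have "x \<in> K'" if x: "x \<in> carrier P" for x
      using mod_hom_closed[OF proj_homs(4) x] proj_zero(2)[OF x] unfolding 0 by simp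
    then show False using K_subset(2) M submodule_subset[OF M(1)] by blast
  qed
  note loc = local_module_image[OF P_module P_local mods(6) this proj_homs(4) proj_surj(4)]
    and endo = quotient_surj_endo_inj[OF P_projective P_local N_fg this proj_homs(4) proj_surj(4)]
  have "right_almost_split A E N g"
    by (rule right_almost_split_if_left[OF mods(3) E_fg mods(6) exact las loc endo])
  then show ?thesis
    unfolding almost_split_sequence_def using L_fg E_fg N_fg exact las by blast
qed

end

theorem theorem2p2p1:
  fixes R :: "('r, 'x) ring_scheme"
    and A :: "('r, 'a) module"
    and P :: "('a, 'm) module"
    and M :: "'m set"
    and I :: "('a, 'i) module"
    and \<iota> :: "'m set \<Rightarrow> 'i"
    and s :: nat
  assumes "artin_algebra R A"
    and "projective_in_mod A P"
    and "indecomposable A P"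
    and "submodule M A P" and "M \<noteq> carrier P"
    and "s \<ge> 1"
    and "uniserial A (top_module A s (P\<lparr>carrier := M\<rparr>))"
    and "\<not> rad A (s - 1) (P\<lparr>carrier := M\<rparr>) \<subseteq> rad A (s + 1) P"
    and "injective_envelope A
          ((top_module A s (P\<lparr>carrier := M\<rparr>))
            \<lparr>carrier := socle A (top_module A s (P\<lparr>carrier := M\<rparr>))\<rparr>) I \<iota>"
    and "uniserial A (I\<lparr>carrier := soc A (s + 1) I\<rparr>)"
  shows "almost_split_sequence A
          (top_module A s (P\<lparr>carrier := M\<rparr>))
          (direct_sum_module
            (quotient_module P (rad A s (P\<lparr>carrier := M\<rparr>)))
            (top_module A (s - 1) (P\<lparr>carrier := M\<rparr>)))
          (quotient_module P (rad A (s - 1) (P\<lparr>carrier := M\<rparr>)))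
          (\<lambda>X. (X, canonical_projection (P\<lparr>carrier := M\<rparr>) (rad A (s - 1) (P\<lparr>carrier := M\<rparr>)) X))
          (\<lambda>(Y, Z).
            (\<ominus>\<^bsub>quotient_module P (rad A (s - 1) (P\<lparr>carrier := M\<rparr>))\<^esub>
              canonical_projection P (rad A (s - 1) (P\<lparr>carrier := M\<rparr>)) Y)
            \<oplus>\<^bsub>quotient_module P (rad A (s - 1) (P\<lparr>carrier := M\<rparr>))\<^esub> Z)"
proof -
  interpret artin_alg R A by (rule artin_alg.intro) fact
  define t where "t = s - 1"
  have s: "s = Suc t" "s + 1 = Suc (Suc t)" "s - 1 = t" using \<open>s \<ge> 1\<close> by (simp_all add: t_def)
  have P: "left_module A P" using assms(2) by (simp add: projective_in_mod_def fg_left_module_def)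
  have rad: "rad A i (P\<lparr>carrier := M\<rparr>) = (radical_of P ^^ i) M" "rad A i P = (radical_of P ^^ i) (carrier P)" for i
    using rad_restrict_eq[OF P assms(4)] rad_eq[OF P] by auto
  have "uniserial_top R A P M t I \<iota>"
    using assms(4,5,7-10) unfolding top_module_def rad s(2,3) unfolding s(1)
    by (intro uniserial_top.intro uniserial_top_axioms.intro artin_alg_axioms assms(2)
        indecomposable_projective_local[OF assms(2,3)])
  then interpret uniserial_top R A P M t I \<iota> .
  show ?thesis using almost_split unfolding top_module_def rad s(3) unfolding s(1) f_def g_def K_def K'_def .
qed

end
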